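(* Let $R$ be a commutative ring, $M$ an $R$-bimodule, and $R'$ a square-zero extension of $R$ by $M$ such that $R'$ is commutative (so that in particular the left and right $R$-actions on $M$ coincide). Then the elementary extension of $R$ by $M$ corresponding to $R'$ can be chosen to be multiplicative; that is, the class in $\mathrm{El}(R,M)$ corresponding to $R'$ is represented by a multiplicative elementary extension.
   Context: Complexes are homologically graded, $E[m]_n=E_{n-m}$, and $\tau_{[0,1]}$ is the canonical truncation to degrees $0,1$. A sequence of complexes $0\to B_\bullet\xrightarrow{b}E_\bullet\xrightarrow{a}A_\bullet\to 0$ (with $ab=0$) in an abelian category is quasiexact if $b$ is injective, $a$ is surjective and $\operatorname{Ker}a/\operatorname{Im}b$ is acyclic. An elementary extension of an object $A$ by an object $B$ is a quasiexact sequence $0\to B[1]\xrightarrow{b}C_\bullet\xrightarrow{a}A\to0$ with $C_\bullet$ concentrated in degrees $0,1$; morphisms are maps of complexes $C_\bullet\to C'_\bullet$ compatible with $a,b$. $R\text{-proj}$ is the category of finitely generated projective $R$-modules; $\mathcal B(R,R')$ is the abelian category of pointed functors ($F(0)=0$, not necessarily additive) $R\text{-proj}\to R'\text{-mod}$, $\mathcal B(R)=\mathcal B(R,R)$. $\mathsf I(M)\in\mathcal B(R)$ is $V\mapsto M\otimes_RV$, $\mathsf I=\mathsf I(R)$ is the tautological inclusion. An elementary extension of $R$ by $M$ is an elementary extension of $\mathsf I$ by $\mathsf I(M)$ in $\mathcal B(R)$; $\mathrm{El}(R,M)$ is the set of connected components of the category of these. A square-zero extension of $R$ by $M$ is a ring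 $R'$ with a short exact sequence of abelian groups $0\to M\xrightarrow{i}R'\xrightarrow{q}R\to0$ such that $q$ is a unital ring map and $i(m)r'=i(mq(r'))$, $r'i(m)=i(q(r')m)$, $i(m)i(m')=0$. The class in $\mathrm{El}(R,M)$ corresponding to $R'$ is the class of $\tau_{[0,1]}q^*P'_\bullet$, where $q_*:\mathcal B(R)\to\mathcal B(R,R')$ is composition with restriction of scalars, $q^*:\mathcal B(R,R')\to\mathcal B(R)$ is composition with $R\otimes_{R'}-$, and $P'_\bullet$ is any projective resolution of $q_*(\mathsf I)$ in $\mathcal B(R,R')$; it is an elementary extension of $R$ by $M$ via $R\otimes_{R'}q_*V\cong V$ and the connecting isomorphism $\operatorname{Tor}_1^{R'}(R,q_*V)\cong M\otimes_RV$. A multiplicative structure on a complex $F_\bullet$ in $\mathcal B(R)$ is a map $R\to F_0(R)$ and a collection of functorial maps of complexes $F_\bullet(V)\otimes_RF_\bullet(V')\to F_\bullet(V\otimes_RV')$, $V,V'\in R\text{-proj}$, subject to the obvious associativity and unitality conditions. $\mathsf I$ has the obvious multiplicative structure. An elementary extension $\langle C_\bullet,a,b\rangle$ of $R$ by $M$ is multiplicative if $C_\bullet$ is equipped with a multiplicative structure such that $a:C_\bullet\to\mathsf I$ is multiplicative. *)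

theory Defs
  imports "HOL-Library.Infinite_Typeclass" "HOL-Algebra.Free_Abelian_Groups" "HOL-Algebra.RingHom" "HOL-Algebra.Module"
begin

text \<open>
  Rings, modules and all values of functors live in subsets of one infinite type \<open>'u\<close>.
  An infinite set is closed, up to bijection, under the constructions used below
  (tensor products, quotients, finite sums, free modules on lists of elements), so the modules
  carried by \<open>'u\<close> form an abelian category with enough projectives, and so do the functor
  categories built on them.  The ground rings are commutative, as in the locale \<^locale>\<open>module\<close>.
\<close>

type_synonym 'u md = "('u, 'u) module"


section \<open>Modules\<close>

text \<open>Homomorphisms are extensional, so that equality of functions is equality of homomorphisms.\<close>

definition mod_hom :: "'u ring \<Rightarrow> 'u md \<Rightarrow> 'u md \<Rightarrow> ('u \<Rightarrow> 'u) set" where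
  "mod_hom R V W = {f \<in> hom (add_monoid V) (add_monoid W) \<inter> extensional (carrier V).
     \<forall>r\<in>carrier R. \<forall>x\<in>carrier V. f (r \<odot>\<^bsub>V\<^esub> x) = r \<odot>\<^bsub>W\<^esub> f x}"

definition zero_map :: "'u md \<Rightarrow> 'u md \<Rightarrow> 'u \<Rightarrow> 'u" where
  "zero_map V W = (\<lambda>x\<in>carrier V. \<zero>\<^bsub>W\<^esub>)"

definition zero_md :: "'u md" where
  "zero_md = \<lparr>carrier = {undefined}, mult = \<lambda>_ _. undefined, one = undefined,
     zero = undefined, add = \<lambda>_ _. undefined, smult = \<lambda>_ _. undefined\<rparr>"

definition self_md :: "'u ring \<Rightarrow> 'u md" where
  "self_md R = \<lparr>carrier = carrier R, mult = mult R, one = \<one>\<^bsub>R\<^esub>,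
     zero = \<zero>\<^bsub>R\<^esub>, add = add R, smult = mult R\<rparr>"

definition restrict_scalars :: "('u \<Rightarrow> 'u) \<Rightarrow> 'u md \<Rightarrow> 'u md" where
  "restrict_scalars q N = N\<lparr>smult := \<lambda>r' x. q r' \<odot>\<^bsub>N\<^esub> x\<rparr>"

definition fin_gen :: "'u ring \<Rightarrow> 'u md \<Rightarrow> bool" where
  "fin_gen R V \<longleftrightarrow> (\<exists>G. finite G \<and> G \<subseteq> carrier V \<and>
     (\<forall>v\<in>carrier V. \<exists>c\<in>G \<rightarrow> carrier R. v = (\<Oplus>\<^bsub>V\<^esub>g\<in>G. c g \<odot>\<^bsub>V\<^esub> g)))"

definition projective_md :: "'u ring \<Rightarrow> 'u md \<Rightarrow> bool" where
  "projective_md R V \<longleftrightarrow> (\<forall>A B. \<forall>g\<in>mod_hom R A B. \<forall>f\<in>mod_hom R V B.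
     module R A \<longrightarrow> module R B \<longrightarrow> g ` carrier A = carrier B \<longrightarrow>
     (\<exists>h\<in>mod_hom R V A. \<forall>x\<in>carrier V. g (h x) = f x))"

definition proj :: "'u ring \<Rightarrow> 'u md set" where
  "proj R = {V. module R V \<and> fin_gen R V \<and> projective_md R V}"


subsection \<open>Transport of modules into \<open>'u\<close>\<close>

text \<open>
  Quotients have sets as elements.  They are copied into \<open>'u\<close> along a chosen injection;
  the two lemmas \<open>ex_emb_quot\<close> and \<open>ex_emb_tensor\<close> below say that one exists.
\<close>

definition emb :: "('r, 'b) module \<Rightarrow> 'b \<Rightarrow> 'u" where
  "emb X = (SOME h. inj_on h (carrier X))"

definition resize :: "('r, 'b) module \<Rightarrow> ('r, 'u) module" where
  "resize X = (let h = emb X; h' = inv_into (carrier X) h in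
     \<lparr>carrier = h ` carrier X, mult = \<lambda>_ _. undefined, one = undefined,
      zero = h \<zero>\<^bsub>X\<^esub>, add = \<lambda>x y. h (h' x \<oplus>\<^bsub>X\<^esub> h' y), smult = \<lambda>r x. h (r \<odot>\<^bsub>X\<^esub> h' x)\<rparr>)"


subsection \<open>Quotient modules\<close>

definition raw_quot :: "'u md \<Rightarrow> 'u set \<Rightarrow> ('u, 'u set) module" where
  "raw_quot V N = \<lparr>carrier = a_rcosets\<^bsub>V\<^esub> N, mult = \<lambda>_ _. undefined, one = undefined,
     zero = N, add = set_add V, smult = \<lambda>r X. \<Union>x\<in>X. N +>\<^bsub>V\<^esub> (r \<odot>\<^bsub>V\<^esub> x)\<rparr>"

definition quot_md :: "'u md \<Rightarrow> 'u set \<Rightarrow> 'u md" where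
  "quot_md V N = resize (raw_quot V N)"

definition quot_cls :: "'u md \<Rightarrow> 'u set \<Rightarrow> 'u \<Rightarrow> 'u" where
  "quot_cls V N x = emb (raw_quot V N) (N +>\<^bsub>V\<^esub> x)"

definition quot_rep :: "'u md \<Rightarrow> 'u set \<Rightarrow> 'u \<Rightarrow> 'u" where
  "quot_rep V N c = (SOME x. x \<in> carrier V \<and> quot_cls V N x = c)"


subsection \<open>Tensor products\<close>

text \<open>
  The tensor product over \<open>R\<close> of a right \<open>R\<close>-module \<open>A\<close>, with right action \<open>ra\<close>, and a left
  \<open>R\<close>-module \<open>N\<close>.  The scalar multiplication of \<open>A\<close>, by a possibly different ring, commutes
  with \<open>ra\<close> and induces the one of the tensor product.
\<close>

definition tensor_rel ::
    "'u md \<Rightarrow> ('u \<Rightarrow> 'u \<Rightarrow> 'u) \<Rightarrow> 'u ring \<Rightarrow> 'u md \<Rightarrow> ('u \<times> 'u \<Rightarrow>\<^sub>0 int) set" where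
  "tensor_rel A ra R N =
     {frag_of (a \<oplus>\<^bsub>A\<^esub> b, n) - frag_of (a, n) - frag_of (b, n) | a b n.
        a \<in> carrier A \<and> b \<in> carrier A \<and> n \<in> carrier N} \<union>
     {frag_of (a, n \<oplus>\<^bsub>N\<^esub> k) - frag_of (a, n) - frag_of (a, k) | a n k.
        a \<in> carrier A \<and> n \<in> carrier N \<and> k \<in> carrier N} \<union>
     {frag_of (ra a r, n) - frag_of (a, r \<odot>\<^bsub>N\<^esub> n) | a r n.
        a \<in> carrier A \<and> r \<in> carrier R \<and> n \<in> carrier N}"

definition raw_tensor ::
    "'u md \<Rightarrow> ('u \<Rightarrow> 'u \<Rightarrow> 'u) \<Rightarrow> 'u ring \<Rightarrow> 'u md \<Rightarrow> ('u, ('u \<times> 'u \<Rightarrow>\<^sub>0 int) set) module" where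
  "raw_tensor A ra R N =
     (let F = free_Abelian_group (carrier A \<times> carrier N); K = generate F (tensor_rel A ra R N) in
      \<lparr>carrier = rcosets\<^bsub>F\<^esub> K, mult = \<lambda>_ _. undefined, one = undefined, zero = K, add = set_mult F,
       smult = \<lambda>s X. \<Union>x\<in>X. K #>\<^bsub>F\<^esub> frag_extend (\<lambda>(a, n). frag_of (s \<odot>\<^bsub>A\<^esub> a, n)) x\<rparr>)"

definition tensor :: "'u md \<Rightarrow> ('u \<Rightarrow> 'u \<Rightarrow> 'u) \<Rightarrow> 'u ring \<Rightarrow> 'u md \<Rightarrow> 'u md" where
  "tensor A ra R N = resize (raw_tensor A ra R N)"

definition tens :: "'u md \<Rightarrow> ('u \<Rightarrow> 'u \<Rightarrow> 'u) \<Rightarrow> 'u ring \<Rightarrow> 'u md \<Rightarrow> 'u \<Rightarrow> 'u \<Rightarrow> 'u" where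
  "tens A ra R N a n =
     (let F = free_Abelian_group (carrier A \<times> carrier N); K = generate F (tensor_rel A ra R N) in
      emb (raw_tensor A ra R N) (K #>\<^bsub>F\<^esub> frag_of (a, n)))"

text \<open>The homomorphism of abelian groups into \<open>T\<close> induced by a balanced biadditive map.\<close>

definition tens_lift ::
    "'u md \<Rightarrow> ('u \<Rightarrow> 'u \<Rightarrow> 'u) \<Rightarrow> 'u ring \<Rightarrow> 'u md \<Rightarrow> 'u md \<Rightarrow> ('u \<Rightarrow> 'u \<Rightarrow> 'u) \<Rightarrow> 'u \<Rightarrow> 'u" where
  "tens_lift A ra R N T f =
     (THE g. g \<in> hom (add_monoid (tensor A ra R N)) (add_monoid T)
             \<inter> extensional (carrier (tensor A ra R N)) \<and>
             (\<forall>a\<in>carrier A. \<forall>n\<in>carrier N. g (tens A ra R N a n) = f a n))"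

definition tens_right ::
    "'u md \<Rightarrow> ('u \<Rightarrow> 'u \<Rightarrow> 'u) \<Rightarrow> 'u ring \<Rightarrow> 'u md \<Rightarrow> 'u md \<Rightarrow> ('u \<Rightarrow> 'u) \<Rightarrow> 'u \<Rightarrow> 'u" where
  "tens_right A ra R N N' h =
     tens_lift A ra R N (tensor A ra R N') (\<lambda>a n. tens A ra R N' a (h n))"

text \<open>Modules over the commutative ring \<open>R\<close>, regarded as symmetric bimodules.\<close>

definition tmod :: "'u ring \<Rightarrow> 'u md \<Rightarrow> 'u md \<Rightarrow> 'u md" where
  "tmod R V W = tensor V (\<lambda>v r. r \<odot>\<^bsub>V\<^esub> v) R W"

definition tel :: "'u ring \<Rightarrow> 'u md \<Rightarrow> 'u md \<Rightarrow> 'u \<Rightarrow> 'u \<Rightarrow> 'u" where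
  "tel R V W v w = tens V (\<lambda>v r. r \<odot>\<^bsub>V\<^esub> v) R W v w"

definition tlift :: "'u ring \<Rightarrow> 'u md \<Rightarrow> 'u md \<Rightarrow> 'u md \<Rightarrow> ('u \<Rightarrow> 'u \<Rightarrow> 'u) \<Rightarrow> 'u \<Rightarrow> 'u" where
  "tlift R V W T f = tens_lift V (\<lambda>v r. r \<odot>\<^bsub>V\<^esub> v) R W T f"

definition tmap ::
    "'u ring \<Rightarrow> 'u md \<Rightarrow> 'u md \<Rightarrow> 'u md \<Rightarrow> 'u md \<Rightarrow> ('u \<Rightarrow> 'u) \<Rightarrow> ('u \<Rightarrow> 'u) \<Rightarrow> 'u \<Rightarrow> 'u" where
  "tmap R V V' W W' f g = tlift R V V' (tmod R W W') (\<lambda>v v'. tel R W W' (f v) (g v'))"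

definition tassoc :: "'u ring \<Rightarrow> 'u md \<Rightarrow> 'u md \<Rightarrow> 'u md \<Rightarrow> 'u \<Rightarrow> 'u" where
  "tassoc R U V W = tlift R (tmod R U V) W (tmod R U (tmod R V W))
     (\<lambda>t w. tlift R U V (tmod R U (tmod R V W))
              (\<lambda>u v. tel R U (tmod R V W) u (tel R V W v w)) t)"

definition tunit_l :: "'u ring \<Rightarrow> 'u md \<Rightarrow> 'u \<Rightarrow> 'u" where
  "tunit_l R V = tlift R (self_md R) V V (\<lambda>r v. r \<odot>\<^bsub>V\<^esub> v)"

definition tunit_r :: "'u ring \<Rightarrow> 'u md \<Rightarrow> 'u \<Rightarrow> 'u" where
  "tunit_r R V = tlift R V (self_md R) V (\<lambda>v r. r \<odot>\<^bsub>V\<^esub> v)"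


subsection \<open>The injections used for transport exist\<close>

lemma ex_emb_quot: "\<exists>h :: 'u set \<Rightarrow> 'u. inj_on h (carrier (raw_quot V N))"
proof -
  have "carrier (raw_quot V N) = (\<lambda>x. N +>\<^bsub>V\<^esub> x) ` carrier V"
    by (auto simp: raw_quot_def A_RCOSETS_def')
  then show ?thesis
    by (metis inj_on_inv_into order_refl)
qed

lemma ex_emb_tensor:
  "\<exists>h :: ('u \<times> 'u \<Rightarrow>\<^sub>0 int) set \<Rightarrow> 'u. inj_on h (carrier (raw_tensor A ra R (N :: 'u::infinite md)))"
proof -
  let ?F = "free_Abelian_group (carrier A \<times> carrier N)"
  have inf: "infinite (UNIV :: ('u \<times> 'u) set)"
    using infinite_UNIV[where ?'a = 'u] by (simp add: finite_prod)
  have "carrier (raw_tensor A ra R N) \<lesssim> carrier ?F"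
    unfolding raw_tensor_def Let_def RCOSETS_def
    by (simp add: UNION_singleton_eq_range image_lepoll)
  also have "carrier ?F \<lesssim> carrier (free_Abelian_group (UNIV :: ('u \<times> 'u) set))"
    by (rule subset_imp_lepoll) auto
  also have "\<dots> \<lesssim> (UNIV :: ('u \<times> 'u) set)"
    by (rule eqpoll_imp_lepoll[OF eqpoll_free_Abelian_group_infinite[OF inf]])
  also have "\<dots> \<lesssim> (UNIV :: 'u set)"
    using card_of_Times_same_infinite[OF infinite_UNIV[where ?'a = 'u]]
    by (simp add: eqpoll_iff_card_of_ordIso eqpoll_imp_lepoll)
  finally show ?thesis
    by (auto simp: lepoll_def)
qed


section \<open>Functors from finitely generated projective modules\<close>

record 'u fctr =
  fobj :: "'u md \<Rightarrow> 'u md"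
  farr :: "'u md \<Rightarrow> 'u md \<Rightarrow> ('u \<Rightarrow> 'u) \<Rightarrow> 'u \<Rightarrow> 'u"

type_synonym 'u ntrans = "'u md \<Rightarrow> 'u \<Rightarrow> 'u"

text \<open>Pointed functors from finitely generated projective \<open>R\<close>-modules to \<open>S\<close>-modules.\<close>

definition functors :: "'u ring \<Rightarrow> 'u ring \<Rightarrow> 'u fctr set" where
  "functors R S = {F.
     (\<forall>V\<in>proj R. module S (fobj F V)) \<and>
     (\<forall>V\<in>proj R. \<forall>W\<in>proj R. \<forall>f\<in>mod_hom R V W. farr F V W f \<in> mod_hom S (fobj F V) (fobj F W)) \<and>
     (\<forall>V\<in>proj R. farr F V V (\<lambda>x\<in>carrier V. x) = (\<lambda>x\<in>carrier (fobj F V). x)) \<and>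
     (\<forall>U\<in>proj R. \<forall>V\<in>proj R. \<forall>W\<in>proj R. \<forall>f\<in>mod_hom R U V. \<forall>g\<in>mod_hom R V W.
        farr F U W (compose (carrier U) g f) =
        compose (carrier (fobj F U)) (farr F V W g) (farr F U V f)) \<and>
     (\<forall>V\<in>proj R. carrier V = {\<zero>\<^bsub>V\<^esub>} \<longrightarrow> carrier (fobj F V) = {\<zero>\<^bsub>fobj F V\<^esub>})}"

definition nat_trans :: "'u ring \<Rightarrow> 'u ring \<Rightarrow> 'u fctr \<Rightarrow> 'u fctr \<Rightarrow> 'u ntrans set" where
  "nat_trans R S F G = {\<eta>.
     (\<forall>V\<in>proj R. \<eta> V \<in> mod_hom S (fobj F V) (fobj G V)) \<and>
     (\<forall>V\<in>proj R. \<forall>W\<in>proj R. \<forall>f\<in>mod_hom R V W. \<forall>x\<in>carrier (fobj F V).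
        \<eta> W (farr F V W f x) = farr G V W f (\<eta> V x))}"

text \<open>Epimorphisms of functors are the pointwise surjections.\<close>

definition projective_fctr :: "'u ring \<Rightarrow> 'u ring \<Rightarrow> 'u fctr \<Rightarrow> bool" where
  "projective_fctr R S P \<longleftrightarrow> P \<in> functors R S \<and>
     (\<forall>F\<in>functors R S. \<forall>G\<in>functors R S. \<forall>g\<in>nat_trans R S F G. \<forall>f\<in>nat_trans R S P G.
        (\<forall>V\<in>proj R. g V ` carrier (fobj F V) = carrier (fobj G V)) \<longrightarrow>
        (\<exists>h\<in>nat_trans R S P F. \<forall>V\<in>proj R. \<forall>x\<in>carrier (fobj P V). g V (h V x) = f V x))"

definition zero_fctr :: "'u fctr" where
  "zero_fctr = \<lparr>fobj = \<lambda>V. zero_md, farr = \<lambda>V W f. zero_map zero_md zero_md\<rparr>"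

definition incl_fctr :: "'u fctr" where
  "incl_fctr = \<lparr>fobj = \<lambda>V. V, farr = \<lambda>V W f. f\<rparr>"

text \<open>\<open>V \<mapsto> A \<otimes>\<^sub>R F V\<close>\<close>

definition tensor_fctr :: "'u md \<Rightarrow> ('u \<Rightarrow> 'u \<Rightarrow> 'u) \<Rightarrow> 'u ring \<Rightarrow> 'u fctr \<Rightarrow> 'u fctr" where
  "tensor_fctr A ra R F = \<lparr>fobj = \<lambda>V. tensor A ra R (fobj F V),
     farr = \<lambda>V W f. tens_right A ra R (fobj F V) (fobj F W) (farr F V W f)\<rparr>"

definition bimod_fctr :: "'u ring \<Rightarrow> 'u md \<Rightarrow> ('u \<Rightarrow> 'u \<Rightarrow> 'u) \<Rightarrow> 'u fctr" where
  "bimod_fctr R M ra = tensor_fctr M ra R incl_fctr"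

definition push_fctr :: "('u \<Rightarrow> 'u) \<Rightarrow> 'u fctr \<Rightarrow> 'u fctr" where
  "push_fctr q F = \<lparr>fobj = \<lambda>V. restrict_scalars q (fobj F V), farr = farr F\<rparr>"

text \<open>\<open>R\<close> is an \<open>R\<close>-\<open>R'\<close>-bimodule through \<open>q\<close>.\<close>

definition base_act :: "'u ring \<Rightarrow> ('u \<Rightarrow> 'u) \<Rightarrow> 'u \<Rightarrow> 'u \<Rightarrow> 'u" where
  "base_act R q a r' = a \<otimes>\<^bsub>R\<^esub> q r'"

definition pull_fctr :: "'u ring \<Rightarrow> 'u ring \<Rightarrow> ('u \<Rightarrow> 'u) \<Rightarrow> 'u fctr \<Rightarrow> 'u fctr" where
  "pull_fctr R R' q F = tensor_fctr (self_md R) (base_act R q) R' F"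

definition kernel_fctr :: "'u fctr \<Rightarrow> 'u fctr \<Rightarrow> 'u ntrans \<Rightarrow> 'u fctr" where
  "kernel_fctr F G \<eta> =
     (let K = \<lambda>V. {x \<in> carrier (fobj F V). \<eta> V x = \<zero>\<^bsub>fobj G V\<^esub>} in
      \<lparr>fobj = \<lambda>V. (fobj F V)\<lparr>carrier := K V\<rparr>, farr = \<lambda>V W f. restrict (farr F V W f) (K V)\<rparr>)"

definition coker_fctr :: "'u fctr \<Rightarrow> 'u fctr \<Rightarrow> 'u ntrans \<Rightarrow> 'u fctr" where
  "coker_fctr F G \<eta> =
     (let N = \<lambda>V. \<eta> V ` carrier (fobj F V) in
      \<lparr>fobj = \<lambda>V. quot_md (fobj G V) (N V),
       farr = \<lambda>V W f. \<lambda>c\<in>carrier (quot_md (fobj G V) (N V)).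
         quot_cls (fobj G W) (N W) (farr G V W f (quot_rep (fobj G V) (N V) c))\<rparr>)"


section \<open>Complexes of functors\<close>

text \<open>The differential \<open>dif X n\<close> goes from degree \<open>n\<close> to degree \<open>n - 1\<close>.\<close>

record 'u cplx =
  ob :: "int \<Rightarrow> 'u fctr"
  dif :: "int \<Rightarrow> 'u ntrans"

abbreviation val :: "'u cplx \<Rightarrow> int \<Rightarrow> 'u md \<Rightarrow> 'u md" where
  "val X n V \<equiv> fobj (ob X n) V"

definition complexes :: "'u ring \<Rightarrow> 'u ring \<Rightarrow> 'u cplx set" where
  "complexes R S = {X. \<forall>n. ob X n \<in> functors R S \<and> dif X n \<in> nat_trans R S (ob X n) (ob X (n - 1)) \<and>
     (\<forall>V\<in>proj R. \<forall>x\<in>carrier (val X n V). dif X (n - 1) V (dif X n V x) = \<zero>\<^bsub>val X (n - 2) V\<^esub>)}"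

definition chain_maps :: "'u ring \<Rightarrow> 'u ring \<Rightarrow> 'u cplx \<Rightarrow> 'u cplx \<Rightarrow> (int \<Rightarrow> 'u ntrans) set" where
  "chain_maps R S X Y = {\<phi>. \<forall>n. \<phi> n \<in> nat_trans R S (ob X n) (ob Y n) \<and>
     (\<forall>V\<in>proj R. \<forall>x\<in>carrier (val X n V). dif Y n V (\<phi> n V x) = \<phi> (n - 1) V (dif X n V x))}"

definition zero_in_degree :: "'u ring \<Rightarrow> 'u cplx \<Rightarrow> int \<Rightarrow> bool" where
  "zero_in_degree R X n \<longleftrightarrow> (\<forall>V\<in>proj R. carrier (val X n V) = {\<zero>\<^bsub>val X n V\<^esub>})"

text \<open>The complex \<open>F[n]\<close>, for a single functor \<open>F\<close>.\<close>

definition stalk :: "int \<Rightarrow> 'u fctr \<Rightarrow> 'u cplx" where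
  "stalk n F = (let A = \<lambda>k. if k = n then F else zero_fctr in
     \<lparr>ob = A, dif = \<lambda>k V. zero_map (fobj (A k) V) (fobj (A (k - 1)) V)\<rparr>)"

definition pull_cplx :: "'u ring \<Rightarrow> 'u ring \<Rightarrow> ('u \<Rightarrow> 'u) \<Rightarrow> 'u cplx \<Rightarrow> 'u cplx" where
  "pull_cplx R R' q X = \<lparr>ob = \<lambda>n. pull_fctr R R' q (ob X n),
     dif = \<lambda>n V. tens_right (self_md R) (base_act R q) R' (val X n V) (val X (n - 1) V) (dif X n V)\<rparr>"

definition bnd :: "'u cplx \<Rightarrow> int \<Rightarrow> 'u md \<Rightarrow> 'u set" where
  "bnd X n V = dif X (n + 1) V ` carrier (val X (n + 1) V)"

text \<open>The canonical truncation to degrees 0 and 1: cycles in degree 0, cokernel in degree 1.\<close>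

definition trunc01 :: "'u cplx \<Rightarrow> 'u cplx" where
  "trunc01 X = (let A = \<lambda>n. if n = 0 then kernel_fctr (ob X 0) (ob X (-1)) (dif X 0)
                         else if n = 1 then coker_fctr (ob X 2) (ob X 1) (dif X 2)
                         else zero_fctr in
     \<lparr>ob = A,
      dif = \<lambda>n V. if n = 1
        then \<lambda>c\<in>carrier (fobj (A 1) V). dif X 1 V (quot_rep (val X 1 V) (bnd X 1 V) c)
        else zero_map (fobj (A n) V) (fobj (A (n - 1)) V)\<rparr>)"

definition proj_resolution :: "'u ring \<Rightarrow> 'u ring \<Rightarrow> 'u fctr \<Rightarrow> 'u cplx \<Rightarrow> 'u ntrans \<Rightarrow> bool" where
  "proj_resolution R S F P \<epsilon> \<longleftrightarrow> P \<in> complexes R S \<and>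
     (\<forall>n<0. zero_in_degree R P n) \<and> (\<forall>n\<ge>0. projective_fctr R S (ob P n)) \<and>
     \<epsilon> \<in> nat_trans R S (ob P 0) F \<and>
     (\<forall>V\<in>proj R.
        \<epsilon> V ` carrier (val P 0 V) = carrier (fobj F V) \<and>
        {x \<in> carrier (val P 0 V). \<epsilon> V x = \<zero>\<^bsub>fobj F V\<^esub>} = bnd P 0 V \<and>
        (\<forall>n\<ge>1. {x \<in> carrier (val P n V). dif P n V x = \<zero>\<^bsub>val P (n - 1) V\<^esub>} = bnd P n V))"


section \<open>Elementary extensions\<close>

text \<open>
  The last clause says that every cycle of the quotient complex \<open>Ker a / Im b\<close> is a boundary.
\<close>

definition quasiexact ::
    "'u ring \<Rightarrow> 'u ring \<Rightarrow> 'u cplx \<Rightarrow> 'u cplx \<Rightarrow> 'u cplx \<Rightarrow> (int \<Rightarrow> 'u ntrans) \<Rightarrow> (int \<Rightarrow> 'u ntrans) \<Rightarrow> bool"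
  where
  "quasiexact R S B E A b a \<longleftrightarrow>
     B \<in> complexes R S \<and> E \<in> complexes R S \<and> A \<in> complexes R S \<and>
     b \<in> chain_maps R S B E \<and> a \<in> chain_maps R S E A \<and>
     (\<forall>n. \<forall>V\<in>proj R.
        (\<forall>x\<in>carrier (val B n V). a n V (b n V x) = \<zero>\<^bsub>val A n V\<^esub>) \<and>
        inj_on (b n V) (carrier (val B n V)) \<and>
        a n V ` carrier (val E n V) = carrier (val A n V) \<and>
        (\<forall>x\<in>carrier (val E n V).
           a n V x = \<zero>\<^bsub>val A n V\<^esub> \<longrightarrow>
           dif E n V x \<in> b (n - 1) V ` carrier (val B (n - 1) V) \<longrightarrow>
           (\<exists>y\<in>carrier (val E (n + 1) V). \<exists>z\<in>carrier (val B n V).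
              a (n + 1) V y = \<zero>\<^bsub>val A (n + 1) V\<^esub> \<and> x = dif E (n + 1) V y \<oplus>\<^bsub>val E n V\<^esub> b n V z)))"

record 'u elext =
  emid :: "'u cplx"
  epr :: "int \<Rightarrow> 'u ntrans"
  ein :: "int \<Rightarrow> 'u ntrans"

definition elem_exts_of :: "'u ring \<Rightarrow> 'u fctr \<Rightarrow> 'u fctr \<Rightarrow> 'u elext set" where
  "elem_exts_of R A B = {E.
     quasiexact R R (stalk 1 B) (emid E) (stalk 0 A) (ein E) (epr E) \<and>
     (\<forall>n. n \<noteq> 0 \<and> n \<noteq> 1 \<longrightarrow> zero_in_degree R (emid E) n)}"

definition elem_exts :: "'u ring \<Rightarrow> 'u md \<Rightarrow> ('u \<Rightarrow> 'u \<Rightarrow> 'u) \<Rightarrow> 'u elext set" where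
  "elem_exts R M ra = elem_exts_of R incl_fctr (bimod_fctr R M ra)"

definition elext_maps ::
    "'u ring \<Rightarrow> 'u md \<Rightarrow> ('u \<Rightarrow> 'u \<Rightarrow> 'u) \<Rightarrow> 'u elext \<Rightarrow> 'u elext \<Rightarrow> (int \<Rightarrow> 'u ntrans) set" where
  "elext_maps R M ra E E' = {\<phi> \<in> chain_maps R R (emid E) (emid E'). \<forall>n. \<forall>V\<in>proj R.
     (\<forall>x\<in>carrier (val (emid E) n V). epr E' n V (\<phi> n V x) = epr E n V x) \<and>
     (\<forall>x\<in>carrier (val (stalk 1 (bimod_fctr R M ra)) n V). \<phi> n V (ein E n V x) = ein E' n V x)}"

definition el_connected :: "'u ring \<Rightarrow> 'u md \<Rightarrow> ('u \<Rightarrow> 'u \<Rightarrow> 'u) \<Rightarrow> 'u elext rel" where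
  "el_connected R M ra = (let r = {(E, E'). E \<in> elem_exts R M ra \<and> E' \<in> elem_exts R M ra \<and>
     elext_maps R M ra E E' \<noteq> {}} in (r \<union> r\<inverse>)\<^sup>*)"

definition El :: "'u ring \<Rightarrow> 'u md \<Rightarrow> ('u \<Rightarrow> 'u \<Rightarrow> 'u) \<Rightarrow> 'u elext set set" where
  "El R M ra = elem_exts R M ra // el_connected R M ra"

definition el_class :: "'u ring \<Rightarrow> 'u md \<Rightarrow> ('u \<Rightarrow> 'u \<Rightarrow> 'u) \<Rightarrow> 'u elext \<Rightarrow> 'u elext set" where
  "el_class R M ra E = el_connected R M ra `` {E}"


section \<open>Square-zero extensions\<close>

text \<open>Since \<open>R\<close> is commutative, a right \<open>R\<close>-module is the same as a left one.\<close>

definition bimodule :: "'u ring \<Rightarrow> 'u md \<Rightarrow> ('u \<Rightarrow> 'u \<Rightarrow> 'u) \<Rightarrow> bool" where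
  "bimodule R M ra \<longleftrightarrow> module R M \<and> module R (M\<lparr>smult := \<lambda>r m. ra m r\<rparr>) \<and>
     (\<forall>r\<in>carrier R. \<forall>s\<in>carrier R. \<forall>m\<in>carrier M. ra (r \<odot>\<^bsub>M\<^esub> m) s = r \<odot>\<^bsub>M\<^esub> ra m s)"

definition square_zero_ext ::
    "'u ring \<Rightarrow> 'u md \<Rightarrow> ('u \<Rightarrow> 'u \<Rightarrow> 'u) \<Rightarrow> 'u ring \<Rightarrow> ('u \<Rightarrow> 'u) \<Rightarrow> ('u \<Rightarrow> 'u) \<Rightarrow> bool" where
  "square_zero_ext R M ra R' i q \<longleftrightarrow> ring R' \<and>
     i \<in> hom (add_monoid M) (add_monoid R') \<and> inj_on i (carrier M) \<and>
     q \<in> ring_hom R' R \<and> q ` carrier R' = carrier R \<and>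
     i ` carrier M = a_kernel R' R q \<and>
     (\<forall>m\<in>carrier M. \<forall>r'\<in>carrier R'.
        i m \<otimes>\<^bsub>R'\<^esub> r' = i (ra m (q r')) \<and> r' \<otimes>\<^bsub>R'\<^esub> i m = i (q r' \<odot>\<^bsub>M\<^esub> m)) \<and>
     (\<forall>m\<in>carrier M. \<forall>m'\<in>carrier M. i m \<otimes>\<^bsub>R'\<^esub> i m' = \<zero>\<^bsub>R'\<^esub>)"

text \<open>
  The connecting homomorphism \<open>H\<^sub>1(R \<otimes>\<^bsub>R'\<^esub> P) \<rightarrow> M \<otimes>\<^bsub>R'\<^esub> V = M \<otimes>\<^sub>R V\<close> of the sequence
  \<open>0 \<rightarrow> M \<otimes>\<^bsub>R'\<^esub> P \<rightarrow> P \<rightarrow> R \<otimes>\<^bsub>R'\<^esub> P \<rightarrow> 0\<close>, as a relation: the class \<open>c\<close> of \<open>1 \<otimes> y\<close>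
  is sent to the image in \<open>M \<otimes>\<^sub>R V\<close> of the element \<open>z\<close> of \<open>M \<otimes>\<^bsub>R'\<^esub> P\<^sub>0\<close> that maps to \<open>d y\<close>.
\<close>

definition connecting ::
    "'u ring \<Rightarrow> 'u md \<Rightarrow> ('u \<Rightarrow> 'u \<Rightarrow> 'u) \<Rightarrow> 'u ring \<Rightarrow> ('u \<Rightarrow> 'u) \<Rightarrow> ('u \<Rightarrow> 'u) \<Rightarrow>
     'u cplx \<Rightarrow> 'u ntrans \<Rightarrow> 'u md \<Rightarrow> 'u \<Rightarrow> 'u \<Rightarrow> bool" where
  "connecting R M ra R' i q P \<epsilon> V c t \<longleftrightarrow>
     (let X = pull_cplx R R' q P; ra' = \<lambda>m r'. ra m (q r') in
      \<exists>y\<in>carrier (val P 1 V). \<exists>z\<in>carrier (tensor M ra' R' (val P 0 V)).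
        c = quot_cls (val X 1 V) (bnd X 1 V) (tens (self_md R) (base_act R q) R' (val P 1 V) \<one>\<^bsub>R\<^esub> y) \<and>
        tens_lift M ra' R' (val P 0 V) (val P 0 V) (\<lambda>m p. i m \<odot>\<^bsub>val P 0 V\<^esub> p) z = dif P 1 V y \<and>
        tens_lift M ra' R' (val P 0 V) (tensor M ra R V) (\<lambda>m p. tens M ra R V m (\<epsilon> V p)) z = t)"

text \<open>
  The elementary extension given by a resolution \<open>P\<close>, \<open>\<epsilon>\<close> of \<open>q\<^sub>*\<close> of the tautological functor.
  The map \<open>a\<close> is induced by \<open>r \<otimes> p \<mapsto> r \<odot> \<epsilon> p\<close>, and \<open>b\<close> is the inverse of the connecting
  isomorphism.
\<close>

definition sqz_elext ::
    "'u ring \<Rightarrow> 'u md \<Rightarrow> ('u \<Rightarrow> 'u \<Rightarrow> 'u) \<Rightarrow> 'u ring \<Rightarrow> ('u \<Rightarrow> 'u) \<Rightarrow> ('u \<Rightarrow> 'u) \<Rightarrow>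
     'u cplx \<Rightarrow> 'u ntrans \<Rightarrow> 'u elext" where
  "sqz_elext R M ra R' i q P \<epsilon> =
     (let C = trunc01 (pull_cplx R R' q P) in
      \<lparr>emid = C,
       epr = \<lambda>n V. if n = 0
         then restrict (tens_lift (self_md R) (base_act R q) R' (val P 0 V) V (\<lambda>r p. r \<odot>\<^bsub>V\<^esub> \<epsilon> V p))
                (carrier (val C 0 V))
         else zero_map (val C n V) (val (stalk 0 incl_fctr) n V),
       ein = \<lambda>n V. if n = 1
         then \<lambda>t\<in>carrier (tensor M ra R V). THE c. connecting R M ra R' i q P \<epsilon> V c t
         else zero_map (val (stalk 1 (bimod_fctr R M ra)) n V) (val C n V)\<rparr>)"

definition sqz_class ::
    "'u ring \<Rightarrow> 'u md \<Rightarrow> ('u \<Rightarrow> 'u \<Rightarrow> 'u) \<Rightarrow> 'u ring \<Rightarrow> ('u \<Rightarrow> 'u) \<Rightarrow> ('u \<Rightarrow> 'u) \<Rightarrow> 'u elext set" where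
  "sqz_class R M ra R' i q = (THE c. c \<in> El R M ra \<and>
     (\<exists>P \<epsilon>. proj_resolution R R' (push_fctr q incl_fctr) P \<epsilon> \<and>
        c = el_class R M ra (sqz_elext R M ra R' i q P \<epsilon>)))"


section \<open>Multiplicative structures\<close>

type_synonym 'u mulfam = "int \<Rightarrow> int \<Rightarrow> 'u md \<Rightarrow> 'u md \<Rightarrow> 'u \<Rightarrow> 'u"

text \<open>
  A map of complexes from the tensor product complex \<open>X V \<otimes>\<^sub>R X V'\<close>, with its Koszul sign, is given
  by its components \<open>\<mu> p k V V'\<close> on \<open>X\<^sub>p V \<otimes>\<^sub>R X\<^sub>k V'\<close>; equations between homomorphisms
  out of tensor products are stated on pure tensors.  The unit is a map of complexes from
  \<open>R\<close>, placed in degree 0, to \<open>X R\<close>.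
\<close>

definition mult_structure ::
    "'u ring \<Rightarrow> 'u cplx \<Rightarrow> ('u \<Rightarrow> 'u) \<Rightarrow> 'u mulfam \<Rightarrow> bool" where
  "mult_structure R X u \<mu> \<longleftrightarrow>
     (let m = \<lambda>p k V V' x y. \<mu> p k V V' (tel R (val X p V) (val X k V') x y) in
      u \<in> mod_hom R (self_md R) (val X 0 (self_md R)) \<and>
      (\<forall>r\<in>carrier R. dif X 0 (self_md R) (u r) = \<zero>\<^bsub>val X (-1) (self_md R)\<^esub>) \<and>
      (\<forall>p k. \<forall>V\<in>proj R. \<forall>V'\<in>proj R.
         \<mu> p k V V' \<in> mod_hom R (tmod R (val X p V) (val X k V')) (val X (p + k) (tmod R V V'))) \<and>
      (\<forall>p k. \<forall>V\<in>proj R. \<forall>V'\<in>proj R. \<forall>W\<in>proj R. \<forall>W'\<in>proj R.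
         \<forall>f\<in>mod_hom R V W. \<forall>g\<in>mod_hom R V' W'.
         \<forall>x\<in>carrier (val X p V). \<forall>y\<in>carrier (val X k V').
         farr (ob X (p + k)) (tmod R V V') (tmod R W W') (tmap R V V' W W' f g) (m p k V V' x y) =
         m p k W W' (farr (ob X p) V W f x) (farr (ob X k) V' W' g y)) \<and>
      (\<forall>p k. \<forall>V\<in>proj R. \<forall>V'\<in>proj R. \<forall>x\<in>carrier (val X p V). \<forall>y\<in>carrier (val X k V').
         let T = val X (p + k - 1) (tmod R V V'); s = m p (k - 1) V V' x (dif X k V' y) in
         dif X (p + k) (tmod R V V') (m p k V V' x y) =
         m (p - 1) k V V' (dif X p V x) y \<oplus>\<^bsub>T\<^esub> (if even p then s else \<ominus>\<^bsub>T\<^esub> s)) \<and>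
      (\<forall>p k l. \<forall>U\<in>proj R. \<forall>V\<in>proj R. \<forall>W\<in>proj R.
         \<forall>x\<in>carrier (val X p U). \<forall>y\<in>carrier (val X k V). \<forall>z\<in>carrier (val X l W).
         farr (ob X (p + k + l)) (tmod R (tmod R U V) W) (tmod R U (tmod R V W)) (tassoc R U V W)
           (m (p + k) l (tmod R U V) W (m p k U V x y) z) =
         m p (k + l) U (tmod R V W) x (m k l V W y z)) \<and>
      (\<forall>p. \<forall>V\<in>proj R. \<forall>r\<in>carrier R. \<forall>x\<in>carrier (val X p V).
         farr (ob X p) (tmod R (self_md R) V) V (tunit_l R V) (m 0 p (self_md R) V (u r) x) =
           r \<odot>\<^bsub>val X p V\<^esub> x \<and>
         farr (ob X p) (tmod R V (self_md R)) V (tunit_r R V) (m p 0 V (self_md R) x (u r)) =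
           r \<odot>\<^bsub>val X p V\<^esub> x))"

definition mult_map ::
    "'u ring \<Rightarrow> 'u cplx \<Rightarrow> ('u \<Rightarrow> 'u) \<Rightarrow> 'u mulfam \<Rightarrow> 'u cplx \<Rightarrow> ('u \<Rightarrow> 'u) \<Rightarrow> 'u mulfam \<Rightarrow>
     (int \<Rightarrow> 'u ntrans) \<Rightarrow> bool" where
  "mult_map R X u \<mu> Y w \<nu> \<phi> \<longleftrightarrow>
     (\<forall>r\<in>carrier R. \<phi> 0 (self_md R) (u r) = w r) \<and>
     (\<forall>p k. \<forall>V\<in>proj R. \<forall>V'\<in>proj R. \<forall>x\<in>carrier (val X p V). \<forall>y\<in>carrier (val X k V').
        \<phi> (p + k) (tmod R V V') (\<mu> p k V V' (tel R (val X p V) (val X k V') x y)) =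
        \<nu> p k V V' (tel R (val Y p V) (val Y k V') (\<phi> p V x) (\<phi> k V' y)))"

definition incl_unit :: "'u ring \<Rightarrow> 'u \<Rightarrow> 'u" where
  "incl_unit R = (\<lambda>r\<in>carrier R. r)"

definition incl_mul :: "'u ring \<Rightarrow> 'u mulfam" where
  "incl_mul R p k V V' =
     (if p = 0 \<and> k = 0 then \<lambda>t\<in>carrier (tmod R V V'). t
      else zero_map (tmod R (val (stalk 0 incl_fctr) p V) (val (stalk 0 incl_fctr) k V'))
             (val (stalk 0 incl_fctr) (p + k) (tmod R V V')))"

definition mult_elem_ext ::
    "'u ring \<Rightarrow> 'u md \<Rightarrow> ('u \<Rightarrow> 'u \<Rightarrow> 'u) \<Rightarrow> 'u elext \<Rightarrow> ('u \<Rightarrow> 'u) \<Rightarrow> 'u mulfam \<Rightarrow> bool" where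
  "mult_elem_ext R M ra E u \<mu> \<longleftrightarrow> E \<in> elem_exts R M ra \<and> mult_structure R (emid E) u \<mu> \<and>
     mult_map R (emid E) u \<mu> (stalk 0 incl_fctr) (incl_unit R) (incl_mul R) (epr E)"

end

theory Submission
  imports Defs
begin

text \<open>
  Let \<open>Q V = R'[V]/R'[0]\<close>, let \<open>\<epsilon>\<close> be the evaluation map from \<open>Q\<close> to \<open>q\<^sub>*\<close> of the tautological functor,
  and let \<open>K\<close> be its kernel.  The base change \<open>R \<otimes>\<^bsub>R'\<^esub> K \<rightarrow> R \<otimes>\<^bsub>R'\<^esub> Q\<close> of the inclusion is an elementary
  extension, with \<open>m \<otimes> v \<mapsto> 1 \<otimes> i(m)[v]\<close> as the map from \<open>M \<otimes> V\<close>; this map is injective because \<open>Q V\<close> is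
  free, hence \<open>M \<otimes>\<^bsub>R'\<^esub> Q V \<rightarrow> Q V\<close> is injective.  The product \<open>[v][v'] = [v \<otimes> v']\<close> on \<open>Q\<close> is compatible
  with \<open>\<epsilon>\<close>, so it makes the extension multiplicative once products of two elements of degree 1 are
  set to zero: in that bidegree the Leibniz rule reads \<open>kk' - kk' = 0\<close>.

  A resolution \<open>P\<close> enters only through \<open>P\<^sub>0\<close>.  The map \<open>1 \<otimes> y \<mapsto> 1 \<otimes> dy\<close> identifies the truncation of the
  base change of \<open>P\<close> with the analogous two-term complex of \<open>P\<^sub>0\<close>, and a lift \<open>P\<^sub>0 \<rightarrow> Q\<close> of the augmentation
  maps that complex to the one of \<open>Q\<close>, compatibly with the maps from \<open>M \<otimes> V\<close>.  So the latter are
  injective for \<open>P\<^sub>0\<close> too, and all resolutions give the class of the extension defined by \<open>Q\<close>.  Resolutions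
  exist because every functor is a quotient of a free one on generators placed at the modules \<open>R\<^sup>n\<close>.
\<close>

section \<open>Modules and their homomorphisms\<close>

text \<open>Base change is handled through representatives. As \<open>q\<close> is onto, each
  element of \<open>R \<otimes> N\<close> is of the form \<open>1 \<otimes> n\<close>, and it
  vanishes exactly when \<open>n\<close> lies in \<open>I N\<close>, the submodule
  \<open>i(M) N\<close>. A cover \<open>F\<close> with kernel \<open>K\<close> thus gives
  \<open>K / I K \<rightarrow> F / I F\<close>, and since \<open>q\<close> kills
  \<open>i(M)\<close>, the homology in degree 1 is \<open>I F / I K\<close>. For every cover the
  rule \<open>m \<otimes> \<epsilon> p \<mapsto> i(m) p\<close> maps \<open>M \<otimes> V\<close>
  onto it; only the injectivity needs more. For \<open>Q\<close> it comes from freeness, and it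
  passes to any cover that maps to \<open>Q\<close>. This is why the construction is made for
  arbitrary covers and then compared.

  The obstacle to a multiplicative structure is strictness: a resolution in general carries products
  only up to homotopy. On \<open>Q\<close> there is no choice. Brackets form a basis, a bilinear map
  over the commutative ring \<open>R'\<close> is fixed by its values on pairs of brackets, and
  associativity, naturality and unitality become identities between pure tensors. As
  \<open>\<epsilon>\<close> is multiplicative, \<open>K\<close> is an ideal, so the products stay in
  the right degrees.\<close>

lemma mod_homI:
  assumes "\<And>x. x \<in> carrier V \<Longrightarrow> f x \<in> carrier W"
    and "\<And>x y. \<lbrakk>x \<in> carrier V; y \<in> carrier V\<rbrakk> \<Longrightarrow> f (x \<oplus>\<^bsub>V\<^esub> y) = f x \<oplus>\<^bsub>W\<^esub> f y"
    and "\<And>r x. \<lbrakk>r \<in> carrier R; x \<in> carrier V\<rbrakk> \<Longrightarrow> f (r \<odot>\<^bsub>V\<^esub> x) = r \<odot>\<^bsub>W\<^esub> f x"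
    and "f \<in> extensional (carrier V)"
  shows "f \<in> mod_hom R V W"
  using assms by (auto simp: mod_hom_def hom_def)

lemma restrict_mod_homI:
  assumes "\<And>x. x \<in> carrier V \<Longrightarrow> f x \<in> carrier W"
    and "\<And>x y. \<lbrakk>x \<in> carrier V; y \<in> carrier V\<rbrakk> \<Longrightarrow> f (x \<oplus>\<^bsub>V\<^esub> y) = f x \<oplus>\<^bsub>W\<^esub> f y"
    and "\<And>r x. \<lbrakk>r \<in> carrier R; x \<in> carrier V\<rbrakk> \<Longrightarrow> f (r \<odot>\<^bsub>V\<^esub> x) = r \<odot>\<^bsub>W\<^esub> f x"
    and "module R V"
  shows "restrict f (carrier V) \<in> mod_hom R V W"
proof -
  interpret V: module R V by fact
  show ?thesis by (rule mod_homI) (use assms in auto)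
qed

lemma mod_hom_closed: "f \<in> mod_hom R V W \<Longrightarrow> x \<in> carrier V \<Longrightarrow> f x \<in> carrier W"
  by (auto simp: mod_hom_def hom_def)

lemma mod_hom_add:
  "f \<in> mod_hom R V W \<Longrightarrow> x \<in> carrier V \<Longrightarrow> y \<in> carrier V \<Longrightarrow> f (x \<oplus>\<^bsub>V\<^esub> y) = f x \<oplus>\<^bsub>W\<^esub> f y"
  by (auto simp: mod_hom_def hom_def)

lemma mod_hom_smult:
  "f \<in> mod_hom R V W \<Longrightarrow> r \<in> carrier R \<Longrightarrow> x \<in> carrier V \<Longrightarrow> f (r \<odot>\<^bsub>V\<^esub> x) = r \<odot>\<^bsub>W\<^esub> f x"
  by (auto simp: mod_hom_def)

lemma mod_hom_ext: "f \<in> mod_hom R V W \<Longrightarrow> f \<in> extensional (carrier V)"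
  by (auto simp: mod_hom_def)

lemma mod_hom_eqI:
  "\<lbrakk>f \<in> mod_hom R V W; g \<in> mod_hom R V W'; \<And>x. x \<in> carrier V \<Longrightarrow> f x = g x\<rbrakk> \<Longrightarrow> f = g"
  by (metis extensionalityI mod_hom_ext)

text \<open>Stated for additive maps because it is also applied to \<open>i\<close>,
  \<open>q\<close> and \<open>tens_lift\<close>, for which no common ring of scalars is at
  hand.\<close>

lemma additive_zero:
  assumes V: "abelian_group V" and W: "abelian_group W"
    and "\<And>x. x \<in> carrier V \<Longrightarrow> f x \<in> carrier W"
    and "\<And>x y. \<lbrakk>x \<in> carrier V; y \<in> carrier V\<rbrakk> \<Longrightarrow> f (x \<oplus>\<^bsub>V\<^esub> y) = f x \<oplus>\<^bsub>W\<^esub> f y"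
  shows "f \<zero>\<^bsub>V\<^esub> = \<zero>\<^bsub>W\<^esub>"
proof -
  interpret V: abelian_group V by fact
  interpret W: abelian_group W by fact
  have "f \<zero>\<^bsub>V\<^esub> \<oplus>\<^bsub>W\<^esub> f \<zero>\<^bsub>V\<^esub> = f \<zero>\<^bsub>V\<^esub>"
    using assms(4)[of "\<zero>\<^bsub>V\<^esub>" "\<zero>\<^bsub>V\<^esub>"] by simp
  then show ?thesis using assms(3)[of "\<zero>\<^bsub>V\<^esub>"] by (metis V.zero_closed W.add.r_cancel_one)
qed

lemma additive_neg:
  assumes V: "abelian_group V" and W: "abelian_group W"
    and f: "\<And>x. x \<in> carrier V \<Longrightarrow> f x \<in> carrier W"
    and a: "\<And>x y. \<lbrakk>x \<in> carrier V; y \<in> carrier V\<rbrakk> \<Longrightarrow> f (x \<oplus>\<^bsub>V\<^esub> y) = f x \<oplus>\<^bsub>W\<^esub> f y"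
    and x: "x \<in> carrier V"
  shows "f (\<ominus>\<^bsub>V\<^esub> x) = \<ominus>\<^bsub>W\<^esub> f x"
proof -
  interpret V: abelian_group V by fact
  interpret W: abelian_group W by fact
  have "f (\<ominus>\<^bsub>V\<^esub> x) \<oplus>\<^bsub>W\<^esub> f x = \<zero>\<^bsub>W\<^esub>"
    using additive_zero[OF V W f a] a[of "\<ominus>\<^bsub>V\<^esub> x" x] x by (simp add: V.l_neg)
  then show ?thesis using f x by (simp add: W.minus_equality)
qed

lemma mod_hom_zero:
  assumes "f \<in> mod_hom R V W" "module R V" "module R W"
  shows "f \<zero>\<^bsub>V\<^esub> = \<zero>\<^bsub>W\<^esub>"
  by (rule additive_zero) (use assms module.axioms(2) in \<open>auto simp: mod_hom_closed mod_hom_add\<close>)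

lemma mod_hom_neg:
  assumes "f \<in> mod_hom R V W" "module R V" "module R W" "x \<in> carrier V"
  shows "f (\<ominus>\<^bsub>V\<^esub> x) = \<ominus>\<^bsub>W\<^esub> f x"
  by (rule additive_neg) (use assms module.axioms(2) in \<open>auto simp: mod_hom_closed mod_hom_add\<close>)

lemma mod_hom_diff:
  assumes "f \<in> mod_hom R V W" "module R V" "module R W" "x \<in> carrier V" "y \<in> carrier V"
  shows "f (x \<ominus>\<^bsub>V\<^esub> y) = f x \<ominus>\<^bsub>W\<^esub> f y"
proof -
  interpret V: module R V by fact
  interpret W: module R W by fact
  show ?thesis using assms
    by (simp add: a_minus_def mod_hom_add[OF assms(1)] mod_hom_neg[OF assms(1-3)])
qed

lemma mod_hom_compose:
  "f \<in> mod_hom R U V \<Longrightarrow> g \<in> mod_hom R V W \<Longrightarrow> module R U \<Longrightarrow> compose (carrier U) g f \<in> mod_hom R U W"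
  unfolding compose_def
  by (rule restrict_mod_homI) (auto simp: mod_hom_closed mod_hom_add mod_hom_smult)

lemma mod_hom_id: "module R V \<Longrightarrow> (\<lambda>x\<in>carrier V. x) \<in> mod_hom R V V"
  by (rule restrict_mod_homI) auto

lemma zero_map_mod_hom: "module R V \<Longrightarrow> module R W \<Longrightarrow> zero_map V W \<in> mod_hom R V W"
proof -
  assume V: "module R V" and W: "module R W"
  interpret V: module R V by fact
  interpret W: module R W by fact
  show ?thesis unfolding zero_map_def by (rule restrict_mod_homI) (use V in auto)
qed

lemma zero_md_module: "cring R \<Longrightarrow> module R zero_md"
  by (rule moduleI)
     (auto simp: zero_md_def intro!: abelian_groupI)

lemma carrier_zero_md [simp]: "carrier zero_md = {\<zero>\<^bsub>zero_md\<^esub>}"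
  by (simp add: zero_md_def)

lemma self_md_simps [simp]:
  "carrier (self_md R) = carrier R" "\<zero>\<^bsub>self_md R\<^esub> = \<zero>\<^bsub>R\<^esub>" "add (self_md R) = add R"
  "smult (self_md R) = mult R"
  by (simp_all add: self_md_def)

lemma self_md_module: "cring R \<Longrightarrow> module R (self_md R)"
proof -
  assume "cring R"
  then interpret cring R .
  have "\<exists>y\<in>carrier R. y \<oplus>\<^bsub>R\<^esub> x = \<zero>\<^bsub>R\<^esub>" if "x \<in> carrier R" for x
    using that l_neg by blast
  then show ?thesis
    by (intro moduleI abelian_groupI) (auto simp: a_ac l_distr r_distr m_assoc \<open>cring R\<close>)
qed

lemma restrict_scalars_simps [simp]:
  "carrier (restrict_scalars q N) = carrier N" "\<zero>\<^bsub>restrict_scalars q N\<^esub> = \<zero>\<^bsub>N\<^esub>"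
  "add (restrict_scalars q N) = add N"
  "smult (restrict_scalars q N) = (\<lambda>r' x. q r' \<odot>\<^bsub>N\<^esub> x)"
  by (simp_all add: restrict_scalars_def)

lemma abelian_group_cong:
  assumes "abelian_group V" "carrier W = carrier V" "add W = add V" "zero W = zero V"
  shows "abelian_group W"
proof -
  interpret V: abelian_group V by fact
  have "\<exists>y\<in>carrier V. y \<oplus>\<^bsub>V\<^esub> x = \<zero>\<^bsub>V\<^esub>" if "x \<in> carrier V" for x
    using that V.l_neg by blast
  then show ?thesis using assms(2-4)
    by (intro abelian_groupI) (auto simp: V.a_ac)
qed

lemma restrict_scalars_module:
  assumes "module R N" "q \<in> ring_hom R' R" "cring R'"
  shows "module R' (restrict_scalars q N)"
proof -
  interpret N: module R N by fact
  show ?thesis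
    by (rule moduleI)
       (use assms in \<open>auto simp: ring_hom_closed ring_hom_add ring_hom_mult ring_hom_one N.smult_l_distr
          N.smult_r_distr N.smult_assoc1 intro: abelian_group_cong[OF N.abelian_group_axioms]\<close>)
qed

text \<open>Subtraction is defined from the carrier, the addition and the zero alone, and all three
  survive the change of scalars.\<close>

lemma minus_restrict_scalars:
  "x \<ominus>\<^bsub>restrict_scalars q N\<^esub> y = x \<ominus>\<^bsub>N\<^esub> y"
  by (simp add: a_minus_def a_inv_def m_inv_def)

subsection \<open>Submodules and surjective images\<close>

text \<open>Closure under negatives is left to \<open>submod_neg\<close>, which obtains it from the
  scalar \<open>\<ominus> 1\<close>.\<close>

definition submod :: "'u ring \<Rightarrow> 'u md \<Rightarrow> 'u set \<Rightarrow> bool" where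
  "submod R V N \<longleftrightarrow> N \<subseteq> carrier V \<and> \<zero>\<^bsub>V\<^esub> \<in> N \<and> (\<forall>x\<in>N. \<forall>y\<in>N. x \<oplus>\<^bsub>V\<^esub> y \<in> N) \<and>
     (\<forall>r\<in>carrier R. \<forall>x\<in>N. r \<odot>\<^bsub>V\<^esub> x \<in> N)"

lemma submodD:
  assumes "submod R V N"
  shows "x \<in> N \<Longrightarrow> x \<in> carrier V" "\<zero>\<^bsub>V\<^esub> \<in> N" "x \<in> N \<Longrightarrow> y \<in> N \<Longrightarrow> x \<oplus>\<^bsub>V\<^esub> y \<in> N"
    "r \<in> carrier R \<Longrightarrow> x \<in> N \<Longrightarrow> r \<odot>\<^bsub>V\<^esub> x \<in> N"
  using assms by (auto simp: submod_def)

lemma submod_neg: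
  assumes "module R V" "submod R V N" "x \<in> N"
  shows "\<ominus>\<^bsub>V\<^esub> x \<in> N"
proof -
  interpret V: module R V by fact
  have x: "x \<in> carrier V" using assms submodD(1) by metis
  have "\<ominus>\<^bsub>V\<^esub> x = (\<ominus>\<^bsub>R\<^esub> \<one>\<^bsub>R\<^esub>) \<odot>\<^bsub>V\<^esub> x"
    using V.smult_l_minus[of "\<one>\<^bsub>R\<^esub>" x] x by simp
  then show ?thesis using submodD(4)[OF assms(2)] assms(3) by simp
qed

lemma submod_module:
  assumes "module R V" "submod R V N"
  shows "module R (V\<lparr>carrier := N\<rparr>)"
proof -
  interpret V: module R V by fact
  note d = submodD[OF assms(2)]
  have inv: "\<exists>y\<in>N. y \<oplus>\<^bsub>V\<^esub> x = \<zero>\<^bsub>V\<^esub>" if "x \<in> N" for x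
    using that V.l_neg d(1) submod_neg[OF assms] by blast
  show ?thesis
    by (intro moduleI abelian_groupI)
       (use d inv in \<open>auto simp: V.a_ac V.smult_l_distr V.smult_r_distr V.smult_assoc1
         V.R.cring_axioms\<close>)
qed

lemma submod_kernel:
  assumes "module R V" "module R W" "f \<in> mod_hom R V W"
  shows "submod R V {x \<in> carrier V. f x = \<zero>\<^bsub>W\<^esub>}"
proof -
  interpret V: module R V by fact
  interpret W: module R W by fact
  show ?thesis using mod_hom_zero[OF assms(3,1,2)]
    by (auto simp: submod_def mod_hom_add[OF assms(3)] mod_hom_smult[OF assms(3)])
qed

lemma submod_image:
  assumes "module R V" "module R W" "f \<in> mod_hom R V W"
  shows "submod R W (f ` carrier V)"
proof -
  interpret V: module R V by fact
  interpret W: module R W by fact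
  show ?thesis unfolding submod_def
  proof (intro conjI ballI)
    show "f ` carrier V \<subseteq> carrier W" using mod_hom_closed[OF assms(3)] by auto
    show "\<zero>\<^bsub>W\<^esub> \<in> f ` carrier V" using mod_hom_zero[OF assms(3,1,2)] by (metis V.zero_closed image_eqI)
  next
    fix x y assume "x \<in> f ` carrier V" "y \<in> f ` carrier V"
    then show "x \<oplus>\<^bsub>W\<^esub> y \<in> f ` carrier V"
      by (auto simp: mod_hom_add[OF assms(3), symmetric])
  next
    fix r x assume "r \<in> carrier R" "x \<in> f ` carrier V"
    then show "r \<odot>\<^bsub>W\<^esub> x \<in> f ` carrier V"
      by (auto simp: mod_hom_smult[OF assms(3), symmetric])
  qed
qed

lemma submod_zero: "module R V \<Longrightarrow> submod R V {\<zero>\<^bsub>V\<^esub>}"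
proof -
  assume "module R V" then interpret V: module R V .
  show ?thesis by (auto simp: submod_def)
qed

lemma submod_carrier: "module R V \<Longrightarrow> submod R V (carrier V)"
proof -
  assume "module R V" then interpret V: module R V .
  show ?thesis by (auto simp: submod_def)
qed

text \<open>Negatives are given by a description that ranges over the carrier, so shrinking the
  carrier could change them. Uniqueness of inverses in \<open>V\<close> shows that it does
  not.\<close>

lemma minus_sub:
  assumes V: "module R V" and N: "submod R V N" and "x \<in> N" "y \<in> N"
  shows "x \<ominus>\<^bsub>V\<lparr>carrier := N\<rparr>\<^esub> y = x \<ominus>\<^bsub>V\<^esub> y"
proof -
  interpret V: module R V by fact
  interpret N: module R "V\<lparr>carrier := N\<rparr>" by (rule submod_module[OF V N])
  have "\<ominus>\<^bsub>V\<lparr>carrier := N\<rparr>\<^esub> y \<oplus>\<^bsub>V\<^esub> y = \<zero>\<^bsub>V\<^esub>"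
    using N.l_neg[of y] assms by simp
  moreover have "\<ominus>\<^bsub>V\<lparr>carrier := N\<rparr>\<^esub> y \<in> carrier V"
    using N.a_inv_closed[of y] assms submodD(1)[OF N] by simp
  ultimately have "\<ominus>\<^bsub>V\<^esub> y = \<ominus>\<^bsub>V\<lparr>carrier := N\<rparr>\<^esub> y"
    using assms submodD(1)[OF N] V.minus_equality by blast
  then show ?thesis by (simp add: a_minus_def)
qed

text \<open>The axioms are carried along a surjection that respects the operations. Quotients,
  tensor products and copies into \<open>'u\<close> get their group structure this way, from the
  object that they are an image of.\<close>

lemma abelian_group_image:
  assumes "comm_group G" "p ` carrier G = carrier X" "\<zero>\<^bsub>X\<^esub> = p \<one>\<^bsub>G\<^esub>"
    and p: "\<And>x y. \<lbrakk>x \<in> carrier G; y \<in> carrier G\<rbrakk> \<Longrightarrow> p x \<oplus>\<^bsub>X\<^esub> p y = p (x \<otimes>\<^bsub>G\<^esub> y)"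
  shows "abelian_group X"
proof -
  interpret G: comm_group G by fact
  have c: "\<And>x. x \<in> carrier X \<Longrightarrow> \<exists>y\<in>carrier G. x = p y"
    and pc: "\<And>y. y \<in> carrier G \<Longrightarrow> p y \<in> carrier X" using assms(2) by auto
  show ?thesis
  proof (rule abelian_groupI)
    fix x y assume xy: "x \<in> carrier X" "y \<in> carrier X"
    then obtain x' y' where e: "x = p x'" "y = p y'" "x' \<in> carrier G" "y' \<in> carrier G" using c by blast
    then show "x \<oplus>\<^bsub>X\<^esub> y \<in> carrier X" using p pc by simp
    show "x \<oplus>\<^bsub>X\<^esub> y = y \<oplus>\<^bsub>X\<^esub> x" using e p by (simp add: G.m_comm)
    fix z assume "z \<in> carrier X"
    then obtain z' where "z = p z'" "z' \<in> carrier G" using c by blast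
    then show "x \<oplus>\<^bsub>X\<^esub> y \<oplus>\<^bsub>X\<^esub> z = x \<oplus>\<^bsub>X\<^esub> (y \<oplus>\<^bsub>X\<^esub> z)" using e p by (simp add: G.m_assoc)
  next
    show "\<zero>\<^bsub>X\<^esub> \<in> carrier X" using assms(3) pc by simp
  next
    fix x assume "x \<in> carrier X"
    then obtain x' where e: "x = p x'" "x' \<in> carrier G" using c by blast
    then show "\<zero>\<^bsub>X\<^esub> \<oplus>\<^bsub>X\<^esub> x = x" using assms(3) p by simp
    have "p (inv\<^bsub>G\<^esub> x') \<oplus>\<^bsub>X\<^esub> x = \<zero>\<^bsub>X\<^esub>" using e p assms(3) by simp
    then show "\<exists>y\<in>carrier X. y \<oplus>\<^bsub>X\<^esub> x = \<zero>\<^bsub>X\<^esub>" using pc e by blast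
  qed
qed

lemma module_image:
  assumes V: "module R V" "p ` carrier V = carrier X" "\<zero>\<^bsub>X\<^esub> = p \<zero>\<^bsub>V\<^esub>"
    and p: "\<And>x y. \<lbrakk>x \<in> carrier V; y \<in> carrier V\<rbrakk> \<Longrightarrow> p x \<oplus>\<^bsub>X\<^esub> p y = p (x \<oplus>\<^bsub>V\<^esub> y)"
    and s: "\<And>r x. \<lbrakk>r \<in> carrier R; x \<in> carrier V\<rbrakk> \<Longrightarrow> r \<odot>\<^bsub>X\<^esub> p x = p (r \<odot>\<^bsub>V\<^esub> x)"
  shows "module R X"
proof -
  interpret V: module R V by fact
  have c: "\<And>x. x \<in> carrier X \<Longrightarrow> \<exists>y\<in>carrier V. x = p y"
    and pc: "\<And>y. y \<in> carrier V \<Longrightarrow> p y \<in> carrier X" using assms(2) by auto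
  have "abelian_group X"
    by (rule abelian_group_image[of "add_monoid V" p])
       (use assms V.a_comm_group in auto)
  then interpret X: abelian_group X .
  show ?thesis
  proof (rule moduleI)
    fix a x y assume a: "a \<in> carrier R" and "x \<in> carrier X" "y \<in> carrier X"
    then obtain x' y' where e: "x = p x'" "y = p y'" "x' \<in> carrier V" "y' \<in> carrier V" using c by blast
    then show "a \<odot>\<^bsub>X\<^esub> (x \<oplus>\<^bsub>X\<^esub> y) = a \<odot>\<^bsub>X\<^esub> x \<oplus>\<^bsub>X\<^esub> a \<odot>\<^bsub>X\<^esub> y"
      using a p s by (simp add: V.smult_r_distr)
  next
    fix a b x assume a: "a \<in> carrier R" "b \<in> carrier R" and "x \<in> carrier X"
    then obtain x' where e: "x = p x'" "x' \<in> carrier V" using c by blast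
    show "(a \<oplus>\<^bsub>R\<^esub> b) \<odot>\<^bsub>X\<^esub> x = a \<odot>\<^bsub>X\<^esub> x \<oplus>\<^bsub>X\<^esub> b \<odot>\<^bsub>X\<^esub> x" "a \<otimes>\<^bsub>R\<^esub> b \<odot>\<^bsub>X\<^esub> x = a \<odot>\<^bsub>X\<^esub> (b \<odot>\<^bsub>X\<^esub> x)"
      using a e p s by (simp_all add: V.smult_l_distr V.smult_assoc1)
  next
    fix a x assume a: "a \<in> carrier R" and "x \<in> carrier X"
    then obtain x' where e: "x = p x'" "x' \<in> carrier V" using c by blast
    show "a \<odot>\<^bsub>X\<^esub> x \<in> carrier X" using a e s pc by simp
  next
    fix x assume "x \<in> carrier X"
    then obtain x' where e: "x = p x'" "x' \<in> carrier V" using c by blast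
    then show "\<one>\<^bsub>R\<^esub> \<odot>\<^bsub>X\<^esub> x = x" using s by simp
  qed (use V.R.cring_axioms \<open>abelian_group X\<close> in auto)
qed

text \<open>As soon as some injection into \<open>'u\<close> exists, the chosen one is injective and
  is an isomorphism onto the copy. From here on a copy is described only through
  \<open>h\<close>.\<close>

lemma resize_simps:
  assumes "\<exists>h :: 'b \<Rightarrow> 'u. inj_on h (carrier X)"
  defines "h \<equiv> emb X :: 'b \<Rightarrow> 'u"
  shows "inj_on h (carrier X)" "carrier (resize X) = h ` carrier X" "\<zero>\<^bsub>resize X\<^esub> = h \<zero>\<^bsub>X\<^esub>"
    "\<And>x y. \<lbrakk>x \<in> carrier X; y \<in> carrier X\<rbrakk> \<Longrightarrow> h x \<oplus>\<^bsub>resize X\<^esub> h y = h (x \<oplus>\<^bsub>X\<^esub> y)"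
    "\<And>r x. x \<in> carrier X \<Longrightarrow> r \<odot>\<^bsub>resize X\<^esub> h x = h (r \<odot>\<^bsub>X\<^esub> x)"
proof -
  show i: "inj_on h (carrier X)"
    using assms(1) unfolding h_def emb_def by (rule someI_ex)
  show "carrier (resize X) = h ` carrier X" "\<zero>\<^bsub>resize X\<^esub> = h \<zero>\<^bsub>X\<^esub>"
    "\<And>x y. \<lbrakk>x \<in> carrier X; y \<in> carrier X\<rbrakk> \<Longrightarrow> h x \<oplus>\<^bsub>resize X\<^esub> h y = h (x \<oplus>\<^bsub>X\<^esub> y)"
    "\<And>r x. x \<in> carrier X \<Longrightarrow> r \<odot>\<^bsub>resize X\<^esub> h x = h (r \<odot>\<^bsub>X\<^esub> x)"
    using i by (auto simp: resize_def Let_def h_def)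
qed

subsection \<open>Quotient modules\<close>

lemma quot_facts:
  assumes V: "module R V" and N: "submod R V N"
  shows quot_cls_onto: "quot_cls V N ` carrier V = carrier (quot_md V N)"
    and quot_cls_add: "\<And>x y. \<lbrakk>x \<in> carrier V; y \<in> carrier V\<rbrakk> \<Longrightarrow>
      quot_cls V N (x \<oplus>\<^bsub>V\<^esub> y) = quot_cls V N x \<oplus>\<^bsub>quot_md V N\<^esub> quot_cls V N y"
    and quot_cls_smult: "\<And>r x. \<lbrakk>r \<in> carrier R; x \<in> carrier V\<rbrakk> \<Longrightarrow>
      quot_cls V N (r \<odot>\<^bsub>V\<^esub> x) = r \<odot>\<^bsub>quot_md V N\<^esub> quot_cls V N x"
    and quot_zero: "\<zero>\<^bsub>quot_md V N\<^esub> = quot_cls V N \<zero>\<^bsub>V\<^esub>"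
    and quot_cls_eq: "\<And>x y. \<lbrakk>x \<in> carrier V; y \<in> carrier V\<rbrakk> \<Longrightarrow>
      quot_cls V N x = quot_cls V N y \<longleftrightarrow> x \<ominus>\<^bsub>V\<^esub> y \<in> N"
proof -
  interpret V: module R V by fact
  note d = submodD[OF N]
  let ?G = "add_monoid V"
  have sg: "subgroup N ?G"
    by (rule V.add.subgroupI) (use d submod_neg[OF V N] in auto)
  then have nm: "N \<lhd> ?G"
    by (simp add: V.add.subgroup_imp_normal)
  interpret nrm: normal N ?G by fact
  have cos: "carrier (raw_quot V N) = (\<lambda>x. N +>\<^bsub>V\<^esub> x) ` carrier V"
    by (auto simp: raw_quot_def A_RCOSETS_def')
  note rs = resize_simps[OF ex_emb_quot[of V N]]
  have qc: "quot_cls V N = (\<lambda>x. emb (raw_quot V N) (N +>\<^bsub>V\<^esub> x))"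
    by (auto simp: quot_cls_def)
  have ceq: "N +>\<^bsub>V\<^esub> x = N +>\<^bsub>V\<^esub> y \<longleftrightarrow> x \<ominus>\<^bsub>V\<^esub> y \<in> N" if "x \<in> carrier V" "y \<in> carrier V" for x y
  proof
    assume "N +>\<^bsub>V\<^esub> x = N +>\<^bsub>V\<^esub> y"
    then have "x \<in> N +>\<^bsub>V\<^esub> y"
      using V.add.rcos_self[OF that(1) sg] by (simp add: a_r_coset_def)
    then obtain n where "n \<in> N" "x = n \<oplus>\<^bsub>V\<^esub> y" by (auto simp: a_r_coset_def r_coset_def)
    then show "x \<ominus>\<^bsub>V\<^esub> y \<in> N" using that d(1)
      by (simp add: a_minus_def V.a_assoc V.r_neg)
  next
    assume n: "x \<ominus>\<^bsub>V\<^esub> y \<in> N"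
    have "x = (x \<ominus>\<^bsub>V\<^esub> y) \<oplus>\<^bsub>V\<^esub> y" using that by (simp add: a_minus_def V.a_assoc V.l_neg)
    then have "x \<in> N #>\<^bsub>?G\<^esub> y" using n by (force simp: r_coset_def)
    then show "N +>\<^bsub>V\<^esub> x = N +>\<^bsub>V\<^esub> y"
      using V.add.repr_independence[OF _ _ sg] that by (simp add: a_r_coset_def)
  qed
  show "quot_cls V N ` carrier V = carrier (quot_md V N)"
    by (simp add: qc quot_md_def rs(2) cos image_image)
  show "quot_cls V N (x \<oplus>\<^bsub>V\<^esub> y) = quot_cls V N x \<oplus>\<^bsub>quot_md V N\<^esub> quot_cls V N y"
    if "x \<in> carrier V" "y \<in> carrier V" for x y
  proof -
    have "(N +>\<^bsub>V\<^esub> x) \<oplus>\<^bsub>raw_quot V N\<^esub> (N +>\<^bsub>V\<^esub> y) = N +>\<^bsub>V\<^esub> (x \<oplus>\<^bsub>V\<^esub> y)"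
      using nrm.rcos_sum[of x y] that by (simp add: raw_quot_def a_r_coset_def set_add_def)
    then show ?thesis unfolding qc quot_md_def
      by (subst rs(4)) (use that cos in auto)
  qed
  show "quot_cls V N (r \<odot>\<^bsub>V\<^esub> x) = r \<odot>\<^bsub>quot_md V N\<^esub> quot_cls V N x"
    if r: "r \<in> carrier R" and x: "x \<in> carrier V" for r x
  proof -
    \<comment> \<open>In \<open>raw_quot\<close> a scalar acts on a coset by a union over its
      representatives. All cosets in this union agree, so the union is one coset.\<close>
    have "N +>\<^bsub>V\<^esub> (r \<odot>\<^bsub>V\<^esub> y) = N +>\<^bsub>V\<^esub> (r \<odot>\<^bsub>V\<^esub> x)" if y: "y \<in> N +>\<^bsub>V\<^esub> x" for y
    proof -
      obtain n where n: "n \<in> N" "y = n \<oplus>\<^bsub>V\<^esub> x" using y by (auto simp: a_r_coset_def r_coset_def)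
      then have "r \<odot>\<^bsub>V\<^esub> y \<ominus>\<^bsub>V\<^esub> r \<odot>\<^bsub>V\<^esub> x = r \<odot>\<^bsub>V\<^esub> n"
        using r x d(1) by (simp add: V.smult_r_distr a_minus_def V.a_assoc V.r_neg)
      then show ?thesis using ceq n r x d by auto
    qed
    moreover have "x \<in> N +>\<^bsub>V\<^esub> x"
      using V.add.rcos_self[of x N] sg x by (simp add: a_r_coset_def)
    ultimately have "(\<Union>y\<in>N +>\<^bsub>V\<^esub> x. N +>\<^bsub>V\<^esub> (r \<odot>\<^bsub>V\<^esub> y)) = N +>\<^bsub>V\<^esub> (r \<odot>\<^bsub>V\<^esub> x)"
      by (intro SUP_eq_const) blast+
    then have "r \<odot>\<^bsub>raw_quot V N\<^esub> (N +>\<^bsub>V\<^esub> x) = N +>\<^bsub>V\<^esub> (r \<odot>\<^bsub>V\<^esub> x)"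
      by (simp add: raw_quot_def)
    then show ?thesis unfolding qc quot_md_def
      by (subst rs(5)) (use x cos in auto)
  qed
  have "N +>\<^bsub>V\<^esub> \<zero>\<^bsub>V\<^esub> = N"
    using d(1) by (force simp: a_r_coset_def r_coset_def)
  then show "\<zero>\<^bsub>quot_md V N\<^esub> = quot_cls V N \<zero>\<^bsub>V\<^esub>"
    by (simp add: qc quot_md_def rs(3)) (simp add: raw_quot_def)
  show "quot_cls V N x = quot_cls V N y \<longleftrightarrow> x \<ominus>\<^bsub>V\<^esub> y \<in> N" if "x \<in> carrier V" "y \<in> carrier V" for x y
    using ceq[OF that] inj_on_eq_iff[OF rs(1)] that cos by (auto simp: qc)
qed

lemma quot_cls_closed:
  "\<lbrakk>module R V; submod R V N; x \<in> carrier V\<rbrakk> \<Longrightarrow> quot_cls V N x \<in> carrier (quot_md V N)"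
  using quot_cls_onto by blast

lemma quot_module:
  assumes "module R V" "submod R V N"
  shows "module R (quot_md V N)"
  by (rule module_image[OF assms(1), of "quot_cls V N"]) (use quot_facts[OF assms] in auto)

lemma quot_rep:
  assumes "module R V" "submod R V N" "c \<in> carrier (quot_md V N)"
  shows "quot_rep V N c \<in> carrier V" "quot_cls V N (quot_rep V N c) = c"
proof -
  have "\<exists>x. x \<in> carrier V \<and> quot_cls V N x = c" using quot_cls_onto[OF assms(1,2)] assms(3) by (metis imageE)
  from someI_ex[OF this] show "quot_rep V N c \<in> carrier V" "quot_cls V N (quot_rep V N c) = c"
    unfolding quot_rep_def by auto
qed

section \<open>Tensor products\<close>

locale tensor_data =
  fixes S :: "('u::infinite) ring" and A :: "'u md" and ra :: "'u \<Rightarrow> 'u \<Rightarrow> 'u"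
    and R :: "'u ring" and N :: "'u md"
  assumes A_module: "module S A" and N_module: "module R N"
    and ra_closed: "\<And>a r. \<lbrakk>a \<in> carrier A; r \<in> carrier R\<rbrakk> \<Longrightarrow> ra a r \<in> carrier A"
    and ra_smult: "\<And>s a r. \<lbrakk>s \<in> carrier S; a \<in> carrier A; r \<in> carrier R\<rbrakk> \<Longrightarrow>
      ra (s \<odot>\<^bsub>A\<^esub> a) r = s \<odot>\<^bsub>A\<^esub> ra a r"
begin

interpretation A: module S A by (rule A_module)
interpretation N: module R N by (rule N_module)

abbreviation "T \<equiv> tensor A ra R N"
abbreviation "t \<equiv> tens A ra R N"
abbreviation "F \<equiv> free_Abelian_group (carrier A \<times> carrier N)"
abbreviation "K \<equiv> generate F (tensor_rel A ra R N)"

text \<open>The projection from the free abelian group, with the copying into \<open>'u\<close>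
  included. All properties of the tensor product are read off from it.\<close>

definition pr :: "('u \<times> 'u \<Rightarrow>\<^sub>0 int) \<Rightarrow> 'u" where
  "pr x = emb (raw_tensor A ra R N) (K #>\<^bsub>F\<^esub> x)"

lemma t_pr: "t a n = pr (frag_of (a, n))"
  by (simp add: tens_def pr_def Let_def)

lemma comm_F: "comm_group F" by (rule abelian_free_Abelian_group)

interpretation F: comm_group F by (rule comm_F)

lemma F_diff: "\<lbrakk>x \<in> carrier F; y \<in> carrier F\<rbrakk> \<Longrightarrow> x - y \<in> carrier F"
  using F.m_closed[of x "- y"] by simp

lemma F_frag: "\<lbrakk>a \<in> carrier A; n \<in> carrier N\<rbrakk> \<Longrightarrow> frag_of (a, n) \<in> carrier F"
  by simp

lemma rel_sub: "tensor_rel A ra R N \<subseteq> carrier F"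
  by (auto simp: tensor_rel_def ra_closed simp del: carrier_free_Abelian_group_iff intro!: F_diff F_frag)

lemma rel_l: "\<lbrakk>a \<in> carrier A; b \<in> carrier A; n \<in> carrier N\<rbrakk> \<Longrightarrow>
    frag_of (a \<oplus>\<^bsub>A\<^esub> b, n) - frag_of (a, n) - frag_of (b, n) \<in> tensor_rel A ra R N"
  and rel_r: "\<lbrakk>a \<in> carrier A; n \<in> carrier N; k \<in> carrier N\<rbrakk> \<Longrightarrow>
    frag_of (a, n \<oplus>\<^bsub>N\<^esub> k) - frag_of (a, n) - frag_of (a, k) \<in> tensor_rel A ra R N"
  and rel_b: "\<lbrakk>a \<in> carrier A; r \<in> carrier R; n \<in> carrier N\<rbrakk> \<Longrightarrow>
    frag_of (ra a r, n) - frag_of (a, r \<odot>\<^bsub>N\<^esub> n) \<in> tensor_rel A ra R N"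
  by (auto simp: tensor_rel_def)

lemma subgroup_K: "subgroup K F" by (rule F.generate_is_subgroup[OF rel_sub])

lemma K_normal: "K \<lhd> F" by (rule F.subgroup_imp_normal[OF subgroup_K])

interpretation K: normal K F by (rule K_normal)

lemma coset_eq: "\<lbrakk>x \<in> carrier F; y \<in> carrier F\<rbrakk> \<Longrightarrow> K #>\<^bsub>F\<^esub> x = K #>\<^bsub>F\<^esub> y \<longleftrightarrow> x - y \<in> K"
proof
  assume xy: "x \<in> carrier F" "y \<in> carrier F"
  { assume "K #>\<^bsub>F\<^esub> x = K #>\<^bsub>F\<^esub> y"
    then have "x \<in> K #>\<^bsub>F\<^esub> y" using F.rcos_self[OF xy(1) subgroup_K] by simp
    then show "x - y \<in> K" by (auto simp: r_coset_def) }
  assume "x - y \<in> K"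
  then have "x \<in> K #>\<^bsub>F\<^esub> y" by (auto simp: r_coset_def intro!: bexI[of _ "x - y"])
  then show "K #>\<^bsub>F\<^esub> x = K #>\<^bsub>F\<^esub> y"
    using F.repr_independence[OF _ _ subgroup_K] xy by simp
qed

lemma raw_carrier: "carrier (raw_tensor A ra R N) = (\<lambda>x. K #>\<^bsub>F\<^esub> x) ` carrier F"
  by (auto simp: raw_tensor_def Let_def RCOSETS_def)

lemmas rs = resize_simps[OF ex_emb_tensor[of A ra R N]]

lemma T_carrier: "carrier T = pr ` carrier F"
  by (simp add: tensor_def rs(2) raw_carrier pr_def image_image)

lemma pr_add: "\<lbrakk>x \<in> carrier F; y \<in> carrier F\<rbrakk> \<Longrightarrow> pr x \<oplus>\<^bsub>T\<^esub> pr y = pr (x + y)"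
proof -
  assume xy: "x \<in> carrier F" "y \<in> carrier F"
  have "(K #>\<^bsub>F\<^esub> x) \<oplus>\<^bsub>raw_tensor A ra R N\<^esub> (K #>\<^bsub>F\<^esub> y) = K #>\<^bsub>F\<^esub> (x + y)"
    using K.rcos_sum[OF xy] by (simp add: raw_tensor_def Let_def)
  then show ?thesis unfolding pr_def tensor_def
    by (subst rs(4)) (use xy raw_carrier in auto)
qed

lemma pr_zero: "\<zero>\<^bsub>T\<^esub> = pr 0"
proof -
  have "K #>\<^bsub>F\<^esub> 0 = K" using F.coset_mult_one[OF subgroup.subset[OF subgroup_K]] by simp
  then show ?thesis by (simp add: pr_def tensor_def rs(3)) (simp add: raw_tensor_def Let_def)
qed

lemma pr_eq: "\<lbrakk>x \<in> carrier F; y \<in> carrier F\<rbrakk> \<Longrightarrow> pr x = pr y \<longleftrightarrow> x - y \<in> K"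
  using coset_eq[of x y] inj_on_eq_iff[OF rs(1)] raw_carrier by (auto simp: pr_def)

lemma T_group: "abelian_group T"
  by (rule abelian_group_image[OF comm_F, of pr]) (simp_all add: T_carrier pr_zero pr_add)

interpretation T: abelian_group T by (rule T_group)

lemma t_closed [simp]: "\<lbrakk>a \<in> carrier A; n \<in> carrier N\<rbrakk> \<Longrightarrow> t a n \<in> carrier T"
  by (auto simp: t_pr T_carrier)

lemma t_rel:
  assumes "x - y - z \<in> tensor_rel A ra R N" "x \<in> carrier F" "y \<in> carrier F" "z \<in> carrier F"
  shows "pr x = pr y \<oplus>\<^bsub>T\<^esub> pr z"
proof -
  have "y + z \<in> carrier F" using F.m_closed[OF assms(3,4)] by simp
  moreover have "x - (y + z) \<in> K" using generate.incl[OF assms(1)] by (simp add: algebra_simps)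
  ultimately show ?thesis using assms pr_eq[of x "y + z"] pr_add by simp
qed

lemma t_add_l:
  "\<lbrakk>a \<in> carrier A; b \<in> carrier A; n \<in> carrier N\<rbrakk> \<Longrightarrow> t (a \<oplus>\<^bsub>A\<^esub> b) n = t a n \<oplus>\<^bsub>T\<^esub> t b n"
  unfolding t_pr by (rule t_rel) (auto simp: tensor_rel_def)

lemma t_add_r:
  "\<lbrakk>a \<in> carrier A; n \<in> carrier N; k \<in> carrier N\<rbrakk> \<Longrightarrow> t a (n \<oplus>\<^bsub>N\<^esub> k) = t a n \<oplus>\<^bsub>T\<^esub> t a k"
  unfolding t_pr by (rule t_rel) (auto simp: tensor_rel_def)

lemma t_bal:
  "\<lbrakk>a \<in> carrier A; r \<in> carrier R; n \<in> carrier N\<rbrakk> \<Longrightarrow> t (ra a r) n = t a (r \<odot>\<^bsub>N\<^esub> n)"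
  unfolding t_pr
  by (subst pr_eq) (auto simp: ra_closed tensor_rel_def intro!: generate.incl)

lemma t_zero_l [simp]: "n \<in> carrier N \<Longrightarrow> t \<zero>\<^bsub>A\<^esub> n = \<zero>\<^bsub>T\<^esub>"
  by (rule additive_zero[OF A.abelian_group_axioms T_group, of "\<lambda>a. t a n"]) (auto simp: t_add_l)

lemma t_zero_r [simp]: "a \<in> carrier A \<Longrightarrow> t a \<zero>\<^bsub>N\<^esub> = \<zero>\<^bsub>T\<^esub>"
  by (rule additive_zero[OF N.abelian_group_axioms T_group]) (auto simp: t_add_r)

lemma t_neg_l: "\<lbrakk>a \<in> carrier A; n \<in> carrier N\<rbrakk> \<Longrightarrow> t (\<ominus>\<^bsub>A\<^esub> a) n = \<ominus>\<^bsub>T\<^esub> t a n"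
  by (rule additive_neg[OF A.abelian_group_axioms T_group, of "\<lambda>a. t a n"]) (auto simp: t_add_l)

lemma pr_neg: "x \<in> carrier F \<Longrightarrow> pr (- x) = \<ominus>\<^bsub>T\<^esub> pr x"
proof -
  assume x: "x \<in> carrier F"
  then have x': "- x \<in> carrier F" by simp
  have "pr (- x) \<oplus>\<^bsub>T\<^esub> pr x = \<zero>\<^bsub>T\<^esub>" using pr_add[OF x' x] by (simp add: pr_zero)
  then show ?thesis using T.minus_equality[of "pr (- x)" "pr x"] x x' by (simp add: T_carrier)
qed

text \<open>Zero and negatives need no case of their own, since \<open>0 = 0 \<otimes> 0\<close> and
  \<open>-(a \<otimes> n) = (-a) \<otimes> n\<close> are pure. The induction on the free abelian
  group proceeds by differences, so the claim is proved for \<open>x\<close> and \<open>- x\<close>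
  together.\<close>

lemma tensor_induct [consumes 1, case_names pure add]:
  assumes "z \<in> carrier T"
    and pure: "\<And>a n. \<lbrakk>a \<in> carrier A; n \<in> carrier N\<rbrakk> \<Longrightarrow> P (t a n)"
    and add: "\<And>x y. \<lbrakk>x \<in> carrier T; y \<in> carrier T; P x; P y\<rbrakk> \<Longrightarrow> P (x \<oplus>\<^bsub>T\<^esub> y)"
  shows "P z"
proof -
  have P0: "P \<zero>\<^bsub>T\<^esub>" using pure[of "\<zero>\<^bsub>A\<^esub>" "\<zero>\<^bsub>N\<^esub>"] by simp
  have "x \<in> carrier F \<Longrightarrow> P (pr x) \<and> P (pr (- x))" for x
  proof -
    assume "x \<in> carrier F"
    then have "Poly_Mapping.keys x \<subseteq> carrier A \<times> carrier N" by simp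
    then have "P (pr x) \<and> P (pr (- x)) \<and> x \<in> carrier F"
    proof (induction rule: frag_induction)
      case (one x)
      then obtain a n where an: "x = (a, n)" "a \<in> carrier A" "n \<in> carrier N" by auto
      then have "P (pr (- frag_of x))" using pure[of "\<ominus>\<^bsub>A\<^esub> a" n] t_neg_l[of a n] pr_neg[of "frag_of x"]
        by (simp add: t_pr)
      then show ?case using pure[of a n] an by (simp add: t_pr)
    next
      case (diff x y)
      then have c: "x \<in> carrier F" "- y \<in> carrier F" "- x \<in> carrier F" "y \<in> carrier F" by auto
      have "P (pr x \<oplus>\<^bsub>T\<^esub> pr (- y))" "P (pr (- x) \<oplus>\<^bsub>T\<^esub> pr y)"
        using diff c T_carrier by (auto intro!: add)
      moreover have "x - y \<in> carrier F" using F.m_closed[OF c(1,2)] by simp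
      ultimately show ?case using pr_add[OF c(1,2)] pr_add[OF c(3,4)] by (simp add: algebra_simps)
    qed (use P0 pr_zero in auto)
    then show ?thesis by blast
  qed
  then show ?thesis using assms(1) T_carrier by auto
qed

text \<open>The universal property: \<open>f\<close> extends to the free abelian group, and the
  three kinds of relations lie in the kernel of the extension because \<open>f\<close> is biadditive
  and balanced.\<close>

lemma ex_hom:
  fixes G :: "('b, 'c) monoid_scheme"
  assumes G: "comm_group G"
    and f: "\<And>a n. \<lbrakk>a \<in> carrier A; n \<in> carrier N\<rbrakk> \<Longrightarrow> f a n \<in> carrier G"
    and "\<And>a b n. \<lbrakk>a \<in> carrier A; b \<in> carrier A; n \<in> carrier N\<rbrakk> \<Longrightarrow> f (a \<oplus>\<^bsub>A\<^esub> b) n = f a n \<otimes>\<^bsub>G\<^esub> f b n"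
    and "\<And>a n k. \<lbrakk>a \<in> carrier A; n \<in> carrier N; k \<in> carrier N\<rbrakk> \<Longrightarrow> f a (n \<oplus>\<^bsub>N\<^esub> k) = f a n \<otimes>\<^bsub>G\<^esub> f a k"
    and "\<And>a r n. \<lbrakk>a \<in> carrier A; r \<in> carrier R; n \<in> carrier N\<rbrakk> \<Longrightarrow> f (ra a r) n = f a (r \<odot>\<^bsub>N\<^esub> n)"
  obtains g where "\<And>x. x \<in> carrier T \<Longrightarrow> g x \<in> carrier G"
    "\<And>x y. \<lbrakk>x \<in> carrier T; y \<in> carrier T\<rbrakk> \<Longrightarrow> g (x \<oplus>\<^bsub>T\<^esub> y) = g x \<otimes>\<^bsub>G\<^esub> g y"
    "\<And>a n. \<lbrakk>a \<in> carrier A; n \<in> carrier N\<rbrakk> \<Longrightarrow> g (t a n) = f a n"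
proof -
  interpret G: comm_group G by fact
  have im: "case_prod f ` (carrier A \<times> carrier N) \<subseteq> carrier G" using f by auto
  obtain h where h: "h \<in> hom F G" "\<And>x. x \<in> carrier A \<times> carrier N \<Longrightarrow> h (frag_of x) = case_prod f x"
    by (rule G.free_Abelian_group_universal[OF im]) (rule that)
  interpret h: group_hom F G h
    by unfold_locales (rule h(1))
  have hf: "\<And>a n. \<lbrakk>a \<in> carrier A; n \<in> carrier N\<rbrakk> \<Longrightarrow> h (frag_of (a, n)) = f a n"
    using h(2) by auto
  have hd: "h (x - y) = h x \<otimes>\<^bsub>G\<^esub> inv\<^bsub>G\<^esub> h y" "x - y \<in> carrier F"
    if "x \<in> carrier F" "y \<in> carrier F" for x y
  proof -
    have m: "- y \<in> carrier F" using that by simp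
    show "h (x - y) = h x \<otimes>\<^bsub>G\<^esub> inv\<^bsub>G\<^esub> h y"
      using h.hom_mult[OF that(1) m] h.hom_inv[OF that(2)] that by simp
    show "x - y \<in> carrier F" using F.m_closed[OF that(1) m] by simp
  qed
  have fo: "\<And>a n. \<lbrakk>a \<in> carrier A; n \<in> carrier N\<rbrakk> \<Longrightarrow> frag_of (a, n) \<in> carrier F" by simp
  have canc: "(x \<otimes>\<^bsub>G\<^esub> y) \<otimes>\<^bsub>G\<^esub> inv\<^bsub>G\<^esub> x \<otimes>\<^bsub>G\<^esub> inv\<^bsub>G\<^esub> y = \<one>\<^bsub>G\<^esub>"
    if "x \<in> carrier G" "y \<in> carrier G" for x y
    using that by (metis G.inv_closed G.inv_solve_right' G.m_comm G.m_assoc G.r_inv G.m_closed)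
  have "tensor_rel A ra R N \<subseteq> kernel F G h"
    using rel_sub assms(2-) unfolding tensor_rel_def kernel_def
    by (auto simp: hd fo hf canc ra_closed simp del: carrier_free_Abelian_group_iff)
  then have "K \<subseteq> kernel F G h"
    by (rule F.generate_subgroup_incl[OF _ h.subgroup_kernel])
  then have hK: "h x = \<one>\<^bsub>G\<^esub>" if "x \<in> K" for x using that by (auto simp: kernel_def)
  \<comment> \<open>A map on classes is defined through a chosen representative; \<open>gp\<close>
    shows that the choice is irrelevant, because \<open>h\<close> is trivial on
    \<open>K\<close>.\<close>
  define g where "g x = h (SOME y. y \<in> carrier F \<and> pr y = x)" for x
  have gp: "g (pr x) = h x" if x: "x \<in> carrier F" for x
  proof -
    define y where "y = (SOME y. y \<in> carrier F \<and> pr y = pr x)"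
    have y: "y \<in> carrier F \<and> pr y = pr x" unfolding y_def by (rule someI[of _ x]) (use x in auto)
    then have "h (y - x) = \<one>\<^bsub>G\<^esub>" using pr_eq x hK by auto
    then have "h y = h x" using hd[of y x] x y by (metis G.inv_equality G.inv_inv G.inv_closed h.hom_closed)
    then show ?thesis by (simp add: g_def y_def)
  qed
  show thesis
  proof
    show "g x \<in> carrier G" if "x \<in> carrier T" for x
      using that unfolding T_carrier by (auto simp: gp simp del: carrier_free_Abelian_group_iff)
    show "g (x \<oplus>\<^bsub>T\<^esub> y) = g x \<otimes>\<^bsub>G\<^esub> g y" if xy: "x \<in> carrier T" "y \<in> carrier T" for x y
    proof -
      obtain x' y' where e: "x = pr x'" "y = pr y'" "x' \<in> carrier F" "y' \<in> carrier F"
        using xy T_carrier by blast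
      have "x' + y' \<in> carrier F" using F.m_closed[OF e(3,4)] by simp
      then show ?thesis using h.hom_mult[OF e(3,4)] gp e by (simp add: pr_add del: carrier_free_Abelian_group_iff)
    qed
    show "\<And>a n. \<lbrakk>a \<in> carrier A; n \<in> carrier N\<rbrakk> \<Longrightarrow> g (t a n) = f a n"
      by (simp add: t_pr gp hf)
  qed
qed

text \<open>The scalar acts on generators through the first factor. This map of the free group sends
  each relation to a relation of the same kind, hence \<open>K\<close> into \<open>K\<close>, and
  the union that defines the action on a coset is again a single coset.\<close>

lemma smult_pr:
  assumes s: "s \<in> carrier S" and x: "x \<in> carrier F"
  defines "\<phi> \<equiv> frag_extend (\<lambda>(a, n). frag_of (s \<odot>\<^bsub>A\<^esub> a, n))"
  shows "s \<odot>\<^bsub>T\<^esub> pr x = pr (\<phi> x)" and "\<phi> x \<in> carrier F"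
proof -
  have \<phi>F: "\<phi> x \<in> carrier F" if "x \<in> carrier F" for x
  proof -
    have "Poly_Mapping.keys x \<subseteq> carrier A \<times> carrier N" using that by simp
    then show ?thesis
    proof (induction rule: frag_induction)
      case (diff a b)
      then show ?case using F_diff[OF diff] by (simp only: \<phi>_def frag_extend_diff)
    qed (use s in \<open>auto simp: \<phi>_def\<close>)
  qed
  then show "\<phi> x \<in> carrier F" using x by blast
  have \<phi>rel: "\<phi> h \<in> tensor_rel A ra R N" if h: "h \<in> tensor_rel A ra R N" for h
  proof -
    consider (l) a b n where "a \<in> carrier A" "b \<in> carrier A" "n \<in> carrier N"
        "h = frag_of (a \<oplus>\<^bsub>A\<^esub> b, n) - frag_of (a, n) - frag_of (b, n)"
      | (r) a n k where "a \<in> carrier A" "n \<in> carrier N" "k \<in> carrier N"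
        "h = frag_of (a, n \<oplus>\<^bsub>N\<^esub> k) - frag_of (a, n) - frag_of (a, k)"
      | (b) a r n where "a \<in> carrier A" "r \<in> carrier R" "n \<in> carrier N"
        "h = frag_of (ra a r, n) - frag_of (a, r \<odot>\<^bsub>N\<^esub> n)"
      using h unfolding tensor_rel_def
      by (elim UnE CollectE exE conjE) (rule l r b; assumption)+
    then show ?thesis
    proof cases
      case l
      then have "\<phi> h = frag_of (s \<odot>\<^bsub>A\<^esub> a \<oplus>\<^bsub>A\<^esub> s \<odot>\<^bsub>A\<^esub> b, n) - frag_of (s \<odot>\<^bsub>A\<^esub> a, n) - frag_of (s \<odot>\<^bsub>A\<^esub> b, n)"
        using s by (simp add: \<phi>_def frag_extend_diff A.smult_r_distr)
      then show ?thesis using l(1-3) s by (simp add: rel_l)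
    next
      case r
      then have "\<phi> h = frag_of (s \<odot>\<^bsub>A\<^esub> a, n \<oplus>\<^bsub>N\<^esub> k) - frag_of (s \<odot>\<^bsub>A\<^esub> a, n) - frag_of (s \<odot>\<^bsub>A\<^esub> a, k)"
        by (simp add: \<phi>_def frag_extend_diff)
      then show ?thesis using r(1-3) s by (simp add: rel_r)
    next
      case b
      then have "\<phi> h = frag_of (ra (s \<odot>\<^bsub>A\<^esub> a) r, n) - frag_of (s \<odot>\<^bsub>A\<^esub> a, r \<odot>\<^bsub>N\<^esub> n)"
        using s by (simp add: \<phi>_def frag_extend_diff ra_smult)
      then show ?thesis using b(1-3) s by (simp add: rel_b)
    qed
  qed
  have \<phi>K: "\<phi> x \<in> K" if "x \<in> K" for x
    using that
  proof (induction rule: generate.induct)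
    case one
    then show ?case using generate.one[of F] by (simp add: \<phi>_def)
  next
    case (incl h)
    then show ?case by (intro generate.incl \<phi>rel)
  next
    case (inv h)
    then have "inv\<^bsub>F\<^esub> \<phi> h \<in> K" by (intro generate.inv \<phi>rel)
    moreover have "h \<in> carrier F" "\<phi> h \<in> carrier F" using inv rel_sub \<phi>F by blast+
    ultimately show ?case by (simp add: \<phi>_def frag_extend_minus)
  next
    case (eng a b)
    then show ?case using generate.eng[OF eng(3,4)] by (simp add: \<phi>_def frag_extend_add)
  qed
  have "K #>\<^bsub>F\<^esub> \<phi> y = K #>\<^bsub>F\<^esub> \<phi> x" if y: "y \<in> K #>\<^bsub>F\<^esub> x" for y
  proof -
    obtain k where k: "k \<in> K" "y = k + x" using y by (auto simp: r_coset_def)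
    then have "k \<in> carrier F" using subgroup.mem_carrier[OF subgroup_K] by blast
    then have "y \<in> carrier F" using k x F.m_closed by fastforce
    moreover have "\<phi> y - \<phi> x = \<phi> k" using k by (simp add: \<phi>_def frag_extend_add)
    ultimately show ?thesis using coset_eq[OF \<phi>F \<phi>F, of y x] x \<phi>K[OF k(1)] by simp
  qed
  moreover have "x \<in> K #>\<^bsub>F\<^esub> x" by (rule F.rcos_self[OF x subgroup_K])
  ultimately have "(\<Union>y\<in>K #>\<^bsub>F\<^esub> x. K #>\<^bsub>F\<^esub> \<phi> y) = K #>\<^bsub>F\<^esub> \<phi> x"
    by (intro SUP_eq_const) blast+
  then have "s \<odot>\<^bsub>raw_tensor A ra R N\<^esub> (K #>\<^bsub>F\<^esub> x) = K #>\<^bsub>F\<^esub> \<phi> x"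
    by (simp add: raw_tensor_def Let_def \<phi>_def)
  then show "s \<odot>\<^bsub>T\<^esub> pr x = pr (\<phi> x)"
    unfolding pr_def tensor_def by (subst rs(5)) (use x raw_carrier in auto)
qed

lemma smult_t:
  assumes "s \<in> carrier S" "a \<in> carrier A" "n \<in> carrier N"
  shows "s \<odot>\<^bsub>T\<^esub> t a n = t (s \<odot>\<^bsub>A\<^esub> a) n"
  using smult_pr(1)[OF assms(1), of "frag_of (a, n)"] assms by (simp add: t_pr)

lemma T_module: "module S T"
proof -
  have cl: "s \<odot>\<^bsub>T\<^esub> x \<in> carrier T" if "s \<in> carrier S" "x \<in> carrier T" for s x
    using that smult_pr by (auto simp: T_carrier simp del: carrier_free_Abelian_group_iff)
  have distr: "s \<odot>\<^bsub>T\<^esub> (x \<oplus>\<^bsub>T\<^esub> y) = s \<odot>\<^bsub>T\<^esub> x \<oplus>\<^bsub>T\<^esub> s \<odot>\<^bsub>T\<^esub> y"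
    if s: "s \<in> carrier S" and xy: "x \<in> carrier T" "y \<in> carrier T" for s x y
  proof -
    obtain x' y' where e: "x = pr x'" "y = pr y'" "x' \<in> carrier F" "y' \<in> carrier F"
      using xy T_carrier by blast
    have "x' + y' \<in> carrier F" using F.m_closed[OF e(3,4)] by simp
    then show ?thesis using e smult_pr[OF s]
      by (simp add: pr_add frag_extend_add del: carrier_free_Abelian_group_iff)
  qed
  show ?thesis
  proof (rule moduleI)
    fix a b x assume ab: "a \<in> carrier S" "b \<in> carrier S" and "x \<in> carrier T"
    show "(a \<oplus>\<^bsub>S\<^esub> b) \<odot>\<^bsub>T\<^esub> x = a \<odot>\<^bsub>T\<^esub> x \<oplus>\<^bsub>T\<^esub> b \<odot>\<^bsub>T\<^esub> x"
      using \<open>x \<in> carrier T\<close>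
    proof (induction rule: tensor_induct)
      case (pure x n) then show ?case using ab by (simp add: smult_t A.smult_l_distr t_add_l)
    next
      case (add x y) then show ?case using ab cl by (simp add: distr T.a_ac)
    qed
    show "a \<otimes>\<^bsub>S\<^esub> b \<odot>\<^bsub>T\<^esub> x = a \<odot>\<^bsub>T\<^esub> (b \<odot>\<^bsub>T\<^esub> x)"
      using \<open>x \<in> carrier T\<close>
    proof (induction rule: tensor_induct)
      case (pure x n) then show ?case using ab by (simp add: smult_t A.smult_assoc1)
    next
      case (add x y) then show ?case using ab cl by (simp add: distr)
    qed
  next
    fix x assume "x \<in> carrier T"
    then show "\<one>\<^bsub>S\<^esub> \<odot>\<^bsub>T\<^esub> x = x"
    proof (induction rule: tensor_induct)
      case (pure x n) then show ?case by (simp add: smult_t)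
    next
      case (add x y) then show ?case by (simp add: distr)
    qed
  qed (use cl distr A.R.cring_axioms T_group in auto)
qed

text \<open>\<open>pl\<close> is an arbitrary operation: agreement on pure tensors passes to sums
  once both maps turn sums into the same \<open>pl\<close>. This covers composites without first
  making them homomorphisms.\<close>

lemma hom_eqI:
  assumes "\<And>x y. \<lbrakk>x \<in> carrier T; y \<in> carrier T\<rbrakk> \<Longrightarrow> g (x \<oplus>\<^bsub>T\<^esub> y) = pl (g x) (g y)"
    and "\<And>x y. \<lbrakk>x \<in> carrier T; y \<in> carrier T\<rbrakk> \<Longrightarrow> h (x \<oplus>\<^bsub>T\<^esub> y) = pl (h x) (h y)"
    and "\<And>a n. \<lbrakk>a \<in> carrier A; n \<in> carrier N\<rbrakk> \<Longrightarrow> g (t a n) = h (t a n)"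
    and "x \<in> carrier T"
  shows "g x = h x"
  using assms(4) by (induction rule: tensor_induct) (auto simp: assms)

definition balanced :: "'u md \<Rightarrow> ('u \<Rightarrow> 'u \<Rightarrow> 'u) \<Rightarrow> bool" where
  "balanced W f \<longleftrightarrow> abelian_group W \<and>
     (\<forall>a\<in>carrier A. \<forall>n\<in>carrier N. f a n \<in> carrier W) \<and>
     (\<forall>a\<in>carrier A. \<forall>b\<in>carrier A. \<forall>n\<in>carrier N. f (a \<oplus>\<^bsub>A\<^esub> b) n = f a n \<oplus>\<^bsub>W\<^esub> f b n) \<and>
     (\<forall>a\<in>carrier A. \<forall>n\<in>carrier N. \<forall>k\<in>carrier N. f a (n \<oplus>\<^bsub>N\<^esub> k) = f a n \<oplus>\<^bsub>W\<^esub> f a k) \<and>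
     (\<forall>a\<in>carrier A. \<forall>r\<in>carrier R. \<forall>n\<in>carrier N. f (ra a r) n = f a (r \<odot>\<^bsub>N\<^esub> n))"

lemma balancedI:
  assumes "abelian_group W"
    "\<And>a n. \<lbrakk>a \<in> carrier A; n \<in> carrier N\<rbrakk> \<Longrightarrow> f a n \<in> carrier W"
    "\<And>a b n. \<lbrakk>a \<in> carrier A; b \<in> carrier A; n \<in> carrier N\<rbrakk> \<Longrightarrow> f (a \<oplus>\<^bsub>A\<^esub> b) n = f a n \<oplus>\<^bsub>W\<^esub> f b n"
    "\<And>a n k. \<lbrakk>a \<in> carrier A; n \<in> carrier N; k \<in> carrier N\<rbrakk> \<Longrightarrow> f a (n \<oplus>\<^bsub>N\<^esub> k) = f a n \<oplus>\<^bsub>W\<^esub> f a k"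
    "\<And>a r n. \<lbrakk>a \<in> carrier A; r \<in> carrier R; n \<in> carrier N\<rbrakk> \<Longrightarrow> f (ra a r) n = f a (r \<odot>\<^bsub>N\<^esub> n)"
  shows "balanced W f"
  using assms by (auto simp: balanced_def)

text \<open>The description in \<open>tens_lift\<close> is meaningful: \<open>ex_hom\<close> gives
  existence, and extensionality together with \<open>hom_eqI\<close> gives uniqueness.\<close>

lemma lift_facts:
  assumes b: "balanced W f"
  defines "g \<equiv> tens_lift A ra R N W f"
  shows lift_closed: "\<And>x. x \<in> carrier T \<Longrightarrow> g x \<in> carrier W"
    and lift_add: "\<And>x y. \<lbrakk>x \<in> carrier T; y \<in> carrier T\<rbrakk> \<Longrightarrow> g (x \<oplus>\<^bsub>T\<^esub> y) = g x \<oplus>\<^bsub>W\<^esub> g y"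
    and lift_t: "\<And>a n. \<lbrakk>a \<in> carrier A; n \<in> carrier N\<rbrakk> \<Longrightarrow> g (t a n) = f a n"
    and lift_ext: "g \<in> extensional (carrier T)"
proof -
  let ?P = "\<lambda>g. g \<in> hom (add_monoid T) (add_monoid W) \<inter> extensional (carrier T) \<and>
             (\<forall>a\<in>carrier A. \<forall>n\<in>carrier N. g (t a n) = f a n)"
  interpret W: abelian_group W using b by (simp add: balanced_def)
  have "\<exists>g. ?P g"
  proof -
    obtain g where g: "\<And>x. x \<in> carrier T \<Longrightarrow> g x \<in> carrier (add_monoid W)"
    "\<And>x y. \<lbrakk>x \<in> carrier T; y \<in> carrier T\<rbrakk> \<Longrightarrow> g (x \<oplus>\<^bsub>T\<^esub> y) = g x \<otimes>\<^bsub>add_monoid W\<^esub> g y"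
    "\<And>a n. \<lbrakk>a \<in> carrier A; n \<in> carrier N\<rbrakk> \<Longrightarrow> g (t a n) = f a n"
      by (rule ex_hom[of "add_monoid W" f])
         (use b W.a_comm_group in \<open>auto simp: balanced_def\<close>)
    have "?P (restrict g (carrier T))" using g by (auto simp: hom_def)
    then show ?thesis by blast
  qed
  moreover have "g1 = g2" if "?P g1" "?P g2" for g1 g2
  proof (rule extensionalityI)
    show "g1 x = g2 x" if "x \<in> carrier T" for x
      by (rule hom_eqI[OF _ _ _ that, of _ "add W"]) (use \<open>?P g1\<close> \<open>?P g2\<close> in \<open>auto simp: hom_def\<close>)
  qed (use that in auto)
  ultimately have "\<exists>!g. ?P g" by (rule ex_ex1I)
  then have "?P g" unfolding g_def tens_lift_def by (rule theI')
  then show "\<And>x. x \<in> carrier T \<Longrightarrow> g x \<in> carrier W"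
    "\<And>x y. \<lbrakk>x \<in> carrier T; y \<in> carrier T\<rbrakk> \<Longrightarrow> g (x \<oplus>\<^bsub>T\<^esub> y) = g x \<oplus>\<^bsub>W\<^esub> g y"
    "\<And>a n. \<lbrakk>a \<in> carrier A; n \<in> carrier N\<rbrakk> \<Longrightarrow> g (t a n) = f a n"
    "g \<in> extensional (carrier T)" by (auto simp: hom_def)
qed

lemma lift_mod_hom:
  assumes b: "balanced W f" and W: "module S W"
    and s: "\<And>s a n. \<lbrakk>s \<in> carrier S; a \<in> carrier A; n \<in> carrier N\<rbrakk> \<Longrightarrow> f (s \<odot>\<^bsub>A\<^esub> a) n = s \<odot>\<^bsub>W\<^esub> f a n"
  shows "tens_lift A ra R N W f \<in> mod_hom S T W"
proof -
  interpret W: module S W by fact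
  interpret TM: module S T by (rule T_module)
  show ?thesis
  proof (rule mod_homI)
    fix r x assume r: "r \<in> carrier S" and "x \<in> carrier T"
    from this(2) show "tens_lift A ra R N W f (r \<odot>\<^bsub>T\<^esub> x) = r \<odot>\<^bsub>W\<^esub> tens_lift A ra R N W f x"
    proof (induction rule: tensor_induct)
      case (pure a n)
      then show ?case using r s by (simp add: smult_t lift_t[OF b])
    next
      case (add x y)
      then show ?case using r
        by (simp add: TM.smult_r_distr lift_add[OF b] lift_closed[OF b] W.smult_r_distr)
    qed
  qed (use lift_facts[OF b] in auto)
qed

end

lemma tensor_data_cong:
  "tensor_data S A ra R N \<Longrightarrow> module R N' \<Longrightarrow> tensor_data S A ra R N'"
  by (simp add: tensor_data_def)

lemma tens_right_facts:
  assumes d: "tensor_data S A ra R N" and N': "module R N'" and h: "h \<in> mod_hom R N N'"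
  shows tens_right_mod_hom: "tens_right A ra R N N' h \<in> mod_hom S (tensor A ra R N) (tensor A ra R N')"
    and tens_right_tens: "\<And>a n. \<lbrakk>a \<in> carrier A; n \<in> carrier N\<rbrakk> \<Longrightarrow>
      tens_right A ra R N N' h (tens A ra R N a n) = tens A ra R N' a (h n)"
proof -
  interpret N: tensor_data S A ra R N by fact
  interpret N': tensor_data S A ra R N' by (rule tensor_data_cong[OF d N'])
  have b: "N.balanced (tensor A ra R N') (\<lambda>a n. tens A ra R N' a (h n))"
    by (rule N.balancedI)
       (use N'.T_group h in \<open>auto simp: N'.t_add_l N'.t_add_r N'.t_bal mod_hom_closed mod_hom_add mod_hom_smult\<close>)
  show "tens_right A ra R N N' h \<in> mod_hom S (tensor A ra R N) (tensor A ra R N')"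
    unfolding tens_right_def
    by (rule N.lift_mod_hom[OF b N'.T_module]) (simp add: N'.smult_t mod_hom_closed[OF h])
  show "\<And>a n. \<lbrakk>a \<in> carrier A; n \<in> carrier N\<rbrakk> \<Longrightarrow>
      tens_right A ra R N N' h (tens A ra R N a n) = tens A ra R N' a (h n)"
    unfolding tens_right_def by (simp add: N.lift_t[OF b])
qed

section \<open>Functors and complexes\<close>

lemma proj_module: "V \<in> proj R \<Longrightarrow> module R V"
  by (simp add: proj_def)

lemma functorsI:
  assumes "\<And>V. V \<in> proj R \<Longrightarrow> module S (fobj F V)"
    and "\<And>V W f. \<lbrakk>V \<in> proj R; W \<in> proj R; f \<in> mod_hom R V W\<rbrakk> \<Longrightarrow> farr F V W f \<in> mod_hom S (fobj F V) (fobj F W)"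
    and "\<And>V x. \<lbrakk>V \<in> proj R; x \<in> carrier (fobj F V)\<rbrakk> \<Longrightarrow> farr F V V (\<lambda>x\<in>carrier V. x) x = x"
    and "\<And>U V W f g x. \<lbrakk>U \<in> proj R; V \<in> proj R; W \<in> proj R; f \<in> mod_hom R U V; g \<in> mod_hom R V W;
      x \<in> carrier (fobj F U)\<rbrakk> \<Longrightarrow> farr F U W (compose (carrier U) g f) x = farr F V W g (farr F U V f x)"
    and "\<And>V. \<lbrakk>V \<in> proj R; carrier V = {\<zero>\<^bsub>V\<^esub>}\<rbrakk> \<Longrightarrow> carrier (fobj F V) = {\<zero>\<^bsub>fobj F V\<^esub>}"
  shows "F \<in> functors R S"
proof -
  have "farr F V V (\<lambda>x\<in>carrier V. x) = (\<lambda>x\<in>carrier (fobj F V). x)" if V: "V \<in> proj R" for V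
  proof (rule extensionalityI)
    show "farr F V V (\<lambda>x\<in>carrier V. x) \<in> extensional (carrier (fobj F V))"
      using assms(2)[OF V V mod_hom_id[OF proj_module[OF V]]] by (rule mod_hom_ext)
  qed (use assms(3)[OF V] in auto)
  moreover have "farr F U W (compose (carrier U) g f) = compose (carrier (fobj F U)) (farr F V W g) (farr F U V f)"
    if UVW: "U \<in> proj R" "V \<in> proj R" "W \<in> proj R" and fg: "f \<in> mod_hom R U V" "g \<in> mod_hom R V W"
    for U V W f g
  proof (rule extensionalityI)
    show "farr F U W (compose (carrier U) g f) \<in> extensional (carrier (fobj F U))"
      using assms(2)[OF UVW(1,3) mod_hom_compose[OF fg proj_module[OF UVW(1)]]] by (rule mod_hom_ext)
  qed (use assms(4)[OF UVW fg] in \<open>auto simp: compose_eq\<close>)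
  ultimately show ?thesis using assms(1,2,5) by (simp add: functors_def)
qed

lemma functor_module: "F \<in> functors R S \<Longrightarrow> V \<in> proj R \<Longrightarrow> module S (fobj F V)"
  by (simp add: functors_def)

lemma functor_arr:
  "\<lbrakk>F \<in> functors R S; V \<in> proj R; W \<in> proj R; f \<in> mod_hom R V W\<rbrakk> \<Longrightarrow>
    farr F V W f \<in> mod_hom S (fobj F V) (fobj F W)"
  by (simp add: functors_def)

lemma functor_id:
  "\<lbrakk>F \<in> functors R S; V \<in> proj R; x \<in> carrier (fobj F V)\<rbrakk> \<Longrightarrow> farr F V V (\<lambda>x\<in>carrier V. x) x = x"
  by (simp add: functors_def)

lemma functor_comp:
  "\<lbrakk>F \<in> functors R S; U \<in> proj R; V \<in> proj R; W \<in> proj R; f \<in> mod_hom R U V; g \<in> mod_hom R V W;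
    x \<in> carrier (fobj F U)\<rbrakk> \<Longrightarrow> farr F U W (compose (carrier U) g f) x = farr F V W g (farr F U V f x)"
  by (simp add: functors_def compose_eq)

lemma functor_pointed:
  "\<lbrakk>F \<in> functors R S; V \<in> proj R; carrier V = {\<zero>\<^bsub>V\<^esub>}\<rbrakk> \<Longrightarrow> carrier (fobj F V) = {\<zero>\<^bsub>fobj F V\<^esub>}"
  unfolding functors_def by blast

lemma nat_transI:
  assumes "\<And>V. V \<in> proj R \<Longrightarrow> \<eta> V \<in> mod_hom S (fobj F V) (fobj G V)"
    and "\<And>V W f x. \<lbrakk>V \<in> proj R; W \<in> proj R; f \<in> mod_hom R V W; x \<in> carrier (fobj F V)\<rbrakk> \<Longrightarrow>
        \<eta> W (farr F V W f x) = farr G V W f (\<eta> V x)"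
  shows "\<eta> \<in> nat_trans R S F G"
  using assms by (simp add: nat_trans_def)

lemma nat_hom: "\<lbrakk>\<eta> \<in> nat_trans R S F G; V \<in> proj R\<rbrakk> \<Longrightarrow> \<eta> V \<in> mod_hom S (fobj F V) (fobj G V)"
  by (simp add: nat_trans_def)

lemma nat_arr:
  "\<lbrakk>\<eta> \<in> nat_trans R S F G; V \<in> proj R; W \<in> proj R; f \<in> mod_hom R V W; x \<in> carrier (fobj F V)\<rbrakk> \<Longrightarrow>
    \<eta> W (farr F V W f x) = farr G V W f (\<eta> V x)"
  by (simp add: nat_trans_def)

lemmas nat_closed = mod_hom_closed[OF nat_hom]
lemmas arr_closed = mod_hom_closed[OF functor_arr]

lemma arr_zero:
  "\<lbrakk>F \<in> functors R S; V \<in> proj R; W \<in> proj R; f \<in> mod_hom R V W\<rbrakk> \<Longrightarrow>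
    farr F V W f \<zero>\<^bsub>fobj F V\<^esub> = \<zero>\<^bsub>fobj F W\<^esub>"
  by (rule mod_hom_zero[OF functor_arr]) (auto intro: functor_module)

lemma nat_zero:
  "\<lbrakk>\<eta> \<in> nat_trans R S F G; F \<in> functors R S; G \<in> functors R S; V \<in> proj R\<rbrakk> \<Longrightarrow>
    \<eta> V \<zero>\<^bsub>fobj F V\<^esub> = \<zero>\<^bsub>fobj G V\<^esub>"
  by (rule mod_hom_zero[OF nat_hom]) (auto intro: functor_module)

lemma zero_map_apply [simp]: "x \<in> carrier V \<Longrightarrow> zero_map V W x = \<zero>\<^bsub>W\<^esub>"
  by (simp add: zero_map_def)

lemma zero_map_nat:
  assumes "F \<in> functors R S" "G \<in> functors R S"
  shows "(\<lambda>V. zero_map (fobj F V) (fobj G V)) \<in> nat_trans R S F G"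
  by (rule nat_transI)
     (use assms in \<open>auto simp: zero_map_mod_hom functor_module arr_closed[OF assms(1)] arr_zero[OF assms(2)]\<close>)

lemma zero_fctr_functor: "cring S \<Longrightarrow> zero_fctr \<in> functors R S"
  by (rule functorsI)
     (auto simp: zero_fctr_def zero_md_module intro!: zero_map_mod_hom)

lemma zero_fctr_simps [simp]: "fobj zero_fctr V = zero_md"
  by (simp add: zero_fctr_def)

lemma incl_fctr_functor: "incl_fctr \<in> functors R R"
  by (rule functorsI) (auto simp: incl_fctr_def proj_module compose_eq)

lemma incl_fctr_simps [simp]: "fobj incl_fctr V = V" "farr incl_fctr V W f = f"
  by (simp_all add: incl_fctr_def)

lemma push_fctr_simps [simp]: "fobj (push_fctr q F) V = restrict_scalars q (fobj F V)" "farr (push_fctr q F) = farr F"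
  by (simp_all add: push_fctr_def)

lemma push_fctr_functor:
  assumes "F \<in> functors R S" "q \<in> ring_hom S' S" "cring S'"
  shows "push_fctr q F \<in> functors R S'"
proof (rule functorsI)
  fix V W f assume *: "V \<in> proj R" "W \<in> proj R" "f \<in> mod_hom R V W"
  have "farr F V W f \<in> mod_hom S (fobj F V) (fobj F W)" using functor_arr[OF assms(1) *] .
  then show "farr (push_fctr q F) V W f \<in> mod_hom S' (fobj (push_fctr q F) V) (fobj (push_fctr q F) W)"
    using assms(2) by (intro mod_homI) (auto simp: mod_hom_closed mod_hom_add mod_hom_smult mod_hom_ext ring_hom_closed)
qed (use assms in \<open>auto simp: functor_module functor_id functor_comp functor_pointed intro!: restrict_scalars_module\<close>)

lemma tensor_fctr_simps [simp]:
  "fobj (tensor_fctr A ra R F) V = tensor A ra R (fobj F V)"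
  "farr (tensor_fctr A ra R F) V W f = tens_right A ra R (fobj F V) (fobj F W) (farr F V W f)"
  by (simp_all add: tensor_fctr_def)

text \<open>Identity and composition laws equate homomorphisms out of a tensor product, so they are
  checked on pure tensors, where the functor acts on the second factor only.\<close>

lemma tensor_fctr_functor:
  assumes F: "F \<in> functors R R'" and d: "\<And>N. module R' N \<Longrightarrow> tensor_data S A ra R' N"
  shows "tensor_fctr A ra R' F \<in> functors R S"
proof -
  have dV: "tensor_data S A ra R' (fobj F V)" if "V \<in> proj R" for V
    by (rule d[OF functor_module[OF F that]])
  have hom: "farr (tensor_fctr A ra R' F) V W f \<in>
      mod_hom S (fobj (tensor_fctr A ra R' F) V) (fobj (tensor_fctr A ra R' F) W)"
    if "V \<in> proj R" "W \<in> proj R" "f \<in> mod_hom R V W" for V W f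
    using tens_right_mod_hom[OF dV[OF that(1)] functor_module[OF F that(2)] functor_arr[OF F that]] by simp
  have pure: "farr (tensor_fctr A ra R' F) V W f (tens A ra R' (fobj F V) a n) = tens A ra R' (fobj F W) a (farr F V W f n)"
    if "V \<in> proj R" "W \<in> proj R" "f \<in> mod_hom R V W" "a \<in> carrier A" "n \<in> carrier (fobj F V)" for V W f a n
    using tens_right_tens[OF dV[OF that(1)] functor_module[OF F that(2)] functor_arr[OF F that(1-3)]] that by simp
  show ?thesis
  proof (rule functorsI)
    fix V assume V: "V \<in> proj R"
    interpret V: tensor_data S A ra R' "fobj F V" by (rule dV[OF V])
    show "module S (fobj (tensor_fctr A ra R' F) V)" using V.T_module by simp
    define e where "e = (\<lambda>x\<in>carrier V. x)"
    have id: "e \<in> mod_hom R V V" unfolding e_def by (rule mod_hom_id[OF proj_module[OF V]])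
    { fix x assume "x \<in> carrier (fobj (tensor_fctr A ra R' F) V)"
      then have x: "x \<in> carrier (tensor A ra R' (fobj F V))" by simp
      show "farr (tensor_fctr A ra R' F) V V (\<lambda>x\<in>carrier V. x) x = x"
        unfolding e_def[symmetric]
        by (rule V.hom_eqI[OF _ _ _ x, of _ "add (tensor A ra R' (fobj F V))" "\<lambda>x. x"])
           (use hom[OF V V id] pure[OF V V id] functor_id[OF F V, folded e_def] in \<open>auto simp: mod_hom_add\<close>) }
    { assume z: "carrier V = {\<zero>\<^bsub>V\<^esub>}"
      interpret T: module S "tensor A ra R' (fobj F V)" by (rule V.T_module)
      have "x = \<zero>\<^bsub>tensor A ra R' (fobj F V)\<^esub>" if "x \<in> carrier (tensor A ra R' (fobj F V))" for x
        using that
        by (induction rule: V.tensor_induct) (use functor_pointed[OF F V z] in auto)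
      then show "carrier (fobj (tensor_fctr A ra R' F) V) = {\<zero>\<^bsub>fobj (tensor_fctr A ra R' F) V\<^esub>}"
        by auto }
  next
    fix U V W f g x
    assume UVW: "U \<in> proj R" "V \<in> proj R" "W \<in> proj R" and fg: "f \<in> mod_hom R U V" "g \<in> mod_hom R V W"
      and "x \<in> carrier (fobj (tensor_fctr A ra R' F) U)"
    then have x: "x \<in> carrier (tensor A ra R' (fobj F U))" by simp
    interpret U: tensor_data S A ra R' "fobj F U" by (rule dV[OF UVW(1)])
    have gf: "compose (carrier U) g f \<in> mod_hom R U W" by (rule mod_hom_compose[OF fg proj_module[OF UVW(1)]])
    note h1 = hom[OF UVW(1,2) fg(1)] and h2 = hom[OF UVW(2,3) fg(2)] and h3 = hom[OF UVW(1,3) gf]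
    show "farr (tensor_fctr A ra R' F) U W (compose (carrier U) g f) x =
      farr (tensor_fctr A ra R' F) V W g (farr (tensor_fctr A ra R' F) U V f x)"
    proof (rule U.hom_eqI[OF _ _ _ x, of _ "add (tensor A ra R' (fobj F W))"
        "\<lambda>x. farr (tensor_fctr A ra R' F) V W g (farr (tensor_fctr A ra R' F) U V f x)"])
      fix a n assume "a \<in> carrier A" "n \<in> carrier (fobj F U)"
      then show "farr (tensor_fctr A ra R' F) U W (compose (carrier U) g f) (tens A ra R' (fobj F U) a n) =
        farr (tensor_fctr A ra R' F) V W g (farr (tensor_fctr A ra R' F) U V f (tens A ra R' (fobj F U) a n))"
        using pure[OF UVW(1,2) fg(1)] pure[OF UVW(2,3) fg(2)] pure[OF UVW(1,3) gf]
          functor_comp[OF F UVW fg] arr_closed[OF F UVW(1,2) fg(1)] by simp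
    qed (use mod_hom_add[OF h1] mod_hom_add[OF h2] mod_hom_add[OF h3] mod_hom_closed[OF h1] in auto)
  qed (rule hom)
qed

text \<open>Kernels are one instance; the other is the family of layers of a cover, which includes
  the whole functor and its zero subfunctor.\<close>

definition sub_fctr :: "'u fctr \<Rightarrow> ('u md \<Rightarrow> 'u set) \<Rightarrow> 'u fctr" where
  "sub_fctr F N = \<lparr>fobj = \<lambda>V. (fobj F V)\<lparr>carrier := N V\<rparr>, farr = \<lambda>V W f. restrict (farr F V W f) (N V)\<rparr>"

lemma sub_fctr_simps [simp]:
  "fobj (sub_fctr F N) V = (fobj F V)\<lparr>carrier := N V\<rparr>" "farr (sub_fctr F N) V W f = restrict (farr F V W f) (N V)"
  by (simp_all add: sub_fctr_def)

lemma kernel_fctr_sub: "kernel_fctr F G \<eta> = sub_fctr F (\<lambda>V. {x \<in> carrier (fobj F V). \<eta> V x = \<zero>\<^bsub>fobj G V\<^esub>})"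
  by (simp add: kernel_fctr_def sub_fctr_def Let_def)

lemma sub_fctr_functor:
  assumes F: "F \<in> functors R S" and N: "\<And>V. V \<in> proj R \<Longrightarrow> submod S (fobj F V) (N V)"
    and s: "\<And>V W f x. \<lbrakk>V \<in> proj R; W \<in> proj R; f \<in> mod_hom R V W; x \<in> N V\<rbrakk> \<Longrightarrow> farr F V W f x \<in> N W"
  shows "sub_fctr F N \<in> functors R S"
proof (rule functorsI)
  fix V assume V: "V \<in> proj R"
  note d = submodD[OF N[OF V]]
  show "module S (fobj (sub_fctr F N) V)"
    using submod_module[OF functor_module[OF F V] N[OF V]] by simp
  show "farr (sub_fctr F N) V V (\<lambda>x\<in>carrier V. x) x = x" if "x \<in> carrier (fobj (sub_fctr F N) V)" for x
    using that d(1) functor_id[OF F V] by auto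
  show "carrier (fobj (sub_fctr F N) V) = {\<zero>\<^bsub>fobj (sub_fctr F N) V\<^esub>}" if "carrier V = {\<zero>\<^bsub>V\<^esub>}"
  proof -
    have "carrier (fobj F V) = {\<zero>\<^bsub>fobj F V\<^esub>}" by (rule functor_pointed[OF F V that])
    then have "N V = {\<zero>\<^bsub>fobj F V\<^esub>}" using d(1,2) by blast
    then show ?thesis by simp
  qed
next
  fix V W f assume VW: "V \<in> proj R" "W \<in> proj R" "f \<in> mod_hom R V W"
  note d = submodD[OF N[OF VW(1)]]
  show "farr (sub_fctr F N) V W f \<in> mod_hom S (fobj (sub_fctr F N) V) (fobj (sub_fctr F N) W)"
    using functor_arr[OF F VW] d s[OF VW] by (intro mod_homI) (auto simp: mod_hom_add mod_hom_smult)
next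
  fix U V W f g x
  assume UVW: "U \<in> proj R" "V \<in> proj R" "W \<in> proj R" and fg: "f \<in> mod_hom R U V" "g \<in> mod_hom R V W"
    and "x \<in> carrier (fobj (sub_fctr F N) U)"
  then show "farr (sub_fctr F N) U W (compose (carrier U) g f) x =
      farr (sub_fctr F N) V W g (farr (sub_fctr F N) U V f x)"
    using functor_comp[OF F UVW fg] submodD(1)[OF N[OF UVW(1)]] s[OF UVW(1,2) fg(1)] by simp
qed

lemma kernel_fctr_functor:
  assumes F: "F \<in> functors R S" and G: "G \<in> functors R S" and n: "\<eta> \<in> nat_trans R S F G"
  shows "kernel_fctr F G \<eta> \<in> functors R S"
  unfolding kernel_fctr_sub
proof (rule sub_fctr_functor[OF F])
  fix V assume V: "V \<in> proj R"
  show "submod S (fobj F V) {x \<in> carrier (fobj F V). \<eta> V x = \<zero>\<^bsub>fobj G V\<^esub>}"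
    by (rule submod_kernel[OF functor_module[OF F V] functor_module[OF G V] nat_hom[OF n V]])
next
  fix V W f x assume VW: "V \<in> proj R" "W \<in> proj R" "f \<in> mod_hom R V W"
    and "x \<in> {x \<in> carrier (fobj F V). \<eta> V x = \<zero>\<^bsub>fobj G V\<^esub>}"
  then show "farr F V W f x \<in> {x \<in> carrier (fobj F W). \<eta> W x = \<zero>\<^bsub>fobj G W\<^esub>}"
    using arr_closed[OF F VW] nat_arr[OF n VW] arr_zero[OF G VW] by auto
qed

text \<open>The action on morphisms is defined through chosen representatives. By naturality it
  carries the image of \<open>\<eta>\<close> into the image of \<open>\<eta>\<close>, so the class
  of the result does not depend on the choice.\<close>

lemma coker_fctr_facts:
  assumes F: "F \<in> functors R S" and G: "G \<in> functors R S" and n: "\<eta> \<in> nat_trans R S F G"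
  defines "N \<equiv> \<lambda>V. \<eta> V ` carrier (fobj F V)"
  shows coker_submod: "\<And>V. V \<in> proj R \<Longrightarrow> submod S (fobj G V) (N V)"
    and coker_fctr_arr: "\<And>V W f x. \<lbrakk>V \<in> proj R; W \<in> proj R; f \<in> mod_hom R V W; x \<in> carrier (fobj G V)\<rbrakk> \<Longrightarrow>
      farr (coker_fctr F G \<eta>) V W f (quot_cls (fobj G V) (N V) x) = quot_cls (fobj G W) (N W) (farr G V W f x)"
    and coker_fctr_functor: "coker_fctr F G \<eta> \<in> functors R S"
proof -
  show sm: "submod S (fobj G V) (N V)" if V: "V \<in> proj R" for V
    unfolding N_def by (rule submod_image[OF functor_module[OF F V] functor_module[OF G V] nat_hom[OF n V]])
  note md = functor_module[OF G]
  note q = quot_facts[OF md sm]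
  have ob: "fobj (coker_fctr F G \<eta>) V = quot_md (fobj G V) (N V)" for V
    by (simp add: coker_fctr_def Let_def N_def)
  have ar: "farr (coker_fctr F G \<eta>) V W f =
    (\<lambda>c\<in>carrier (quot_md (fobj G V) (N V)). quot_cls (fobj G W) (N W) (farr G V W f (quot_rep (fobj G V) (N V) c)))" for V W f
    by (simp add: coker_fctr_def Let_def N_def)
  have st: "farr G V W f x \<in> N W" if "V \<in> proj R" "W \<in> proj R" "f \<in> mod_hom R V W" "x \<in> N V" for V W f x
  proof -
    obtain y where "y \<in> carrier (fobj F V)" "x = \<eta> V y" using \<open>x \<in> N V\<close> by (auto simp: N_def)
    then show ?thesis using nat_arr[OF n that(1-3)] arr_closed[OF F that(1-3)]
      by (auto simp: N_def intro!: image_eqI[of _ _ "farr F V W f y"])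
  qed
  show arr: "farr (coker_fctr F G \<eta>) V W f (quot_cls (fobj G V) (N V) x) = quot_cls (fobj G W) (N W) (farr G V W f x)"
    if VW: "V \<in> proj R" "W \<in> proj R" "f \<in> mod_hom R V W" and x: "x \<in> carrier (fobj G V)" for V W f x
  proof -
    let ?c = "quot_cls (fobj G V) (N V) x"
    let ?y = "quot_rep (fobj G V) (N V) ?c"
    have c: "?c \<in> carrier (quot_md (fobj G V) (N V))" by (rule quot_cls_closed[OF md[OF VW(1)] sm[OF VW(1)] x])
    note y = quot_rep[OF md[OF VW(1)] sm[OF VW(1)] c]
    have "?y \<ominus>\<^bsub>fobj G V\<^esub> x \<in> N V" using y q(5)[OF VW(1) VW(1) y(1) x] by simp
    then have "farr G V W f (?y \<ominus>\<^bsub>fobj G V\<^esub> x) \<in> N W" by (rule st[OF VW])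
    then have "farr G V W f ?y \<ominus>\<^bsub>fobj G W\<^esub> farr G V W f x \<in> N W"
      using mod_hom_diff[OF functor_arr[OF G VW] md md] VW y x by simp
    then show ?thesis using q(5)[OF VW(2) VW(2)] y x arr_closed[OF G VW] c by (simp add: ar)
  qed
  have onto: "\<exists>x\<in>carrier (fobj G V). c = quot_cls (fobj G V) (N V) x"
    if "V \<in> proj R" "c \<in> carrier (quot_md (fobj G V) (N V))" for V c
    using q(1)[OF that(1) that(1)] that(2) by auto
  note cl = quot_cls_closed[OF md sm]
  show "coker_fctr F G \<eta> \<in> functors R S"
  proof (rule functorsI)
    fix V assume V: "V \<in> proj R"
    show "module S (fobj (coker_fctr F G \<eta>) V)" using quot_module[OF md[OF V] sm[OF V]] by (simp add: ob)
    show "farr (coker_fctr F G \<eta>) V V (\<lambda>x\<in>carrier V. x) x = x" if "x \<in> carrier (fobj (coker_fctr F G \<eta>) V)" for x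
      using onto[OF V, of x] that arr[OF V V mod_hom_id[OF proj_module[OF V]]] functor_id[OF G V] by (auto simp: ob)
    show "carrier (fobj (coker_fctr F G \<eta>) V) = {\<zero>\<^bsub>fobj (coker_fctr F G \<eta>) V\<^esub>}" if "carrier V = {\<zero>\<^bsub>V\<^esub>}"
      using functor_pointed[OF G V that] q(1)[OF V V] q(4)[OF V V] unfolding ob by auto
  next
    fix V W f assume VW: "V \<in> proj R" "W \<in> proj R" "f \<in> mod_hom R V W"
    interpret G: module S "fobj G V" by (rule md[OF VW(1)])
    note ac = arr_closed[OF G VW]
    show "farr (coker_fctr F G \<eta>) V W f \<in> mod_hom S (fobj (coker_fctr F G \<eta>) V) (fobj (coker_fctr F G \<eta>) W)"
    proof (rule mod_homI)
      fix x assume "x \<in> carrier (fobj (coker_fctr F G \<eta>) V)"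
      then obtain x' where x: "x' \<in> carrier (fobj G V)" "x = quot_cls (fobj G V) (N V) x'" using onto[OF VW(1)] by (auto simp: ob)
      then show "farr (coker_fctr F G \<eta>) V W f x \<in> carrier (fobj (coker_fctr F G \<eta>) W)"
        using arr[OF VW] cl[OF VW(2,2)] ac by (simp add: ob)
      fix y assume "y \<in> carrier (fobj (coker_fctr F G \<eta>) V)"
      then obtain y' where y: "y' \<in> carrier (fobj G V)" "y = quot_cls (fobj G V) (N V) y'" using onto[OF VW(1)] by (auto simp: ob)
      show "farr (coker_fctr F G \<eta>) V W f (x \<oplus>\<^bsub>fobj (coker_fctr F G \<eta>) V\<^esub> y) =
        farr (coker_fctr F G \<eta>) V W f x \<oplus>\<^bsub>fobj (coker_fctr F G \<eta>) W\<^esub> farr (coker_fctr F G \<eta>) V W f y"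
        using x y arr[OF VW] ac q(2)[OF VW(1,1), symmetric] q(2)[OF VW(2,2), symmetric] mod_hom_add[OF functor_arr[OF G VW]]
        by (simp add: ob)
    next
      fix r x assume r: "r \<in> carrier S" and "x \<in> carrier (fobj (coker_fctr F G \<eta>) V)"
      then obtain x' where x: "x' \<in> carrier (fobj G V)" "x = quot_cls (fobj G V) (N V) x'" using onto[OF VW(1)] by (auto simp: ob)
      then show "farr (coker_fctr F G \<eta>) V W f (r \<odot>\<^bsub>fobj (coker_fctr F G \<eta>) V\<^esub> x) =
        r \<odot>\<^bsub>fobj (coker_fctr F G \<eta>) W\<^esub> farr (coker_fctr F G \<eta>) V W f x"
        using r x arr[OF VW] ac q(3)[OF VW(1,1), symmetric] q(3)[OF VW(2,2), symmetric] mod_hom_smult[OF functor_arr[OF G VW]]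
        by (simp add: ob)
    next
      show "farr (coker_fctr F G \<eta>) V W f \<in> extensional (carrier (fobj (coker_fctr F G \<eta>) V))"
        by (simp add: ar ob)
    qed
  next
    fix U V W f g x
    assume UVW: "U \<in> proj R" "V \<in> proj R" "W \<in> proj R" and fg: "f \<in> mod_hom R U V" "g \<in> mod_hom R V W"
      and "x \<in> carrier (fobj (coker_fctr F G \<eta>) U)"
    then obtain x' where x: "x' \<in> carrier (fobj G U)" "x = quot_cls (fobj G U) (N U) x'" using onto[OF UVW(1)] by (auto simp: ob)
    then show "farr (coker_fctr F G \<eta>) U W (compose (carrier U) g f) x =
      farr (coker_fctr F G \<eta>) V W g (farr (coker_fctr F G \<eta>) U V f x)"
      using arr[OF UVW(1,3) mod_hom_compose[OF fg proj_module[OF UVW(1)]]] arr[OF UVW(1,2) fg(1)]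
        arr[OF UVW(2,3) fg(2)] arr_closed[OF G UVW(1,2) fg(1)] functor_comp[OF G UVW fg] by simp
  qed
qed

lemma coker_fctr_obj [simp]: "fobj (coker_fctr F G \<eta>) V = quot_md (fobj G V) (\<eta> V ` carrier (fobj F V))"
  by (simp add: coker_fctr_def Let_def)

section \<open>Complexes and complexes concentrated in one degree\<close>

lemma complexesI:
  assumes "\<And>n. ob X n \<in> functors R S" "\<And>n. dif X n \<in> nat_trans R S (ob X n) (ob X (n - 1))"
    "\<And>n V x. \<lbrakk>V \<in> proj R; x \<in> carrier (val X n V)\<rbrakk> \<Longrightarrow> dif X (n - 1) V (dif X n V x) = \<zero>\<^bsub>val X (n - 2) V\<^esub>"
  shows "X \<in> complexes R S"
  using assms by (simp add: complexes_def)

lemma complex_functor: "X \<in> complexes R S \<Longrightarrow> ob X n \<in> functors R S"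
  by (simp add: complexes_def)

lemma complex_dif: "X \<in> complexes R S \<Longrightarrow> dif X n \<in> nat_trans R S (ob X n) (ob X (n - 1))"
  by (simp add: complexes_def)

lemma complex_dd:
  "\<lbrakk>X \<in> complexes R S; V \<in> proj R; x \<in> carrier (val X n V)\<rbrakk> \<Longrightarrow>
    dif X (n - 1) V (dif X n V x) = \<zero>\<^bsub>val X (n - 2) V\<^esub>"
  by (simp add: complexes_def)

lemma chain_mapsI:
  assumes "\<And>n. \<phi> n \<in> nat_trans R S (ob X n) (ob Y n)"
    "\<And>n V x. \<lbrakk>V \<in> proj R; x \<in> carrier (val X n V)\<rbrakk> \<Longrightarrow> dif Y n V (\<phi> n V x) = \<phi> (n - 1) V (dif X n V x)"
  shows "\<phi> \<in> chain_maps R S X Y"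
  using assms by (simp add: chain_maps_def)

lemma stalk_complex:
  assumes "F \<in> functors R S" "cring S"
  shows "stalk n F \<in> complexes R S"
proof -
  have ob: "ob (stalk n F) k \<in> functors R S" for k
    using assms by (simp add: stalk_def Let_def zero_fctr_functor)
  have d: "dif (stalk n F) k = (\<lambda>V. zero_map (val (stalk n F) k V) (val (stalk n F) (k - 1) V))" for k
    by (simp add: stalk_def Let_def)
  show ?thesis
  proof (rule complexesI)
    show "dif (stalk n F) k \<in> nat_trans R S (ob (stalk n F) k) (ob (stalk n F) (k - 1))" for k
      unfolding d by (rule zero_map_nat[OF ob ob])
    show "dif (stalk n F) (k - 1) V (dif (stalk n F) k V x) = \<zero>\<^bsub>val (stalk n F) (k - 2) V\<^esub>"
      if "V \<in> proj R" "x \<in> carrier (val (stalk n F) k V)" for k V x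
    proof -
      interpret m: module S "val (stalk n F) (k - 1) V" by (rule functor_module[OF ob that(1)])
      have "\<zero>\<^bsub>val (stalk n F) (k - 1) V\<^esub> \<in> carrier (val (stalk n F) (k - 1) V)" by simp
      moreover have "k - 1 - 1 = k - 2" by simp
      ultimately show ?thesis using that unfolding d by simp
    qed
  qed (rule ob)
qed

lemma stalk_ob: "ob (stalk n F) k = (if k = n then F else zero_fctr)"
  by (simp add: stalk_def Let_def)

lemma stalk_dif: "dif (stalk n F) k V = zero_map (val (stalk n F) k V) (val (stalk n F) (k - 1) V)"
  by (simp add: stalk_def Let_def)

lemma (in abelian_group) diff_zero_iff:
  "\<lbrakk>x \<in> carrier G; y \<in> carrier G\<rbrakk> \<Longrightarrow> x \<ominus> y = \<zero> \<longleftrightarrow> x = y"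
  using minus_equality[of x "\<ominus> y"] by (auto simp: a_minus_def r_neg)

lemma (in abelian_group) diff_zero: "x \<in> carrier G \<Longrightarrow> x \<ominus> \<zero> = x"
  using minus_equality[of \<zero> \<zero>] by (simp add: a_minus_def)

section \<open>Base change along a square-zero extension\<close>

locale sqz =
  fixes R R' :: "('u :: infinite) ring" and M :: "'u md"
    and ra :: "'u \<Rightarrow> 'u \<Rightarrow> 'u" and i q :: "'u \<Rightarrow> 'u"
  assumes R_cring: "cring R" and R'_cring: "cring R'"
    and bim: "bimodule R M ra" and sq: "square_zero_ext R M ra R' i q"
begin

sublocale R: cring R by (rule R_cring)
sublocale R': cring R' by (rule R'_cring)
sublocale M: module R M using bim by (simp add: bimodule_def)

lemma q_hom: "q \<in> ring_hom R' R" using sq by (simp add: square_zero_ext_def)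
lemma q_closed [simp]: "x \<in> carrier R' \<Longrightarrow> q x \<in> carrier R" using q_hom by (rule ring_hom_closed)
lemma q_add: "\<lbrakk>x \<in> carrier R'; y \<in> carrier R'\<rbrakk> \<Longrightarrow> q (x \<oplus>\<^bsub>R'\<^esub> y) = q x \<oplus>\<^bsub>R\<^esub> q y"
  using q_hom by (rule ring_hom_add)
lemma q_mult: "\<lbrakk>x \<in> carrier R'; y \<in> carrier R'\<rbrakk> \<Longrightarrow> q (x \<otimes>\<^bsub>R'\<^esub> y) = q x \<otimes>\<^bsub>R\<^esub> q y"
  using q_hom by (rule ring_hom_mult)
lemma q_one [simp]: "q \<one>\<^bsub>R'\<^esub> = \<one>\<^bsub>R\<^esub>" using q_hom by (rule ring_hom_one)
lemma q_zero [simp]: "q \<zero>\<^bsub>R'\<^esub> = \<zero>\<^bsub>R\<^esub>"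
  by (rule additive_zero[OF R'.abelian_group_axioms R.abelian_group_axioms]) (auto simp: q_add)
lemma q_diff: "\<lbrakk>x \<in> carrier R'; y \<in> carrier R'\<rbrakk> \<Longrightarrow> q (x \<ominus>\<^bsub>R'\<^esub> y) = q x \<ominus>\<^bsub>R\<^esub> q y"
  using additive_neg[OF R'.abelian_group_axioms R.abelian_group_axioms, of q y]
  by (simp add: a_minus_def q_add)
lemma q_onto: "r \<in> carrier R \<Longrightarrow> \<exists>r'\<in>carrier R'. q r' = r"
  using sq unfolding square_zero_ext_def by (metis imageE)

lemma i_closed [simp]: "m \<in> carrier M \<Longrightarrow> i m \<in> carrier R'"
  using sq by (auto simp: square_zero_ext_def hom_def)
lemma i_add: "\<lbrakk>m \<in> carrier M; k \<in> carrier M\<rbrakk> \<Longrightarrow> i (m \<oplus>\<^bsub>M\<^esub> k) = i m \<oplus>\<^bsub>R'\<^esub> i k"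
  using sq by (auto simp: square_zero_ext_def hom_def)
lemma i_zero [simp]: "i \<zero>\<^bsub>M\<^esub> = \<zero>\<^bsub>R'\<^esub>"
  by (rule additive_zero[OF M.abelian_group_axioms R'.abelian_group_axioms]) (auto simp: i_add)
lemma i_inj: "inj_on i (carrier M)" using sq by (simp add: square_zero_ext_def)
lemma i_kernel: "i ` carrier M = {x \<in> carrier R'. q x = \<zero>\<^bsub>R\<^esub>}"
  using sq by (simp add: square_zero_ext_def a_kernel_def kernel_def)
lemma q_i [simp]: "m \<in> carrier M \<Longrightarrow> q (i m) = \<zero>\<^bsub>R\<^esub>" using i_kernel by blast
lemma i_smult: "\<lbrakk>m \<in> carrier M; r \<in> carrier R'\<rbrakk> \<Longrightarrow> r \<otimes>\<^bsub>R'\<^esub> i m = i (q r \<odot>\<^bsub>M\<^esub> m)"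
  using sq by (simp add: square_zero_ext_def)
lemma i_ra: "\<lbrakk>m \<in> carrier M; r \<in> carrier R'\<rbrakk> \<Longrightarrow> i m \<otimes>\<^bsub>R'\<^esub> r = i (ra m (q r))"
  using sq by (simp add: square_zero_ext_def)

text \<open>In the commutative ring \<open>R'\<close> the products of \<open>i m\<close> with a lift
  of \<open>r\<close> on either side agree. They are the images under \<open>i\<close> of the right
  and the left multiple of \<open>m\<close>, and \<open>i\<close> is injective.\<close>

lemma ra_eq: "\<lbrakk>m \<in> carrier M; r \<in> carrier R\<rbrakk> \<Longrightarrow> ra m r = r \<odot>\<^bsub>M\<^esub> m"
proof -
  assume m: "m \<in> carrier M" and r: "r \<in> carrier R"
  obtain r' where r': "r' \<in> carrier R'" "q r' = r" using q_onto[OF r] by blast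
  interpret ra: module R "M\<lparr>smult := \<lambda>r m. ra m r\<rparr>" using bim by (simp add: bimodule_def)
  have c: "ra m r \<in> carrier M" using ra.smult_closed[OF r, of m] m by simp
  have "i (ra m r) = i (r \<odot>\<^bsub>M\<^esub> m)" using i_smult[OF m r'(1)] i_ra[OF m r'(1)] r' m R'.m_comm by simp
  then show ?thesis using inj_onD[OF i_inj] c m r by simp
qed

abbreviation "base \<equiv> base_act R q"
abbreviation "TT N \<equiv> tensor (self_md R) base R' N"
abbreviation "ot N n \<equiv> tens (self_md R) base R' N \<one>\<^bsub>R\<^esub> n"
abbreviation "ra' \<equiv> \<lambda>m r'. ra m (q r')"
abbreviation "MT N \<equiv> tensor M ra' R' N"
abbreviation "mt N \<equiv> tens M ra' R' N"
abbreviation "MV V \<equiv> tensor M ra R V"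
abbreviation "mv V \<equiv> tens M ra R V"
abbreviation "push_incl \<equiv> push_fctr q incl_fctr"

lemma TT_data: "module R' N \<Longrightarrow> tensor_data R (self_md R) base R' N"
  using self_md_module[OF R_cring] by (auto simp: tensor_data_def base_act_def R.m_assoc)

lemma MT_data: "module R' N \<Longrightarrow> tensor_data R M ra' R' N"
  by (auto simp: tensor_data_def ra_eq M.module_axioms M.smult_assoc1[symmetric] R.m_comm)

lemma MV_data: "module R V \<Longrightarrow> tensor_data R M ra R V"
  by (auto simp: tensor_data_def ra_eq M.module_axioms M.smult_assoc1[symmetric] R.m_comm)

lemmas TT_module = tensor_data.T_module[OF TT_data]

lemma ot_closed [simp]: "\<lbrakk>module R' N; n \<in> carrier N\<rbrakk> \<Longrightarrow> ot N n \<in> carrier (TT N)"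
  using tensor_data.t_closed[OF TT_data] by simp

lemma ot_add: "\<lbrakk>module R' N; n \<in> carrier N; k \<in> carrier N\<rbrakk> \<Longrightarrow> ot N (n \<oplus>\<^bsub>N\<^esub> k) = ot N n \<oplus>\<^bsub>TT N\<^esub> ot N k"
  using tensor_data.t_add_r[OF TT_data] by simp

lemma ot_zero [simp]: "module R' N \<Longrightarrow> ot N \<zero>\<^bsub>N\<^esub> = \<zero>\<^bsub>TT N\<^esub>"
  using tensor_data.t_zero_r[OF TT_data] by simp

text \<open>The scalar crosses the tensor sign because \<open>q r\<close> is \<open>1\<close> acted
  on by \<open>r\<close> from the right.\<close>

lemma tens_q:
  "\<lbrakk>module R' N; r \<in> carrier R'; n \<in> carrier N\<rbrakk> \<Longrightarrow> tens (self_md R) base R' N (q r) n = ot N (r \<odot>\<^bsub>N\<^esub> n)"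
  using tensor_data.t_bal[OF TT_data, of N "\<one>\<^bsub>R\<^esub>" r n] by (simp add: base_act_def)

lemma ot_smult:
  assumes N: "module R' N" and "r \<in> carrier R'" "n \<in> carrier N"
  shows "ot N (r \<odot>\<^bsub>N\<^esub> n) = q r \<odot>\<^bsub>TT N\<^esub> ot N n"
  using tensor_data.smult_t[OF TT_data[OF N], of "q r" "\<one>\<^bsub>R\<^esub>" n] tens_q assms by simp

lemma ot_diff: "\<lbrakk>module R' N; n \<in> carrier N; k \<in> carrier N\<rbrakk> \<Longrightarrow> ot N (n \<ominus>\<^bsub>N\<^esub> k) = ot N n \<ominus>\<^bsub>TT N\<^esub> ot N k"
proof -
  assume N: "module R' N" and nk: "n \<in> carrier N" "k \<in> carrier N"
  interpret N: module R' N by fact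
  have "ot N (\<ominus>\<^bsub>N\<^esub> k) = \<ominus>\<^bsub>TT N\<^esub> ot N k"
    by (rule additive_neg[OF N.abelian_group_axioms module.axioms(2)[OF TT_module[OF N]]])
       (use N nk ot_add in auto)
  then show ?thesis using ot_add[OF N nk(1), of "\<ominus>\<^bsub>N\<^esub> k"] nk by (simp add: a_minus_def)
qed

text \<open>Every scalar of \<open>R\<close> lifts to \<open>R'\<close>, and a lifted scalar can be
  moved to the second factor, so pure tensors are of this form. Sums of such elements are again of
  this form.\<close>

lemma ot_onto: "module R' N \<Longrightarrow> x \<in> carrier (TT N) \<Longrightarrow> \<exists>n\<in>carrier N. x = ot N n"
proof -
  assume N: "module R' N" and x: "x \<in> carrier (TT N)"
  interpret N: module R' N by fact
  interpret T: tensor_data R "self_md R" base R' N by (rule TT_data[OF N])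
  show ?thesis using x
  proof (induction rule: T.tensor_induct)
    case (pure a n)
    then obtain r where "r \<in> carrier R'" "q r = a" using q_onto by auto
    then show ?case using tens_q[OF N, of r n] pure by auto
  next
    case (add x y)
    then obtain n k where "n \<in> carrier N" "k \<in> carrier N" "x = ot N n" "y = ot N k" by blast
    then show ?case using ot_add[OF N, of n k] by (metis N.a_closed)
  qed
qed

section \<open>The submodule \<open>i(M) N\<close> and the identification of the base change with a
  quotient\<close>

definition j :: "'u md \<Rightarrow> 'u \<Rightarrow> 'u" where
  "j N = tens_lift M ra' R' N N (\<lambda>m p. i m \<odot>\<^bsub>N\<^esub> p)"

text \<open>This is \<open>i(M) N\<close>, given as the image of \<open>M \<otimes> N\<close> so
  that elements of \<open>I N\<close> come with a preimage under \<open>j\<close>. The surjectivity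
  and injectivity arguments for \<open>\<beta>\<close> start from such preimages.\<close>

definition I :: "'u md \<Rightarrow> 'u set" where
  "I N = j N ` carrier (MT N)"

lemma j_balanced: "module R' N \<Longrightarrow> tensor_data.balanced M ra' R' N N (\<lambda>m p. i m \<odot>\<^bsub>N\<^esub> p)"
proof -
  assume N: "module R' N"
  interpret N: module R' N by fact
  interpret T: tensor_data R M ra' R' N by (rule MT_data[OF N])
  show ?thesis
    by (rule T.balancedI)
       (auto simp: N.abelian_group_axioms i_add N.smult_l_distr N.smult_r_distr i_ra[symmetric] N.smult_assoc1)
qed

lemmas j_closed = tensor_data.lift_closed[OF MT_data j_balanced, folded j_def]
lemmas j_add = tensor_data.lift_add[OF MT_data j_balanced, folded j_def]
lemmas j_pure = tensor_data.lift_t[OF MT_data j_balanced, folded j_def]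

lemma I_base: "\<lbrakk>module R' N; m \<in> carrier M; n \<in> carrier N\<rbrakk> \<Longrightarrow> i m \<odot>\<^bsub>N\<^esub> n \<in> I N"
  using j_pure[of N m n] tensor_data.t_closed[OF MT_data, of N m n] by (metis I_def imageI)

lemma I_induct [consumes 2, case_names base add]:
  assumes N: "module R' N" and x: "x \<in> I N"
    and "\<And>m n. \<lbrakk>m \<in> carrier M; n \<in> carrier N\<rbrakk> \<Longrightarrow> P (i m \<odot>\<^bsub>N\<^esub> n)"
    and "\<And>x y. \<lbrakk>x \<in> I N; y \<in> I N; P x; P y\<rbrakk> \<Longrightarrow> P (x \<oplus>\<^bsub>N\<^esub> y)"
  shows "P x"
proof -
  interpret T: tensor_data R M ra' R' N by (rule MT_data[OF N])
  obtain z where z: "z \<in> carrier (MT N)" "x = j N z" using x by (auto simp: I_def)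
  have "P (j N z)" using z(1)
    by (induction rule: T.tensor_induct) (use assms in \<open>auto simp: j_pure j_add I_def\<close>)
  then show ?thesis using z by simp
qed

lemma I_submod: assumes N: "module R' N" shows "submod R' N (I N)"
proof -
  interpret N: module R' N by fact
  interpret T: tensor_data R M ra' R' N by (rule MT_data[OF N])
  interpret TM: module R "MT N" by (rule T.T_module)
  have a: "x \<oplus>\<^bsub>N\<^esub> y \<in> I N" if "x \<in> I N" "y \<in> I N" for x y
  proof -
    from that obtain x' y' where "x' \<in> carrier (MT N)" "y' \<in> carrier (MT N)" "x = j N x'" "y = j N y'"
      by (auto simp: I_def)
    then show ?thesis using j_add[OF N N, of x' y'] unfolding I_def by (metis TM.a_closed imageI)
  qed
  have c: "I N \<subseteq> carrier N" using j_closed[OF N N] by (auto simp: I_def)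
  have s: "r \<odot>\<^bsub>N\<^esub> x \<in> I N" if r: "r \<in> carrier R'" and x: "x \<in> I N" for r x
    using N x
  proof (induction rule: I_induct)
    case (base m n)
    then have "r \<odot>\<^bsub>N\<^esub> (i m \<odot>\<^bsub>N\<^esub> n) = i (q r \<odot>\<^bsub>M\<^esub> m) \<odot>\<^bsub>N\<^esub> n"
      using r by (simp add: N.smult_assoc1[symmetric] i_smult)
    then show ?case using base r N by (simp add: I_base)
  next
    case (add x y)
    then show ?case using a r c by (simp add: N.smult_r_distr subset_iff)
  qed
  have "\<zero>\<^bsub>N\<^esub> \<in> I N" using I_base[OF N, of "\<zero>\<^bsub>M\<^esub>" "\<zero>\<^bsub>N\<^esub>"] by simp
  then show ?thesis using a c s by (auto simp: submod_def)
qed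

lemma I_hom:
  assumes N: "module R' N" and N': "module R' N'" and f: "f \<in> mod_hom R' N N'" and x: "x \<in> I N"
  shows "f x \<in> I N'"
  using N x
proof (induction rule: I_induct)
  case (base m n)
  then show ?case using mod_hom_smult[OF f, of "i m" n] I_base[OF N', of m "f n"] mod_hom_closed[OF f] by simp
next
  case (add x y)
  then show ?case using mod_hom_add[OF f, of x y] submodD[OF I_submod[OF N']] submodD(1)[OF I_submod[OF N]] by simp
qed

text \<open>For the harder direction a map from \<open>R \<otimes> N\<close> to
  \<open>N / I N\<close> is built that sends \<open>r \<otimes> k\<close> to the class of
  \<open>r' k\<close>, where \<open>r'\<close> is any lift of \<open>r\<close>. It recovers the
  class of \<open>n\<close> from \<open>1 \<otimes> n\<close>.\<close>

lemma ot_zero_iff: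
  assumes N: "module R' N" and n: "n \<in> carrier N"
  shows "ot N n = \<zero>\<^bsub>TT N\<^esub> \<longleftrightarrow> n \<in> I N"
proof
  interpret N: module R' N by fact
  interpret T: tensor_data R "self_md R" base R' N by (rule TT_data[OF N])
  interpret TM: module R "TT N" by (rule T.T_module)
  { assume "n \<in> I N"
    with N show "ot N n = \<zero>\<^bsub>TT N\<^esub>"
    proof (induction rule: I_induct)
      case (base m k)
      then show ?case using ot_smult[OF N, of "i m" k] N by simp
    next
      case (add x y)
      then show ?case using ot_add[OF N] submodD(1)[OF I_submod[OF N]] by simp
    qed }
  assume z: "ot N n = \<zero>\<^bsub>TT N\<^esub>"
  note sm = I_submod[OF N]
  interpret Q: module R' "quot_md N (I N)" by (rule quot_module[OF N sm])
  let ?c = "quot_cls N (I N)"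
  note qf = quot_facts[OF N sm]
  define l where "l r = (SOME r'. r' \<in> carrier R' \<and> q r' = r)" for r
  have l: "l r \<in> carrier R'" "q (l r) = r" if "r \<in> carrier R" for r
    using someI_ex[of "\<lambda>r'. r' \<in> carrier R' \<and> q r' = r"] q_onto[OF that] unfolding l_def by blast+
  \<comment> \<open>Two lifts of one scalar differ by an element of \<open>i(M)\<close>, so the
    multiples of \<open>k\<close> by them agree modulo \<open>I N\<close>. The section
    \<open>l\<close> need not be additive or multiplicative for the map to be balanced.\<close>
  have indep: "?c (a \<odot>\<^bsub>N\<^esub> k) = ?c (b \<odot>\<^bsub>N\<^esub> k)"
    if "a \<in> carrier R'" "b \<in> carrier R'" "q a = q b" "k \<in> carrier N" for a b k
  proof -
    have "q (a \<ominus>\<^bsub>R'\<^esub> b) = \<zero>\<^bsub>R\<^esub>" using that by (simp add: q_diff R.diff_zero_iff)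
    then have "a \<ominus>\<^bsub>R'\<^esub> b \<in> i ` carrier M" using that by (simp add: i_kernel)
    then have "(a \<ominus>\<^bsub>R'\<^esub> b) \<odot>\<^bsub>N\<^esub> k \<in> I N" using I_base[OF N] that by auto
    moreover have "(a \<ominus>\<^bsub>R'\<^esub> b) \<odot>\<^bsub>N\<^esub> k = a \<odot>\<^bsub>N\<^esub> k \<ominus>\<^bsub>N\<^esub> b \<odot>\<^bsub>N\<^esub> k"
      using that by (simp add: a_minus_def N.smult_l_distr N.smult_l_minus)
    ultimately show ?thesis using qf(5) that by simp
  qed
  have b: "T.balanced (quot_md N (I N)) (\<lambda>r k. ?c (l r \<odot>\<^bsub>N\<^esub> k))"
  proof (rule T.balancedI)
    show "abelian_group (quot_md N (I N))" by (rule Q.abelian_group_axioms)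
    fix a k assume "a \<in> carrier (self_md R)" and k: "k \<in> carrier N"
    then have a: "a \<in> carrier R" by simp
    show "?c (l a \<odot>\<^bsub>N\<^esub> k) \<in> carrier (quot_md N (I N))"
      using quot_cls_closed[OF N sm] l a k by simp
    { fix b assume "b \<in> carrier (self_md R)"
      then have b: "b \<in> carrier R" by simp
      have "?c (l (a \<oplus>\<^bsub>R\<^esub> b) \<odot>\<^bsub>N\<^esub> k) = ?c ((l a \<oplus>\<^bsub>R'\<^esub> l b) \<odot>\<^bsub>N\<^esub> k)"
        using a b k l by (intro indep) (auto simp: q_add)
      then show "?c (l (a \<oplus>\<^bsub>self_md R\<^esub> b) \<odot>\<^bsub>N\<^esub> k) = ?c (l a \<odot>\<^bsub>N\<^esub> k) \<oplus>\<^bsub>quot_md N (I N)\<^esub> ?c (l b \<odot>\<^bsub>N\<^esub> k)"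
        using a b k l qf(2) by (simp add: N.smult_l_distr) }
    { fix k' assume "k' \<in> carrier N"
      then show "?c (l a \<odot>\<^bsub>N\<^esub> (k \<oplus>\<^bsub>N\<^esub> k')) = ?c (l a \<odot>\<^bsub>N\<^esub> k) \<oplus>\<^bsub>quot_md N (I N)\<^esub> ?c (l a \<odot>\<^bsub>N\<^esub> k')"
        using a k l qf(2) by (simp add: N.smult_r_distr) }
    { fix r assume r: "r \<in> carrier R'"
      have "?c (l (a \<otimes>\<^bsub>R\<^esub> q r) \<odot>\<^bsub>N\<^esub> k) = ?c ((l a \<otimes>\<^bsub>R'\<^esub> r) \<odot>\<^bsub>N\<^esub> k)"
        using a r k l by (intro indep) (auto simp: q_mult)
      then show "?c (l (base a r) \<odot>\<^bsub>N\<^esub> k) = ?c (l a \<odot>\<^bsub>N\<^esub> (r \<odot>\<^bsub>N\<^esub> k))"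
        using a r k l by (simp add: N.smult_assoc1 base_act_def) }
  qed
  \<comment> \<open>The map sends \<open>ot N n\<close> to the class of \<open>l 1\<close> times
    \<open>n\<close>, which is the class of \<open>n\<close>. If \<open>ot N n\<close> is zero, this
    class is zero.\<close>
  have "tens_lift (self_md R) base R' N (quot_md N (I N)) (\<lambda>r k. ?c (l r \<odot>\<^bsub>N\<^esub> k)) \<zero>\<^bsub>TT N\<^esub> = \<zero>\<^bsub>quot_md N (I N)\<^esub>"
    by (rule additive_zero[OF T.T_group Q.abelian_group_axioms T.lift_closed[OF b] T.lift_add[OF b]])
  then have "?c (l \<one>\<^bsub>R\<^esub> \<odot>\<^bsub>N\<^esub> n) = \<zero>\<^bsub>quot_md N (I N)\<^esub>"
    using T.lift_t[OF b, of "\<one>\<^bsub>R\<^esub>" n] n by (simp add: z)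
  moreover have "?c (l \<one>\<^bsub>R\<^esub> \<odot>\<^bsub>N\<^esub> n) = ?c (\<one>\<^bsub>R'\<^esub> \<odot>\<^bsub>N\<^esub> n)"
    using l n by (intro indep) auto
  ultimately have "?c n = ?c \<zero>\<^bsub>N\<^esub>" using n by (metis N.smult_one qf(4))
  then have "n \<ominus>\<^bsub>N\<^esub> \<zero>\<^bsub>N\<^esub> \<in> I N" using qf(5)[OF n N.zero_closed] by blast
  then show "n \<in> I N" using n by (simp add: N.diff_zero)
qed

lemma ot_eq_iff:
  assumes N: "module R' N" and n: "n \<in> carrier N" "k \<in> carrier N"
  shows "ot N n = ot N k \<longleftrightarrow> n \<ominus>\<^bsub>N\<^esub> k \<in> I N"
proof -
  interpret N: module R' N by fact
  interpret TM: module R "TT N" by (rule TT_module[OF N])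
  have "ot N n = ot N k \<longleftrightarrow> ot N n \<ominus>\<^bsub>TT N\<^esub> ot N k = \<zero>\<^bsub>TT N\<^esub>"
    using N n by (simp add: TM.diff_zero_iff)
  then show ?thesis using ot_zero_iff[OF N, of "n \<ominus>\<^bsub>N\<^esub> k"] ot_diff[OF N n] n by simp
qed

text \<open>The map \<open>R \<otimes> N \<rightarrow> W\<close> that corresponds to
  \<open>g\<close> under the adjunction between base change and restriction of scalars.\<close>

definition adj :: "'u md \<Rightarrow> 'u md \<Rightarrow> ('u \<Rightarrow> 'u) \<Rightarrow> 'u \<Rightarrow> 'u" where
  "adj N W g = tens_lift (self_md R) base R' N W (\<lambda>r p. r \<odot>\<^bsub>W\<^esub> g p)"

lemma adj_facts:
  assumes N: "module R' N" and W: "module R W" and g: "g \<in> mod_hom R' N (restrict_scalars q W)"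
  shows adj_hom: "adj N W g \<in> mod_hom R (TT N) W"
    and adj_ot: "\<And>n. n \<in> carrier N \<Longrightarrow> adj N W g (ot N n) = g n"
proof -
  interpret W: module R W by fact
  interpret T: tensor_data R "self_md R" base R' N by (rule TT_data[OF N])
  have gc: "\<And>n. n \<in> carrier N \<Longrightarrow> g n \<in> carrier W" using mod_hom_closed[OF g] by simp
  have b: "T.balanced W (\<lambda>r p. r \<odot>\<^bsub>W\<^esub> g p)"
    by (rule T.balancedI)
       (use W.abelian_group_axioms gc mod_hom_add[OF g] mod_hom_smult[OF g] in
         \<open>auto simp: W.smult_l_distr W.smult_r_distr base_act_def W.smult_assoc1\<close>)
  show "adj N W g \<in> mod_hom R (TT N) W" unfolding adj_def
    by (rule T.lift_mod_hom[OF b W]) (use gc in \<open>auto simp: W.smult_assoc1\<close>)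
  show "\<And>n. n \<in> carrier N \<Longrightarrow> adj N W g (ot N n) = g n"
    using T.lift_t[OF b] gc by (simp add: adj_def)
qed

section \<open>Base change of functors and of complexes\<close>

lemma pull_functor: "F \<in> functors R R' \<Longrightarrow> pull_fctr R R' q F \<in> functors R R"
  unfolding pull_fctr_def by (rule tensor_fctr_functor) (auto intro: TT_data)

lemma pull_simps [simp]: "fobj (pull_fctr R R' q F) V = TT (fobj F V)"
  by (simp add: pull_fctr_def)

lemma pull_arr:
  assumes F: "F \<in> functors R R'" and VW: "V \<in> proj R" "W \<in> proj R" "f \<in> mod_hom R V W" and x: "x \<in> carrier (fobj F V)"
  shows "farr (pull_fctr R R' q F) V W f (ot (fobj F V) x) = ot (fobj F W) (farr F V W f x)"
  using tens_right_tens[OF TT_data[OF functor_module[OF F VW(1)]] functor_module[OF F VW(2)] functor_arr[OF F VW] _ x]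
  by (simp add: pull_fctr_def)

lemma tens_right_ot:
  assumes "module R' N" "module R' N'" "h \<in> mod_hom R' N N'"
  shows "tens_right (self_md R) base R' N N' h \<in> mod_hom R (TT N) (TT N')"
    and "n \<in> carrier N \<Longrightarrow> tens_right (self_md R) base R' N N' h (ot N n) = ot N' (h n)"
  using tens_right_facts[OF TT_data[OF assms(1)] assms(2,3)] by auto

lemma bimod_functor: "bimod_fctr R M ra \<in> functors R R"
  unfolding bimod_fctr_def by (rule tensor_fctr_functor[OF incl_fctr_functor]) (rule MV_data)

lemma bimod_simps [simp]: "fobj (bimod_fctr R M ra) V = MV V"
  by (simp add: bimod_fctr_def)

lemma bimod_arr:
  assumes VW: "V \<in> proj R" "W \<in> proj R" "f \<in> mod_hom R V W" and x: "m \<in> carrier M" "v \<in> carrier V"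
  shows "farr (bimod_fctr R M ra) V W f (mv V m v) = mv W m (f v)"
  using tens_right_tens[OF MV_data[OF proj_module[OF VW(1)]] proj_module[OF VW(2)] VW(3) x]
  by (simp add: bimod_fctr_def)

lemma pull_cplx_simps [simp]: "ob (pull_cplx R R' q X) n = pull_fctr R R' q (ob X n)"
  by (simp add: pull_cplx_def)

lemma pull_dif:
  assumes X: "X \<in> complexes R R'" and V: "V \<in> proj R"
  shows "dif (pull_cplx R R' q X) n V \<in> mod_hom R (TT (val X n V)) (TT (val X (n - 1) V))"
    and "x \<in> carrier (val X n V) \<Longrightarrow> dif (pull_cplx R R' q X) n V (ot (val X n V) x) = ot (val X (n - 1) V) (dif X n V x)"
proof -
  note m = functor_module[OF complex_functor[OF X] V]
  note h = nat_hom[OF complex_dif[OF X] V]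
  show "dif (pull_cplx R R' q X) n V \<in> mod_hom R (TT (val X n V)) (TT (val X (n - 1) V))"
    using tens_right_ot(1)[OF m m h] by (simp add: pull_cplx_def)
  show "x \<in> carrier (val X n V) \<Longrightarrow> dif (pull_cplx R R' q X) n V (ot (val X n V) x) = ot (val X (n - 1) V) (dif X n V x)"
    using tens_right_ot(2)[OF m m h] by (simp add: pull_cplx_def)
qed

lemma pull_complex:
  assumes X: "X \<in> complexes R R'"
  shows "pull_cplx R R' q X \<in> complexes R R"
proof (rule complexesI)
  note F = complex_functor[OF X]
  note m = functor_module[OF F]
  show "ob (pull_cplx R R' q X) n \<in> functors R R" for n using pull_functor[OF F] by simp
  show "dif (pull_cplx R R' q X) n \<in> nat_trans R R (ob (pull_cplx R R' q X) n) (ob (pull_cplx R R' q X) (n - 1))" for n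
  proof (rule nat_transI)
    fix V W f x assume VW: "V \<in> proj R" "W \<in> proj R" "f \<in> mod_hom R V W"
      and "x \<in> carrier (val (pull_cplx R R' q X) n V)"
    then obtain y where y: "y \<in> carrier (val X n V)" "x = ot (val X n V) y" using ot_onto[OF m[OF VW(1)]] by auto
    then show "dif (pull_cplx R R' q X) n W (farr (ob (pull_cplx R R' q X) n) V W f x) =
      farr (ob (pull_cplx R R' q X) (n - 1)) V W f (dif (pull_cplx R R' q X) n V x)"
      using pull_dif(2)[OF X] VW pull_arr[OF F VW] arr_closed[OF F VW] nat_closed[OF complex_dif[OF X] VW(1)]
        nat_arr[OF complex_dif[OF X] VW] by simp
  qed (use pull_dif(1)[OF X] in simp)
  fix n V x assume V: "V \<in> proj R" and "x \<in> carrier (val (pull_cplx R R' q X) n V)"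
  then obtain y where y: "y \<in> carrier (val X n V)" "x = ot (val X n V) y" using ot_onto[OF m[OF V]] by auto
  have [simp]: "n - 1 - 1 = n - 2" by simp
  have d: "dif X n V y \<in> carrier (val X (n - 1) V)" by (rule nat_closed[OF complex_dif[OF X] V y(1)])
  show "dif (pull_cplx R R' q X) (n - 1) V (dif (pull_cplx R R' q X) n V x) = \<zero>\<^bsub>val (pull_cplx R R' q X) (n - 2) V\<^esub>"
    using y pull_dif(2)[OF X V y(1)] pull_dif(2)[OF X V d] complex_dd[OF X V y(1)] m[OF V] by simp
qed

end

section \<open>The elementary extension of a surjection onto the tautological functor\<close>

locale cover = sqz +
  fixes F :: "('a :: infinite) fctr" and \<epsilon> :: "'a ntrans"
  assumes F: "F \<in> functors R R'" and \<epsilon>: "\<epsilon> \<in> nat_trans R R' F push_incl"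
    and \<epsilon>_onto: "\<And>V. V \<in> proj R \<Longrightarrow> \<epsilon> V ` carrier (fobj F V) = carrier V"
begin

text \<open>
  The part of degree \<open>n\<close> of the complex \<open>ker \<epsilon> \<rightarrow> F\<close> in degrees 1 and 0 is kept as a subset of \<open>F V\<close>;
  all degrees, the zero ones included, can then be treated at once.
\<close>

definition lay :: "int \<Rightarrow> 'a md \<Rightarrow> 'a set" where
  "lay n V = (if n = 0 then carrier (fobj F V)
     else if n = 1 then {x \<in> carrier (fobj F V). \<epsilon> V x = \<zero>\<^bsub>V\<^esub>} else {\<zero>\<^bsub>fobj F V\<^esub>})"

abbreviation "L n V \<equiv> (fobj F V)\<lparr>carrier := lay n V\<rparr>"

definition X :: "'a cplx" where
  "X = \<lparr>ob = \<lambda>n. sub_fctr F (lay n),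
        dif = \<lambda>n V. \<lambda>x\<in>lay n V. if n = 1 then x else \<zero>\<^bsub>fobj F V\<^esub>\<rparr>"

definition C :: "'a cplx" where "C = pull_cplx R R' q X"

definition aug :: "int \<Rightarrow> 'a ntrans" where
  "aug n V = (if n = 0 then adj (fobj F V) V (\<epsilon> V) else zero_map (val C n V) (val (stalk 0 incl_fctr) n V))"

definition pre :: "'a md \<Rightarrow> 'a \<Rightarrow> 'a" where
  "pre V v = (SOME p. p \<in> carrier (fobj F V) \<and> \<epsilon> V p = v)"

text \<open>\<open>pre\<close> merely fixes a preimage of \<open>v\<close>; by
  \<open>ot_ip_cong\<close> any other preimage gives the same class. This is the inverse of the
  connecting isomorphism, as \<open>\<beta>_me\<close> and later \<open>connecting_iff\<close> make
  precise.\<close>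

definition \<beta> :: "'a md \<Rightarrow> 'a \<Rightarrow> 'a" where
  "\<beta> V = tens_lift M ra R V (TT (L 1 V)) (\<lambda>m v. ot (L 1 V) (i m \<odot>\<^bsub>fobj F V\<^esub> pre V v))"

definition ext :: "'a elext" where
  "ext = \<lparr>emid = C, epr = aug,
     ein = \<lambda>n V. if n = 1 then \<beta> V else zero_map (val (stalk 1 (bimod_fctr R M ra)) n V) (val C n V)\<rparr>"

section \<open>The two-term complex of a cover after base change\<close>

lemma X_ob [simp]: "ob X n = sub_fctr F (lay n)" by (simp add: X_def)
lemma X_dif: "x \<in> lay n V \<Longrightarrow> dif X n V x = (if n = 1 then x else \<zero>\<^bsub>fobj F V\<^esub>)" by (simp add: X_def)
lemma C_val [simp]: "val C n V = TT (L n V)" by (simp add: C_def)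

lemma F_mod: "V \<in> proj R \<Longrightarrow> module R' (fobj F V)" by (rule functor_module[OF F])

lemma \<epsilon>_hom: "V \<in> proj R \<Longrightarrow> \<epsilon> V \<in> mod_hom R' (fobj F V) (restrict_scalars q V)"
  using nat_hom[OF \<epsilon>] by simp

lemma \<epsilon>_closed: "\<lbrakk>V \<in> proj R; x \<in> carrier (fobj F V)\<rbrakk> \<Longrightarrow> \<epsilon> V x \<in> carrier V"
  using mod_hom_closed[OF \<epsilon>_hom] by simp

lemma \<epsilon>_smult: "\<lbrakk>V \<in> proj R; r \<in> carrier R'; x \<in> carrier (fobj F V)\<rbrakk> \<Longrightarrow>
    \<epsilon> V (r \<odot>\<^bsub>fobj F V\<^esub> x) = q r \<odot>\<^bsub>V\<^esub> \<epsilon> V x"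
  using mod_hom_smult[OF \<epsilon>_hom] by simp

lemma \<epsilon>_diff: "\<lbrakk>V \<in> proj R; x \<in> carrier (fobj F V); y \<in> carrier (fobj F V)\<rbrakk> \<Longrightarrow>
    \<epsilon> V (x \<ominus>\<^bsub>fobj F V\<^esub> y) = \<epsilon> V x \<ominus>\<^bsub>V\<^esub> \<epsilon> V y"
  using mod_hom_diff[OF \<epsilon>_hom F_mod restrict_scalars_module[OF proj_module q_hom R'_cring]]
  by (simp add: minus_restrict_scalars)

lemma \<epsilon>_arr: "\<lbrakk>V \<in> proj R; W \<in> proj R; f \<in> mod_hom R V W; x \<in> carrier (fobj F V)\<rbrakk> \<Longrightarrow>
    \<epsilon> W (farr F V W f x) = f (\<epsilon> V x)"
  using nat_arr[OF \<epsilon>] by simp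

lemma lay_submod: assumes V: "V \<in> proj R" shows "submod R' (fobj F V) (lay n V)"
proof -
  have "submod R' (fobj F V) {x \<in> carrier (fobj F V). \<epsilon> V x = \<zero>\<^bsub>restrict_scalars q V\<^esub>}"
    by (rule submod_kernel[OF F_mod[OF V] restrict_scalars_module[OF proj_module[OF V] q_hom R'_cring] \<epsilon>_hom[OF V]])
  then show ?thesis using submod_carrier[OF F_mod[OF V]] submod_zero[OF F_mod[OF V]] by (simp add: lay_def)
qed

lemma lay_sub: "\<lbrakk>V \<in> proj R; x \<in> lay n V\<rbrakk> \<Longrightarrow> x \<in> carrier (fobj F V)"
  using submodD(1)[OF lay_submod] .

lemma L_mod: "V \<in> proj R \<Longrightarrow> module R' (L n V)"
  by (rule submod_module[OF F_mod lay_submod])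

lemma L_zero [simp]: "V \<in> proj R \<Longrightarrow> \<zero>\<^bsub>fobj F V\<^esub> \<in> lay n V"
  using submodD(2)[OF lay_submod] .

lemma ot_L_zero [simp]: "V \<in> proj R \<Longrightarrow> ot (L n V) \<zero>\<^bsub>fobj F V\<^esub> = \<zero>\<^bsub>TT (L n V)\<^esub>"
  using ot_zero[OF L_mod] by simp

lemma L_0 [simp]: "L 0 V = fobj F V" by (simp add: lay_def)

lemma lay_0 [simp]: "lay 0 V = carrier (fobj F V)" by (simp add: lay_def)

lemma lay_arr:
  assumes VW: "V \<in> proj R" "W \<in> proj R" "f \<in> mod_hom R V W" and x: "x \<in> lay n V"
  shows "farr F V W f x \<in> lay n W"
  using x arr_closed[OF F VW] \<epsilon>_arr[OF VW] arr_zero[OF F VW]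
    mod_hom_zero[OF VW(3) proj_module[OF VW(1)] proj_module[OF VW(2)]]
  by (auto simp: lay_def split: if_splits)

lemma X_functor: "sub_fctr F (lay n) \<in> functors R R'"
  by (rule sub_fctr_functor[OF F lay_submod lay_arr])

lemma X_complex: "X \<in> complexes R R'"
proof (rule complexesI)
  show "ob X n \<in> functors R R'" for n using X_functor by simp
  show "dif X n \<in> nat_trans R R' (ob X n) (ob X (n - 1))" for n
  proof (rule nat_transI)
    fix V assume V: "V \<in> proj R"
    interpret m: module R' "fobj F V" by (rule F_mod[OF V])
    show "dif X n V \<in> mod_hom R' (val X n V) (val X (n - 1) V)"
    proof (cases "n = 1")
      case True
      then show ?thesis
        by (intro mod_homI) (use submodD[OF lay_submod[OF V]] lay_sub[OF V] in \<open>auto simp: X_def\<close>)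
    next
      case False
      then show ?thesis
        by (intro mod_homI) (use submodD[OF lay_submod[OF V]] lay_sub[OF V] V in \<open>auto simp: X_def\<close>)
    qed
  next
    fix V W f x assume VW: "V \<in> proj R" "W \<in> proj R" "f \<in> mod_hom R V W" and x: "x \<in> carrier (val X n V)"
    then have x: "x \<in> lay n V" by simp
    have "x \<in> lay (n - 1) V" if "n = 1" using x lay_sub[OF VW(1)] that by simp
    then show "dif X n W (farr (ob X n) V W f x) = farr (ob X (n - 1)) V W f (dif X n V x)"
      using x lay_arr[OF VW x] arr_zero[OF F VW] VW(1) by (simp add: X_dif)
  qed
  fix n V x assume V: "V \<in> proj R" and x: "x \<in> carrier (val X n V)"
  then have "x \<in> lay (n - 1) V" if "n = 1" using lay_sub[OF V] that by simp
  then show "dif X (n - 1) V (dif X n V x) = \<zero>\<^bsub>val X (n - 2) V\<^esub>"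
    using x V by (auto simp: X_dif)
qed

lemma C_complex: "C \<in> complexes R R"
  unfolding C_def by (rule pull_complex[OF X_complex])

lemma C_functor: "ob C n \<in> functors R R" by (rule complex_functor[OF C_complex])

lemma C_dif_hom: "V \<in> proj R \<Longrightarrow> dif C n V \<in> mod_hom R (TT (L n V)) (TT (L (n - 1) V))"
  using pull_dif(1)[OF X_complex, of V n] by (simp add: C_def)

lemma C_dif: "\<lbrakk>V \<in> proj R; x \<in> lay n V\<rbrakk> \<Longrightarrow>
    dif C n V (ot (L n V) x) = (if n = 1 then ot (fobj F V) x else \<zero>\<^bsub>TT (L (n - 1) V)\<^esub>)"
  using pull_dif(2)[OF X_complex, of V x n] by (auto simp: C_def X_dif)

lemma C_arr: "\<lbrakk>V \<in> proj R; W \<in> proj R; f \<in> mod_hom R V W; x \<in> lay n V\<rbrakk> \<Longrightarrow>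
    farr (ob C n) V W f (ot (L n V) x) = ot (L n W) (farr F V W f x)"
  using pull_arr[OF X_functor, of V W f x n] by (simp add: C_def)

lemma C_onto: "\<lbrakk>V \<in> proj R; c \<in> carrier (TT (L n V))\<rbrakk> \<Longrightarrow> \<exists>x\<in>lay n V. c = ot (L n V) x"
  using ot_onto[OF L_mod, of V c n] by simp

lemma C_zero:
  assumes "V \<in> proj R" "n \<noteq> 0" "n \<noteq> 1"
  shows "carrier (TT (L n V)) = {\<zero>\<^bsub>TT (L n V)\<^esub>}"
proof -
  interpret T: module R "TT (L n V)" by (rule TT_module[OF L_mod[OF assms(1)]])
  have "c = \<zero>\<^bsub>TT (L n V)\<^esub>" if c: "c \<in> carrier (TT (L n V))" for c
  proof -
    obtain x where x: "x \<in> lay n V" "c = ot (L n V) x" using C_onto[OF assms(1) c] by blast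
    moreover from x have "x = \<zero>\<^bsub>fobj F V\<^esub>" using assms by (simp add: lay_def)
    ultimately show ?thesis using assms(1) by simp
  qed
  then show ?thesis using T.zero_closed by blast
qed

lemma aug_hom: "V \<in> proj R \<Longrightarrow> aug n V \<in> mod_hom R (TT (L n V)) (val (stalk 0 incl_fctr) n V)"
proof (cases "n = 0")
  case True
  assume "V \<in> proj R"
  then show ?thesis using adj_hom[OF F_mod proj_module \<epsilon>_hom] True by (simp add: aug_def stalk_ob)
next
  case False
  assume V: "V \<in> proj R"
  show ?thesis
    using False zero_map_mod_hom[OF TT_module[OF L_mod[OF V]] zero_md_module[OF R_cring]]
    by (simp add: aug_def stalk_ob)
qed

lemma aug_ot: "\<lbrakk>V \<in> proj R; x \<in> carrier (fobj F V)\<rbrakk> \<Longrightarrow> aug 0 V (ot (fobj F V) x) = \<epsilon> V x"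
  using adj_ot[OF F_mod proj_module \<epsilon>_hom] by (simp add: aug_def)

lemma aug_nonzero: "\<lbrakk>V \<in> proj R; n \<noteq> 0; c \<in> carrier (TT (L n V))\<rbrakk> \<Longrightarrow> aug n V c = \<zero>\<^bsub>zero_md\<^esub>"
  by (simp add: aug_def stalk_ob)

lemma aug_chain: "aug \<in> chain_maps R R C (stalk 0 incl_fctr)"
proof (rule chain_mapsI)
  fix n
  show "aug n \<in> nat_trans R R (ob C n) (ob (stalk 0 incl_fctr) n)"
  proof (rule nat_transI)
    fix V W f x assume VW: "V \<in> proj R" "W \<in> proj R" "f \<in> mod_hom R V W" and "x \<in> carrier (val C n V)"
    then have "x \<in> carrier (TT (L n V))" by simp
    then obtain y where y: "y \<in> lay n V" "x = ot (L n V) y" using C_onto[OF VW(1)] by blast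
    show "aug n W (farr (ob C n) V W f x) = farr (ob (stalk 0 incl_fctr) n) V W f (aug n V x)"
    proof (cases "n = 0")
      case True
      then show ?thesis using y VW C_arr[OF VW, of y 0] arr_closed[OF F VW] \<epsilon>_arr[OF VW]
        by (simp add: aug_ot stalk_ob)
    next
      case False
      have "farr (ob C n) V W f x \<in> carrier (TT (L n W))"
        using C_arr[OF VW y(1)] lay_arr[OF VW y(1)] y L_mod[OF VW(2)] by simp
      moreover have "farr zero_fctr V W f \<zero>\<^bsub>zero_md\<^esub> = \<zero>\<^bsub>zero_md\<^esub>"
        by (simp add: zero_fctr_def)
      ultimately show ?thesis using False y VW aug_nonzero[of V n x] aug_nonzero[of W n] L_mod[OF VW(1)]
        by (simp add: stalk_ob)
    qed
  qed (use aug_hom in simp)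
  fix V x assume V: "V \<in> proj R" and "x \<in> carrier (val C n V)"
  then have "x \<in> carrier (TT (L n V))" by simp
  then obtain y where y: "y \<in> lay n V" "x = ot (L n V) y" using C_onto[OF V] by blast
  have ac: "aug n V x \<in> carrier (val (stalk 0 incl_fctr) n V)"
    using mod_hom_closed[OF aug_hom[OF V]] y L_mod[OF V] by simp
  then have l: "dif (stalk 0 incl_fctr) n V (aug n V x) = \<zero>\<^bsub>val (stalk 0 incl_fctr) (n - 1) V\<^esub>"
    by (simp add: stalk_dif)
  show "dif (stalk 0 incl_fctr) n V (aug n V x) = aug (n - 1) V (dif C n V x)"
  proof (cases "n = 1")
    case True
    then have "y \<in> carrier (fobj F V)" "\<epsilon> V y = \<zero>\<^bsub>V\<^esub>" using y by (simp_all add: lay_def)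
    then show ?thesis using l C_dif[OF V y(1)] y True aug_ot[OF V] by (simp add: stalk_ob)
  next
    case False
    then have d: "dif C n V x = \<zero>\<^bsub>TT (L (n - 1) V)\<^esub>" using C_dif[OF V y(1)] y by simp
    interpret T: module R "TT (L (n - 1) V)" by (rule TT_module[OF L_mod[OF V]])
    show ?thesis using False l aug_nonzero[OF V, of "n - 1" "\<zero>\<^bsub>TT (L (n - 1) V)\<^esub>"] d by (simp add: stalk_ob)
  qed
qed

section \<open>The map from \<open>M \<otimes> V\<close> into degree 1\<close>

lemma pre: "\<lbrakk>V \<in> proj R; v \<in> carrier V\<rbrakk> \<Longrightarrow> pre V v \<in> carrier (fobj F V) \<and> \<epsilon> V (pre V v) = v"
  unfolding pre_def by (rule someI_ex) (use \<epsilon>_onto in \<open>metis imageE\<close>)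

text \<open>\<open>\<epsilon>\<close> turns the scalar \<open>i m\<close> into
  \<open>q (i m)\<close>, which is zero.\<close>

lemma ip_lay:
  assumes "V \<in> proj R" "m \<in> carrier M" "p \<in> carrier (fobj F V)"
  shows "i m \<odot>\<^bsub>fobj F V\<^esub> p \<in> lay 1 V"
proof -
  interpret V: module R V by (rule proj_module[OF assms(1)])
  interpret F: module R' "fobj F V" by (rule F_mod[OF assms(1)])
  show ?thesis using assms \<epsilon>_smult[OF assms(1), of "i m" p] \<epsilon>_closed[OF assms(1,3)] by (simp add: lay_def)
qed

lemma I_L: "\<lbrakk>V \<in> proj R; m \<in> carrier M; p \<in> lay n V\<rbrakk> \<Longrightarrow> i m \<odot>\<^bsub>fobj F V\<^esub> p \<in> I (L n V)"
  using I_base[OF L_mod, of V m p n] by simp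

lemma ot_L_eqI: "\<lbrakk>V \<in> proj R; x \<in> lay n V; y \<in> lay n V; x \<ominus>\<^bsub>fobj F V\<^esub> y \<in> I (L n V)\<rbrakk> \<Longrightarrow> ot (L n V) x = ot (L n V) y"
  using ot_eq_iff[OF L_mod, of V x n y] minus_sub[OF F_mod lay_submod] by simp

text \<open>The difference of the two elements is \<open>i m\<close> times \<open>p - p'\<close>,
  and \<open>p - p'\<close> lies in the kernel of \<open>\<epsilon>\<close>. So the difference
  belongs to \<open>I\<close> of the kernel, not just to \<open>I\<close> of \<open>F V\<close>, and
  it vanishes in degree 1.\<close>

lemma ot_ip_cong:
  assumes V: "V \<in> proj R" and m: "m \<in> carrier M" and p: "p \<in> carrier (fobj F V)" "p' \<in> carrier (fobj F V)"
    and e: "\<epsilon> V p = \<epsilon> V p'"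
  shows "ot (L 1 V) (i m \<odot>\<^bsub>fobj F V\<^esub> p) = ot (L 1 V) (i m \<odot>\<^bsub>fobj F V\<^esub> p')"
proof (rule ot_L_eqI[OF V ip_lay[OF V m p(1)] ip_lay[OF V m p(2)]])
  interpret V: module R V by (rule proj_module[OF V])
  interpret F: module R' "fobj F V" by (rule F_mod[OF V])
  have "p \<ominus>\<^bsub>fobj F V\<^esub> p' \<in> lay 1 V"
    using p e \<epsilon>_closed[OF V p(2)] by (simp add: lay_def \<epsilon>_diff[OF V] V.diff_zero_iff)
  then have "i m \<odot>\<^bsub>fobj F V\<^esub> (p \<ominus>\<^bsub>fobj F V\<^esub> p') \<in> I (L 1 V)" by (rule I_L[OF V m])
  then show "i m \<odot>\<^bsub>fobj F V\<^esub> p \<ominus>\<^bsub>fobj F V\<^esub> i m \<odot>\<^bsub>fobj F V\<^esub> p' \<in> I (L 1 V)"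
    using m p by (simp add: a_minus_def F.smult_r_distr F.smult_r_minus)
qed

lemma \<beta>_facts:
  assumes V: "V \<in> proj R"
  shows \<beta>_hom: "\<beta> V \<in> mod_hom R (MV V) (TT (L 1 V))"
    and \<beta>_mv: "\<And>m p. \<lbrakk>m \<in> carrier M; p \<in> carrier (fobj F V)\<rbrakk> \<Longrightarrow> \<beta> V (mv V m (\<epsilon> V p)) = ot (L 1 V) (i m \<odot>\<^bsub>fobj F V\<^esub> p)"
proof -
  interpret V: module R V by (rule proj_module[OF V])
  interpret F: module R' "fobj F V" by (rule F_mod[OF V])
  interpret T: tensor_data R M ra R V by (rule MV_data[OF proj_module[OF V]])
  note Lm = L_mod[OF V, of 1]
  interpret TL: module R "TT (L 1 V)" by (rule TT_module[OF Lm])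
  let ?f = "\<lambda>m v. ot (L 1 V) (i m \<odot>\<^bsub>fobj F V\<^esub> pre V v)"
  \<comment> \<open>Once the chosen preimage is replaced by an arbitrary one, sums and multiples can
    be represented by sums and multiples of preimages. This gives additivity and balancedness,
    although \<open>pre\<close> itself respects no structure.\<close>
  have fp: "?f m (\<epsilon> V p) = ot (L 1 V) (i m \<odot>\<^bsub>fobj F V\<^esub> p)" if "m \<in> carrier M" "p \<in> carrier (fobj F V)" for m p
    using that pre[OF V, of "\<epsilon> V p"] \<epsilon>_closed[OF V] by (intro ot_ip_cong[OF V]) auto
  have fe: "\<exists>p\<in>carrier (fobj F V). v = \<epsilon> V p" if "v \<in> carrier V" for v
    using \<epsilon>_onto[OF V] that by (metis imageE)
  have oa: "ot (L 1 V) (x \<oplus>\<^bsub>fobj F V\<^esub> y) = ot (L 1 V) x \<oplus>\<^bsub>TT (L 1 V)\<^esub> ot (L 1 V) y" if "x \<in> lay 1 V" "y \<in> lay 1 V" for x y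
    using ot_add[OF Lm, of x y] that by simp
  have os: "ot (L 1 V) (r \<odot>\<^bsub>fobj F V\<^esub> x) = q r \<odot>\<^bsub>TT (L 1 V)\<^esub> ot (L 1 V) x" if "r \<in> carrier R'" "x \<in> lay 1 V" for x r
    using ot_smult[OF Lm, of r x] that by simp
  have bal: "T.balanced (TT (L 1 V)) ?f"
  proof (rule T.balancedI)
    fix a v assume a: "a \<in> carrier M" and "v \<in> carrier V"
    then obtain p where p: "p \<in> carrier (fobj F V)" "v = \<epsilon> V p" using fe by blast
    show "?f a v \<in> carrier (TT (L 1 V))" using p a fp ip_lay[OF V a p(1)] Lm by simp
    { fix b assume b: "b \<in> carrier M"
      then show "?f (a \<oplus>\<^bsub>M\<^esub> b) v = ?f a v \<oplus>\<^bsub>TT (L 1 V)\<^esub> ?f b v"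
        using p a fp[of "a \<oplus>\<^bsub>M\<^esub> b" p] by (simp add: fp[of a] fp[of b]) (simp add: i_add F.smult_l_distr oa ip_lay[OF V]) }
    { fix w assume "w \<in> carrier V"
      then obtain p' where p': "p' \<in> carrier (fobj F V)" "w = \<epsilon> V p'" using fe by blast
      have "\<epsilon> V (p \<oplus>\<^bsub>fobj F V\<^esub> p') = v \<oplus>\<^bsub>V\<^esub> w" using p p' mod_hom_add[OF \<epsilon>_hom[OF V]] by simp
      then have "?f a (v \<oplus>\<^bsub>V\<^esub> w) = ot (L 1 V) (i a \<odot>\<^bsub>fobj F V\<^esub> (p \<oplus>\<^bsub>fobj F V\<^esub> p'))"
        using fp[OF a, of "p \<oplus>\<^bsub>fobj F V\<^esub> p'"] p p' by simp
      then show "?f a (v \<oplus>\<^bsub>V\<^esub> w) = ?f a v \<oplus>\<^bsub>TT (L 1 V)\<^esub> ?f a w"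
        using p p' a by (simp add: fp F.smult_r_distr oa ip_lay[OF V]) }
    { fix r assume r: "r \<in> carrier R"
      then obtain r' where r': "r' \<in> carrier R'" "q r' = r" using q_onto by blast
      have "\<epsilon> V (r' \<odot>\<^bsub>fobj F V\<^esub> p) = r \<odot>\<^bsub>V\<^esub> v" using p r' \<epsilon>_smult[OF V] by simp
      then have "?f a (r \<odot>\<^bsub>V\<^esub> v) = ot (L 1 V) (i a \<odot>\<^bsub>fobj F V\<^esub> (r' \<odot>\<^bsub>fobj F V\<^esub> p))"
        using fp[OF a, of "r' \<odot>\<^bsub>fobj F V\<^esub> p"] p r' by simp
      then show "?f (ra a r) v = ?f a (r \<odot>\<^bsub>V\<^esub> v)"
        using p a r r' T.ra_closed[OF a r] by (simp add: fp F.smult_assoc1[symmetric] i_ra) }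
  qed (rule TL.abelian_group_axioms)
  show "\<beta> V \<in> mod_hom R (MV V) (TT (L 1 V))" unfolding \<beta>_def
  proof (rule T.lift_mod_hom[OF bal TL.module_axioms])
    fix s a v assume s: "s \<in> carrier R" and a: "a \<in> carrier M" and "v \<in> carrier V"
    then obtain p where p: "p \<in> carrier (fobj F V)" "v = \<epsilon> V p" using fe by blast
    obtain r' where r': "r' \<in> carrier R'" "q r' = s" using q_onto s by blast
    have "i (s \<odot>\<^bsub>M\<^esub> a) \<odot>\<^bsub>fobj F V\<^esub> p = r' \<odot>\<^bsub>fobj F V\<^esub> (i a \<odot>\<^bsub>fobj F V\<^esub> p)"
      using i_smult[OF a r'(1)] r' a p F.smult_assoc1[of r' "i a" p] by simp
    then show "?f (s \<odot>\<^bsub>M\<^esub> a) v = s \<odot>\<^bsub>TT (L 1 V)\<^esub> ?f a v"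
      using p a s r' os[OF r'(1) ip_lay[OF V a p(1)]] by (simp add: fp)
  qed
  show "\<beta> V (mv V m (\<epsilon> V p)) = ot (L 1 V) (i m \<odot>\<^bsub>fobj F V\<^esub> p)" if "m \<in> carrier M" "p \<in> carrier (fobj F V)" for m p
    unfolding \<beta>_def using T.lift_t[OF bal that(1) \<epsilon>_closed[OF V that(2)]] fp[OF that] by simp
qed

text \<open>The map \<open>M \<otimes> F V \<rightarrow> M \<otimes> V\<close> induced by
  \<open>\<epsilon>\<close>, from a tensor product over \<open>R'\<close> to one over
  \<open>R\<close>.\<close>

definition me :: "'a md \<Rightarrow> 'a \<Rightarrow> 'a" where
  "me V = tens_lift M ra' R' (fobj F V) (MV V) (\<lambda>m p. mv V m (\<epsilon> V p))"

lemma me_facts: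
  assumes V: "V \<in> proj R"
  shows me_closed: "\<And>z. z \<in> carrier (MT (fobj F V)) \<Longrightarrow> me V z \<in> carrier (MV V)"
    and me_add: "\<And>y z. \<lbrakk>y \<in> carrier (MT (fobj F V)); z \<in> carrier (MT (fobj F V))\<rbrakk> \<Longrightarrow>
      me V (y \<oplus>\<^bsub>MT (fobj F V)\<^esub> z) = me V y \<oplus>\<^bsub>MV V\<^esub> me V z"
    and me_mt: "\<And>m p. \<lbrakk>m \<in> carrier M; p \<in> carrier (fobj F V)\<rbrakk> \<Longrightarrow> me V (mt (fobj F V) m p) = mv V m (\<epsilon> V p)"
    and me_onto: "\<And>t. t \<in> carrier (MV V) \<Longrightarrow> \<exists>z\<in>carrier (MT (fobj F V)). t = me V z"
proof -
  interpret T: tensor_data R M ra R V by (rule MV_data[OF proj_module[OF V]])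
  interpret TF: tensor_data R M ra' R' "fobj F V" by (rule MT_data[OF F_mod[OF V]])
  interpret TFM: module R "MT (fobj F V)" by (rule TF.T_module)
  have bal: "TF.balanced (MV V) (\<lambda>m p. mv V m (\<epsilon> V p))"
    by (rule TF.balancedI)
       (use T.T_group \<epsilon>_closed[OF V] mod_hom_add[OF \<epsilon>_hom[OF V]] \<epsilon>_smult[OF V] in
         \<open>auto simp: T.t_add_l T.t_add_r T.t_bal\<close>)
  show cl: "\<And>z. z \<in> carrier (MT (fobj F V)) \<Longrightarrow> me V z \<in> carrier (MV V)"
    and ad: "\<And>y z. \<lbrakk>y \<in> carrier (MT (fobj F V)); z \<in> carrier (MT (fobj F V))\<rbrakk> \<Longrightarrow>
      me V (y \<oplus>\<^bsub>MT (fobj F V)\<^esub> z) = me V y \<oplus>\<^bsub>MV V\<^esub> me V z"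
    and mt: "\<And>m p. \<lbrakk>m \<in> carrier M; p \<in> carrier (fobj F V)\<rbrakk> \<Longrightarrow> me V (mt (fobj F V) m p) = mv V m (\<epsilon> V p)"
    using TF.lift_facts[OF bal] by (auto simp: me_def)
  show "\<exists>z\<in>carrier (MT (fobj F V)). t = me V z" if "t \<in> carrier (MV V)" for t
    using that
  proof (induction rule: T.tensor_induct)
    case (pure m v)
    then show ?case using pre[OF V, of v] mt[of m "pre V v"] TF.t_closed[of m "pre V v"] by metis
  next
    case (add x y)
    then show ?case using ad by (metis TFM.a_closed)
  qed
qed

text \<open>Both sides are additive and send \<open>m \<otimes> p\<close> to the class of
  \<open>i m\<close> times \<open>p\<close>. With \<open>me\<close> onto, this describes
  \<open>\<beta>\<close> completely: lift a tensor to \<open>M \<otimes> F V\<close>, multiply out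
  in \<open>F V\<close>, and take the class in degree 1.\<close>

lemma \<beta>_me:
  assumes V: "V \<in> proj R" and z: "z \<in> carrier (MT (fobj F V))"
  shows "j (fobj F V) z \<in> lay 1 V \<and> \<beta> V (me V z) = ot (L 1 V) (j (fobj F V) z)"
proof -
  interpret TF: tensor_data R M ra' R' "fobj F V" by (rule MT_data[OF F_mod[OF V]])
  note Fm = F_mod[OF V] and Lm = L_mod[OF V, of 1]
  show ?thesis using z
  proof (induction rule: TF.tensor_induct)
    case (pure m p)
    then show ?case by (simp add: j_pure[OF Fm Fm] me_mt[OF V] \<beta>_mv[OF V] ip_lay[OF V])
  next
    case (add x y)
    then show ?case
      using submodD(3)[OF lay_submod[OF V]] ot_add[OF Lm, of "j (fobj F V) x" "j (fobj F V) y"]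
      by (simp add: j_add[OF Fm Fm] me_add[OF V] mod_hom_add[OF \<beta>_hom[OF V]] me_closed[OF V])
  qed
qed

lemma ein_hom: "V \<in> proj R \<Longrightarrow> ein ext n V \<in> mod_hom R (val (stalk 1 (bimod_fctr R M ra)) n V) (TT (L n V))"
proof (cases "n = 1")
  case True
  assume "V \<in> proj R"
  then show ?thesis using \<beta>_hom True by (simp add: ext_def stalk_ob)
next
  case False
  assume V: "V \<in> proj R"
  show ?thesis
    using False zero_map_mod_hom[OF zero_md_module[OF R_cring] TT_module[OF L_mod[OF V]]]
    by (simp add: ext_def stalk_ob)
qed

lemma ein_nonzero: "n \<noteq> 1 \<Longrightarrow> ein ext n V \<zero>\<^bsub>zero_md\<^esub> = \<zero>\<^bsub>TT (L n V)\<^esub>"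
  by (simp add: ext_def stalk_ob)

lemma \<beta>_arr:
  assumes VW: "V \<in> proj R" "W \<in> proj R" "f \<in> mod_hom R V W" and t: "t \<in> carrier (MV V)"
  shows "\<beta> W (farr (bimod_fctr R M ra) V W f t) = farr (ob C 1) V W f (\<beta> V t)"
proof -
  interpret T: tensor_data R M ra R V by (rule MV_data[OF proj_module[OF VW(1)]])
  have ah: "farr (bimod_fctr R M ra) V W f \<in> mod_hom R (MV V) (MV W)"
    using functor_arr[OF bimod_functor VW] by simp
  have ch: "farr (ob C 1) V W f \<in> mod_hom R (TT (L 1 V)) (TT (L 1 W))"
    using functor_arr[OF C_functor[of 1] VW] by simp
  show ?thesis
  proof (rule T.hom_eqI[OF _ _ _ t, of _ "add (TT (L 1 W))" "\<lambda>t. farr (ob C 1) V W f (\<beta> V t)"])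
    fix m v assume m: "m \<in> carrier M" and v: "v \<in> carrier V"
    define p where "p = pre V v"
    have p: "p \<in> carrier (fobj F V)" "v = \<epsilon> V p" using pre[OF VW(1) v] by (auto simp: p_def)
    interpret F: module R' "fobj F V" by (rule F_mod[OF VW(1)])
    have "\<beta> W (mv W m (f v)) = ot (L 1 W) (i m \<odot>\<^bsub>fobj F W\<^esub> farr F V W f p)"
      using \<beta>_mv[OF VW(2) m, of "farr F V W f p"] arr_closed[OF F VW p(1)] \<epsilon>_arr[OF VW p(1)] p by simp
    then show "\<beta> W (farr (bimod_fctr R M ra) V W f (mv V m v)) = farr (ob C 1) V W f (\<beta> V (mv V m v))"
      using bimod_arr[OF VW m v] C_arr[OF VW ip_lay[OF VW(1) m p(1)]] \<beta>_mv[OF VW(1) m p(1)] p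
        mod_hom_smult[OF functor_arr[OF F VW] i_closed[OF m] p(1)] by simp
  qed (use mod_hom_add[OF ah] mod_hom_closed[OF ah] mod_hom_add[OF ch] mod_hom_add[OF \<beta>_hom[OF VW(1)]]
        mod_hom_add[OF \<beta>_hom[OF VW(2)]] mod_hom_closed[OF \<beta>_hom[OF VW(1)]] in auto)
qed

text \<open>The values of \<open>\<beta>\<close> are represented by elements of
  \<open>I (fobj F V)\<close>, and these vanish in the base change of \<open>F V\<close>, although
  in general not in that of the kernel.\<close>

lemma dif_\<beta>:
  assumes V: "V \<in> proj R" and t: "t \<in> carrier (MV V)"
  shows "dif C 1 V (\<beta> V t) = \<zero>\<^bsub>TT (fobj F V)\<^esub>"
proof -
  obtain z where z: "z \<in> carrier (MT (fobj F V))" "t = me V z" using me_onto[OF V t] by blast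
  have "j (fobj F V) z \<in> I (fobj F V)" using z by (simp add: I_def)
  then have "ot (fobj F V) (j (fobj F V) z) = \<zero>\<^bsub>TT (fobj F V)\<^esub>"
    using ot_zero_iff[OF F_mod[OF V]] j_closed[OF F_mod[OF V] F_mod[OF V] z(1)] by simp
  then show ?thesis using \<beta>_me[OF V z(1)] C_dif[OF V, of "j (fobj F V) z" 1] z by simp
qed

lemma ein_chain: "ein ext \<in> chain_maps R R (stalk 1 (bimod_fctr R M ra)) C"
proof (rule chain_mapsI)
  fix n
  show "ein ext n \<in> nat_trans R R (ob (stalk 1 (bimod_fctr R M ra)) n) (ob C n)"
  proof (rule nat_transI)
    fix V W f x assume VW: "V \<in> proj R" "W \<in> proj R" "f \<in> mod_hom R V W" and x: "x \<in> carrier (val (stalk 1 (bimod_fctr R M ra)) n V)"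
    show "ein ext n W (farr (ob (stalk 1 (bimod_fctr R M ra)) n) V W f x) = farr (ob C n) V W f (ein ext n V x)"
    proof (cases "n = 1")
      case True
      then show ?thesis using \<beta>_arr[OF VW] x by (simp add: stalk_ob ext_def)
    next
      case False
      then have x: "x = \<zero>\<^bsub>zero_md\<^esub>" using x by (simp add: stalk_ob)
      have "farr zero_fctr V W f \<zero>\<^bsub>zero_md\<^esub> = \<zero>\<^bsub>zero_md\<^esub>" by (simp add: zero_fctr_def)
      moreover have "farr (ob C n) V W f \<zero>\<^bsub>TT (L n V)\<^esub> = \<zero>\<^bsub>TT (L n W)\<^esub>"
        using arr_zero[OF C_functor[of n] VW] by simp
      ultimately show ?thesis using x False by (simp add: stalk_ob ein_nonzero)
    qed
  qed (use ein_hom in simp)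
  fix V x assume V: "V \<in> proj R" and x: "x \<in> carrier (val (stalk 1 (bimod_fctr R M ra)) n V)"
  have r: "ein ext (n - 1) V (dif (stalk 1 (bimod_fctr R M ra)) n V x) = \<zero>\<^bsub>TT (L (n - 1) V)\<^esub>"
    using mod_hom_zero[OF ein_hom[OF V] functor_module[OF complex_functor[OF stalk_complex[OF bimod_functor R_cring]] V] TT_module[OF L_mod[OF V]]] x
    by (simp add: stalk_dif)
  show "dif C n V (ein ext n V x) = ein ext (n - 1) V (dif (stalk 1 (bimod_fctr R M ra)) n V x)"
  proof (cases "n = 1")
    case True
    then have t: "x \<in> carrier (MV V)" "ein ext n V x = \<beta> V x" using x by (auto simp: stalk_ob ext_def)
    then show ?thesis using dif_\<beta>[OF V t(1)] r True by simp
  next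
    case False
    then have x: "x = \<zero>\<^bsub>zero_md\<^esub>" using x by (simp add: stalk_ob)
    then show ?thesis using r False mod_hom_zero[OF C_dif_hom[OF V] TT_module[OF L_mod[OF V]] TT_module[OF L_mod[OF V]]]
      by (simp add: ein_nonzero)
  qed
qed

text \<open>In degree 0 the kernel of the augmentation is the image of degree 1 by the choice of
  layers. In degree 1 a cycle has a representative in \<open>I (fobj F V)\<close>, hence of the form
  \<open>j z\<close>, and it is the value of \<open>\<beta>\<close> at
  \<open>me V z\<close>.\<close>

lemma C_exact:
  assumes V: "V \<in> proj R" and c: "c \<in> carrier (TT (L n V))"
    and a: "aug n V c = \<zero>\<^bsub>val (stalk 0 incl_fctr) n V\<^esub>"
    and d: "dif C n V c \<in> ein ext (n - 1) V ` carrier (val (stalk 1 (bimod_fctr R M ra)) (n - 1) V)"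
  shows "\<exists>y\<in>carrier (TT (L (n + 1) V)). \<exists>z\<in>carrier (val (stalk 1 (bimod_fctr R M ra)) n V).
     aug (n + 1) V y = \<zero>\<^bsub>val (stalk 0 incl_fctr) (n + 1) V\<^esub> \<and>
     c = dif C (n + 1) V y \<oplus>\<^bsub>TT (L n V)\<^esub> ein ext n V z"
proof -
  interpret T: module R "TT (L n V)" by (rule TT_module[OF L_mod[OF V]])
  interpret T1: module R "TT (L (n + 1) V)" by (rule TT_module[OF L_mod[OF V]])
  obtain k where k: "k \<in> lay n V" "c = ot (L n V) k" using C_onto[OF V c] by blast
  have dz: "dif C (n + 1) V \<zero>\<^bsub>TT (L (n + 1) V)\<^esub> = \<zero>\<^bsub>TT (L n V)\<^esub>"
    using mod_hom_zero[OF C_dif_hom[OF V, of "n + 1"] TT_module[OF L_mod[OF V]] TT_module[OF L_mod[OF V]]] by simp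
  have az: "aug (n + 1) V \<zero>\<^bsub>TT (L (n + 1) V)\<^esub> = \<zero>\<^bsub>val (stalk 0 incl_fctr) (n + 1) V\<^esub>"
    using mod_hom_zero[OF aug_hom[OF V] TT_module[OF L_mod[OF V]]
      functor_module[OF complex_functor[OF stalk_complex[OF incl_fctr_functor R_cring]] V]] .
  consider "n = 0" | "n = 1" | "n \<noteq> 0" "n \<noteq> 1" by blast
  then show ?thesis
  proof cases
    case 1
    then have "\<epsilon> V k = \<zero>\<^bsub>V\<^esub>" using a k aug_ot[OF V] by (simp add: stalk_ob)
    then have k1: "k \<in> lay 1 V" using k 1 by (simp add: lay_def)
    then have y: "ot (L 1 V) k \<in> carrier (TT (L 1 V))" using L_mod[OF V] by simp
    have "c = dif C (n + 1) V (ot (L (n + 1) V) k) \<oplus>\<^bsub>TT (L n V)\<^esub> ein ext n V \<zero>\<^bsub>zero_md\<^esub>"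
      using C_dif[OF V k1] k 1 T.r_zero[OF c] by (simp add: ein_nonzero)
    then show ?thesis using y 1 aug_nonzero[OF V, of 1] by (auto simp: stalk_ob)
  next
    case 2
    \<comment> \<open>The functor \<open>B[1]\<close> vanishes in degree 0, so the hypothesis on the
      differential says that \<open>c\<close> is a genuine cycle.\<close>
    have "ein ext 0 V ` carrier (val (stalk 1 (bimod_fctr R M ra)) 0 V) = {\<zero>\<^bsub>TT (fobj F V)\<^esub>}"
      using ein_nonzero[of 0 V] by (simp add: stalk_ob)
    then have "ot (fobj F V) k = \<zero>\<^bsub>TT (fobj F V)\<^esub>" using d k C_dif[OF V k(1)] 2 by simp
    then have "k \<in> I (fobj F V)" using ot_zero_iff[OF F_mod[OF V] lay_sub[OF V k(1)]] by simp
    then obtain z where z: "z \<in> carrier (MT (fobj F V))" "k = j (fobj F V) z" by (auto simp: I_def)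
    have "c = \<beta> V (me V z)" using \<beta>_me[OF V z(1)] z k 2 by simp
    then have "c = dif C (n + 1) V \<zero>\<^bsub>TT (L (n + 1) V)\<^esub> \<oplus>\<^bsub>TT (L n V)\<^esub> ein ext n V (me V z)"
      using dz 2 T.l_zero[OF c] by (simp add: ext_def)
    then show ?thesis using az me_closed[OF V z(1)] 2 T1.zero_closed
      by (intro bexI[of _ "\<zero>\<^bsub>TT (L (n + 1) V)\<^esub>"] bexI[of _ "me V z"]) (auto simp: stalk_ob)
  next
    case 3
    then have "c = \<zero>\<^bsub>TT (L n V)\<^esub>" using C_zero[OF V] c by blast
    then have "c = dif C (n + 1) V \<zero>\<^bsub>TT (L (n + 1) V)\<^esub> \<oplus>\<^bsub>TT (L n V)\<^esub> ein ext n V \<zero>\<^bsub>zero_md\<^esub>"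
      using dz 3 by (simp add: ein_nonzero)
    then show ?thesis using az 3 T1.zero_closed
      by (intro bexI[of _ "\<zero>\<^bsub>TT (L (n + 1) V)\<^esub>"] bexI[of _ "\<zero>\<^bsub>zero_md\<^esub>"]) (auto simp: stalk_ob)
  qed
qed

text \<open>Every condition except injectivity holds for an arbitrary cover; injectivity of
  \<open>\<beta>\<close> is a flatness condition and is supplied separately for each cover.\<close>

lemma ext_elem:
  assumes inj: "\<And>V. V \<in> proj R \<Longrightarrow> inj_on (\<beta> V) (carrier (MV V))"
  shows "ext \<in> elem_exts R M ra"
proof -
  have s: "emid ext = C" "epr ext = aug" by (simp_all add: ext_def)
  have "quasiexact R R (stalk 1 (bimod_fctr R M ra)) C (stalk 0 incl_fctr) (ein ext) aug"
    unfolding quasiexact_def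
  proof (intro conjI allI ballI impI)
    show "stalk 1 (bimod_fctr R M ra) \<in> complexes R R" by (rule stalk_complex[OF bimod_functor R_cring])
    show "stalk 0 incl_fctr \<in> complexes R R" by (rule stalk_complex[OF incl_fctr_functor R_cring])
    fix n V assume V: "V \<in> proj R"
    interpret T: module R "TT (L n V)" by (rule TT_module[OF L_mod[OF V]])
    { fix x assume x: "x \<in> carrier (val (stalk 1 (bimod_fctr R M ra)) n V)"
      show "aug n V (ein ext n V x) = \<zero>\<^bsub>val (stalk 0 incl_fctr) n V\<^esub>"
      proof (cases "n = 1")
        case True
        then show ?thesis using aug_nonzero[OF V, of n "ein ext n V x"] mod_hom_closed[OF ein_hom[OF V] x]
          by (simp add: stalk_ob)
      next
        case False
        then have "ein ext n V x = \<zero>\<^bsub>TT (L n V)\<^esub>" using x ein_nonzero by (simp add: stalk_ob)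
        then show ?thesis using mod_hom_zero[OF aug_hom[OF V] TT_module[OF L_mod[OF V]]
          functor_module[OF complex_functor[OF stalk_complex[OF incl_fctr_functor R_cring]] V]] by simp
      qed }
    show "inj_on (ein ext n V) (carrier (val (stalk 1 (bimod_fctr R M ra)) n V))"
      using inj[OF V] by (simp add: stalk_ob ext_def)
    show "aug n V ` carrier (val C n V) = carrier (val (stalk 0 incl_fctr) n V)"
    proof (cases "n = 0")
      case True
      have "v \<in> aug 0 V ` carrier (TT (fobj F V))" if "v \<in> carrier V" for v
        using pre[OF V that] aug_ot[OF V, of "pre V v"] F_mod[OF V]
        by (intro image_eqI[of _ _ "ot (fobj F V) (pre V v)"]) auto
      then show ?thesis using True mod_hom_closed[OF aug_hom[OF V, of 0]] by (auto simp: stalk_ob)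
    next
      case False
      then show ?thesis using aug_nonzero[OF V False] T.zero_closed
        by (auto simp: stalk_ob image_iff)
    qed
    fix x assume "x \<in> carrier (val C n V)" "aug n V x = \<zero>\<^bsub>val (stalk 0 incl_fctr) n V\<^esub>"
      "dif C n V x \<in> ein ext (n - 1) V ` carrier (val (stalk 1 (bimod_fctr R M ra)) (n - 1) V)"
    then show "\<exists>y\<in>carrier (val C (n + 1) V). \<exists>z\<in>carrier (val (stalk 1 (bimod_fctr R M ra)) n V).
       aug (n + 1) V y = \<zero>\<^bsub>val (stalk 0 incl_fctr) (n + 1) V\<^esub> \<and>
       x = dif C (n + 1) V y \<oplus>\<^bsub>val C n V\<^esub> ein ext n V z"
      using C_exact[OF V, of x n] by simp
  qed (use C_complex ein_chain aug_chain in auto)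
  then show ?thesis using C_zero
    by (auto simp: elem_exts_def elem_exts_of_def s zero_in_degree_def)
qed

end

section \<open>The elementary extension of a projective resolution\<close>

text \<open>A morphism of covers. It induces a map of the kernels and so of the two-term complexes,
  which is how a resolution is compared with \<open>Q\<close>.\<close>

locale cover_map =
  F: cover R R' M ra i q F \<epsilon> + G: cover R R' M ra i q G \<delta>
  for R R' :: "('a :: infinite) ring" and M ra i q F \<epsilon> G \<delta> +
  fixes f :: "'a ntrans"
  assumes f: "f \<in> nat_trans R R' F G"
    and f_over: "\<And>V x. \<lbrakk>V \<in> proj R; x \<in> carrier (fobj F V)\<rbrakk> \<Longrightarrow> \<delta> V (f V x) = \<epsilon> V x"
begin

definition fl :: "int \<Rightarrow> 'a md \<Rightarrow> 'a \<Rightarrow> 'a" where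
  "fl n V = restrict (f V) (F.lay n V)"

definition \<phi> :: "int \<Rightarrow> 'a ntrans" where
  "\<phi> n V = tens_right (self_md R) (base_act R q) R' (F.L n V) (G.L n V) (fl n V)"

lemma f_closed: "\<lbrakk>V \<in> proj R; x \<in> carrier (fobj F V)\<rbrakk> \<Longrightarrow> f V x \<in> carrier (fobj G V)"
  by (rule nat_closed[OF f])

lemma f_lay: "\<lbrakk>V \<in> proj R; x \<in> F.lay n V\<rbrakk> \<Longrightarrow> f V x \<in> G.lay n V"
  using f_closed f_over nat_zero[OF f F.F G.F] by (auto simp: F.lay_def G.lay_def split: if_splits)

lemma fl_hom: "V \<in> proj R \<Longrightarrow> fl n V \<in> mod_hom R' (F.L n V) (G.L n V)"
  unfolding fl_def
  by (rule mod_homI)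
     (use f_lay submodD[OF F.lay_submod] F.lay_sub in
       \<open>auto simp: mod_hom_add[OF nat_hom[OF f]] mod_hom_smult[OF nat_hom[OF f]]\<close>)

lemma \<phi>_hom: "V \<in> proj R \<Longrightarrow> \<phi> n V \<in> mod_hom R (F.TT (F.L n V)) (F.TT (G.L n V))"
  unfolding \<phi>_def by (rule F.tens_right_ot(1)[OF F.L_mod G.L_mod fl_hom])

lemma \<phi>_ot: "\<lbrakk>V \<in> proj R; x \<in> F.lay n V\<rbrakk> \<Longrightarrow> \<phi> n V (F.ot (F.L n V) x) = F.ot (G.L n V) (f V x)"
  using F.tens_right_ot(2)[OF F.L_mod G.L_mod fl_hom, of V x n] by (simp add: \<phi>_def fl_def)

text \<open>If \<open>p\<close> lies over \<open>v\<close> in \<open>F\<close>, then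
  \<open>f p\<close> lies over \<open>v\<close> in \<open>G\<close>, and \<open>f\<close> commutes
  with the scalar \<open>i m\<close>. Hence both sides agree on
  \<open>m \<otimes> v\<close>.\<close>

lemma \<phi>_\<beta>:
  assumes V: "V \<in> proj R" and t: "t \<in> carrier (F.MV V)"
  shows "\<phi> 1 V (F.\<beta> V t) = G.\<beta> V t"
proof -
  interpret T: tensor_data R M ra R V by (rule F.MV_data[OF proj_module[OF V]])
  note ph = \<phi>_hom[OF V, of 1] and Fh = F.\<beta>_hom[OF V] and Gh = G.\<beta>_hom[OF V]
  show ?thesis
  proof (rule T.hom_eqI[OF _ _ _ t, of _ "add (F.TT (G.L 1 V))" "\<lambda>t. G.\<beta> V t"])
    fix m v assume m: "m \<in> carrier M" and v: "v \<in> carrier V"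
    define p where "p = F.pre V v"
    have p: "p \<in> carrier (fobj F V)" "v = \<epsilon> V p" using F.pre[OF V v] by (auto simp: p_def)
    have "G.\<beta> V (F.mv V m v) = F.ot (G.L 1 V) (i m \<odot>\<^bsub>fobj G V\<^esub> f V p)"
      using G.\<beta>_mv[OF V m f_closed[OF V p(1)]] f_over[OF V p(1)] p by simp
    then show "\<phi> 1 V (F.\<beta> V (F.mv V m v)) = G.\<beta> V (F.mv V m v)"
      using F.\<beta>_mv[OF V m p(1)] \<phi>_ot[OF V F.ip_lay[OF V m p(1)]] p
        mod_hom_smult[OF nat_hom[OF f V] F.i_closed[OF m] p(1)] by simp
  qed (use mod_hom_add[OF ph] mod_hom_add[OF Fh] mod_hom_add[OF Gh] mod_hom_closed[OF Fh] in auto)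
qed

text \<open>By \<open>\<phi>_\<beta>\<close> the map of \<open>G\<close> factors through that of
  \<open>F\<close>, so injectivity passes from the target of a morphism of covers to its
  source.\<close>

lemma inj_\<beta>:
  assumes V: "V \<in> proj R" and "inj_on (G.\<beta> V) (carrier (F.MV V))"
  shows "inj_on (F.\<beta> V) (carrier (F.MV V))"
proof (rule inj_onI)
  fix x y assume xy: "x \<in> carrier (F.MV V)" "y \<in> carrier (F.MV V)" "F.\<beta> V x = F.\<beta> V y"
  then have "G.\<beta> V x = G.\<beta> V y" using \<phi>_\<beta>[OF V xy(1)] \<phi>_\<beta>[OF V xy(2)] by simp
  then show "x = y" using inj_onD[OF assms(2) _ xy(1,2)] by blast
qed

lemma ext_map: "\<phi> \<in> elext_maps R M ra F.ext G.ext"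
proof -
  have s: "emid F.ext = F.C" "emid G.ext = G.C" "epr F.ext = F.aug" "epr G.ext = G.aug"
    by (simp_all add: F.ext_def G.ext_def)
  have onto: "\<exists>y\<in>F.lay n V. x = F.ot (F.L n V) y" if "V \<in> proj R" "x \<in> carrier (val F.C n V)" for n V x
    using F.C_onto[OF that(1), of x n] that by simp
  have "\<phi> \<in> chain_maps R R F.C G.C"
  proof (rule chain_mapsI)
    fix n
    show "\<phi> n \<in> nat_trans R R (ob F.C n) (ob G.C n)"
    proof (rule nat_transI)
      fix V W h x assume VW: "V \<in> proj R" "W \<in> proj R" "h \<in> mod_hom R V W" and "x \<in> carrier (val F.C n V)"
      then obtain y where y: "y \<in> F.lay n V" "x = F.ot (F.L n V) y" using onto by blast
      show "\<phi> n W (farr (ob F.C n) V W h x) = farr (ob G.C n) V W h (\<phi> n V x)"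
        using F.C_arr[OF VW y(1)] G.C_arr[OF VW f_lay[OF VW(1) y(1)]] \<phi>_ot[OF VW(1) y(1)]
          \<phi>_ot[OF VW(2) F.lay_arr[OF VW y(1)]] nat_arr[OF f VW F.lay_sub[OF VW(1) y(1)]] y by simp
    qed (use \<phi>_hom in simp)
    fix V x assume V: "V \<in> proj R" and "x \<in> carrier (val F.C n V)"
    then obtain y where y: "y \<in> F.lay n V" "x = F.ot (F.L n V) y" using onto by blast
    show "dif G.C n V (\<phi> n V x) = \<phi> (n - 1) V (dif F.C n V x)"
      using y F.C_dif[OF V y(1)] G.C_dif[OF V f_lay[OF V y(1)]] \<phi>_ot[OF V y(1)] \<phi>_ot[OF V, of y 0] F.lay_sub[OF V y(1)]
        mod_hom_zero[OF \<phi>_hom[OF V] F.TT_module[OF F.L_mod[OF V]] F.TT_module[OF G.L_mod[OF V]]]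
      by simp
  qed
  moreover have "G.aug n V (\<phi> n V x) = F.aug n V x" if V: "V \<in> proj R" and "x \<in> carrier (val F.C n V)" for n V x
  proof -
    obtain y where y: "y \<in> F.lay n V" "x = F.ot (F.L n V) y" using onto \<open>x \<in> _\<close> V by blast
    show ?thesis
    proof (cases "n = 0")
      case True
      then show ?thesis using y \<phi>_ot[OF V y(1)] F.aug_ot[OF V] G.aug_ot[OF V f_closed[OF V]] f_over[OF V] by simp
    next
      case False
      then show ?thesis using G.aug_nonzero[OF V False mod_hom_closed[OF \<phi>_hom[OF V]]] F.aug_nonzero[OF V False] that(2) by simp
    qed
  qed
  moreover have "\<phi> n V (ein F.ext n V x) = ein G.ext n V x"
    if V: "V \<in> proj R" and x: "x \<in> carrier (val (stalk 1 (bimod_fctr R M ra)) n V)" for n V x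
  proof (cases "n = 1")
    case True
    then show ?thesis using \<phi>_\<beta>[OF V] x by (simp add: F.ext_def G.ext_def stalk_ob)
  next
    case False
    then show ?thesis using x F.ein_nonzero G.ein_nonzero
        mod_hom_zero[OF \<phi>_hom[OF V] F.TT_module[OF F.L_mod[OF V]] F.TT_module[OF G.L_mod[OF V]]] by (simp add: stalk_ob)
  qed
  ultimately show ?thesis by (simp add: elext_maps_def s)
qed

end

text \<open>The truncated base change of a resolution is isomorphic, but not equal, to the complex
  of the cover. Linearity and naturality of \<open>ein E\<close>, which is defined by a description,
  are not assumed: they hold for \<open>ein E'\<close> and are pulled back along the injective
  \<open>\<theta>\<close>. Exactness is pulled back in the same way.\<close>

lemma elem_exts_transport:
  assumes E': "E' \<in> elem_exts R M ra"
    and X: "emid E \<in> complexes R R" and \<theta>: "\<theta> \<in> chain_maps R R (emid E) (emid E')"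
    and bij: "\<And>n V. V \<in> proj R \<Longrightarrow> bij_betw (\<theta> n V) (carrier (val (emid E) n V)) (carrier (val (emid E') n V))"
    and pr: "\<And>n V x. \<lbrakk>V \<in> proj R; x \<in> carrier (val (emid E) n V)\<rbrakk> \<Longrightarrow> epr E n V x = epr E' n V (\<theta> n V x)"
    and pr_ext: "\<And>n V. V \<in> proj R \<Longrightarrow> epr E n V \<in> extensional (carrier (val (emid E) n V))"
    and inn: "\<And>n V x. \<lbrakk>V \<in> proj R; x \<in> carrier (val (stalk 1 (bimod_fctr R M ra)) n V)\<rbrakk> \<Longrightarrow>
      ein E n V x \<in> carrier (val (emid E) n V) \<and> \<theta> n V (ein E n V x) = ein E' n V x"
    and in_ext: "\<And>n V. V \<in> proj R \<Longrightarrow> ein E n V \<in> extensional (carrier (val (stalk 1 (bimod_fctr R M ra)) n V))"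
  shows "E \<in> elem_exts R M ra" and "\<theta> \<in> elext_maps R M ra E E'"
proof -
  let ?B = "stalk 1 (bimod_fctr R M ra)" and ?A = "stalk 0 incl_fctr"
  have qe: "quasiexact R R ?B (emid E') ?A (ein E') (epr E')"
    and z': "\<And>n. n \<noteq> 0 \<Longrightarrow> n \<noteq> 1 \<Longrightarrow> zero_in_degree R (emid E') n"
    using E' by (auto simp: elem_exts_def elem_exts_of_def)
  then have B: "?B \<in> complexes R R" and X': "emid E' \<in> complexes R R" and A: "?A \<in> complexes R R"
    and b: "ein E' \<in> chain_maps R R ?B (emid E')" and a: "epr E' \<in> chain_maps R R (emid E') ?A"
    by (simp_all add: quasiexact_def)
  have th: "\<theta> n \<in> nat_trans R R (ob (emid E) n) (ob (emid E') n)" for n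
    using \<theta> by (simp add: chain_maps_def)
  have td: "dif (emid E') n V (\<theta> n V x) = \<theta> (n - 1) V (dif (emid E) n V x)"
    if "V \<in> proj R" "x \<in> carrier (val (emid E) n V)" for n V x
    using \<theta> that by (simp add: chain_maps_def)
  have bh: "ein E' n \<in> nat_trans R R (ob ?B n) (ob (emid E') n)" for n using b by (simp add: chain_maps_def)
  have ah: "epr E' n \<in> nat_trans R R (ob (emid E') n) (ob ?A n)" for n using a by (simp add: chain_maps_def)
  note Xf = complex_functor[OF X] and Bf = complex_functor[OF B]
  note tc = nat_closed[OF th] and ta = mod_hom_add[OF nat_hom[OF th]] and ts = mod_hom_smult[OF nat_hom[OF th]]
  have inj: "x = y" if "V \<in> proj R" "x \<in> carrier (val (emid E) n V)" "y \<in> carrier (val (emid E) n V)" "\<theta> n V x = \<theta> n V y" for n V x y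
    using bij_betw_imp_inj_on[OF bij[OF that(1)]] that by (auto dest: inj_onD)
  have xd: "dif (emid E) n V x \<in> carrier (val (emid E) (n - 1) V)" if "V \<in> proj R" "x \<in> carrier (val (emid E) n V)" for n V x
    by (rule nat_closed[OF complex_dif[OF X] that])
  have bc: "ein E n V x \<in> carrier (val (emid E) n V)" if "V \<in> proj R" "x \<in> carrier (val ?B n V)" for n V x
    using inn that by blast
  have tb: "\<theta> n V (ein E n V x) = ein E' n V x" if "V \<in> proj R" "x \<in> carrier (val ?B n V)" for n V x
    using inn that by blast
  have a1: "epr E \<in> chain_maps R R (emid E) ?A"
  proof (rule chain_mapsI)
    fix n
    show "epr E n \<in> nat_trans R R (ob (emid E) n) (ob ?A n)"
    proof (rule nat_transI)
      fix V assume V: "V \<in> proj R"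
      interpret m: module R "val (emid E) n V" by (rule functor_module[OF Xf V])
      show "epr E n V \<in> mod_hom R (val (emid E) n V) (val ?A n V)"
        by (rule mod_homI)
           (use V pr pr_ext tc ta ts nat_closed[OF ah] mod_hom_add[OF nat_hom[OF ah]] mod_hom_smult[OF nat_hom[OF ah]] in auto)
    next
      fix V W f x assume VW: "V \<in> proj R" "W \<in> proj R" "f \<in> mod_hom R V W" and x: "x \<in> carrier (val (emid E) n V)"
      then show "epr E n W (farr (ob (emid E) n) V W f x) = farr (ob ?A n) V W f (epr E n V x)"
        using pr arr_closed[OF Xf VW x] nat_arr[OF th VW x] nat_arr[OF ah VW tc[OF VW(1) x]] by simp
    qed
    fix V x assume V: "V \<in> proj R" and x: "x \<in> carrier (val (emid E) n V)"
    have "dif ?A n V (epr E' n V (\<theta> n V x)) = epr E' (n - 1) V (dif (emid E') n V (\<theta> n V x))"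
      using a tc[OF V x] V by (simp add: chain_maps_def)
    then show "dif ?A n V (epr E n V x) = epr E (n - 1) V (dif (emid E) n V x)"
      using pr[OF V x] pr[OF V xd[OF V x]] td[OF V x] by simp
  qed
  have b1: "ein E \<in> chain_maps R R ?B (emid E)"
  proof (rule chain_mapsI)
    fix n
    show "ein E n \<in> nat_trans R R (ob ?B n) (ob (emid E) n)"
    proof (rule nat_transI)
      fix V assume V: "V \<in> proj R"
      interpret m: module R "val (emid E) n V" by (rule functor_module[OF Xf V])
      interpret B: module R "val ?B n V" by (rule functor_module[OF Bf V])
      show "ein E n V \<in> mod_hom R (val ?B n V) (val (emid E) n V)"
      proof (rule mod_homI)
        fix x y assume x: "x \<in> carrier (val ?B n V)" and y: "y \<in> carrier (val ?B n V)"
        show "ein E n V (x \<oplus>\<^bsub>val ?B n V\<^esub> y) = ein E n V x \<oplus>\<^bsub>val (emid E) n V\<^esub> ein E n V y"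
          using tb[OF V x] tb[OF V y] tb[OF V B.a_closed[OF x y]] ta[OF V bc[OF V x] bc[OF V y]]
            mod_hom_add[OF nat_hom[OF bh V] x y]
          by (intro inj[OF V bc[OF V B.a_closed[OF x y]] m.a_closed[OF bc[OF V x] bc[OF V y]]]) simp
      next
        fix r x assume r: "r \<in> carrier R" and x: "x \<in> carrier (val ?B n V)"
        show "ein E n V (r \<odot>\<^bsub>val ?B n V\<^esub> x) = r \<odot>\<^bsub>val (emid E) n V\<^esub> ein E n V x"
          using tb[OF V x] tb[OF V B.smult_closed[OF r x]] ts[OF V r bc[OF V x]]
            mod_hom_smult[OF nat_hom[OF bh V] r x]
          by (intro inj[OF V bc[OF V B.smult_closed[OF r x]] m.smult_closed[OF r bc[OF V x]]]) simp
      qed (use bc[OF V] in_ext[OF V] in auto)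
    next
      fix V W f x assume VW: "V \<in> proj R" "W \<in> proj R" "f \<in> mod_hom R V W" and x: "x \<in> carrier (val ?B n V)"
      note fx = arr_closed[OF Bf VW x]
      show "ein E n W (farr (ob ?B n) V W f x) = farr (ob (emid E) n) V W f (ein E n V x)"
      proof (rule inj[OF VW(2)])
        show "\<theta> n W (ein E n W (farr (ob ?B n) V W f x)) = \<theta> n W (farr (ob (emid E) n) V W f (ein E n V x))"
          using tb[OF VW(1) x] tb[OF VW(2) fx] nat_arr[OF th VW bc[OF VW(1) x]] nat_arr[OF bh VW x] by simp
      qed (use bc[OF VW(2) fx] arr_closed[OF Xf VW bc[OF VW(1) x]] in auto)
    qed
    fix V x assume V: "V \<in> proj R" and x: "x \<in> carrier (val ?B n V)"
    have dx: "dif ?B n V x \<in> carrier (val ?B (n - 1) V)" by (rule nat_closed[OF complex_dif[OF B] V x])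
    have "dif (emid E') n V (ein E' n V x) = ein E' (n - 1) V (dif ?B n V x)"
      using b V x by (simp add: chain_maps_def)
    then show "dif (emid E) n V (ein E n V x) = ein E (n - 1) V (dif ?B n V x)"
      using td[OF V bc[OF V x]] tb[OF V x] tb[OF V dx]
      by (intro inj[OF V xd[OF V bc[OF V x]] bc[OF V dx]]) simp
  qed
  have "quasiexact R R ?B (emid E) ?A (ein E) (epr E)"
    unfolding quasiexact_def
  proof (intro conjI allI ballI impI)
    fix n V assume V: "V \<in> proj R"
    have qV: "(\<forall>x\<in>carrier (val ?B n V). epr E' n V (ein E' n V x) = \<zero>\<^bsub>val ?A n V\<^esub>)"
      "inj_on (ein E' n V) (carrier (val ?B n V))"
      "epr E' n V ` carrier (val (emid E') n V) = carrier (val ?A n V)"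
      using qe V by (simp_all add: quasiexact_def)
    show "epr E n V (ein E n V x) = \<zero>\<^bsub>val ?A n V\<^esub>" if "x \<in> carrier (val ?B n V)" for x
      using that qV(1) pr[OF V bc[OF V that]] tb[OF V that] by simp
    show "inj_on (ein E n V) (carrier (val ?B n V))"
    proof (rule inj_onI)
      fix x y assume xy: "x \<in> carrier (val ?B n V)" "y \<in> carrier (val ?B n V)" "ein E n V x = ein E n V y"
      then have "ein E' n V x = ein E' n V y" using tb[OF V xy(1)] tb[OF V xy(2)] by simp
      then show "x = y" using inj_onD[OF qV(2) _ xy(1,2)] by blast
    qed
    have "epr E n V ` carrier (val (emid E) n V) = epr E' n V ` (\<theta> n V ` carrier (val (emid E) n V))"
      using pr[OF V] by (simp add: image_image)
    then show "epr E n V ` carrier (val (emid E) n V) = carrier (val ?A n V)"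
      using qV(3) bij_betw_imp_surj_on[OF bij[OF V]] by simp
    fix x assume x: "x \<in> carrier (val (emid E) n V)" and e: "epr E n V x = \<zero>\<^bsub>val ?A n V\<^esub>"
      and "dif (emid E) n V x \<in> ein E (n - 1) V ` carrier (val ?B (n - 1) V)"
    then obtain w where w: "w \<in> carrier (val ?B (n - 1) V)" "dif (emid E) n V x = ein E (n - 1) V w" by blast
    have "dif (emid E') n V (\<theta> n V x) = ein E' (n - 1) V w" using td[OF V x] w tb[OF V w(1)] by simp
    moreover have "epr E' n V (\<theta> n V x) = \<zero>\<^bsub>val ?A n V\<^esub>" using e pr[OF V x] by simp
    ultimately obtain y z where yz: "y \<in> carrier (val (emid E') (n + 1) V)" "z \<in> carrier (val ?B n V)"
      "epr E' (n + 1) V y = \<zero>\<^bsub>val ?A (n + 1) V\<^esub>" "\<theta> n V x = dif (emid E') (n + 1) V y \<oplus>\<^bsub>val (emid E') n V\<^esub> ein E' n V z"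
      using qe V tc[OF V x] w(1) unfolding quasiexact_def by blast
    obtain y' where y': "y' \<in> carrier (val (emid E) (n + 1) V)" "\<theta> (n + 1) V y' = y"
      using bij_betw_imp_surj_on[OF bij[OF V, of "n + 1"]] yz(1) by (metis imageE)
    interpret m: module R "val (emid E) n V" by (rule functor_module[OF Xf V])
    have dy: "dif (emid E) (n + 1) V y' \<in> carrier (val (emid E) n V)" using xd[OF V y'(1)] by simp
    have "x = dif (emid E) (n + 1) V y' \<oplus>\<^bsub>val (emid E) n V\<^esub> ein E n V z"
      using td[OF V y'(1)] y'(2) yz(4) tb[OF V yz(2)] ta[OF V dy bc[OF V yz(2)]]
      by (intro inj[OF V x m.a_closed[OF dy bc[OF V yz(2)]]]) simp
    then show "\<exists>y\<in>carrier (val (emid E) (n + 1) V). \<exists>z\<in>carrier (val ?B n V).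
         epr E (n + 1) V y = \<zero>\<^bsub>val ?A (n + 1) V\<^esub> \<and> x = dif (emid E) (n + 1) V y \<oplus>\<^bsub>val (emid E) n V\<^esub> ein E n V z"
      using y' yz pr[OF V y'(1)] by auto
  qed (use A B X a1 b1 in auto)
  moreover have "zero_in_degree R (emid E) n" if n: "n \<noteq> 0" "n \<noteq> 1" for n
    unfolding zero_in_degree_def
  proof
    fix V assume V: "V \<in> proj R"
    interpret m: module R "val (emid E) n V" by (rule functor_module[OF Xf V])
    have z: "carrier (val (emid E') n V) = {\<zero>\<^bsub>val (emid E') n V\<^esub>}" using z'[OF n] V by (simp add: zero_in_degree_def)
    have "x = \<zero>\<^bsub>val (emid E) n V\<^esub>" if "x \<in> carrier (val (emid E) n V)" for x
      using inj[OF V that m.zero_closed] tc[OF V that] tc[OF V m.zero_closed] unfolding z by simp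
    then show "carrier (val (emid E) n V) = {\<zero>\<^bsub>val (emid E) n V\<^esub>}" using m.zero_closed by blast
  qed
  ultimately show "E \<in> elem_exts R M ra" by (simp add: elem_exts_def elem_exts_of_def)
  show "\<theta> \<in> elext_maps R M ra E E'" using \<theta> pr tb by (simp add: elext_maps_def)
qed

section \<open>The canonical truncation to degrees 0 and 1\<close>

lemma trunc01_ob: "ob (trunc01 X) n = (if n = 0 then kernel_fctr (ob X 0) (ob X (-1)) (dif X 0)
    else if n = 1 then coker_fctr (ob X 2) (ob X 1) (dif X 2) else zero_fctr)"
  by (simp add: trunc01_def Let_def)

lemma trunc01_dif: "n \<noteq> 1 \<Longrightarrow> dif (trunc01 X) n V = zero_map (val (trunc01 X) n V) (val (trunc01 X) (n - 1) V)"
  by (auto simp: trunc01_def Let_def)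

text \<open>On the cokernel in degree 1 the differential is defined through representatives. It is
  independent of them because the original differential vanishes on boundaries, and it lands in the
  cycles of degree 0 because its square is zero.\<close>

lemma trunc01_facts:
  assumes X: "X \<in> complexes R S" and S: "cring S"
  shows trunc01_cls: "\<And>V x. \<lbrakk>V \<in> proj R; x \<in> carrier (val X 1 V)\<rbrakk> \<Longrightarrow>
      dif (trunc01 X) 1 V (quot_cls (val X 1 V) (bnd X 1 V) x) = dif X 1 V x"
    and trunc01_complex: "trunc01 X \<in> complexes R S"
proof -
  note F = complex_functor[OF X] and d = complex_dif[OF X]
  have d0: "dif X 0 \<in> nat_trans R S (ob X 0) (ob X (-1))" using d[of 0] by simp
  have d1: "dif X 1 \<in> nat_trans R S (ob X 1) (ob X 0)" using d[of 1] by simp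
  have d2: "dif X 2 \<in> nat_trans R S (ob X 2) (ob X 1)" using d[of 2] by simp
  have dd0: "dif X 0 V (dif X 1 V x) = \<zero>\<^bsub>val X (-1) V\<^esub>" if "V \<in> proj R" "x \<in> carrier (val X 1 V)" for V x
    using complex_dd[OF X that] by simp
  have dd1: "dif X 1 V (dif X 2 V x) = \<zero>\<^bsub>val X 0 V\<^esub>" if "V \<in> proj R" "x \<in> carrier (val X 2 V)" for V x
    using complex_dd[OF X that] by simp
  have ob: "ob (trunc01 X) n \<in> functors R S" for n
    using kernel_fctr_functor[OF F F d0] coker_fctr_functor[OF F F d2] zero_fctr_functor[OF S] by (simp add: trunc01_ob)
  have b: "bnd X 1 V = dif X 2 V ` carrier (val X 2 V)" for V by (simp add: bnd_def)
  have sm: "submod S (val X 1 V) (bnd X 1 V)" if "V \<in> proj R" for V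
    unfolding b by (rule coker_submod[OF F F d2 that])
  note md = functor_module[OF F]
  let ?c = "\<lambda>V. quot_cls (val X 1 V) (bnd X 1 V)"
  have v1: "val (trunc01 X) 1 V = quot_md (val X 1 V) (bnd X 1 V)" for V by (simp add: trunc01_ob b)
  have v0: "val (trunc01 X) 0 V = (val X 0 V)\<lparr>carrier := {x \<in> carrier (val X 0 V). dif X 0 V x = \<zero>\<^bsub>val X (-1) V\<^esub>}\<rparr>" for V
    by (simp add: trunc01_ob kernel_fctr_sub)
  have de: "dif (trunc01 X) 1 V = (\<lambda>c\<in>carrier (quot_md (val X 1 V) (bnd X 1 V)). dif X 1 V (quot_rep (val X 1 V) (bnd X 1 V) c))" for V
    using v1[of V] by (simp add: trunc01_def Let_def)
  show cls: "dif (trunc01 X) 1 V (?c V x) = dif X 1 V x" if V: "V \<in> proj R" and x: "x \<in> carrier (val X 1 V)" for V x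
  proof -
    have cc: "?c V x \<in> carrier (quot_md (val X 1 V) (bnd X 1 V))" by (rule quot_cls_closed[OF md[OF V] sm[OF V] x])
    let ?y = "quot_rep (val X 1 V) (bnd X 1 V) (?c V x)"
    note y = quot_rep[OF md[OF V] sm[OF V] cc]
    have "?y \<ominus>\<^bsub>val X 1 V\<^esub> x \<in> bnd X 1 V" using y quot_cls_eq[OF md[OF V] sm[OF V] y(1) x] by simp
    then have "dif X 1 V (?y \<ominus>\<^bsub>val X 1 V\<^esub> x) = \<zero>\<^bsub>val X 0 V\<^esub>" using dd1[OF V] by (auto simp: b)
    then have "dif X 1 V ?y \<ominus>\<^bsub>val X 0 V\<^esub> dif X 1 V x = \<zero>\<^bsub>val X 0 V\<^esub>"
      using mod_hom_diff[OF nat_hom[OF d1 V] md[OF V] md[OF V] y(1) x] by simp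
    then have "dif X 1 V ?y = dif X 1 V x"
      using abelian_group.diff_zero_iff[OF module.axioms(2)[OF md[OF V]]] nat_closed[OF d1 V] y(1) x by blast
    then show ?thesis using cc by (simp add: de)
  qed
  have onto: "\<exists>x\<in>carrier (val X 1 V). c = ?c V x" if "V \<in> proj R" "c \<in> carrier (val (trunc01 X) 1 V)" for V c
    using quot_cls_onto[OF md[OF that(1)] sm[OF that(1)]] that(2) unfolding v1 by (metis imageE)
  have nt1: "dif (trunc01 X) 1 \<in> nat_trans R S (ob (trunc01 X) 1) (ob (trunc01 X) 0)"
  proof (rule nat_transI)
    fix V assume V: "V \<in> proj R"
    note dh = nat_hom[OF d1 V]
    interpret m: module S "val X 1 V" by (rule md[OF V])
    show "dif (trunc01 X) 1 V \<in> mod_hom S (val (trunc01 X) 1 V) (val (trunc01 X) 0 V)"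
    proof (rule mod_homI)
      fix x assume "x \<in> carrier (val (trunc01 X) 1 V)"
      then obtain x' where x: "x' \<in> carrier (val X 1 V)" "x = ?c V x'" using onto[OF V] by blast
      show "dif (trunc01 X) 1 V x \<in> carrier (val (trunc01 X) 0 V)"
        unfolding x(2) cls[OF V x(1)] using mod_hom_closed[OF dh x(1)] dd0[OF V x(1)] by (simp add: v0)
      { fix y assume "y \<in> carrier (val (trunc01 X) 1 V)"
        then obtain y' where y: "y' \<in> carrier (val X 1 V)" "y = ?c V y'" using onto[OF V] by blast
        have "x \<oplus>\<^bsub>val (trunc01 X) 1 V\<^esub> y = ?c V (x' \<oplus>\<^bsub>val X 1 V\<^esub> y')"
          using quot_cls_add[OF md[OF V] sm[OF V] x(1) y(1)] x y by (simp add: v1)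
        then show "dif (trunc01 X) 1 V (x \<oplus>\<^bsub>val (trunc01 X) 1 V\<^esub> y) =
            dif (trunc01 X) 1 V x \<oplus>\<^bsub>val (trunc01 X) 0 V\<^esub> dif (trunc01 X) 1 V y"
          using x y mod_hom_add[OF dh x(1) y(1)] by (simp add: cls[OF V] v0) }
      { fix r assume r: "r \<in> carrier S"
        have "r \<odot>\<^bsub>val (trunc01 X) 1 V\<^esub> x = ?c V (r \<odot>\<^bsub>val X 1 V\<^esub> x')"
          using quot_cls_smult[OF md[OF V] sm[OF V] r x(1)] x by (simp add: v1)
        then show "dif (trunc01 X) 1 V (r \<odot>\<^bsub>val (trunc01 X) 1 V\<^esub> x) = r \<odot>\<^bsub>val (trunc01 X) 0 V\<^esub> dif (trunc01 X) 1 V x"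
          using x r mod_hom_smult[OF dh r x(1)] by (simp add: cls[OF V] v0) }
    next
      show "dif (trunc01 X) 1 V \<in> extensional (carrier (val (trunc01 X) 1 V))" by (simp add: de v1)
    qed
  next
    fix V W f x assume VW: "V \<in> proj R" "W \<in> proj R" "f \<in> mod_hom R V W" and "x \<in> carrier (val (trunc01 X) 1 V)"
    then obtain x' where x: "x' \<in> carrier (val X 1 V)" "x = ?c V x'" using onto by blast
    have "farr (ob (trunc01 X) 1) V W f x = ?c W (farr (ob X 1) V W f x')"
      using coker_fctr_arr[OF F F d2 VW x(1)] x by (simp add: trunc01_ob b)
    moreover have "farr (ob (trunc01 X) 0) V W f (dif X 1 V x') = farr (ob X 0) V W f (dif X 1 V x')"
      using nat_closed[OF d1 VW(1) x(1)] dd0[OF VW(1) x(1)] by (simp add: trunc01_ob kernel_fctr_sub)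
    ultimately show "dif (trunc01 X) 1 W (farr (ob (trunc01 X) 1) V W f x) = farr (ob (trunc01 X) 0) V W f (dif (trunc01 X) 1 V x)"
      using nat_arr[OF d1 VW x(1)] x cls[OF VW(1) x(1)] cls[OF VW(2) arr_closed[OF F VW x(1)]] by simp
  qed
  have nt: "dif (trunc01 X) n \<in> nat_trans R S (ob (trunc01 X) n) (ob (trunc01 X) (n - 1))" for n
  proof (cases "n = 1")
    case False
    then show ?thesis using zero_map_nat[OF ob ob, of n "n - 1"] trunc01_dif[OF False, of X] by presburger
  qed (use nt1 in simp)
  show "trunc01 X \<in> complexes R S"
  proof (rule complexesI)
    fix n V x assume V: "V \<in> proj R" and x: "x \<in> carrier (val (trunc01 X) n V)"
    note dx = nat_closed[OF nt V x]
    have e: "n - 1 - 1 = n - 2" by simp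
    show "dif (trunc01 X) (n - 1) V (dif (trunc01 X) n V x) = \<zero>\<^bsub>val (trunc01 X) (n - 2) V\<^esub>"
    \<comment> \<open>In every other degree the second of the two differentials is a zero map. Out
      of degree 2 it is the first one that vanishes, and linearity of the second finishes.\<close>
    proof (cases "n = 2")
      case True
      then have "dif (trunc01 X) n V x = \<zero>\<^bsub>val (trunc01 X) 1 V\<^esub>" using trunc01_dif[of n X V] x by simp
      then show ?thesis using mod_hom_zero[OF nat_hom[OF nt1 V] functor_module[OF ob V] functor_module[OF ob V]] True by simp
    next
      case False
      then show ?thesis using trunc01_dif[of "n - 1" X V] dx e by simp
    qed
  qed (use ob nt in auto)
qed

section \<open>The truncated base change of a resolution and the cover given by its degree 0\<close>

locale resolution = sqz +
  fixes P :: "('a :: infinite) cplx" and \<epsilon> :: "'a ntrans"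
  assumes res: "proj_resolution R R' push_incl P \<epsilon>"
begin

lemma P_complex: "P \<in> complexes R R'" using res by (simp add: proj_resolution_def)
lemma P_functor: "ob P n \<in> functors R R'" by (rule complex_functor[OF P_complex])
lemma P_mod: "V \<in> proj R \<Longrightarrow> module R' (val P n V)" by (rule functor_module[OF P_functor])

sublocale cover R R' M ra i q "ob P 0" \<epsilon>
proof
  show "ob P 0 \<in> functors R R'" by (rule P_functor)
qed (use res in \<open>auto simp: proj_resolution_def\<close>)

abbreviation "Y \<equiv> pull_cplx R R' q P"
abbreviation "D \<equiv> trunc01 Y"
abbreviation "cls V y \<equiv> quot_cls (val Y 1 V) (bnd Y 1 V) (ot (val P 1 V) y)"

lemma Y_complex: "Y \<in> complexes R R" by (rule pull_complex[OF P_complex])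
lemma D_complex: "D \<in> complexes R R" by (rule trunc01_complex[OF Y_complex R_cring])

lemma P_neg: "V \<in> proj R \<Longrightarrow> carrier (val P (-1) V) = {\<zero>\<^bsub>val P (-1) V\<^esub>}"
  using res by (simp add: proj_resolution_def zero_in_degree_def)

lemma d1_hom: "V \<in> proj R \<Longrightarrow> dif P 1 V \<in> mod_hom R' (val P 1 V) (val P 0 V)"
  using nat_hom[OF complex_dif[OF P_complex, of 1]] by simp
lemma d2_hom: "V \<in> proj R \<Longrightarrow> dif P 2 V \<in> mod_hom R' (val P 2 V) (val P 1 V)"
  using nat_hom[OF complex_dif[OF P_complex, of 2]] by simp

lemma lay1_bnd: "V \<in> proj R \<Longrightarrow> lay 1 V = dif P 1 V ` carrier (val P 1 V)"
  using res by (simp add: proj_resolution_def lay_def bnd_def)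

lemma d1_lay: "V \<in> proj R \<Longrightarrow> y \<in> carrier (val P 1 V) \<Longrightarrow> dif P 1 V y \<in> lay 1 V"
  by (simp add: lay1_bnd)

lemma d1_L_hom: "V \<in> proj R \<Longrightarrow> dif P 1 V \<in> mod_hom R' (val P 1 V) (L 1 V)"
  by (rule mod_homI)
     (use mod_hom_add[OF d1_hom] mod_hom_smult[OF d1_hom] mod_hom_ext[OF d1_hom] d1_lay in auto)

lemma d1_zero: "\<lbrakk>V \<in> proj R; y \<in> carrier (val P 1 V); dif P 1 V y = \<zero>\<^bsub>val P 0 V\<^esub>\<rbrakk> \<Longrightarrow>
    \<exists>w\<in>carrier (val P 2 V). y = dif P 2 V w"
proof -
  assume V: "V \<in> proj R" and y: "y \<in> carrier (val P 1 V)" "dif P 1 V y = \<zero>\<^bsub>val P 0 V\<^esub>"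
  have "\<forall>n\<ge>1. {x \<in> carrier (val P n V). dif P n V x = \<zero>\<^bsub>val P (n - 1) V\<^esub>} = bnd P n V"
    using res V unfolding proj_resolution_def by blast
  from this[rule_format, of 1] have "y \<in> bnd P 1 V" using y by auto
  then show ?thesis by (auto simp: bnd_def)
qed

lemma bndY: "bnd Y 1 V = dif Y 2 V ` carrier (TT (val P 2 V))"
  by (simp add: bnd_def)

lemma bndY_submod: "V \<in> proj R \<Longrightarrow> submod R (TT (val P 1 V)) (bnd Y 1 V)"
proof -
  assume V: "V \<in> proj R"
  have "dif Y 2 V \<in> mod_hom R (TT (val P 2 V)) (TT (val P 1 V))" using pull_dif(1)[OF P_complex V, of 2] by simp
  then show ?thesis using submod_image[OF TT_module[OF P_mod[OF V]] TT_module[OF P_mod[OF V]]] by (simp add: bndY)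
qed

lemma val_D1: "val D 1 V = quot_md (TT (val P 1 V)) (bnd Y 1 V)"
  by (simp add: trunc01_ob bndY)

text \<open>Right exactness of the base change: the cokernel of
  \<open>R \<otimes> P2 \<rightarrow> R \<otimes> P1\<close> is \<open>R \<otimes> K\<close>, where
  \<open>K\<close> is the image of \<open>P1\<close> in \<open>P0\<close>. In terms of
  representatives, \<open>y\<close> is a boundary modulo \<open>I P1\<close> exactly when
  \<open>d y\<close> lies in \<open>I K\<close>.\<close>

lemma ot_bnd:
  assumes V: "V \<in> proj R" and y: "y \<in> carrier (val P 1 V)"
  shows "ot (val P 1 V) y \<in> bnd Y 1 V \<longleftrightarrow> ot (L 1 V) (dif P 1 V y) = \<zero>\<^bsub>TT (L 1 V)\<^esub>"
proof
  note m1 = P_mod[OF V, of 1] and m2 = P_mod[OF V, of 2] and Lm = L_mod[OF V, of 1]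
  interpret P1: module R' "val P 1 V" by (rule m1)
  interpret P0: module R' "val P 0 V" by (rule P_mod[OF V])
  have dy: "dif P 1 V y \<in> carrier (L 1 V)" using d1_lay[OF V y] by simp
  note d1h = d1_hom[OF V] and d2c = mod_hom_closed[OF d2_hom[OF V]]
  have d1d2: "dif P 1 V (dif P 2 V w) = \<zero>\<^bsub>val P 0 V\<^esub>" if "w \<in> carrier (val P 2 V)" for w
    using complex_dd[OF P_complex V that] by simp
  have Yd: "dif Y 2 V (ot (val P 2 V) w) = ot (val P 1 V) (dif P 2 V w)" if "w \<in> carrier (val P 2 V)" for w
    using pull_dif(2)[OF P_complex V that] by simp
  { assume "ot (val P 1 V) y \<in> bnd Y 1 V"
    then obtain x where x: "x \<in> carrier (TT (val P 2 V))" "ot (val P 1 V) y = dif Y 2 V x" by (auto simp: bndY)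
    obtain w where w: "w \<in> carrier (val P 2 V)" "ot (val P 1 V) y = ot (val P 1 V) (dif P 2 V w)"
      using ot_onto[OF m2 x(1)] x(2) Yd by auto
    then have "y \<ominus>\<^bsub>val P 1 V\<^esub> dif P 2 V w \<in> I (val P 1 V)" using ot_eq_iff[OF m1 y d2c] by blast
    then have "dif P 1 V (y \<ominus>\<^bsub>val P 1 V\<^esub> dif P 2 V w) \<in> I (L 1 V)" by (rule I_hom[OF m1 Lm d1_L_hom[OF V]])
    moreover have "dif P 1 V (y \<ominus>\<^bsub>val P 1 V\<^esub> dif P 2 V w) = dif P 1 V y"
      using mod_hom_diff[OF d1h m1 P_mod[OF V] y d2c[OF w(1)]] d1d2[OF w(1)] mod_hom_closed[OF d1h y]
      by (simp add: P0.diff_zero)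
    ultimately show "ot (L 1 V) (dif P 1 V y) = \<zero>\<^bsub>TT (L 1 V)\<^esub>" using ot_zero_iff[OF Lm dy] by simp }
  assume "ot (L 1 V) (dif P 1 V y) = \<zero>\<^bsub>TT (L 1 V)\<^esub>"
  then have "dif P 1 V y \<in> I (L 1 V)" using ot_zero_iff[OF Lm dy] by simp
  \<comment> \<open>Since \<open>d\<close> maps \<open>P1\<close> onto \<open>K\<close>, it maps
    \<open>I P1\<close> onto \<open>I K\<close>. So \<open>d y\<close> can be cancelled by an
    element \<open>s\<close> that is invisible after base change, and \<open>y - s\<close> is a
    cycle, hence a boundary.\<close>
  have "\<exists>s\<in>I (val P 1 V). x = dif P 1 V s" if "x \<in> I (L 1 V)" for x
    using Lm that
  proof (induction rule: I_induct)
    case (base m k)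
    then obtain y where "y \<in> carrier (val P 1 V)" "k = dif P 1 V y" using lay1_bnd[OF V] by auto
    then show ?case using I_base[OF m1 base(1)] mod_hom_smult[OF d1h i_closed[OF base(1)]]
      by (intro bexI[of _ "i m \<odot>\<^bsub>val P 1 V\<^esub> y"]) auto
  next
    case (add x y)
    then obtain s s' where s: "s \<in> I (val P 1 V)" "s' \<in> I (val P 1 V)" "x = dif P 1 V s" "y = dif P 1 V s'" by blast
    note d = submodD[OF I_submod[OF m1]]
    have "dif P 1 V (s \<oplus>\<^bsub>val P 1 V\<^esub> s') = x \<oplus>\<^bsub>L 1 V\<^esub> y" using mod_hom_add[OF d1h d(1)[OF s(1)] d(1)[OF s(2)]] s by simp
    then show ?case using d(3)[OF s(1,2)] by metis
  qed
  then obtain s where s: "s \<in> I (val P 1 V)" "dif P 1 V y = dif P 1 V s" using \<open>dif P 1 V y \<in> I (L 1 V)\<close> by blast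
  have sc: "s \<in> carrier (val P 1 V)" using submodD(1)[OF I_submod[OF m1] s(1)] .
  have "dif P 1 V (y \<ominus>\<^bsub>val P 1 V\<^esub> s) = \<zero>\<^bsub>val P 0 V\<^esub>"
    using mod_hom_diff[OF d1h m1 P_mod[OF V] y sc] s(2) mod_hom_closed[OF d1h sc] by (simp add: P0.diff_zero_iff)
  then obtain w where w: "w \<in> carrier (val P 2 V)" "y \<ominus>\<^bsub>val P 1 V\<^esub> s = dif P 2 V w"
    using d1_zero[OF V, of "y \<ominus>\<^bsub>val P 1 V\<^esub> s"] y sc by auto
  interpret T1: module R "TT (val P 1 V)" by (rule TT_module[OF m1])
  have "ot (val P 1 V) y \<ominus>\<^bsub>TT (val P 1 V)\<^esub> ot (val P 1 V) s = ot (val P 1 V) (dif P 2 V w)"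
    using ot_diff[OF m1 y sc] w by simp
  moreover have "ot (val P 1 V) s = \<zero>\<^bsub>TT (val P 1 V)\<^esub>" using ot_zero_iff[OF m1 sc] s by simp
  ultimately have "ot (val P 1 V) y = dif Y 2 V (ot (val P 2 V) w)"
    using Yd[OF w(1)] m1 y by (simp add: T1.diff_zero)
  then show "ot (val P 1 V) y \<in> bnd Y 1 V" using w m2 by (simp add: bndY)
qed

lemma cls_closed: "\<lbrakk>V \<in> proj R; y \<in> carrier (val P 1 V)\<rbrakk> \<Longrightarrow> cls V y \<in> carrier (val D 1 V)"
  unfolding val_D1 using quot_cls_closed[OF TT_module[OF P_mod] bndY_submod] P_mod by simp

text \<open>Read from left to right this makes \<open>\<theta>\<close> well defined in degree 1,
  read from right to left it makes it injective.\<close>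

lemma cls_eq:
  assumes V: "V \<in> proj R" and y: "y \<in> carrier (val P 1 V)" "y' \<in> carrier (val P 1 V)"
  shows "cls V y = cls V y' \<longleftrightarrow> ot (L 1 V) (dif P 1 V y) = ot (L 1 V) (dif P 1 V y')"
proof -
  note m1 = P_mod[OF V, of 1] and Lm = L_mod[OF V, of 1]
  interpret P1: module R' "val P 1 V" by (rule m1)
  interpret T: module R "TT (L 1 V)" by (rule TT_module[OF Lm])
  have d: "dif P 1 V y \<in> carrier (L 1 V)" "dif P 1 V y' \<in> carrier (L 1 V)" using d1_lay[OF V] y by auto
  have "cls V y = cls V y' \<longleftrightarrow> ot (val P 1 V) y \<ominus>\<^bsub>TT (val P 1 V)\<^esub> ot (val P 1 V) y' \<in> bnd Y 1 V"
    using quot_cls_eq[OF TT_module[OF m1] bndY_submod[OF V]] m1 y by simp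
  also have "\<dots> \<longleftrightarrow> ot (val P 1 V) (y \<ominus>\<^bsub>val P 1 V\<^esub> y') \<in> bnd Y 1 V" using ot_diff[OF m1 y] by simp
  also have "\<dots> \<longleftrightarrow> ot (L 1 V) (dif P 1 V (y \<ominus>\<^bsub>val P 1 V\<^esub> y')) = \<zero>\<^bsub>TT (L 1 V)\<^esub>"
    using ot_bnd[OF V] y by simp
  also have "dif P 1 V (y \<ominus>\<^bsub>val P 1 V\<^esub> y') = dif P 1 V y \<ominus>\<^bsub>L 1 V\<^esub> dif P 1 V y'"
    by (rule mod_hom_diff[OF d1_L_hom[OF V] m1 Lm y])
  also have "ot (L 1 V) (dif P 1 V y \<ominus>\<^bsub>L 1 V\<^esub> dif P 1 V y') =
     ot (L 1 V) (dif P 1 V y) \<ominus>\<^bsub>TT (L 1 V)\<^esub> ot (L 1 V) (dif P 1 V y')" by (rule ot_diff[OF Lm d])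
  also have "\<dots> = \<zero>\<^bsub>TT (L 1 V)\<^esub> \<longleftrightarrow> ot (L 1 V) (dif P 1 V y) = ot (L 1 V) (dif P 1 V y')"
    using Lm d by (intro T.diff_zero_iff) auto
  finally show ?thesis .
qed

lemma cls_onto: "\<lbrakk>V \<in> proj R; c \<in> carrier (val D 1 V)\<rbrakk> \<Longrightarrow> \<exists>y\<in>carrier (val P 1 V). c = cls V y"
proof -
  assume V: "V \<in> proj R" and c: "c \<in> carrier (val D 1 V)"
  have "c \<in> quot_cls (TT (val P 1 V)) (bnd Y 1 V) ` carrier (TT (val P 1 V))"
    using quot_cls_onto[OF TT_module[OF P_mod[OF V]] bndY_submod[OF V]] c unfolding val_D1 by simp
  then obtain x where x: "x \<in> carrier (TT (val P 1 V))" "c = quot_cls (TT (val P 1 V)) (bnd Y 1 V) x" by blast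
  then show ?thesis using ot_onto[OF P_mod[OF V] x(1)] by auto
qed

lemma cls_add: "\<lbrakk>V \<in> proj R; y \<in> carrier (val P 1 V); y' \<in> carrier (val P 1 V)\<rbrakk> \<Longrightarrow>
    cls V (y \<oplus>\<^bsub>val P 1 V\<^esub> y') = cls V y \<oplus>\<^bsub>val D 1 V\<^esub> cls V y'"
  unfolding val_D1
  using quot_cls_add[OF TT_module[OF P_mod] bndY_submod] P_mod by (simp add: ot_add)

lemma cls_smult: "\<lbrakk>V \<in> proj R; r \<in> carrier R'; y \<in> carrier (val P 1 V)\<rbrakk> \<Longrightarrow>
    cls V (r \<odot>\<^bsub>val P 1 V\<^esub> y) = q r \<odot>\<^bsub>val D 1 V\<^esub> cls V y"
  unfolding val_D1
  using quot_cls_smult[OF TT_module[OF P_mod] bndY_submod] P_mod by (simp add: ot_smult)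

lemma cls_arr:
  assumes VW: "V \<in> proj R" "W \<in> proj R" "f \<in> mod_hom R V W" and y: "y \<in> carrier (val P 1 V)"
  shows "farr (ob D 1) V W f (cls V y) = cls W (farr (ob P 1) V W f y)"
proof -
  have d2: "dif Y 2 \<in> nat_trans R R (ob Y 2) (ob Y 1)" using complex_dif[OF Y_complex, of 2] by simp
  show ?thesis
    using coker_fctr_arr[OF complex_functor[OF Y_complex] complex_functor[OF Y_complex] d2 VW, of "ot (val P 1 V) y"]
      pull_arr[OF P_functor VW y] y P_mod[OF VW(1)] by (simp add: trunc01_ob bndY)
qed

text \<open>The resolution vanishes in degree -1 and so does its base change. Hence the cycles that
  the truncation takes in degree 0 are everything.\<close>

lemma Y_dif0: assumes V: "V \<in> proj R" and x: "x \<in> carrier (TT (val P 0 V))"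
  shows "dif Y 0 V x = \<zero>\<^bsub>TT (val P (-1) V)\<^esub>"
proof -
  have "dif Y 0 V x \<in> carrier (TT (val P (-1) V))"
    using mod_hom_closed[OF pull_dif(1)[OF P_complex V, of 0]] x by simp
  then obtain n where "n \<in> carrier (val P (-1) V)" "dif Y 0 V x = ot (val P (-1) V) n"
    using ot_onto[OF P_mod[OF V]] by blast
  then show ?thesis using P_neg[OF V] ot_zero[OF P_mod[OF V]] by simp
qed

lemma val_D0: "V \<in> proj R \<Longrightarrow> val D 0 V = TT (val P 0 V)"
proof -
  assume V: "V \<in> proj R"
  have "{x \<in> carrier (TT (val P 0 V)). dif Y 0 V x = \<zero>\<^bsub>TT (val P (-1) V)\<^esub>} = carrier (TT (val P 0 V))"
    using Y_dif0[OF V] by blast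
  then show ?thesis by (simp add: trunc01_ob kernel_fctr_sub)
qed

lemma farr_D0: "\<lbrakk>V \<in> proj R; x \<in> carrier (TT (val P 0 V))\<rbrakk> \<Longrightarrow> farr (ob D 0) V W f x = farr (ob Y 0) V W f x"
  by (simp add: trunc01_ob kernel_fctr_sub Y_dif0)

lemma D_dif1: "\<lbrakk>V \<in> proj R; y \<in> carrier (val P 1 V)\<rbrakk> \<Longrightarrow> dif D 1 V (cls V y) = ot (val P 0 V) (dif P 1 V y)"
  using trunc01_cls[OF Y_complex R_cring, of V "ot (val P 1 V) y"] pull_dif(2)[OF P_complex, of V y 1] P_mod by simp

text \<open>The identity in degree 0, and \<open>1 \<otimes> y \<mapsto> 1 \<otimes> d y\<close> in
  degree 1. By \<open>cls_eq\<close> the chosen representative \<open>y\<close> does not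
  matter.\<close>

definition \<theta> :: "int \<Rightarrow> 'a ntrans" where
  "\<theta> n V = (if n = 0 then (\<lambda>x\<in>carrier (val D 0 V). x)
     else if n = 1 then (\<lambda>c\<in>carrier (val D 1 V). ot (L 1 V) (dif P 1 V (SOME y. y \<in> carrier (val P 1 V) \<and> c = cls V y)))
     else zero_map (val D n V) (val C n V))"

lemma \<theta>_cls: "\<lbrakk>V \<in> proj R; y \<in> carrier (val P 1 V)\<rbrakk> \<Longrightarrow> \<theta> 1 V (cls V y) = ot (L 1 V) (dif P 1 V y)"
proof -
  assume V: "V \<in> proj R" and y: "y \<in> carrier (val P 1 V)"
  let ?y = "SOME y'. y' \<in> carrier (val P 1 V) \<and> cls V y = cls V y'"
  have "?y \<in> carrier (val P 1 V) \<and> cls V y = cls V ?y" by (rule someI[of _ y]) (use y in simp)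
  then show ?thesis using cls_eq[OF V y, of ?y] cls_closed[OF V y] by (simp add: \<theta>_def)
qed

lemma \<theta>_hom: assumes V: "V \<in> proj R" shows "\<theta> n V \<in> mod_hom R (val D n V) (val C n V)"
proof -
  note md = functor_module[OF complex_functor[OF D_complex] V]
  consider "n = 0" | "n = 1" | "n \<noteq> 0" "n \<noteq> 1" by blast
  then show ?thesis
  proof cases
    case 1
    then show ?thesis using mod_hom_id[OF TT_module[OF P_mod[OF V]], of 0] val_D0[OF V] by (simp add: \<theta>_def)
  next
    case 2
    interpret m: module R "val D 1 V" by (rule md)
    have "\<theta> 1 V \<in> mod_hom R (val D 1 V) (TT (L 1 V))"
    proof (rule mod_homI)
      fix c assume c: "c \<in> carrier (val D 1 V)"
      then obtain y where y: "y \<in> carrier (val P 1 V)" "c = cls V y" using cls_onto[OF V] by blast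
      interpret P1: module R' "val P 1 V" by (rule P_mod[OF V])
      have dy: "dif P 1 V y \<in> carrier (L 1 V)" using d1_lay[OF V y(1)] by simp
      show "\<theta> 1 V c \<in> carrier (TT (L 1 V))" using \<theta>_cls[OF V y(1)] y dy L_mod[OF V] by simp
      { fix c' assume "c' \<in> carrier (val D 1 V)"
        then obtain y' where y': "y' \<in> carrier (val P 1 V)" "c' = cls V y'" using cls_onto[OF V] by blast
        have dy': "dif P 1 V y' \<in> carrier (L 1 V)" using d1_lay[OF V y'(1)] by simp
        show "\<theta> 1 V (c \<oplus>\<^bsub>val D 1 V\<^esub> c') = \<theta> 1 V c \<oplus>\<^bsub>TT (L 1 V)\<^esub> \<theta> 1 V c'"
          unfolding y y' cls_add[OF V y(1) y'(1), symmetric] \<theta>_cls[OF V y(1)] \<theta>_cls[OF V y'(1)]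
            \<theta>_cls[OF V P1.a_closed[OF y(1) y'(1)]] mod_hom_add[OF d1_L_hom[OF V] y(1) y'(1)]
          by (rule ot_add[OF L_mod[OF V] dy dy']) }
      { fix r assume "r \<in> carrier R"
        then obtain r' where r: "r' \<in> carrier R'" "r = q r'" using q_onto by blast
        show "\<theta> 1 V (r \<odot>\<^bsub>val D 1 V\<^esub> c) = r \<odot>\<^bsub>TT (L 1 V)\<^esub> \<theta> 1 V c"
          unfolding y r cls_smult[OF V r(1) y(1), symmetric] \<theta>_cls[OF V y(1)]
            \<theta>_cls[OF V P1.smult_closed[OF r(1) y(1)]] mod_hom_smult[OF d1_L_hom[OF V] r(1) y(1)]
          by (rule ot_smult[OF L_mod[OF V] r(1) dy]) }
    qed (simp add: \<theta>_def)
    then show ?thesis using 2 by simp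
  next
    case 3
    then show ?thesis using zero_map_mod_hom[OF md TT_module[OF L_mod[OF V]]] by (simp add: \<theta>_def)
  qed
qed

lemma D_zero: "\<lbrakk>n \<noteq> 0; n \<noteq> 1\<rbrakk> \<Longrightarrow> val D n V = zero_md"
  by (simp add: trunc01_ob)

lemma \<theta>_chain: "\<theta> \<in> chain_maps R R D C"
proof (rule chain_mapsI)
  fix n :: int
  have cases: "n = 0 \<or> n = 1 \<or> (n \<noteq> 0 \<and> n \<noteq> 1)" by blast
  note md = functor_module[OF complex_functor[OF D_complex]]
  have z: "\<theta> n V \<zero>\<^bsub>val D n V\<^esub> = \<zero>\<^bsub>TT (L n V)\<^esub>" if "V \<in> proj R" for n :: int and V
    using mod_hom_zero[OF \<theta>_hom[OF that] md[OF that]] TT_module[OF L_mod[OF that]] by simp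
  show "\<theta> n \<in> nat_trans R R (ob D n) (ob C n)"
  proof (rule nat_transI)
    fix V W f x assume VW: "V \<in> proj R" "W \<in> proj R" "f \<in> mod_hom R V W" and x: "x \<in> carrier (val D n V)"
    show "\<theta> n W (farr (ob D n) V W f x) = farr (ob C n) V W f (\<theta> n V x)"
      using cases
    proof (elim disjE conjE)
      assume n: "n = 0"
      have x0: "x \<in> carrier (TT (val P 0 V))" using x n val_D0[OF VW(1)] by simp
      then obtain y where y: "y \<in> carrier (val P 0 V)" "x = ot (val P 0 V) y" using ot_onto[OF P_mod[OF VW(1)]] by blast
      have "farr (ob D 0) V W f x = ot (val P 0 W) (farr (ob P 0) V W f y)"
        using farr_D0[OF VW(1) x0] pull_arr[OF P_functor VW y(1)] y by simp
      moreover have "farr (ob C 0) V W f x = ot (val P 0 W) (farr (ob P 0) V W f y)"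
        using C_arr[OF VW, of y 0] y by simp
      ultimately show ?thesis
        using n x arr_closed[OF complex_functor[OF D_complex] VW x] by (simp add: \<theta>_def)
    next
      assume n: "n = 1"
      then obtain y where y: "y \<in> carrier (val P 1 V)" "x = cls V y" using x cls_onto[OF VW(1)] by blast
      have d: "dif P 1 \<in> nat_trans R R' (ob P 1) (ob P 0)" using complex_dif[OF P_complex, of 1] by simp
      show ?thesis
        using n y \<theta>_cls[OF VW(1) y(1)] cls_arr[OF VW y(1)] \<theta>_cls[OF VW(2) arr_closed[OF P_functor VW y(1)]]
          C_arr[OF VW d1_lay[OF VW(1) y(1)]] nat_arr[OF d VW y(1)] by simp
    next
      assume n: "n \<noteq> 0" "n \<noteq> 1"
      then have "x = \<zero>\<^bsub>val D n V\<^esub>" using x D_zero[OF n, of V] by simp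
      then show ?thesis using z[OF VW(1)] z[OF VW(2)] arr_zero[OF complex_functor[OF D_complex] VW, of n]
          arr_zero[OF C_functor[of n] VW] by simp
    qed
  qed (use \<theta>_hom in simp)
  fix V x assume V: "V \<in> proj R" and x: "x \<in> carrier (val D n V)"
  show "dif C n V (\<theta> n V x) = \<theta> (n - 1) V (dif D n V x)"
  proof (cases "n = 1")
    case True
    then obtain y where y: "y \<in> carrier (val P 1 V)" "x = cls V y" using x cls_onto[OF V] by blast
    have "ot (val P 0 V) (dif P 1 V y) \<in> carrier (val D 0 V)"
      using val_D0[OF V] P_mod[OF V] mod_hom_closed[OF d1_hom[OF V] y(1)] by simp
    then show ?thesis using True y \<theta>_cls[OF V y(1)] D_dif1[OF V y(1)] C_dif[OF V d1_lay[OF V y(1)]]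
      by (simp add: \<theta>_def)
  next
    case False
    have "\<theta> n V x \<in> carrier (TT (L n V))" using mod_hom_closed[OF \<theta>_hom[OF V] x] by simp
    then obtain k where "k \<in> lay n V" "\<theta> n V x = ot (L n V) k" using C_onto[OF V] by blast
    then show ?thesis using False C_dif[OF V, of k n] trunc01_dif[OF False, of Y V] x z[OF V, of "n - 1"] by simp
  qed
qed

lemma \<theta>_bij: assumes V: "V \<in> proj R" shows "bij_betw (\<theta> n V) (carrier (val D n V)) (carrier (val C n V))"
proof -
  consider "n = 0" | "n = 1" | "n \<noteq> 0" "n \<noteq> 1" by blast
  then show ?thesis
  proof cases
    case 1
    then show ?thesis using val_D0[OF V] by (auto simp: \<theta>_def bij_betw_def inj_on_def)
  next
    case 2
    have "inj_on (\<theta> 1 V) (carrier (val D 1 V))"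
    proof (rule inj_onI)
      fix c c' assume "c \<in> carrier (val D 1 V)" "c' \<in> carrier (val D 1 V)" and e: "\<theta> 1 V c = \<theta> 1 V c'"
      then obtain y y' where y: "y \<in> carrier (val P 1 V)" "c = cls V y" and y': "y' \<in> carrier (val P 1 V)" "c' = cls V y'"
        using cls_onto[OF V] by blast
      show "c = c'" using e cls_eq[OF V y(1) y'(1)] \<theta>_cls[OF V y(1)] \<theta>_cls[OF V y'(1)] y y' by simp
    qed
    moreover have "k \<in> \<theta> 1 V ` carrier (val D 1 V)" if k: "k \<in> carrier (TT (L 1 V))" for k
    proof -
      obtain x where x: "x \<in> lay 1 V" "k = ot (L 1 V) x" using C_onto[OF V k] by blast
      then obtain y where "y \<in> carrier (val P 1 V)" "x = dif P 1 V y" using lay1_bnd[OF V] by auto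
      then show ?thesis using \<theta>_cls[OF V] cls_closed[OF V] x by (intro image_eqI[of _ _ "cls V y"]) auto
    qed
    ultimately show ?thesis using 2 mod_hom_closed[OF \<theta>_hom[OF V, of 1]] by (auto simp: bij_betw_def)
  next
    case 3
    then show ?thesis using C_zero[OF V 3] D_zero[OF 3, of V] by (simp add: bij_betw_def \<theta>_def)
  qed
qed

abbreviation "S \<equiv> sqz_elext R M ra R' i q P \<epsilon>"

text \<open>The relation asks for \<open>z\<close> over \<open>t\<close> and \<open>y\<close> with
  \<open>d y = j z\<close>, while by \<open>\<beta>_me\<close> the class of \<open>j z\<close> in
  degree 1 is \<open>\<beta> V t\<close>. So the relation is the graph of the inverse of
  \<open>\<beta>\<close> on its image, transported along \<open>\<theta>\<close>.\<close>

lemma connecting_iff: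
  assumes V: "V \<in> proj R" and t: "t \<in> carrier (MV V)"
  shows "connecting R M ra R' i q P \<epsilon> V c t \<longleftrightarrow> c \<in> carrier (val D 1 V) \<and> \<theta> 1 V c = \<beta> V t"
proof -
  have con: "connecting R M ra R' i q P \<epsilon> V c t \<longleftrightarrow>
      (\<exists>y\<in>carrier (val P 1 V). \<exists>z\<in>carrier (MT (val P 0 V)). c = cls V y \<and> j (val P 0 V) z = dif P 1 V y \<and> me V z = t)"
    by (simp add: connecting_def Let_def j_def me_def)
  show ?thesis
  proof
    assume "connecting R M ra R' i q P \<epsilon> V c t"
    then obtain y z where yz: "y \<in> carrier (val P 1 V)" "z \<in> carrier (MT (val P 0 V))" "c = cls V y"
      "j (val P 0 V) z = dif P 1 V y" "me V z = t" unfolding con by blast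
    then show "c \<in> carrier (val D 1 V) \<and> \<theta> 1 V c = \<beta> V t"
      using cls_closed[OF V yz(1)] \<theta>_cls[OF V yz(1)] \<beta>_me[OF V yz(2)] by simp
  next
    assume c: "c \<in> carrier (val D 1 V) \<and> \<theta> 1 V c = \<beta> V t"
    obtain z where z: "z \<in> carrier (MT (val P 0 V))" "t = me V z" using me_onto[OF V t] by blast
    obtain y where y: "y \<in> carrier (val P 1 V)" "j (val P 0 V) z = dif P 1 V y"
      using \<beta>_me[OF V z(1)] lay1_bnd[OF V] by auto
    obtain y' where y': "y' \<in> carrier (val P 1 V)" "c = cls V y'" using cls_onto[OF V] c by blast
    \<comment> \<open>\<open>y\<close> comes from \<open>t\<close> and \<open>y'\<close> from
      \<open>c\<close>. Both are sent to \<open>\<beta> V t\<close>, so by \<open>cls_eq\<close>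
      they have the same class, and \<open>y\<close> is a valid witness for
      \<open>c\<close>.\<close>
    have "c = cls V y" using cls_eq[OF V y'(1) y(1)] \<theta>_cls[OF V y'(1)] \<beta>_me[OF V z(1)] y y' c z by simp
    then show "connecting R M ra R' i q P \<epsilon> V c t" unfolding con using y z by blast
  qed
qed

text \<open>Bijectivity of \<open>\<theta>\<close> in degree 1 gives exactly one \<open>c\<close>
  over \<open>\<beta> V t\<close>, so the description in \<open>sqz_elext\<close> denotes
  it.\<close>

lemma ein_S: assumes V: "V \<in> proj R" and t: "t \<in> carrier (MV V)"
  shows "ein S 1 V t \<in> carrier (val D 1 V) \<and> \<theta> 1 V (ein S 1 V t) = \<beta> V t"
proof -
  have "\<beta> V t \<in> carrier (val C 1 V)" using mod_hom_closed[OF \<beta>_hom[OF V] t] by simp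
  then have "\<beta> V t \<in> \<theta> 1 V ` carrier (val D 1 V)" using bij_betw_imp_surj_on[OF \<theta>_bij[OF V, of 1]] by simp
  then obtain c where c: "c \<in> carrier (val D 1 V)" "\<theta> 1 V c = \<beta> V t" by auto
  have "\<exists>!c. c \<in> carrier (val D 1 V) \<and> \<theta> 1 V c = \<beta> V t"
  proof (rule ex1I[of _ c])
    show "d = c" if "d \<in> carrier (val D 1 V) \<and> \<theta> 1 V d = \<beta> V t" for d
      using inj_onD[OF bij_betw_imp_inj_on[OF \<theta>_bij[OF V, of 1]], of d c] that c by simp
  qed (use c in blast)
  then have "\<exists>!c. connecting R M ra R' i q P \<epsilon> V c t" by (simp add: connecting_iff[OF V t])
  then have "connecting R M ra R' i q P \<epsilon> V (THE c. connecting R M ra R' i q P \<epsilon> V c t) t" by (rule theI')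
  moreover have "ein S 1 V t = (THE c. connecting R M ra R' i q P \<epsilon> V c t)"
    using t by (simp add: sqz_elext_def Let_def)
  ultimately show ?thesis using connecting_iff[OF V t] by simp
qed

lemma S_elem:
  assumes inj: "\<And>V. V \<in> proj R \<Longrightarrow> inj_on (\<beta> V) (carrier (MV V))"
  shows "S \<in> elem_exts R M ra" and "\<theta> \<in> elext_maps R M ra S ext"
proof -
  have s: "emid S = D" "emid ext = C" "epr ext = aug" by (simp_all add: sqz_elext_def ext_def Let_def)
  have epr0: "epr S n V = (if n = 0 then restrict (adj (val P 0 V) V (\<epsilon> V)) (carrier (val D 0 V))
    else zero_map (val D n V) (val (stalk 0 incl_fctr) n V))" for n V
    by (simp add: sqz_elext_def Let_def adj_def)
  have einz: "ein S n V = zero_map (val (stalk 1 (bimod_fctr R M ra)) n V) (val D n V)" if "n \<noteq> 1" for n V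
    using that by (simp add: sqz_elext_def Let_def)
  have ein1: "ein S 1 V \<in> extensional (carrier (MV V))" for V
    by (simp add: sqz_elext_def Let_def)
  note md = functor_module[OF complex_functor[OF D_complex]]
  have "epr S n V x = aug n V (\<theta> n V x)" if V: "V \<in> proj R" and x: "x \<in> carrier (val D n V)" for n V x
  proof (cases "n = 0")
    case True
    then show ?thesis using x by (simp add: epr0 aug_def \<theta>_def)
  next
    case False
    then show ?thesis using x aug_nonzero[OF V False, of "\<theta> n V x"] mod_hom_closed[OF \<theta>_hom[OF V] x]
      by (simp add: epr0 stalk_ob)
  qed
  moreover have "epr S n V \<in> extensional (carrier (val D n V))" for n V by (simp add: epr0 zero_map_def)
  moreover have "ein S n V x \<in> carrier (val D n V) \<and> \<theta> n V (ein S n V x) = ein ext n V x"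
    if V: "V \<in> proj R" and x: "x \<in> carrier (val (stalk 1 (bimod_fctr R M ra)) n V)" for n V x
  proof (cases "n = 1")
    case True
    then show ?thesis using ein_S[OF V] x by (simp add: stalk_ob ext_def)
  next
    case False
    interpret m: module R "val D n V" by (rule md[OF V])
    show ?thesis using einz[OF False, of V] x False mod_hom_zero[OF \<theta>_hom[OF V] md[OF V]] TT_module[OF L_mod[OF V]]
      by (simp add: ext_def)
  qed
  moreover have "ein S n V \<in> extensional (carrier (val (stalk 1 (bimod_fctr R M ra)) n V))" for n V
    using ein1 einz[of n V] by (cases "n = 1") (auto simp: stalk_ob zero_map_def)
  ultimately show "S \<in> elem_exts R M ra" "\<theta> \<in> elext_maps R M ra S ext"
    using elem_exts_transport[OF ext_elem[OF inj], of S \<theta>] D_complex \<theta>_chain \<theta>_bij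
    unfolding s by blast+
qed

end

section \<open>Free modules\<close>

text \<open>Finitely supported functions. The carrier is written in the shape of
  \<open>lepoll_restricted_funspace\<close>, from which its size is estimated.\<close>

definition raw_free_md :: "'u ring \<Rightarrow> 's set \<Rightarrow> ('u, 's \<Rightarrow> 'u) module" where
  "raw_free_md R S = \<lparr>carrier = {c. c ` S \<subseteq> carrier R \<and> {s. c s \<noteq> \<zero>\<^bsub>R\<^esub>} \<subseteq> S \<and> finite {s. c s \<noteq> \<zero>\<^bsub>R\<^esub>}},
     mult = \<lambda>_ _. undefined, one = undefined, zero = \<lambda>_. \<zero>\<^bsub>R\<^esub>,
     add = \<lambda>c d s. c s \<oplus>\<^bsub>R\<^esub> d s, smult = \<lambda>r c s. r \<otimes>\<^bsub>R\<^esub> c s\<rparr>"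

definition free_md :: "'u ring \<Rightarrow> 's set \<Rightarrow> 'u md" where
  "free_md R S = resize (raw_free_md R S)"

definition free_gen :: "'u ring \<Rightarrow> 's set \<Rightarrow> 's \<Rightarrow> 'u" where
  "free_gen R S s = emb (raw_free_md R S) (\<lambda>t. if t = s \<and> s \<in> S then \<one>\<^bsub>R\<^esub> else \<zero>\<^bsub>R\<^esub>)"

definition free_ext :: "'u ring \<Rightarrow> 's set \<Rightarrow> 'u md \<Rightarrow> ('s \<Rightarrow> 'u) \<Rightarrow> 'u \<Rightarrow> 'u" where
  "free_ext R S T g = (\<lambda>x\<in>carrier (free_md R S). let c = inv_into (carrier (raw_free_md R S)) (emb (raw_free_md R S)) x in
     \<Oplus>\<^bsub>T\<^esub>s\<in>{s. c s \<noteq> \<zero>\<^bsub>R\<^esub>}. c s \<odot>\<^bsub>T\<^esub> g s)"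

text \<open>A finitely supported function is determined by a finite set of pairs, and an infinite
  type has as many finite sets of pairs as elements.\<close>

lemma ex_emb_free:
  assumes "S \<lesssim> (UNIV :: 'u set)"
  shows "\<exists>h :: ('s \<Rightarrow> 'u) \<Rightarrow> 'u. inj_on h (carrier (raw_free_md (R :: ('u :: infinite) ring) S))"
proof -
  obtain e :: "'s \<Rightarrow> 'u" where e: "inj_on e S" using assms by (auto simp: lepoll_def)
  have inf: "infinite (UNIV :: ('u \<times> 'u) set)"
    using infinite_UNIV[where ?'a = 'u] by (simp add: finite_prod)
  have "carrier (raw_free_md R S) \<lesssim> {f. f ` S \<subseteq> carrier R \<and> {x. f x \<noteq> \<zero>\<^bsub>R\<^esub>} \<subseteq> S \<and> finite {x. f x \<noteq> \<zero>\<^bsub>R\<^esub>}}"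
    by (rule subset_imp_lepoll) (auto simp: raw_free_md_def)
  also have "\<dots> \<lesssim> Fpow (S \<times> carrier R)" by (rule lepoll_restricted_funspace)
  also have "\<dots> \<lesssim> Fpow (UNIV :: ('u \<times> 'u) set)"
    unfolding lepoll_def
  proof (intro exI conjI)
    have "inj_on (map_prod e (\<lambda>x. x)) (S \<times> carrier R)" using e by (auto simp: inj_on_def)
    then show "inj_on ((`) (map_prod e (\<lambda>x. x))) (Fpow (S \<times> carrier R))"
      by (rule inj_on_subset[OF inj_on_image_Pow]) (auto simp: Fpow_def)
  qed (auto simp: Fpow_def)
  also have "\<dots> \<lesssim> (UNIV :: ('u \<times> 'u) set)" by (rule eqpoll_imp_lepoll[OF eqpoll_Fpow[OF inf]])
  also have "\<dots> \<lesssim> (UNIV :: 'u set)"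
    using card_of_Times_same_infinite[OF infinite_UNIV[where ?'a = 'u]]
    by (simp add: eqpoll_iff_card_of_ordIso eqpoll_imp_lepoll)
  finally show ?thesis by (auto simp: lepoll_def)
qed

locale free_module = cring R for R :: "('u :: infinite) ring" (structure) +
  fixes S :: "'s set"
  assumes S_small: "S \<lesssim> (UNIV :: 'u set)"
begin

abbreviation "X \<equiv> raw_free_md R S"
abbreviation "h \<equiv> emb X :: ('s \<Rightarrow> 'u) \<Rightarrow> 'u"

lemmas rs = resize_simps[OF ex_emb_free[OF S_small, of R], folded free_md_def]

lemma X_iff: "c \<in> carrier X \<longleftrightarrow> (\<forall>s\<in>S. c s \<in> carrier R) \<and> (\<forall>s. s \<notin> S \<longrightarrow> c s = \<zero>) \<and> finite {s. c s \<noteq> \<zero>}"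
  by (auto simp: raw_free_md_def)

lemma X_closed: "c \<in> carrier X \<Longrightarrow> c s \<in> carrier R"
  by (cases "s \<in> S") (auto simp: X_iff)

lemma X_simps [simp]: "\<zero>\<^bsub>X\<^esub> = (\<lambda>_. \<zero>)" "c \<oplus>\<^bsub>X\<^esub> d = (\<lambda>s. c s \<oplus> d s)" "r \<odot>\<^bsub>X\<^esub> c = (\<lambda>s. r \<otimes> c s)"
  by (simp_all add: raw_free_md_def)

lemma X_add: "\<lbrakk>c \<in> carrier X; d \<in> carrier X\<rbrakk> \<Longrightarrow> c \<oplus>\<^bsub>X\<^esub> d \<in> carrier X"
  unfolding X_iff by (auto intro!: finite_subset[of _ "{s. c s \<noteq> \<zero>} \<union> {s. d s \<noteq> \<zero>}"])

lemma X_smult: "\<lbrakk>r \<in> carrier R; c \<in> carrier X\<rbrakk> \<Longrightarrow> r \<odot>\<^bsub>X\<^esub> c \<in> carrier X"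
  unfolding X_iff by (auto intro!: finite_subset[of _ "{s. c s \<noteq> \<zero>}"])

lemma X_zero: "\<zero>\<^bsub>X\<^esub> \<in> carrier X"
  by (simp add: X_iff)

lemma X_module: "module R X"
proof (rule moduleI)
  have neg: "\<exists>d\<in>carrier X. d \<oplus>\<^bsub>X\<^esub> c = \<zero>\<^bsub>X\<^esub>" if c: "c \<in> carrier X" for c
  proof (rule bexI)
    show "(\<ominus> \<one>) \<odot>\<^bsub>X\<^esub> c \<oplus>\<^bsub>X\<^esub> c = \<zero>\<^bsub>X\<^esub>" using X_closed[OF c] by (auto simp: l_minus l_neg)
  qed (rule X_smult[OF _ c], simp)
  show "abelian_group X"
    by (rule abelian_groupI) (use X_add X_zero neg X_closed in \<open>auto simp: a_ac\<close>)
qed (use X_smult X_closed cring_axioms in \<open>auto simp: l_distr r_distr m_assoc\<close>)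

lemma free_md_module: "module R (free_md R S)"
  by (rule module_image[OF X_module, of h]) (use rs in auto)

interpretation free_md: module R "free_md R S" by (rule free_md_module)

definition \<delta> :: "'s \<Rightarrow> 's \<Rightarrow> 'u" where
  "\<delta> s = (\<lambda>t. if t = s \<and> s \<in> S then \<one> else \<zero>)"

lemma \<delta>_X: "\<delta> s \<in> carrier X"
  unfolding X_iff \<delta>_def by (auto intro!: finite_subset[of _ "{s}"])

lemma free_gen_h: "free_gen R S s = h (\<delta> s)" by (simp add: free_gen_def \<delta>_def)

lemma free_gen_closed [simp]: "free_gen R S s \<in> carrier (free_md R S)"
  using \<delta>_X by (simp add: free_gen_h rs)

lemma free_gen_notin: "s \<notin> S \<Longrightarrow> free_gen R S s = \<zero>\<^bsub>free_md R S\<^esub>"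
  by (simp add: free_gen_h rs \<delta>_def)

lemma free_md_induct [consumes 1, case_names zero bas add smult]:
  assumes x: "x \<in> carrier (free_md R S)"
    and z: "P \<zero>\<^bsub>free_md R S\<^esub>" and b: "\<And>s. s \<in> S \<Longrightarrow> P (free_gen R S s)"
    and a: "\<And>x y. \<lbrakk>x \<in> carrier (free_md R S); y \<in> carrier (free_md R S); P x; P y\<rbrakk> \<Longrightarrow> P (x \<oplus>\<^bsub>free_md R S\<^esub> y)"
    and s: "\<And>r x. \<lbrakk>r \<in> carrier R; x \<in> carrier (free_md R S); P x\<rbrakk> \<Longrightarrow> P (r \<odot>\<^bsub>free_md R S\<^esub> x)"
  shows "P x"
proof -
  have "\<forall>c\<in>carrier X. {s. c s \<noteq> \<zero>} \<subseteq> A \<longrightarrow> P (h c)" if "finite A" for A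
    using that
  proof (induction A)
    case empty
    have "c = \<zero>\<^bsub>X\<^esub>" if "{s. c s \<noteq> \<zero>} \<subseteq> {}" for c using that by auto
    then show ?case using z rs(3) by metis
  next
    case (insert a A)
    show ?case
    proof (intro ballI impI)
      fix c assume c: "c \<in> carrier X" and sub: "{s. c s \<noteq> \<zero>} \<subseteq> insert a A"
      \<comment> \<open>The coordinate at \<open>a\<close> is split off: \<open>c\<close> is the sum
        of a function supported in \<open>A\<close> and a multiple of one generator. If
        \<open>a\<close> is outside \<open>S\<close>, both the coordinate and the generator are
        zero.\<close>
      define d where "d = c(a := \<zero>)"
      have d: "d \<in> carrier X" "{s. d s \<noteq> \<zero>} \<subseteq> A" using c sub
        by (auto simp: X_iff d_def split: if_splits intro!: finite_subset[of _ "{s. c s \<noteq> \<zero>}"])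
      have e: "c = d \<oplus>\<^bsub>X\<^esub> (c a \<odot>\<^bsub>X\<^esub> \<delta> a)"
      proof
        fix t
        have "c a = \<zero>" if "a \<notin> S" using c that by (simp add: X_iff)
        then show "c t = (d \<oplus>\<^bsub>X\<^esub> (c a \<odot>\<^bsub>X\<^esub> \<delta> a)) t"
          using X_closed[OF c, of a] X_closed[OF c, of t] by (auto simp: d_def \<delta>_def)
      qed
      have ca: "c a \<in> carrier R" by (rule X_closed[OF c])
      have Pd: "P (h d)" using insert.IH d by blast
      have Pb: "P (free_gen R S a)" using b z free_gen_notin by metis
      have "h c = h d \<oplus>\<^bsub>free_md R S\<^esub> (c a \<odot>\<^bsub>free_md R S\<^esub> free_gen R S a)"
        unfolding free_gen_h rs(5)[OF \<delta>_X] rs(4)[OF d(1) X_smult[OF ca \<delta>_X]] e[symmetric] ..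
      moreover have "h d \<in> carrier (free_md R S)" using d by (simp add: rs(2))
      ultimately show "P (h c)" using a[OF _ free_md.smult_closed[OF ca free_gen_closed] Pd s[OF ca free_gen_closed Pb]] by simp
    qed
  qed
  then have "P (h c)" if "c \<in> carrier X" for c using that by (auto simp: X_iff)
  then show ?thesis using x by (auto simp: rs(2))
qed

lemma free_md_hom_eqI:
  assumes T: "module R T" and f: "f \<in> mod_hom R (free_md R S) T" and g: "g \<in> mod_hom R (free_md R S) T"
    and e: "\<And>s. s \<in> S \<Longrightarrow> f (free_gen R S s) = g (free_gen R S s)"
  shows "f = g"
proof (rule mod_hom_eqI[OF f g])
  fix x assume "x \<in> carrier (free_md R S)"
  then show "f x = g x"
    by (induction rule: free_md_induct)
       (use e mod_hom_zero[OF f free_md_module T] mod_hom_zero[OF g free_md_module T] in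
         \<open>auto simp: mod_hom_add[OF f] mod_hom_add[OF g] mod_hom_smult[OF f] mod_hom_smult[OF g]\<close>)
qed

lemma free_ext_facts:
  assumes T: "module R T" and g: "\<And>s. s \<in> S \<Longrightarrow> g s \<in> carrier T"
  shows free_ext_hom: "free_ext R S T g \<in> mod_hom R (free_md R S) T"
    and free_ext_gen: "\<And>s. s \<in> S \<Longrightarrow> free_ext R S T g (free_gen R S s) = g s"
proof -
  interpret T: module R T by (rule T)
  have fh: "free_ext R S T g (h c) = (\<Oplus>\<^bsub>T\<^esub>s\<in>{s. c s \<noteq> \<zero>}. c s \<odot>\<^bsub>T\<^esub> g s)" if "c \<in> carrier X" for c
    using that rs(1) by (simp add: free_ext_def rs(2))
  have tm: "c s \<odot>\<^bsub>T\<^esub> g s \<in> carrier T" if "c \<in> carrier X" "s \<in> S" for c s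
    using g X_closed that by simp
  \<comment> \<open>The sum may run over any finite set that contains the support. This allows two
    elements with different supports to be added over the union of the supports.\<close>
  have fA: "free_ext R S T g (h c) = (\<Oplus>\<^bsub>T\<^esub>s\<in>A. c s \<odot>\<^bsub>T\<^esub> g s)"
    if c: "c \<in> carrier X" and A: "finite A" "{s. c s \<noteq> \<zero>} \<subseteq> A" "A \<subseteq> S" for c A
    unfolding fh[OF c] using A tm[OF c] g
    by (intro T.add.finprod_mono_neutral_cong_left) auto
  have fin: "finite {s. c s \<noteq> \<zero>}" "{s. c s \<noteq> \<zero>} \<subseteq> S" if "c \<in> carrier X" for c
    using that by (auto simp: X_iff)
  show "free_ext R S T g \<in> mod_hom R (free_md R S) T"
  proof (rule mod_homI)
    fix x assume "x \<in> carrier (free_md R S)"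
    then obtain c where c: "c \<in> carrier X" "x = h c" by (auto simp: rs(2))
    show "free_ext R S T g x \<in> carrier T"
      unfolding c(2) fh[OF c(1)] using fin[OF c(1)] tm[OF c(1)] by (intro T.finsum_closed) auto
    { fix y assume "y \<in> carrier (free_md R S)"
      then obtain d where d: "d \<in> carrier X" "y = h d" by (auto simp: rs(2))
      define A where "A = {s. c s \<noteq> \<zero>} \<union> {s. d s \<noteq> \<zero>}"
      have A: "finite A" "A \<subseteq> S" using fin[OF c(1)] fin[OF d(1)] by (auto simp: A_def)
      have "x \<oplus>\<^bsub>free_md R S\<^esub> y = h (c \<oplus>\<^bsub>X\<^esub> d)" using c d by (simp add: rs(4))
      also have "free_ext R S T g \<dots> = (\<Oplus>\<^bsub>T\<^esub>s\<in>A. (c \<oplus>\<^bsub>X\<^esub> d) s \<odot>\<^bsub>T\<^esub> g s)"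
        by (rule fA[OF X_add[OF c(1) d(1)] A(1) _ A(2)]) (auto simp: A_def)
      also have "\<dots> = (\<Oplus>\<^bsub>T\<^esub>s\<in>A. c s \<odot>\<^bsub>T\<^esub> g s \<oplus>\<^bsub>T\<^esub> d s \<odot>\<^bsub>T\<^esub> g s)"
        using A g X_closed[OF c(1)] X_closed[OF d(1)] by (intro T.finsum_cong') (auto simp: T.smult_l_distr subset_iff)
      also have "\<dots> = (\<Oplus>\<^bsub>T\<^esub>s\<in>A. c s \<odot>\<^bsub>T\<^esub> g s) \<oplus>\<^bsub>T\<^esub> (\<Oplus>\<^bsub>T\<^esub>s\<in>A. d s \<odot>\<^bsub>T\<^esub> g s)"
        using A tm[OF c(1)] tm[OF d(1)] by (intro T.finsum_addf) auto
      also have "(\<Oplus>\<^bsub>T\<^esub>s\<in>A. c s \<odot>\<^bsub>T\<^esub> g s) = free_ext R S T g x"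
        unfolding c(2) by (rule fA[OF c(1) A(1) _ A(2), symmetric]) (auto simp: A_def)
      also have "(\<Oplus>\<^bsub>T\<^esub>s\<in>A. d s \<odot>\<^bsub>T\<^esub> g s) = free_ext R S T g y"
        unfolding d(2) by (rule fA[OF d(1) A(1) _ A(2), symmetric]) (auto simp: A_def)
      finally show "free_ext R S T g (x \<oplus>\<^bsub>free_md R S\<^esub> y) = free_ext R S T g x \<oplus>\<^bsub>T\<^esub> free_ext R S T g y" . }
    { fix r assume r: "r \<in> carrier R"
      define A where "A = {s. c s \<noteq> \<zero>}"
      have A: "finite A" "A \<subseteq> S" using fin[OF c(1)] by (auto simp: A_def)
      have "r \<odot>\<^bsub>free_md R S\<^esub> x = h (r \<odot>\<^bsub>X\<^esub> c)" using c by (simp add: rs(5))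
      also have "free_ext R S T g \<dots> = (\<Oplus>\<^bsub>T\<^esub>s\<in>A. (r \<odot>\<^bsub>X\<^esub> c) s \<odot>\<^bsub>T\<^esub> g s)"
        by (rule fA[OF X_smult[OF r c(1)] A(1) _ A(2)]) (use r in \<open>auto simp: A_def\<close>)
      also have "\<dots> = (\<Oplus>\<^bsub>T\<^esub>s\<in>A. r \<odot>\<^bsub>T\<^esub> (c s \<odot>\<^bsub>T\<^esub> g s))"
        using A g X_closed[OF c(1)] r by (intro T.finsum_cong') (auto simp: T.smult_assoc1 subset_iff)
      also have "\<dots> = r \<odot>\<^bsub>T\<^esub> (\<Oplus>\<^bsub>T\<^esub>s\<in>A. c s \<odot>\<^bsub>T\<^esub> g s)"
        using A tm[OF c(1)] r by (intro T.finsum_smult_ldistr[symmetric]) auto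
      also have "(\<Oplus>\<^bsub>T\<^esub>s\<in>A. c s \<odot>\<^bsub>T\<^esub> g s) = free_ext R S T g x"
        unfolding c(2) by (rule fA[OF c(1) A(1) _ A(2), symmetric]) (auto simp: A_def)
      finally show "free_ext R S T g (r \<odot>\<^bsub>free_md R S\<^esub> x) = r \<odot>\<^bsub>T\<^esub> free_ext R S T g x" . }
  qed (simp add: free_ext_def)
  show "free_ext R S T g (free_gen R S s) = g s" if s: "s \<in> S" for s
  proof -
    have "free_ext R S T g (h (\<delta> s)) = (\<Oplus>\<^bsub>T\<^esub>t\<in>{s}. \<delta> s t \<odot>\<^bsub>T\<^esub> g t)"
      by (rule fA[OF \<delta>_X]) (use s in \<open>auto simp: \<delta>_def split: if_splits\<close>)
    also have "\<dots> = g s" using s g[OF s] by (simp add: \<delta>_def)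
    finally show ?thesis by (simp add: free_gen_h)
  qed
qed

end

section \<open>Free functors\<close>

text \<open>
  An index outside \<open>S V\<close> stands for zero: \<open>free_gen\<close> vanishes there, so \<open>act\<close> may leave \<open>S\<close>.
\<close>

definition free_fctr :: "'u ring \<Rightarrow> ('u md \<Rightarrow> 's set) \<Rightarrow> ('u md \<Rightarrow> 'u md \<Rightarrow> ('u \<Rightarrow> 'u) \<Rightarrow> 's \<Rightarrow> 's) \<Rightarrow> 'u fctr" where
  "free_fctr R' S act = \<lparr>fobj = \<lambda>V. free_md R' (S V),
     farr = \<lambda>V W f. free_ext R' (S V) (free_md R' (S W)) (\<lambda>s. free_gen R' (S W) (act V W f s))\<rparr>"

lemma free_fctr_simps [simp]: "fobj (free_fctr R' S act) V = free_md R' (S V)"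
  by (simp add: free_fctr_def)

text \<open>\<open>act\<close> is in effect a partial action, where leaving the index set means
  becoming zero. \<open>act_zero\<close> says that what has become zero stays zero under later maps;
  with \<open>act_comp\<close> this is functoriality on generators.\<close>

locale free_functor =
  fixes R R' :: "('u :: infinite) ring" and S :: "'u md \<Rightarrow> 's set" and act
  assumes R'_cring: "cring R'"
    and small: "\<And>V. V \<in> proj R \<Longrightarrow> S V \<lesssim> (UNIV :: 'u set)"
    and act_id: "\<And>V s. \<lbrakk>V \<in> proj R; s \<in> S V\<rbrakk> \<Longrightarrow> act V V (\<lambda>x\<in>carrier V. x) s = s"
    and act_comp: "\<And>U V W f g s. \<lbrakk>U \<in> proj R; V \<in> proj R; W \<in> proj R; f \<in> mod_hom R U V; g \<in> mod_hom R V W;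
      s \<in> S U; act U V f s \<in> S V\<rbrakk> \<Longrightarrow> act U W (compose (carrier U) g f) s = act V W g (act U V f s)"
    and act_zero: "\<And>U V W f g s. \<lbrakk>U \<in> proj R; V \<in> proj R; W \<in> proj R; f \<in> mod_hom R U V; g \<in> mod_hom R V W;
      s \<in> S U; act U V f s \<notin> S V\<rbrakk> \<Longrightarrow> act U W (compose (carrier U) g f) s \<notin> S W"
    and S_pointed: "\<And>V. \<lbrakk>V \<in> proj R; carrier V = {\<zero>\<^bsub>V\<^esub>}\<rbrakk> \<Longrightarrow> S V = {}"
begin

abbreviation "FF \<equiv> free_fctr R' S act"

lemma free_module: "V \<in> proj R \<Longrightarrow> free_module R' (S V)"
  using R'_cring small by (simp add: free_module_def free_module_axioms_def)

lemma FF_hom: assumes VW: "V \<in> proj R" "W \<in> proj R"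
  shows "farr FF V W f \<in> mod_hom R' (free_md R' (S V)) (free_md R' (S W))"
    and "s \<in> S V \<Longrightarrow> farr FF V W f (free_gen R' (S V) s) = free_gen R' (S W) (act V W f s)"
proof -
  interpret V: free_module R' "S V" by (rule free_module[OF VW(1)])
  interpret W: free_module R' "S W" by (rule free_module[OF VW(2)])
  show "farr FF V W f \<in> mod_hom R' (free_md R' (S V)) (free_md R' (S W))"
    and "s \<in> S V \<Longrightarrow> farr FF V W f (free_gen R' (S V) s) = free_gen R' (S W) (act V W f s)"
    using V.free_ext_facts[OF W.free_md_module] by (auto simp: free_fctr_def)
qed

lemma FF_functor: "FF \<in> functors R R'"
proof (rule functorsI)
  fix V assume V: "V \<in> proj R"
  interpret V: free_module R' "S V" by (rule free_module[OF V])
  show "module R' (fobj FF V)" using V.free_md_module by simp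
  define e where "e = (\<lambda>x\<in>carrier V. x)"
  have "farr FF V V e = (\<lambda>x\<in>carrier (free_md R' (S V)). x)"
    by (rule V.free_md_hom_eqI[OF V.free_md_module FF_hom(1)[OF V V] mod_hom_id[OF V.free_md_module]])
       (use FF_hom(2)[OF V V] act_id[OF V, folded e_def] in simp)
  then show "farr FF V V (\<lambda>x\<in>carrier V. x) x = x" if "x \<in> carrier (fobj FF V)" for x
    using that by (simp add: e_def[symmetric])
  show "carrier (fobj FF V) = {\<zero>\<^bsub>fobj FF V\<^esub>}" if z: "carrier V = {\<zero>\<^bsub>V\<^esub>}"
  proof -
    interpret m: module R' "free_md R' (S V)" by (rule V.free_md_module)
    have "x = \<zero>\<^bsub>free_md R' (S V)\<^esub>" if "x \<in> carrier (free_md R' (S V))" for x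
      using that
    proof (induction rule: V.free_md_induct)
      case (bas s)
      then show ?case using S_pointed[OF V z] by blast
    qed auto
    then show ?thesis by auto
  qed
next
  fix V W f assume "V \<in> proj R" "W \<in> proj R" "f \<in> mod_hom R V W"
  then show "farr FF V W f \<in> mod_hom R' (fobj FF V) (fobj FF W)" using FF_hom(1) by simp
next
  fix U V W f g x
  assume UVW: "U \<in> proj R" "V \<in> proj R" "W \<in> proj R" and fg: "f \<in> mod_hom R U V" "g \<in> mod_hom R V W"
    and "x \<in> carrier (fobj FF U)"
  then have x: "x \<in> carrier (free_md R' (S U))" by simp
  interpret U: free_module R' "S U" by (rule free_module[OF UVW(1)])
  interpret V: free_module R' "S V" by (rule free_module[OF UVW(2)])
  interpret W: free_module R' "S W" by (rule free_module[OF UVW(3)])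
  note h1 = FF_hom[OF UVW(1,2), where f = f] and h2 = FF_hom[OF UVW(2,3), where f = g]
    and h3 = FF_hom[OF UVW(1,3), where f = "compose (carrier U) g f"]
  have "farr FF U W (compose (carrier U) g f) = compose (carrier (free_md R' (S U))) (farr FF V W g) (farr FF U V f)"
  proof (rule U.free_md_hom_eqI[OF W.free_md_module h3(1) mod_hom_compose[OF h1(1) h2(1) U.free_md_module]])
    fix s assume s: "s \<in> S U"
    show "farr FF U W (compose (carrier U) g f) (free_gen R' (S U) s) =
      compose (carrier (free_md R' (S U))) (farr FF V W g) (farr FF U V f) (free_gen R' (S U) s)"
    proof (cases "act U V f s \<in> S V")
      case True
      then show ?thesis using h1(2)[OF s] h2(2)[OF True] h3(2)[OF s] act_comp[OF UVW fg s True] by (simp add: compose_eq)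
    next
      case False
      then show ?thesis using h1(2)[OF s] h3(2)[OF s] act_zero[OF UVW fg s False] mod_hom_zero[OF h2(1) V.free_md_module W.free_md_module]
        by (simp add: compose_eq V.free_gen_notin W.free_gen_notin)
    qed
  qed
  then show "farr FF U W (compose (carrier U) g f) x = farr FF V W g (farr FF U V f x)"
    using x by (simp add: compose_eq)
qed

end

section \<open>The free functor on the underlying pointed set\<close>

context sqz
begin

text \<open>Tensoring with a free module gives a direct sum of copies of \<open>M\<close>, on which
  \<open>j\<close> is \<open>i\<close> in each coordinate, and \<open>i\<close> is
  injective.\<close>

lemma free_flat:
  assumes fr: "free_module R' S"
  shows "inj_on (j (free_md R' S)) (carrier (MT (free_md R' S)))"
proof -
  interpret S: free_module R' S by (rule fr)
  let ?N = "free_md R' S"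
  note Nm = S.free_md_module
  interpret N: module R' ?N by (rule Nm)
  interpret T: tensor_data R M ra' R' ?N by (rule MT_data[OF Nm])
  interpret TM: module R "MT ?N" by (rule T.T_module)
  note R'm = self_md_module[OF R'_cring]
  \<comment> \<open>The coordinate functions of the free module; below, \<open>cz s\<close> is the
    corresponding coordinate \<open>M \<otimes> N \<rightarrow> M\<close>. The equation
    \<open>i (cz s z) = co s (j z)\<close> says that \<open>j\<close> acts coordinatewise.\<close>
  define co where "co s = free_ext R' S (self_md R') (\<lambda>t. if t = s then \<one>\<^bsub>R'\<^esub> else \<zero>\<^bsub>R'\<^esub>)" for s
  have co_hom: "co s \<in> mod_hom R' ?N (self_md R')" for s
    unfolding co_def by (rule S.free_ext_hom[OF R'm]) auto
  have co_bas: "co s (free_gen R' S t) = (if t = s then \<one>\<^bsub>R'\<^esub> else \<zero>\<^bsub>R'\<^esub>)" if "t \<in> S" for s t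
    unfolding co_def by (rule S.free_ext_gen[OF R'm _ that]) auto
  have co_closed: "co s x \<in> carrier R'" if "x \<in> carrier ?N" for s x
    using mod_hom_closed[OF co_hom that] by simp
  have co_add: "co s (x \<oplus>\<^bsub>?N\<^esub> y) = co s x \<oplus>\<^bsub>R'\<^esub> co s y" if "x \<in> carrier ?N" "y \<in> carrier ?N" for s x y
    using mod_hom_add[OF co_hom that] by simp
  have co_smult: "co s (r \<odot>\<^bsub>?N\<^esub> x) = r \<otimes>\<^bsub>R'\<^esub> co s x" if "r \<in> carrier R'" "x \<in> carrier ?N" for s r x
    using mod_hom_smult[OF co_hom that] by simp
  have co_zero: "co s \<zero>\<^bsub>?N\<^esub> = \<zero>\<^bsub>R'\<^esub>" for s using mod_hom_zero[OF co_hom Nm R'm] by simp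
  define cz where "cz s = tens_lift M ra' R' ?N M (\<lambda>m x. q (co s x) \<odot>\<^bsub>M\<^esub> m)" for s
  have bal: "T.balanced M (\<lambda>m x. q (co s x) \<odot>\<^bsub>M\<^esub> m)" for s
    by (rule T.balancedI)
       (use M.abelian_group_axioms co_closed in
         \<open>auto simp: M.smult_r_distr M.smult_l_distr co_add co_smult q_add q_mult ra_eq M.smult_assoc1[symmetric] R.m_comm\<close>)
  note cz_closed = T.lift_closed[OF bal, folded cz_def] and cz_add = T.lift_add[OF bal, folded cz_def]
    and cz_mt = T.lift_t[OF bal, folded cz_def]
  have cz_zero: "cz s \<zero>\<^bsub>MT ?N\<^esub> = \<zero>\<^bsub>M\<^esub>" for s
    by (rule additive_zero[OF T.T_group M.abelian_group_axioms cz_closed cz_add])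
  have i_cz: "i (cz s z) = co s (j ?N z)" if "z \<in> carrier (MT ?N)" for s z
    using that
  proof (induction rule: T.tensor_induct)
    case (pure m x)
    then show ?case
      by (simp add: cz_mt j_pure[OF Nm Nm] co_smult i_smult[symmetric] co_closed R'.m_comm)
  next
    case (add x y)
    then show ?case
      by (simp add: cz_add j_add[OF Nm Nm] co_add j_closed[OF Nm Nm] i_add cz_closed)
  qed
  let ?s = "\<lambda>z B. (\<Oplus>\<^bsub>MT ?N\<^esub>s\<in>B. mt ?N (cz s z) (free_gen R' S s))"
  \<comment> \<open>\<open>Z z\<close> says that \<open>z\<close> is the sum of its coordinates. It
    asks for this over all large finite sets of indices instead of over the support, so that it
    passes to sums without a comparison of supports.\<close>
  define Z where "Z z \<longleftrightarrow> (\<exists>A. finite A \<and> A \<subseteq> S \<and> (\<forall>B. finite B \<and> A \<subseteq> B \<and> B \<subseteq> S \<longrightarrow> z = ?s z B))" for z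
  have Z_add: "Z (x \<oplus>\<^bsub>MT ?N\<^esub> y)" if xy: "x \<in> carrier (MT ?N)" "y \<in> carrier (MT ?N)" and Z: "Z x" "Z y" for x y
  proof -
    obtain A where A: "finite A" "A \<subseteq> S" "\<And>B. finite B \<Longrightarrow> A \<subseteq> B \<Longrightarrow> B \<subseteq> S \<Longrightarrow> x = ?s x B" using Z(1) by (auto simp: Z_def)
    obtain A' where A': "finite A'" "A' \<subseteq> S" "\<And>B. finite B \<Longrightarrow> A' \<subseteq> B \<Longrightarrow> B \<subseteq> S \<Longrightarrow> y = ?s y B" using Z(2) by (auto simp: Z_def)
    have "x \<oplus>\<^bsub>MT ?N\<^esub> y = ?s (x \<oplus>\<^bsub>MT ?N\<^esub> y) B" if B: "finite B" "A \<union> A' \<subseteq> B" "B \<subseteq> S" for B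
    proof -
      have "?s (x \<oplus>\<^bsub>MT ?N\<^esub> y) B = (\<Oplus>\<^bsub>MT ?N\<^esub>s\<in>B. mt ?N (cz s x) (free_gen R' S s) \<oplus>\<^bsub>MT ?N\<^esub> mt ?N (cz s y) (free_gen R' S s))"
        using xy cz_closed by (intro TM.finsum_cong') (auto simp: cz_add T.t_add_l)
      also have "\<dots> = ?s x B \<oplus>\<^bsub>MT ?N\<^esub> ?s y B"
        using xy cz_closed by (intro TM.finsum_addf) auto
      also have "\<dots> = x \<oplus>\<^bsub>MT ?N\<^esub> y" using A(3)[of B] A'(3)[of B] B by simp
      finally show ?thesis ..
    qed
    then show ?thesis unfolding Z_def using A A' by (intro exI[of _ "A \<union> A'"]) auto
  qed
  have Z_pure: "\<forall>m\<in>carrier M. Z (mt ?N m x)" if "x \<in> carrier ?N" for x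
    using that
  proof (induction rule: S.free_md_induct)
    case zero
    show ?case
    proof
      fix m assume m: "m \<in> carrier M"
      have "?s (mt ?N m \<zero>\<^bsub>?N\<^esub>) B = (\<Oplus>\<^bsub>MT ?N\<^esub>s\<in>B. \<zero>\<^bsub>MT ?N\<^esub>)" for B
        using m by (intro TM.finsum_cong') (auto simp: cz_zero)
      then show "Z (mt ?N m \<zero>\<^bsub>?N\<^esub>)" using m by (auto simp: Z_def intro!: exI[of _ "{}"])
    qed
  next
    case (bas t)
    show ?case
    proof
      fix m assume m: "m \<in> carrier M"
      have c: "cz s (mt ?N m (free_gen R' S t)) = (if s = t then m else \<zero>\<^bsub>M\<^esub>)" for s
        using m bas by (auto simp: cz_mt co_bas)
      have "?s (mt ?N m (free_gen R' S t)) B = mt ?N m (free_gen R' S t)" if B: "finite B" "t \<in> B" for B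
      proof -
        have "?s (mt ?N m (free_gen R' S t)) B =
            (\<Oplus>\<^bsub>MT ?N\<^esub>s\<in>B. if t = s then mt ?N m (free_gen R' S s) else \<zero>\<^bsub>MT ?N\<^esub>)"
          using m by (intro TM.finsum_cong') (auto simp: c)
        also have "\<dots> = mt ?N m (free_gen R' S t)"
          using m B by (intro TM.add.finprod_singleton) auto
        finally show ?thesis .
      qed
      then show "Z (mt ?N m (free_gen R' S t))" using bas by (auto simp: Z_def intro!: exI[of _ "{t}"])
    qed
  next
    case (add x y)
    then show ?case using Z_add by (simp add: T.t_add_r)
  next
    case (smult r x)
    show ?case
    proof
      fix m assume m: "m \<in> carrier M"
      have "mt ?N m (r \<odot>\<^bsub>?N\<^esub> x) = mt ?N (ra m (q r)) x" using T.t_bal[OF m smult(1,2)] by simp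
      then show "Z (mt ?N m (r \<odot>\<^bsub>?N\<^esub> x))" using smult m T.ra_closed[OF m smult(1)] by simp
    qed
  qed
  have Z: "Z z" if "z \<in> carrier (MT ?N)" for z
    using that by (induction rule: T.tensor_induct) (use Z_pure Z_add in auto)
  have ker: "z = \<zero>\<^bsub>MT ?N\<^esub>" if z: "z \<in> carrier (MT ?N)" "j ?N z = \<zero>\<^bsub>?N\<^esub>" for z
  proof -
    have "i (cz s z) = i \<zero>\<^bsub>M\<^esub>" for s using i_cz[OF z(1)] z(2) co_zero by simp
    then have c: "cz s z = \<zero>\<^bsub>M\<^esub>" for s using inj_onD[OF i_inj] cz_closed[OF z(1)] M.zero_closed by blast
    obtain A where "finite A" "A \<subseteq> S" "z = ?s z A" using Z[OF z(1)] unfolding Z_def by blast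
    moreover have "?s z A = (\<Oplus>\<^bsub>MT ?N\<^esub>s\<in>A. \<zero>\<^bsub>MT ?N\<^esub>)" by (intro TM.finsum_cong') (auto simp: c)
    ultimately show ?thesis by simp
  qed
  show ?thesis
  proof (rule inj_onI)
    fix x y assume xy: "x \<in> carrier (MT ?N)" "y \<in> carrier (MT ?N)" "j ?N x = j ?N y"
    have "j ?N (\<ominus>\<^bsub>MT ?N\<^esub> y) = \<ominus>\<^bsub>?N\<^esub> j ?N y"
      by (rule additive_neg[OF T.T_group N.abelian_group_axioms j_closed[OF Nm Nm] j_add[OF Nm Nm] xy(2)])
    then have "j ?N (x \<ominus>\<^bsub>MT ?N\<^esub> y) = \<zero>\<^bsub>?N\<^esub>"
      using xy j_closed[OF Nm Nm xy(2)] by (simp add: a_minus_def j_add[OF Nm Nm] N.r_neg)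
    then show "x = y" using ker[of "x \<ominus>\<^bsub>MT ?N\<^esub> y"] TM.diff_zero_iff xy by simp
  qed
qed

end

text \<open>Write \<open>t\<close> as \<open>me V z\<close>. If \<open>\<beta>\<close> kills
  \<open>t\<close>, then \<open>j z\<close> lies in \<open>I K\<close> for the kernel
  \<open>K\<close>, so it equals \<open>j w\<close> with \<open>w\<close> coming from
  \<open>M \<otimes> K\<close>. Flatness gives that \<open>z\<close> is the image of
  \<open>w\<close>, and \<open>me\<close> kills that image because \<open>\<epsilon>\<close>
  vanishes on \<open>K\<close>.\<close>

lemma (in cover) inj_\<beta>_flat:
  assumes V: "V \<in> proj R" and flat: "inj_on (j (fobj F V)) (carrier (MT (fobj F V)))"
  shows "inj_on (\<beta> V) (carrier (MV V))"
proof -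
  note Fm = F_mod[OF V] and Lm = L_mod[OF V, of 1]
  interpret V: module R V by (rule proj_module[OF V])
  interpret T: tensor_data R M ra R V by (rule MV_data[OF proj_module[OF V]])
  interpret TM: module R "MV V" by (rule T.T_module)
  interpret TL: tensor_data R M ra' R' "L 1 V" by (rule MT_data[OF Lm])
  interpret TLM: module R "MT (L 1 V)" by (rule TL.T_module)
  interpret C1: module R "TT (L 1 V)" by (rule TT_module[OF Lm])
  define inc where "inc = (\<lambda>x\<in>lay 1 V. x)"
  have inc: "inc \<in> mod_hom R' (L 1 V) (fobj F V)"
    by (rule mod_homI) (use lay_sub[OF V] submodD[OF lay_submod[OF V]] in \<open>auto simp: inc_def\<close>)
  \<comment> \<open>The map \<open>M \<otimes> K \<rightarrow> M \<otimes> F V\<close> induced by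
    the inclusion. It need not be injective, and only its compatibility with \<open>j\<close> and
    \<open>me\<close> is used.\<close>
  define \<iota> where "\<iota> = tens_right M ra' R' (L 1 V) (fobj F V) inc"
  have \<iota>: "\<iota> \<in> mod_hom R (MT (L 1 V)) (MT (fobj F V))"
    unfolding \<iota>_def by (rule tens_right_mod_hom[OF MT_data[OF Lm] Fm inc])
  have \<iota>_mt: "\<iota> (mt (L 1 V) m k) = mt (fobj F V) m k" if "m \<in> carrier M" "k \<in> lay 1 V" for m k
    using tens_right_tens[OF MT_data[OF Lm] Fm inc, of m k] that by (simp add: \<iota>_def inc_def)
  have w: "j (fobj F V) (\<iota> w) = j (L 1 V) w \<and> me V (\<iota> w) = \<zero>\<^bsub>MV V\<^esub>" if "w \<in> carrier (MT (L 1 V))" for w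
    using that
  proof (induction rule: TL.tensor_induct)
    case (pure m k)
    then have k: "k \<in> lay 1 V" by simp
    then have "k \<in> carrier (fobj F V)" "\<epsilon> V k = \<zero>\<^bsub>V\<^esub>" by (auto simp: lay_def)
    then show ?case using pure \<iota>_mt[OF pure(1) k] j_pure[OF Fm Fm pure(1)] j_pure[OF Lm Lm pure(1), of k] me_mt[OF V pure(1)] by simp
  next
    case (add x y)
    then show ?case
      by (simp add: mod_hom_add[OF \<iota>] mod_hom_closed[OF \<iota>] j_add[OF Fm Fm] j_add[OF Lm Lm] me_add[OF V])
  qed
  have ker: "t = \<zero>\<^bsub>MV V\<^esub>" if t: "t \<in> carrier (MV V)" "\<beta> V t = \<zero>\<^bsub>TT (L 1 V)\<^esub>" for t
  proof -
    obtain z where z: "z \<in> carrier (MT (fobj F V))" "t = me V z" using me_onto[OF V t(1)] by blast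
    have "j (fobj F V) z \<in> lay 1 V" "ot (L 1 V) (j (fobj F V) z) = \<zero>\<^bsub>TT (L 1 V)\<^esub>"
      using \<beta>_me[OF V z(1)] t z by auto
    then have "j (fobj F V) z \<in> I (L 1 V)" using ot_zero_iff[OF Lm] by simp
    then obtain w where w': "w \<in> carrier (MT (L 1 V))" "j (fobj F V) z = j (L 1 V) w" by (auto simp: I_def)
    then have "z = \<iota> w" using w[OF w'(1)] inj_onD[OF flat _ z(1) mod_hom_closed[OF \<iota> w'(1)]] by simp
    then show ?thesis using w[OF w'(1)] z by simp
  qed
  show ?thesis
  proof (rule inj_onI)
    fix x y assume xy: "x \<in> carrier (MV V)" "y \<in> carrier (MV V)" "\<beta> V x = \<beta> V y"
    have "\<beta> V (x \<ominus>\<^bsub>MV V\<^esub> y) = \<zero>\<^bsub>TT (L 1 V)\<^esub>"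
      using mod_hom_diff[OF \<beta>_hom[OF V] TM.module_axioms C1.module_axioms xy(1,2)] xy(3) mod_hom_closed[OF \<beta>_hom[OF V] xy(2)]
      by (simp add: C1.diff_zero_iff)
    then show "x = y" using ker[of "x \<ominus>\<^bsub>MV V\<^esub> y"] TM.diff_zero_iff xy by simp
  qed
qed

section \<open>The functor \<open>Q\<close>, its brackets and its augmentation\<close>

context sqz
begin

text \<open>Dividing out \<open>R'[0]\<close> is done by removing zero from the basis, which makes
  the functor pointed. A map that sends a basis vector to zero kills its bracket, by the convention
  on indices outside the basis.\<close>

definition Q :: "'u fctr" where
  "Q = free_fctr R' (\<lambda>V. carrier V - {\<zero>\<^bsub>V\<^esub>}) (\<lambda>V W f v. f v)"

definition br :: "'u md \<Rightarrow> 'u \<Rightarrow> 'u" where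
  "br V v = free_gen R' (carrier V - {\<zero>\<^bsub>V\<^esub>}) v"

definition \<epsilon>Q :: "'u ntrans" where
  "\<epsilon>Q V = free_ext R' (carrier V - {\<zero>\<^bsub>V\<^esub>}) (restrict_scalars q V) (\<lambda>v. v)"

lemma Q_obj: "fobj Q V = free_md R' (carrier V - {\<zero>\<^bsub>V\<^esub>})" by (simp add: Q_def)

lemma Q_free_functor: "free_functor R R' (\<lambda>V. carrier V - {\<zero>\<^bsub>V\<^esub>}) (\<lambda>V W f v. f v)"
proof
  show "carrier V - {\<zero>\<^bsub>V\<^esub>} \<lesssim> (UNIV :: 'u set)" for V :: "'u md" by (rule subset_imp_lepoll) simp
  fix U V W f g s
  assume "U \<in> proj R" "V \<in> proj R" "W \<in> proj R" "f \<in> mod_hom R U V" "g \<in> mod_hom R V W"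
    "s \<in> carrier U - {\<zero>\<^bsub>U\<^esub>}" "f s \<notin> carrier V - {\<zero>\<^bsub>V\<^esub>}"
  then show "compose (carrier U) g f s \<notin> carrier W - {\<zero>\<^bsub>W\<^esub>}"
    using mod_hom_closed[of f R U V s] mod_hom_zero[of g R V W] by (simp add: compose_eq proj_module)
qed (auto simp: R'_cring compose_eq)

lemma Q_free: "free_module R' (carrier (V :: 'u md) - {\<zero>\<^bsub>V\<^esub>})"
  using R'_cring by (auto simp: free_module_def free_module_axioms_def intro!: subset_imp_lepoll)

lemmas Q_functor = free_functor.FF_functor[OF Q_free_functor, folded Q_def]

lemma br_closed [simp]: "br V v \<in> carrier (fobj Q V)"
  using free_module.free_gen_closed[OF Q_free] by (simp add: br_def Q_obj)

lemma br_zero [simp]: "br V \<zero>\<^bsub>V\<^esub> = \<zero>\<^bsub>fobj Q V\<^esub>"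
  using free_module.free_gen_notin[OF Q_free] by (simp add: br_def Q_obj)

lemma Q_mod: "module R' (fobj Q V)"
  using free_module.free_md_module[OF Q_free] by (simp add: Q_obj)

lemma Q_arr: "\<lbrakk>V \<in> proj R; W \<in> proj R; f \<in> mod_hom R V W; v \<in> carrier V\<rbrakk> \<Longrightarrow>
    farr Q V W f (br V v) = br W (f v)"
proof (cases "v = \<zero>\<^bsub>V\<^esub>")
  case True
  assume *: "V \<in> proj R" "W \<in> proj R" "f \<in> mod_hom R V W" "v \<in> carrier V"
  show ?thesis using True arr_zero[OF Q_functor *(1-3)] mod_hom_zero[OF *(3)] * by (simp add: proj_module)
next
  case False
  assume *: "V \<in> proj R" "W \<in> proj R" "f \<in> mod_hom R V W" "v \<in> carrier V"
  show ?thesis using free_functor.FF_hom(2)[OF Q_free_functor *(1,2), of v f] False * by (simp add: Q_def br_def)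
qed

lemma Q_induct [consumes 1, case_names zero br add smult]:
  assumes x: "x \<in> carrier (fobj Q V)"
    and z: "P \<zero>\<^bsub>fobj Q V\<^esub>" and b: "\<And>v. v \<in> carrier V \<Longrightarrow> P (br V v)"
    and a: "\<And>x y. \<lbrakk>x \<in> carrier (fobj Q V); y \<in> carrier (fobj Q V); P x; P y\<rbrakk> \<Longrightarrow> P (x \<oplus>\<^bsub>fobj Q V\<^esub> y)"
    and s: "\<And>r x. \<lbrakk>r \<in> carrier R'; x \<in> carrier (fobj Q V); P x\<rbrakk> \<Longrightarrow> P (r \<odot>\<^bsub>fobj Q V\<^esub> x)"
  shows "P x"
  by (rule free_module.free_md_induct[OF Q_free x[unfolded Q_obj]])
     (use z b a s in \<open>auto simp: Q_obj br_def\<close>)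

definition Qext :: "'u md \<Rightarrow> 'u md \<Rightarrow> ('u \<Rightarrow> 'u) \<Rightarrow> 'u \<Rightarrow> 'u" where
  "Qext V T g = free_ext R' (carrier V - {\<zero>\<^bsub>V\<^esub>}) T g"

lemma Qext_facts:
  assumes T: "module R' T" and g: "\<And>v. v \<in> carrier V \<Longrightarrow> g v \<in> carrier T" and z: "g \<zero>\<^bsub>V\<^esub> = \<zero>\<^bsub>T\<^esub>"
  shows Qext_hom: "Qext V T g \<in> mod_hom R' (fobj Q V) T"
    and Qext_br: "\<And>v. v \<in> carrier V \<Longrightarrow> Qext V T g (br V v) = g v"
proof -
  show h: "Qext V T g \<in> mod_hom R' (fobj Q V) T"
    unfolding Qext_def Q_obj by (rule free_module.free_ext_hom[OF Q_free T]) (use g in auto)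
  show "Qext V T g (br V v) = g v" if "v \<in> carrier V" for v
  proof (cases "v = \<zero>\<^bsub>V\<^esub>")
    case True
    then show ?thesis using mod_hom_zero[OF h Q_mod T] z by simp
  next
    case False
    then show ?thesis using free_module.free_ext_gen[OF Q_free T, of V g v] that g by (simp add: Qext_def br_def)
  qed
qed

lemma \<epsilon>Q_facts:
  assumes V: "V \<in> proj R"
  shows \<epsilon>Q_hom: "\<epsilon>Q V \<in> mod_hom R' (fobj Q V) (restrict_scalars q V)"
    and \<epsilon>Q_br: "\<And>v. v \<in> carrier V \<Longrightarrow> \<epsilon>Q V (br V v) = v"
  using Qext_facts[OF restrict_scalars_module[OF proj_module[OF V] q_hom R'_cring], of V "\<lambda>v. v"]
  by (auto simp: \<epsilon>Q_def Qext_def)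

lemma \<epsilon>Q_nat: "\<epsilon>Q \<in> nat_trans R R' Q push_incl"
proof (rule nat_transI)
  fix V W f x assume VW: "V \<in> proj R" "W \<in> proj R" "f \<in> mod_hom R V W" and x: "x \<in> carrier (fobj Q V)"
  interpret Q: module R' "fobj Q V" by (rule Q_mod)
  note h = functor_arr[OF Q_functor VW] and eV = \<epsilon>Q_hom[OF VW(1)] and eW = \<epsilon>Q_hom[OF VW(2)]
  show "\<epsilon>Q W (farr Q V W f x) = farr push_incl V W f (\<epsilon>Q V x)"
    using x
  proof (induction rule: Q_induct)
    case zero
    then show ?case
      using mod_hom_zero[OF h Q_mod Q_mod] mod_hom_zero[OF eV Q_mod] mod_hom_zero[OF eW Q_mod]
        mod_hom_zero[OF VW(3)] VW restrict_scalars_module[OF proj_module q_hom R'_cring] by (simp add: proj_module)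
  next
    case (br v)
    then show ?case using Q_arr[OF VW br] \<epsilon>Q_br[OF VW(1) br] \<epsilon>Q_br[OF VW(2) mod_hom_closed[OF VW(3) br]] by simp
  next
    case (add x y)
    then show ?case
      using mod_hom_add[OF h add(1,2)] mod_hom_closed[OF h] mod_hom_add[OF eV add(1,2)]
        mod_hom_add[OF eW, of "farr Q V W f x" "farr Q V W f y"] mod_hom_closed[OF eV]
        mod_hom_add[OF VW(3), of "\<epsilon>Q V x" "\<epsilon>Q V y"] by simp
  next
    case (smult r x)
    then show ?case
      using mod_hom_smult[OF h smult(1,2)] mod_hom_closed[OF h] mod_hom_smult[OF eV smult(1,2)]
        mod_hom_smult[OF eW smult(1), of "farr Q V W f x"] mod_hom_closed[OF eV]
        mod_hom_smult[OF VW(3), of "q r" "\<epsilon>Q V x"] by simp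
  qed
qed (use \<epsilon>Q_hom in simp)

sublocale Q: cover R R' M ra i q Q \<epsilon>Q
proof
  show "Q \<in> functors R R'" by (rule Q_functor)
  show "\<epsilon>Q \<in> nat_trans R R' Q push_incl" by (rule \<epsilon>Q_nat)
  fix V assume V: "V \<in> proj R"
  show "\<epsilon>Q V ` carrier (fobj Q V) = carrier V"
  proof
    show "\<epsilon>Q V ` carrier (fobj Q V) \<subseteq> carrier V" using mod_hom_closed[OF \<epsilon>Q_hom[OF V]] by auto
    show "carrier V \<subseteq> \<epsilon>Q V ` carrier (fobj Q V)"
      using \<epsilon>Q_br[OF V] by (metis br_closed image_eqI subsetI)
  qed
qed

lemma Q_inj: "V \<in> proj R \<Longrightarrow> inj_on (Q.\<beta> V) (carrier (MV V))"
  using free_flat[OF Q_free] by (intro Q.inj_\<beta>_flat) (simp_all add: Q_obj)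

lemma Q_elem: "Q.ext \<in> elem_exts R M ra"
  by (rule Q.ext_elem[OF Q_inj])

end

text \<open>Two maps of extensions link the resolution to \<open>Q\<close>: \<open>\<theta>\<close>
  into the extension of the cover \<open>P 0\<close>, and the map induced by a lift of
  \<open>\<epsilon>\<close> to \<open>Q\<close>.\<close>

lemma (in resolution) class_eq:
  "el_class R M ra (sqz_elext R M ra R' i q P \<epsilon>) = el_class R M ra Q.ext \<and> S \<in> elem_exts R M ra"
proof -
  have g: "\<epsilon>Q \<in> nat_trans R R' Q push_incl" by (rule \<epsilon>Q_nat)
  have pf: "push_incl \<in> functors R R'" by (rule push_fctr_functor[OF incl_fctr_functor q_hom R'_cring])
  have onto: "\<forall>V\<in>proj R. \<epsilon>Q V ` carrier (fobj Q V) = carrier (fobj push_incl V)" using Q.\<epsilon>_onto by simp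
  have "projective_fctr R R' (ob P 0)" using res by (simp add: proj_resolution_def)
  \<comment> \<open>Projectivity of \<open>P 0\<close> is applied to the surjection
    \<open>\<epsilon>Q\<close>, with \<open>\<epsilon>\<close> as the map to be lifted.\<close>
  then have "\<exists>f\<in>nat_trans R R' (ob P 0) Q. \<forall>V\<in>proj R. \<forall>x\<in>carrier (val P 0 V). \<epsilon>Q V (f V x) = \<epsilon> V x"
    unfolding projective_fctr_def
    by (elim conjE) (drule bspec[OF _ Q_functor], drule bspec[OF _ pf], drule bspec[OF _ g],
      drule bspec[OF _ \<epsilon>], erule mp, rule onto)
  then obtain f where f: "f \<in> nat_trans R R' (ob P 0) Q"
    "\<And>V x. \<lbrakk>V \<in> proj R; x \<in> carrier (val P 0 V)\<rbrakk> \<Longrightarrow> \<epsilon>Q V (f V x) = \<epsilon> V x"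
    by blast
  interpret m: cover_map R R' M ra i q "ob P 0" \<epsilon> Q \<epsilon>Q f
    by unfold_locales (use f in auto)
  have inj: "inj_on (\<beta> V) (carrier (MV V))" if "V \<in> proj R" for V
    by (rule m.inj_\<beta>[OF that Q_inj[OF that]])
  note S = S_elem[OF inj]
  let ?r = "{(E, E'). E \<in> elem_exts R M ra \<and> E' \<in> elem_exts R M ra \<and> elext_maps R M ra E E' \<noteq> {}}"
  have con: "el_connected R M ra = (?r \<union> ?r\<inverse>)\<^sup>*" by (simp add: el_connected_def Let_def)
  have 1: "(S, ext) \<in> ?r" using S ext_elem[OF inj] by blast
  have 2: "(ext, Q.ext) \<in> ?r" using m.ext_map ext_elem[OF inj] Q_elem by blast
  \<comment> \<open>Connectedness is the equivalence relation generated by maps, and a class is the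
    image of one element under it. Equality of classes thus needs a chain in both
    directions.\<close>
  have a: "(S, Q.ext) \<in> (?r \<union> ?r\<inverse>)\<^sup>*" using 1 2 by (meson UnCI r_into_rtrancl rtrancl_into_rtrancl)
  have b: "(Q.ext, S) \<in> (?r \<union> ?r\<inverse>)\<^sup>*" using 1 2 by (meson UnCI converseI r_into_rtrancl rtrancl_into_rtrancl)
  show ?thesis using a b S(1) unfolding el_class_def con by (auto intro: rtrancl_trans)
qed

section \<open>Finitely generated projective modules\<close>

definition span :: "'u ring \<Rightarrow> 'u md \<Rightarrow> 'u set \<Rightarrow> 'u set" where
  "span R V G = {v. \<exists>c\<in>G \<rightarrow> carrier R. v = (\<Oplus>\<^bsub>V\<^esub>g\<in>G. c g \<odot>\<^bsub>V\<^esub> g)}"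

lemma span_submod:
  assumes V: "module R V" and G: "finite G" "G \<subseteq> carrier V"
  shows "submod R V (span R V G)" and "G \<subseteq> span R V G"
proof -
  interpret V: module R V by fact
  have tm: "c g \<odot>\<^bsub>V\<^esub> g \<in> carrier V" if "c \<in> G \<rightarrow> carrier R" "g \<in> G" for c g
    using that G by auto
  show "submod R V (span R V G)"
    unfolding submod_def
  proof (intro conjI ballI subsetI)
    fix x assume "x \<in> span R V G"
    then obtain c where c: "c \<in> G \<rightarrow> carrier R" "x = (\<Oplus>\<^bsub>V\<^esub>g\<in>G. c g \<odot>\<^bsub>V\<^esub> g)" by (auto simp: span_def)
    show "x \<in> carrier V" unfolding c(2) using tm[OF c(1)] by (intro V.finsum_closed) auto
    { fix y assume "y \<in> span R V G"
      then obtain d where d: "d \<in> G \<rightarrow> carrier R" "y = (\<Oplus>\<^bsub>V\<^esub>g\<in>G. d g \<odot>\<^bsub>V\<^esub> g)" by (auto simp: span_def)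
      have "(\<Oplus>\<^bsub>V\<^esub>g\<in>G. (c g \<oplus>\<^bsub>R\<^esub> d g) \<odot>\<^bsub>V\<^esub> g) = (\<Oplus>\<^bsub>V\<^esub>g\<in>G. c g \<odot>\<^bsub>V\<^esub> g \<oplus>\<^bsub>V\<^esub> d g \<odot>\<^bsub>V\<^esub> g)"
        using c d G by (intro V.finsum_cong') (auto simp: V.smult_l_distr subset_iff Pi_iff)
      also have "\<dots> = x \<oplus>\<^bsub>V\<^esub> y" unfolding c(2) d(2) using tm[OF c(1)] tm[OF d(1)] by (intro V.finsum_addf) auto
      finally show "x \<oplus>\<^bsub>V\<^esub> y \<in> span R V G" using c d unfolding span_def
        by (intro CollectI bexI[of _ "\<lambda>g. c g \<oplus>\<^bsub>R\<^esub> d g"]) (auto simp: Pi_iff) }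
    { fix r assume r: "r \<in> carrier R"
      have "r \<odot>\<^bsub>V\<^esub> x = (\<Oplus>\<^bsub>V\<^esub>g\<in>G. r \<odot>\<^bsub>V\<^esub> (c g \<odot>\<^bsub>V\<^esub> g))"
        unfolding c(2) using tm[OF c(1)] r G by (intro V.finsum_smult_ldistr) auto
      also have "\<dots> = (\<Oplus>\<^bsub>V\<^esub>g\<in>G. (r \<otimes>\<^bsub>R\<^esub> c g) \<odot>\<^bsub>V\<^esub> g)"
        using c r G by (intro V.finsum_cong') (auto simp: V.smult_assoc1 subset_iff Pi_iff)
      finally show "r \<odot>\<^bsub>V\<^esub> x \<in> span R V G" using c r unfolding span_def
        by (intro CollectI bexI[of _ "\<lambda>g. r \<otimes>\<^bsub>R\<^esub> c g"]) (auto simp: Pi_iff) }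
  next
    have "(\<Oplus>\<^bsub>V\<^esub>g\<in>G. \<zero>\<^bsub>R\<^esub> \<odot>\<^bsub>V\<^esub> g) = (\<Oplus>\<^bsub>V\<^esub>g\<in>G. \<zero>\<^bsub>V\<^esub>)"
      using G by (intro V.finsum_cong') (auto simp: subset_iff)
    then show "\<zero>\<^bsub>V\<^esub> \<in> span R V G" unfolding span_def
      by (intro CollectI bexI[of _ "\<lambda>g. \<zero>\<^bsub>R\<^esub>"]) auto
  qed
  show "G \<subseteq> span R V G"
  proof
    fix h assume h: "h \<in> G"
    have "(\<Oplus>\<^bsub>V\<^esub>g\<in>G. (if h = g then \<one>\<^bsub>R\<^esub> else \<zero>\<^bsub>R\<^esub>) \<odot>\<^bsub>V\<^esub> g) = (\<Oplus>\<^bsub>V\<^esub>g\<in>G. if h = g then g else \<zero>\<^bsub>V\<^esub>)"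
      using G by (intro V.finsum_cong') (auto simp: subset_iff)
    also have "\<dots> = h" using h G by (intro V.add.finprod_singleton) auto
    finally show "h \<in> span R V G" unfolding span_def
      by (intro CollectI bexI[of _ "\<lambda>g. if h = g then \<one>\<^bsub>R\<^esub> else \<zero>\<^bsub>R\<^esub>"]) auto
  qed
qed

lemma fin_genI:
  assumes "finite G" "G \<subseteq> carrier V" "\<And>v. v \<in> carrier V \<Longrightarrow> v \<in> span R V G"
  shows "fin_gen R V"
  using assms unfolding fin_gen_def span_def by blast

lemma finsum_submod:
  assumes V: "module R V" and N: "submod R V N" and f: "\<And>g. g \<in> G \<Longrightarrow> f g \<in> N" and "finite G"
  shows "(\<Oplus>\<^bsub>V\<^esub>g\<in>G. f g) \<in> N"
proof -
  interpret V: module R V by fact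
  show ?thesis using \<open>finite G\<close> f
  proof (induction G)
    case empty
    then show ?case using submodD(2)[OF N] by simp
  next
    case (insert a G)
    have "f \<in> G \<rightarrow> carrier V" "f a \<in> carrier V" using insert.prems submodD(1)[OF N] by auto
    then show ?case using insert submodD(3)[OF N] by simp
  qed
qed

lemma proj_self:
  assumes R: "cring R" shows "self_md R \<in> proj R"
proof -
  interpret cring R by fact
  note m = self_md_module[OF R]
  have "fin_gen R (self_md R)"
  proof (rule fin_genI)
    let ?G = "{\<one>\<^bsub>R\<^esub>}"
    show "finite ?G" "?G \<subseteq> carrier (self_md R)" by auto
    then have s: "submod R (self_md R) (span R (self_md R) ?G)" "?G \<subseteq> span R (self_md R) ?G"
      by (rule span_submod[OF m])+
    show "v \<in> span R (self_md R) ?G" if "v \<in> carrier (self_md R)" for v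
      using submodD(4)[OF s(1), of v "\<one>\<^bsub>R\<^esub>"] s(2) that by simp
  qed
  moreover have "projective_md R (self_md R)"
    unfolding projective_md_def
  proof (intro allI ballI impI)
    fix A B :: "'a md" and g f
    assume g: "g \<in> mod_hom R A B" and f: "f \<in> mod_hom R (self_md R) B" and A: "module R A" and B: "module R B"
      and s: "g ` carrier A = carrier B"
    interpret A: module R A by fact
    have "f \<one>\<^bsub>R\<^esub> \<in> carrier B" using mod_hom_closed[OF f] by simp
    then obtain a where a: "a \<in> carrier A" "g a = f \<one>\<^bsub>R\<^esub>" using s by (metis imageE)
    have h: "restrict (\<lambda>r. r \<odot>\<^bsub>A\<^esub> a) (carrier (self_md R)) \<in> mod_hom R (self_md R) A"
      by (rule restrict_mod_homI[OF _ _ _ m]) (use a in \<open>auto simp: A.smult_l_distr A.smult_assoc1\<close>)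
    moreover have "g (r \<odot>\<^bsub>A\<^esub> a) = f r" if "r \<in> carrier R" for r
      using mod_hom_smult[OF g that a(1)] a(2) mod_hom_smult[OF f that, of "\<one>\<^bsub>R\<^esub>"] that by simp
    ultimately show "\<exists>h\<in>mod_hom R (self_md R) A. \<forall>x\<in>carrier (self_md R). g (h x) = f x"
      by (intro bexI[OF _ h]) simp
  qed
  ultimately show ?thesis using m by (simp add: proj_def)
qed

lemma proj_zero: "cring R \<Longrightarrow> zero_md \<in> proj R"
proof -
  assume R: "cring R"
  note m = zero_md_module[OF R]
  interpret m: module R zero_md by (rule m)
  have "fin_gen R zero_md"
    using span_submod(1)[OF m, of "{}"] by (intro fin_genI[of "{}"]) (auto dest: submodD(2))
  moreover have "projective_md R zero_md"
    unfolding projective_md_def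
    by (metis zero_map_mod_hom m mod_hom_zero carrier_zero_md singletonD)
  ultimately show ?thesis using m by (simp add: proj_def)
qed

text \<open>A zero map factors through the zero module, where a pointed functor vanishes. For
  functors that are not additive this is the only reason why zero maps go to zero.\<close>

lemma arr_zero_map:
  assumes R: "cring R" and F: "F \<in> functors R S" and VW: "V \<in> proj R" "W \<in> proj R" and x: "x \<in> carrier (fobj F V)"
  shows "farr F V W (zero_map V W) x = \<zero>\<^bsub>fobj F W\<^esub>"
proof -
  note Z = proj_zero[OF R]
  have a: "zero_map V zero_md \<in> mod_hom R V zero_md" and b: "zero_map zero_md W \<in> mod_hom R zero_md W"
    using VW Z by (auto intro: zero_map_mod_hom proj_module)
  have "zero_map V W = compose (carrier V) (zero_map zero_md W) (zero_map V zero_md)"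
    by (rule extensionalityI[of _ "carrier V"]) (auto simp: zero_map_def compose_def)
  then have e: "farr F V W (zero_map V W) x = farr F zero_md W (zero_map zero_md W) (farr F V zero_md (zero_map V zero_md) x)"
    using functor_comp[OF F VW(1) Z VW(2) a b x] by simp
  have "farr F V zero_md (zero_map V zero_md) x = \<zero>\<^bsub>fobj F zero_md\<^esub>"
    using arr_closed[OF F VW(1) Z a x] functor_pointed[OF F Z] by simp
  then show ?thesis using e arr_zero[OF F Z VW(2) b] by simp
qed

section \<open>The modules \<open>R^n\<close> and the presentation of projective modules as their
  retracts\<close>

definition std :: "('u :: infinite) ring \<Rightarrow> nat \<Rightarrow> 'u md" where
  "std R n = free_md R {..<n}"

lemma lessThan_small: "{..<n :: nat} \<lesssim> (UNIV :: ('u :: infinite) set)"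
  using infinite_le_lepoll[of "UNIV :: 'u set"] infinite_UNIV[where ?'a = 'u] subset_imp_lepoll[of "{..<n}" "UNIV :: nat set"]
  by (blast intro: lepoll_trans)

lemma std_free: "cring R \<Longrightarrow> free_module (R :: ('u :: infinite) ring) {..<n :: nat}"
  by (simp add: free_module_def free_module_axioms_def lessThan_small)

lemma std_proj:
  assumes R: "cring (R :: ('u :: infinite) ring)" shows "std R n \<in> proj R"
proof -
  interpret f: free_module R "{..<n}" by (rule std_free[OF R])
  note m = f.free_md_module[folded std_def]
  have "fin_gen R (std R n)"
  proof (rule fin_genI)
    let ?G = "free_gen R {..<n} ` {..<n}"
    show G: "finite ?G" "?G \<subseteq> carrier (std R n)" by (auto simp: std_def)
    note s = span_submod[OF m G]
    show "v \<in> span R (std R n) ?G" if "v \<in> carrier (std R n)" for v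
      using that unfolding std_def
      by (induction rule: f.free_md_induct) (use submodD[OF s(1)[unfolded std_def]] s(2)[unfolded std_def] in blast)+
  qed
  moreover have "projective_md R (std R n)"
    unfolding projective_md_def
  proof (intro allI ballI impI)
    fix A B :: "'u md" and g f
    assume g: "g \<in> mod_hom R A B" and f: "f \<in> mod_hom R (std R n) B" and A: "module R A" and B: "module R B"
      and s: "g ` carrier A = carrier B"
    have "\<exists>a. a \<in> carrier A \<and> g a = f (free_gen R {..<n} k)" for k
    proof -
      have "f (free_gen R {..<n} k) \<in> carrier B" using mod_hom_closed[OF f] by (simp add: std_def)
      then show ?thesis using s by (metis imageE)
    qed
    then obtain a where a: "\<And>k. a k \<in> carrier A \<and> g (a k) = f (free_gen R {..<n} k)" by metis
    define h where "h = free_ext R {..<n} A a"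
    have h: "h \<in> mod_hom R (std R n) A" "\<And>k. k \<in> {..<n} \<Longrightarrow> h (free_gen R {..<n} k) = a k"
      unfolding h_def std_def using f.free_ext_facts[OF A, of a] a by auto
    have "compose (carrier (std R n)) g h = f"
      unfolding std_def
      by (rule f.free_md_hom_eqI[OF B]) (use mod_hom_compose[OF h(1) g m] f h(2) a in \<open>auto simp: std_def compose_eq\<close>)
    then show "\<exists>h\<in>mod_hom R (std R n) A. \<forall>x\<in>carrier (std R n). g (h x) = f x"
      by (intro bexI[OF _ h(1)] ballI) (metis compose_eq)
  qed
  ultimately show ?thesis using m by (simp add: proj_def)
qed

lemma proj_retract:
  assumes R: "cring (R :: ('u :: infinite) ring)" and V: "V \<in> proj R"
  obtains n p s where "p \<in> mod_hom R (std R n) V" "s \<in> mod_hom R V (std R n)"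
    "\<And>v. v \<in> carrier V \<Longrightarrow> p (s v) = v"
proof -
  note Vm = proj_module[OF V]
  interpret V: module R V by (rule Vm)
  obtain G where G: "finite G" "G \<subseteq> carrier V"
    "\<And>v. v \<in> carrier V \<Longrightarrow> \<exists>c\<in>G \<rightarrow> carrier R. v = (\<Oplus>\<^bsub>V\<^esub>g\<in>G. c g \<odot>\<^bsub>V\<^esub> g)"
    using V by (auto simp: proj_def fin_gen_def)
  \<comment> \<open>The finite generating set is enumerated, so that \<open>std R n\<close> maps
    onto \<open>V\<close>; a section then comes from projectivity of \<open>V\<close>.\<close>
  obtain e :: "nat \<Rightarrow> 'u" and n where e: "G = e ` {..<n}"
    using G(1) by (metis finite_imp_nat_seg_image_inj_on lessThan_def)
  interpret f: free_module R "{..<n}" by (rule std_free[OF R])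
  define p where "p = free_ext R {..<n} V e"
  have p: "p \<in> mod_hom R (std R n) V" "\<And>k. k < n \<Longrightarrow> p (free_gen R {..<n} k) = e k"
    unfolding p_def std_def using f.free_ext_facts[OF Vm, of e] e G by auto
  note W = std_proj[OF R, of n]
  have sm: "submod R V (p ` carrier (std R n))" by (rule submod_image[OF proj_module[OF W] Vm p(1)])
  have Gs: "g \<in> p ` carrier (std R n)" if g: "g \<in> G" for g
  proof -
    obtain k where "k < n" "g = e k" using g e by auto
    then show ?thesis using p(2) by (intro image_eqI[of _ _ "free_gen R {..<n} k"]) (auto simp: std_def)
  qed
  have "v \<in> p ` carrier (std R n)" if v: "v \<in> carrier V" for v
  proof -
    obtain c where c: "c \<in> G \<rightarrow> carrier R" "v = (\<Oplus>\<^bsub>V\<^esub>g\<in>G. c g \<odot>\<^bsub>V\<^esub> g)" using G(3)[OF v] by blast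
    show ?thesis unfolding c(2)
      by (rule finsum_submod[OF Vm sm _ G(1)]) (rule submodD(4)[OF sm funcset_mem[OF c(1)] Gs])
  qed
  then have "p ` carrier (std R n) = carrier V" using mod_hom_closed[OF p(1)] by auto
  moreover have "projective_md R V" using V by (simp add: proj_def)
  ultimately obtain s where "s \<in> mod_hom R V (std R n)" "\<forall>x\<in>carrier V. p (s x) = (\<lambda>x\<in>carrier V. x) x"
    using p(1) mod_hom_id[OF Vm] proj_module[OF W] Vm unfolding projective_md_def by blast
  then show thesis using that[OF p(1)] by simp
qed

section \<open>Projective resolutions of functors\<close>

text \<open>For each \<open>n\<close> and each element \<open>x\<close> of \<open>F (R^n)\<close>
  there is one copy of the reduced free functor on \<open>Hom(R^n, -)\<close>, whose generators are
  the nonzero maps \<open>f\<close>. Only the modules \<open>R^n\<close> occur, because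
  \<open>proj R\<close> is too large to index generators inside \<open>'u\<close>; leaving out
  \<open>f = 0\<close> makes the functor pointed.\<close>

definition cov_set :: "('u :: infinite) ring \<Rightarrow> 'u fctr \<Rightarrow> 'u md \<Rightarrow> (nat \<times> 'u \<times> ('u \<Rightarrow> 'u)) set" where
  "cov_set R F V = {(n, x, f). x \<in> carrier (fobj F (std R n)) \<and> f \<in> mod_hom R (std R n) V \<and> f \<noteq> zero_map (std R n) V}"

definition cov :: "('u :: infinite) ring \<Rightarrow> 'u ring \<Rightarrow> 'u fctr \<Rightarrow> 'u fctr" where
  "cov R R' F = free_fctr R' (cov_set R F) (\<lambda>V W g (n, x, f). (n, x, compose (carrier (std R n)) g f))"

definition cov_map :: "('u :: infinite) ring \<Rightarrow> 'u ring \<Rightarrow> 'u fctr \<Rightarrow> 'u ntrans" where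
  "cov_map R R' F V = free_ext R' (cov_set R F V) (fobj F V) (\<lambda>(n, x, f). farr F (std R n) V f x)"

text \<open>A generator is encoded by a finite list over \<open>'u\<close>, and an infinite type is
  in bijection with the lists over it.\<close>

lemma cov_set_small:
  assumes R: "cring (R :: ('u :: infinite) ring)" and V: "V \<in> proj R"
  shows "cov_set R F V \<lesssim> (UNIV :: 'u set)"
proof -
  \<comment> \<open>The list consists of \<open>x\<close> and the values of \<open>f\<close> on the
    standard generators. Its length recovers \<open>n\<close>, and the values then determine
    \<open>f\<close>.\<close>
  let ?e = "\<lambda>(n, x, f). x # map (\<lambda>k. f (free_gen R {..<n} k)) [0..<n]"
  have "inj_on ?e (cov_set R F V)"
  proof (rule inj_onI)
    fix a b assume a: "a \<in> cov_set R F V" and b: "b \<in> cov_set R F V" and e: "?e a = ?e b"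
    obtain n x f where a': "a = (n, x, f)" by (cases a)
    obtain n' x' f' where b': "b = (n', x', f')" by (cases b)
    have "length (?e a) = length (?e b)" using e by simp
    then have n: "n' = n" by (simp add: a' b')
    interpret f: free_module R "{..<n}" by (rule std_free[OF R])
    have "f (free_gen R {..<n} k) = f' (free_gen R {..<n} k)" if "k < n" for k
      using e that by (simp add: a' b' n)
    moreover have "f \<in> mod_hom R (free_md R {..<n}) V" "f' \<in> mod_hom R (free_md R {..<n}) V"
      using a b by (auto simp: a' b' n cov_set_def std_def)
    ultimately have "f = f'" using f.free_md_hom_eqI[OF proj_module[OF V]] by simp
    then show "a = b" using e by (simp add: a' b' n)
  qed
  then have "cov_set R F V \<lesssim> (UNIV :: 'u list set)" by (auto simp: lepoll_def)
  moreover obtain h :: "'u list \<Rightarrow> 'u" where "bij h"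
    using lists_infinite_bij_betw_types[OF infinite_UNIV[where ?'a = 'u]] by blast
  then have "(UNIV :: 'u list set) \<lesssim> (UNIV :: 'u set)" by (auto simp: lepoll_def bij_def)
  ultimately show ?thesis by (rule lepoll_trans)
qed

lemma compose_zero_map:
  assumes g: "g \<in> mod_hom R V W" and V: "module R V" and W: "module R W"
  shows "compose (carrier U) g (zero_map U V) = zero_map U W"
  by (rule extensionalityI[of _ "carrier U"])
     (use mod_hom_zero[OF g V W] in \<open>auto simp: compose_def zero_map_def\<close>)

text \<open>A generator leaves the index set only by composing to a zero map, and composites of zero
  maps with further maps remain zero.\<close>

lemma cov_free_functor:
  assumes R: "cring (R :: ('u :: infinite) ring)" and R': "cring R'"
  shows "free_functor R R' (cov_set R F) (\<lambda>V W g (n, x, f). (n, x, compose (carrier (std R n)) g f))"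
proof (rule free_functor.intro)
  show "cring R'" by fact
  show "cov_set R F V \<lesssim> (UNIV :: 'u set)" if "V \<in> proj R" for V by (rule cov_set_small[OF R that])
next
  fix V s assume V: "V \<in> proj R" and s: "s \<in> cov_set R F V"
  obtain n x f where s': "s = (n, x, f)" by (cases s)
  have f: "f \<in> mod_hom R (std R n) V" using s by (simp add: s' cov_set_def)
  have "compose (carrier (std R n)) (\<lambda>x\<in>carrier V. x) f = f"
    by (rule extensionalityI[of _ "carrier (std R n)"]) (use mod_hom_ext[OF f] mod_hom_closed[OF f] in \<open>auto simp: compose_def\<close>)
  then show "(case s of (n, x, f) \<Rightarrow> (n, x, compose (carrier (std R n)) (\<lambda>x\<in>carrier V. x) f)) = s" by (simp add: s')
next
  fix U V W f g s
  assume UVW: "U \<in> proj R" "V \<in> proj R" "W \<in> proj R" and fg: "f \<in> mod_hom R U V" "g \<in> mod_hom R V W" and s: "s \<in> cov_set R F U"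
  obtain n x h where s': "s = (n, x, h)" by (cases s)
  let ?S = "std R n"
  have h: "h \<in> mod_hom R ?S U" "x \<in> carrier (fobj F ?S)" using s by (auto simp: s' cov_set_def)
  have as: "compose (carrier ?S) (compose (carrier U) g f) h = compose (carrier ?S) g (compose (carrier ?S) f h)"
    by (rule extensionalityI[of _ "carrier ?S"]) (use mod_hom_closed[OF h(1)] in \<open>auto simp: compose_def\<close>)
  show "(case s of (n, x, h) \<Rightarrow> (n, x, compose (carrier (std R n)) (compose (carrier U) g f) h)) =
      (case (case s of (n, x, h) \<Rightarrow> (n, x, compose (carrier (std R n)) f h)) of (n, x, h) \<Rightarrow> (n, x, compose (carrier (std R n)) g h))"
    by (simp add: s' as)
  assume "(case s of (n, x, h) \<Rightarrow> (n, x, compose (carrier (std R n)) f h)) \<notin> cov_set R F V"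
  then have "compose (carrier ?S) f h = zero_map ?S V"
    using h mod_hom_compose[OF h(1) fg(1) proj_module[OF std_proj[OF R]]] by (simp add: s' cov_set_def)
  then have "compose (carrier ?S) (compose (carrier U) g f) h = zero_map ?S W"
    unfolding as using compose_zero_map[OF fg(2) proj_module[OF UVW(2)] proj_module[OF UVW(3)]] by simp
  then show "(case s of (n, x, h) \<Rightarrow> (n, x, compose (carrier (std R n)) (compose (carrier U) g f) h)) \<notin> cov_set R F W"
    by (simp add: s' cov_set_def)
next
  fix V assume V: "V \<in> proj R" and z: "carrier V = {\<zero>\<^bsub>V\<^esub>}"
  have "f = zero_map (std R n) V" if f: "f \<in> mod_hom R (std R n) V" for n f
    by (rule extensionalityI[of _ "carrier (std R n)"])
       (use mod_hom_ext[OF f] mod_hom_closed[OF f] z in \<open>auto simp: zero_map_def\<close>)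
  then show "cov_set R F V = {}" by (auto simp: cov_set_def)
qed

section \<open>Covers by sums of representable functors\<close>

locale two_crings =
  fixes R R' :: "('u :: infinite) ring"
  assumes R_cring: "cring R" and R'_cring: "cring R'"
begin

lemma cov_functor: "cov R R' F \<in> functors R R'"
  unfolding cov_def by (rule free_functor.FF_functor[OF cov_free_functor[OF R_cring R'_cring]])

lemma cov_obj: "fobj (cov R R' F) V = free_md R' (cov_set R F V)" by (simp add: cov_def)

definition cov_gen :: "'u fctr \<Rightarrow> 'u md \<Rightarrow> nat \<Rightarrow> 'u \<Rightarrow> ('u \<Rightarrow> 'u) \<Rightarrow> 'u" where
  "cov_gen F V n x f = free_gen R' (cov_set R F V) (n, x, f)"

lemma cov_free: "V \<in> proj R \<Longrightarrow> free_module R' (cov_set R F V)"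
  using R'_cring cov_set_small[OF R_cring] by (auto simp: free_module_def free_module_axioms_def)

lemma cov_gen_closed [simp]: "V \<in> proj R \<Longrightarrow> cov_gen F V n x f \<in> carrier (fobj (cov R R' F) V)"
  using free_module.free_gen_closed[OF cov_free] by (simp add: cov_obj cov_gen_def)

lemma cov_gen_zero: "V \<in> proj R \<Longrightarrow> cov_gen F V n x (zero_map (std R n) V) = \<zero>\<^bsub>fobj (cov R R' F) V\<^esub>"
  using free_module.free_gen_notin[OF cov_free] by (simp add: cov_obj cov_gen_def cov_set_def)

lemma cov_arr:
  assumes VW: "V \<in> proj R" "W \<in> proj R" "g \<in> mod_hom R V W"
    and x: "x \<in> carrier (fobj F (std R n))" and f: "f \<in> mod_hom R (std R n) V"
  shows "farr (cov R R' F) V W g (cov_gen F V n x f) = cov_gen F W n x (compose (carrier (std R n)) g f)"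
proof (cases "f = zero_map (std R n) V")
  case True
  then show ?thesis using VW arr_zero[OF cov_functor VW, of F] compose_zero_map[OF VW(3)] by (simp add: cov_gen_zero proj_module)
next
  case False
  then show ?thesis using free_functor.FF_hom(2)[OF cov_free_functor[OF R_cring R'_cring, of F] VW(1,2), of "(n, x, f)" g] x f
    by (simp add: cov_def cov_gen_def) (simp add: cov_set_def)
qed

lemma cov_eqI:
  assumes V: "V \<in> proj R" and T: "module R' T" and f: "f \<in> mod_hom R' (fobj (cov R R' F) V) T"
    and g: "g \<in> mod_hom R' (fobj (cov R R' F) V) T"
    and e: "\<And>n x \<phi>. \<lbrakk>x \<in> carrier (fobj F (std R n)); \<phi> \<in> mod_hom R (std R n) V\<rbrakk> \<Longrightarrow> f (cov_gen F V n x \<phi>) = g (cov_gen F V n x \<phi>)"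
  shows "f = g"
  using free_module.free_md_hom_eqI[OF cov_free[OF V] T f[unfolded cov_obj] g[unfolded cov_obj]] e
  by (auto simp: cov_gen_def cov_set_def)

text \<open>The Yoneda lemma for a sum of representable functors: a natural transformation to
  \<open>A\<close> is obtained by freely choosing, for each \<open>n\<close> and \<open>x\<close>,
  the image \<open>a n x\<close> of the generator at the identity of \<open>R^n\<close>.\<close>

lemma cov_univ:
  assumes A: "A \<in> functors R R'"
    and a: "\<And>n x. x \<in> carrier (fobj F (std R n)) \<Longrightarrow> a n x \<in> carrier (fobj A (std R n))"
  defines "h \<equiv> \<lambda>V. free_ext R' (cov_set R F V) (fobj A V) (\<lambda>(n, x, f). farr A (std R n) V f (a n x))"
  shows cov_univ_nat: "h \<in> nat_trans R R' (cov R R' F) A"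
    and cov_univ_gen: "\<And>V n x f. \<lbrakk>V \<in> proj R; x \<in> carrier (fobj F (std R n)); f \<in> mod_hom R (std R n) V\<rbrakk> \<Longrightarrow>
      h V (cov_gen F V n x f) = farr A (std R n) V f (a n x)"
proof -
  note W = std_proj[OF R_cring]
  have ac: "farr A (std R n) V f (a n x) \<in> carrier (fobj A V)"
    if "V \<in> proj R" "x \<in> carrier (fobj F (std R n))" "f \<in> mod_hom R (std R n) V" for V n x f
    using arr_closed[OF A W that(1,3) a[OF that(2)]] .
  have h: "h V \<in> mod_hom R' (fobj (cov R R' F) V) (fobj A V)" if V: "V \<in> proj R" for V
    unfolding h_def cov_obj
    by (rule free_module.free_ext_hom[OF cov_free[OF V] functor_module[OF A V]]) (use ac[OF V] in \<open>auto simp: cov_set_def\<close>)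
  show hb: "h V (cov_gen F V n x f) = farr A (std R n) V f (a n x)"
    if V: "V \<in> proj R" and x: "x \<in> carrier (fobj F (std R n))" and f: "f \<in> mod_hom R (std R n) V" for V n x f
  proof (cases "f = zero_map (std R n) V")
    case True
    \<comment> \<open>The generator at the zero map is zero, so the formula requires that
      \<open>A\<close> sends the zero map to zero, which holds because \<open>A\<close> is
      pointed.\<close>
    then show ?thesis using mod_hom_zero[OF h[OF V] functor_module[OF cov_functor V] functor_module[OF A V]]
      arr_zero_map[OF R_cring A W V a[OF x]] by (simp add: cov_gen_zero[OF V])
  next
    case False
    then have s: "(n, x, f) \<in> cov_set R F V" using x f by (simp add: cov_set_def)
    have "free_ext R' (cov_set R F V) (fobj A V) (\<lambda>(n, x, f). farr A (std R n) V f (a n x)) (free_gen R' (cov_set R F V) (n, x, f)) =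
      (case (n, x, f) of (n, x, f) \<Rightarrow> farr A (std R n) V f (a n x))"
      by (rule free_module.free_ext_gen[OF cov_free[OF V] functor_module[OF A V] _ s])
         (use ac[OF V] in \<open>auto simp: cov_set_def\<close>)
    then show ?thesis by (simp add: h_def cov_gen_def)
  qed
  show "h \<in> nat_trans R R' (cov R R' F) A"
  proof (rule nat_transI)
    fix V W' k x assume VW: "V \<in> proj R" "W' \<in> proj R" "k \<in> mod_hom R V W'" and x: "x \<in> carrier (fobj (cov R R' F) V)"
    have "compose (carrier (fobj (cov R R' F) V)) (h W') (farr (cov R R' F) V W' k) =
      compose (carrier (fobj (cov R R' F) V)) (farr A V W' k) (h V)"
    proof (rule cov_eqI[OF VW(1) functor_module[OF A VW(2)]])
      fix n x \<phi> assume x: "x \<in> carrier (fobj F (std R n))" and \<phi>: "\<phi> \<in> mod_hom R (std R n) V"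
      show "compose (carrier (fobj (cov R R' F) V)) (h W') (farr (cov R R' F) V W' k) (cov_gen F V n x \<phi>) =
        compose (carrier (fobj (cov R R' F) V)) (farr A V W' k) (h V) (cov_gen F V n x \<phi>)"
        using VW cov_arr[OF VW x \<phi>] hb[OF VW(1) x \<phi>] hb[OF VW(2) x mod_hom_compose[OF \<phi> VW(3) proj_module[OF W]]]
          functor_comp[OF A W VW(1,2) \<phi> VW(3) a[OF x]] by (simp add: compose_eq)
    qed (use mod_hom_compose[OF functor_arr[OF cov_functor VW] h[OF VW(2)] functor_module[OF cov_functor VW(1)]]
          mod_hom_compose[OF h[OF VW(1)] functor_arr[OF A VW] functor_module[OF cov_functor VW(1)]] in auto)
    from fun_cong[OF this, of x] show "h W' (farr (cov R R' F) V W' k x) = farr A V W' k (h V x)"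
      using x by (simp add: compose_eq)
  qed (rule h)
qed

lemma cov_map_facts:
  assumes F: "F \<in> functors R R'"
  shows cov_map_nat: "cov_map R R' F \<in> nat_trans R R' (cov R R' F) F"
    and cov_map_gen: "\<And>V n x f. \<lbrakk>V \<in> proj R; x \<in> carrier (fobj F (std R n)); f \<in> mod_hom R (std R n) V\<rbrakk> \<Longrightarrow>
      cov_map R R' F V (cov_gen F V n x f) = farr F (std R n) V f x"
proof -
  have e: "cov_map R R' F = (\<lambda>V. free_ext R' (cov_set R F V) (fobj F V) (\<lambda>(n, x, f). farr F (std R n) V f x))"
    by (auto simp: cov_map_def)
  show "cov_map R R' F \<in> nat_trans R R' (cov R R' F) F"
    and "\<And>V n x f. \<lbrakk>V \<in> proj R; x \<in> carrier (fobj F (std R n)); f \<in> mod_hom R (std R n) V\<rbrakk> \<Longrightarrow>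
      cov_map R R' F V (cov_gen F V n x f) = farr F (std R n) V f x"
    unfolding e using cov_univ[OF F, of F "\<lambda>n x. x"] by auto
qed

text \<open>\<open>V\<close> is a retract of some \<open>R^n\<close>, with section \<open>s\<close>
  and projection \<open>p\<close>. An element \<open>v\<close> of \<open>F V\<close> is therefore
  \<open>F p\<close> applied to \<open>x = F s v\<close>, which is the value at the generator
  \<open>(n, x, p)\<close>.\<close>

lemma cov_map_onto:
  assumes F: "F \<in> functors R R'" and V: "V \<in> proj R"
  shows "cov_map R R' F V ` carrier (fobj (cov R R' F) V) = carrier (fobj F V)"
proof
  show "cov_map R R' F V ` carrier (fobj (cov R R' F) V) \<subseteq> carrier (fobj F V)"
    using nat_closed[OF cov_map_nat[OF F] V] by auto
  obtain n p s where ps: "p \<in> mod_hom R (std R n) V" "s \<in> mod_hom R V (std R n)"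
    "\<And>v. v \<in> carrier V \<Longrightarrow> p (s v) = v" by (rule proj_retract[OF R_cring V]) (rule that)
  note W = std_proj[OF R_cring, of n]
  have c: "compose (carrier V) p s = (\<lambda>x\<in>carrier V. x)"
    using ps(3) by (auto simp: compose_def)
  show "carrier (fobj F V) \<subseteq> cov_map R R' F V ` carrier (fobj (cov R R' F) V)"
  proof
    fix v assume v: "v \<in> carrier (fobj F V)"
    define x where "x = farr F V (std R n) s v"
    have x: "x \<in> carrier (fobj F (std R n))" unfolding x_def by (rule arr_closed[OF F V W ps(2) v])
    have "farr F (std R n) V p x = v"
      using functor_comp[OF F V W V ps(2,1) v] functor_id[OF F V v] by (simp add: x_def c)
    then show "v \<in> cov_map R R' F V ` carrier (fobj (cov R R' F) V)"
      using cov_map_gen[OF F V x ps(1)] V by (intro image_eqI[of _ _ "cov_gen F V n x p"]) auto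
  qed
qed

text \<open>By the universal property it suffices to lift the images of the generators at the
  identities of the \<open>R^n\<close>, one at a time.\<close>

lemma cov_projective: "projective_fctr R R' (cov R R' F)"
  unfolding projective_fctr_def
proof (intro conjI ballI impI)
  fix A G g f assume A: "A \<in> functors R R'" and G: "G \<in> functors R R'" and g: "g \<in> nat_trans R R' A G"
    and f: "f \<in> nat_trans R R' (cov R R' F) G" and s: "\<forall>V\<in>proj R. g V ` carrier (fobj A V) = carrier (fobj G V)"
  note W = std_proj[OF R_cring]
  define e where "e n = (\<lambda>x\<in>carrier (std R n). x)" for n
  have e: "e n \<in> mod_hom R (std R n) (std R n)" for n unfolding e_def by (rule mod_hom_id[OF proj_module[OF W]])
  have "\<exists>a. a \<in> carrier (fobj A (std R n)) \<and> g (std R n) a = f (std R n) (cov_gen F (std R n) n x (e n))" for n x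
    using nat_closed[OF f W[of n] cov_gen_closed[OF W]] s W by (metis imageE)
  then obtain a where a: "\<And>n x. a n x \<in> carrier (fobj A (std R n)) \<and> g (std R n) (a n x) = f (std R n) (cov_gen F (std R n) n x (e n))"
    by metis
  define h where "h V = free_ext R' (cov_set R F V) (fobj A V) (\<lambda>(n, x, f). farr A (std R n) V f (a n x))" for V
  have h: "h \<in> nat_trans R R' (cov R R' F) A"
    and hb: "\<And>V n x f. \<lbrakk>V \<in> proj R; x \<in> carrier (fobj F (std R n)); f \<in> mod_hom R (std R n) V\<rbrakk> \<Longrightarrow>
      h V (cov_gen F V n x f) = farr A (std R n) V f (a n x)"
    using cov_univ[OF A, of F a] a by (auto simp: h_def[abs_def])
  have "compose (carrier (fobj (cov R R' F) V)) (g V) (h V) = f V" if V: "V \<in> proj R" for V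
  proof (rule cov_eqI[OF V functor_module[OF G V]])
    show "compose (carrier (fobj (cov R R' F) V)) (g V) (h V) \<in> mod_hom R' (fobj (cov R R' F) V) (fobj G V)"
      by (rule mod_hom_compose[OF nat_hom[OF h V] nat_hom[OF g V] functor_module[OF cov_functor V]])
    show "f V \<in> mod_hom R' (fobj (cov R R' F) V) (fobj G V)" by (rule nat_hom[OF f V])
    fix n x \<phi> assume x: "x \<in> carrier (fobj F (std R n))" and \<phi>: "\<phi> \<in> mod_hom R (std R n) V"
    have "compose (carrier (std R n)) \<phi> (e n) = \<phi>"
      by (rule extensionalityI[of _ "carrier (std R n)"]) (use mod_hom_ext[OF \<phi>] in \<open>auto simp: compose_def e_def\<close>)
    \<comment> \<open>Every generator is the image of the one at the identity of \<open>R^n\<close>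
      under the map that labels it, so naturality carries the lifting equation to all of
      them.\<close>
    then have c: "farr (cov R R' F) (std R n) V \<phi> (cov_gen F (std R n) n x (e n)) = cov_gen F V n x \<phi>"
      using cov_arr[OF W V \<phi> x e] by simp
    have "g V (h V (cov_gen F V n x \<phi>)) = farr G (std R n) V \<phi> (g (std R n) (a n x))"
      using hb[OF V x \<phi>] nat_arr[OF g W V \<phi>] a by simp
    also have "\<dots> = f V (cov_gen F V n x \<phi>)" using a nat_arr[OF f W V \<phi> cov_gen_closed[OF W]] c by metis
    finally show "compose (carrier (fobj (cov R R' F) V)) (g V) (h V) (cov_gen F V n x \<phi>) = f V (cov_gen F V n x \<phi>)"
      using V by (simp add: compose_eq)
  qed
  then have "\<forall>V\<in>proj R. \<forall>x\<in>carrier (fobj (cov R R' F) V). g V (h V x) = f V x" by (metis compose_eq)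
  then show "\<exists>h\<in>nat_trans R R' (cov R R' F) A. \<forall>V\<in>proj R. \<forall>x\<in>carrier (fobj (cov R R' F) V). g V (h V x) = f V x"
    using h by blast
qed (rule cov_functor)

text \<open>The iterated syzygies: each one is the kernel of the chosen cover of the previous
  one.\<close>

primrec syz :: "'u fctr \<Rightarrow> nat \<Rightarrow> 'u fctr" where
  "syz F 0 = F"
| "syz F (Suc n) = kernel_fctr (cov R R' (syz F n)) (syz F n) (cov_map R R' (syz F n))"

text \<open>The syzygy \<open>syz F (Suc n)\<close> is a subset of the cover of
  \<open>syz F n\<close> with the same operations. So the covering map of a syzygy serves as the
  differential as it stands, without composing with an inclusion.\<close>

definition resol :: "'u fctr \<Rightarrow> 'u cplx" where
  "resol F = \<lparr>ob = \<lambda>k. if k \<ge> 0 then cov R R' (syz F (nat k)) else zero_fctr,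
     dif = \<lambda>k V. if k \<ge> 1 then cov_map R R' (syz F (nat k)) V
       else zero_map (fobj (if k \<ge> 0 then cov R R' (syz F (nat k)) else zero_fctr) V) zero_md\<rparr>"

lemma syz_functor: "F \<in> functors R R' \<Longrightarrow> syz F n \<in> functors R R'"
  by (induction n) (auto intro: kernel_fctr_functor[OF cov_functor _ cov_map_nat])

lemma syz_Suc: "fobj (syz F (Suc n)) V = (fobj (cov R R' (syz F n)) V)
    \<lparr>carrier := {x \<in> carrier (fobj (cov R R' (syz F n)) V). cov_map R R' (syz F n) V x = \<zero>\<^bsub>fobj (syz F n) V\<^esub>}\<rparr>"
  by (simp add: kernel_fctr_sub)

lemma ex_resolution:
  assumes F: "F \<in> functors R R'"
  shows "proj_resolution R R' F (resol F) (cov_map R R' F)"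
proof -
  note Z = syz_functor[OF F] and cm = cov_map_nat[OF syz_functor[OF F]]
  have ob: "ob (resol F) k = (if k \<ge> 0 then cov R R' (syz F (nat k)) else zero_fctr)" for k by (simp add: resol_def)
  have obf: "ob (resol F) k \<in> functors R R'" for k using cov_functor zero_fctr_functor[OF R'_cring] by (simp add: ob)
  have d1: "dif (resol F) (int (Suc n)) V = cov_map R R' (syz F (Suc n)) V" for n V
    by (simp add: resol_def del: of_nat_Suc syz.simps)
  have d0: "dif (resol F) k V = zero_map (val (resol F) k V) (val (resol F) (k - 1) V)" if "k < 1" for k V
    using that by (simp add: resol_def)
  have obS: "ob (resol F) (int n) = cov R R' (syz F n)" for n by (simp add: ob)
  \<comment> \<open>Surjectivity of the covering map onto the next syzygy is exactly exactness: the
    image of one differential is the kernel of the preceding covering map.\<close>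
  have onto: "cov_map R R' (syz F (Suc n)) V ` carrier (fobj (cov R R' (syz F (Suc n))) V) =
      {x \<in> carrier (fobj (cov R R' (syz F n)) V). cov_map R R' (syz F n) V x = \<zero>\<^bsub>fobj (syz F n) V\<^esub>}" if "V \<in> proj R" for n V
    using cov_map_onto[OF Z that, of "Suc n"] unfolding syz_Suc by simp
  have nt: "dif (resol F) (int (Suc n)) \<in> nat_trans R R' (ob (resol F) (int (Suc n))) (ob (resol F) (int n))" for n
  proof (rule nat_transI)
    fix V assume V: "V \<in> proj R"
    note h = nat_hom[OF cm V, of "Suc n"]
    show "dif (resol F) (int (Suc n)) V \<in> mod_hom R' (val (resol F) (int (Suc n)) V) (val (resol F) (int n) V)"
      unfolding d1 obS
    proof (rule mod_homI)
      show "cov_map R R' (syz F (Suc n)) V x \<in> carrier (fobj (cov R R' (syz F n)) V)"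
        if "x \<in> carrier (fobj (cov R R' (syz F (Suc n))) V)" for x
        using onto[OF V, of n] that by blast
    qed (use mod_hom_add[OF h] mod_hom_smult[OF h] mod_hom_ext[OF h] in \<open>unfold syz_Suc, auto\<close>)
  next
    fix V W f x assume VW: "V \<in> proj R" "W \<in> proj R" "f \<in> mod_hom R V W" and x: "x \<in> carrier (val (resol F) (int (Suc n)) V)"
    have "cov_map R R' (syz F (Suc n)) V x \<in> carrier (fobj (syz F (Suc n)) V)"
      using nat_closed[OF cm VW(1)] x by (simp only: obS)
    then show "dif (resol F) (int (Suc n)) W (farr (ob (resol F) (int (Suc n))) V W f x) =
      farr (ob (resol F) (int n)) V W f (dif (resol F) (int (Suc n)) V x)"
      using nat_arr[OF cm VW, of x "Suc n"] x unfolding d1 obS by (simp add: kernel_fctr_sub)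
  qed
  have cases: "k < 1 \<or> (\<exists>n. k = int (Suc n))" for k
    by (metis nat_0_iff nat_eq_iff2 not_less not0_implies_Suc zero_less_nat_eq le_numeral_extra(4) linorder_not_less zless_nat_eq_int_zless int_one_le_iff_zero_less)
  have nt': "dif (resol F) k \<in> nat_trans R R' (ob (resol F) k) (ob (resol F) (k - 1))" for k
    using cases[of k]
  proof
    assume "k < 1"
    then have "dif (resol F) k = (\<lambda>V. zero_map (val (resol F) k V) (val (resol F) (k - 1) V))" using d0 by auto
    then show ?thesis using zero_map_nat[OF obf obf] by simp
  next
    assume "\<exists>n. k = int (Suc n)"
    then obtain n where k: "k = int (Suc n)" by blast
    have "k - 1 = int n" using k by simp
    then show ?thesis using nt[of n] k by simp
  qed
  have ker: "{x \<in> carrier (val (resol F) (int n) V). cov_map R R' (syz F n) V x = \<zero>\<^bsub>fobj (syz F n) V\<^esub>} = bnd (resol F) (int n) V"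
    if "V \<in> proj R" for n V
    using onto[OF that, of n] d1[of n V] obS[of "Suc n"] obS[of n] by (simp add: bnd_def add.commute)
  have "resol F \<in> complexes R R'"
  proof (rule complexesI[OF obf nt'])
    fix k V x assume V: "V \<in> proj R" and x: "x \<in> carrier (val (resol F) k V)"
    have e: "k - 1 - 1 = k - 2" by simp
    show "dif (resol F) (k - 1) V (dif (resol F) k V x) = \<zero>\<^bsub>val (resol F) (k - 2) V\<^esub>"
    proof (cases "k - 1 < 1")
      case True
      then show ?thesis using d0[OF True] nat_closed[OF nt' V x] e by simp
    next
      case False
      then obtain n where n: "k - 1 = int (Suc n)" using cases by blast
      then have k: "k = int (Suc (Suc n))" "k - 2 = int n" by auto
      have "dif (resol F) k V x \<in> cov_map R R' (syz F (Suc (Suc n))) V ` carrier (fobj (cov R R' (syz F (Suc (Suc n)))) V)"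
        using x unfolding k d1 obS by blast
      then have "cov_map R R' (syz F (Suc n)) V (dif (resol F) k V x) = \<zero>\<^bsub>fobj (syz F (Suc n)) V\<^esub>"
        unfolding onto[OF V] by blast
      then show ?thesis unfolding n k(2) d1 obS syz_Suc by simp
    qed
  qed
  moreover have "\<forall>n<0. zero_in_degree R (resol F) n" by (simp add: zero_in_degree_def ob)
  moreover have "\<forall>n\<ge>0. projective_fctr R R' (ob (resol F) n)" using cov_projective by (simp add: ob)
  moreover have "cov_map R R' F \<in> nat_trans R R' (ob (resol F) 0) F" using cov_map_nat[OF F] by (simp add: ob)
  moreover have "cov_map R R' F V ` carrier (val (resol F) 0 V) = carrier (fobj F V)" if "V \<in> proj R" for V
    using cov_map_onto[OF F that] by (simp add: ob)
  moreover have "{x \<in> carrier (val (resol F) 0 V). cov_map R R' F V x = \<zero>\<^bsub>fobj F V\<^esub>} = bnd (resol F) 0 V" if "V \<in> proj R" for V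
    using ker[OF that, of 0] by simp
  moreover have "{x \<in> carrier (val (resol F) k V). dif (resol F) k V x = \<zero>\<^bsub>val (resol F) (k - 1) V\<^esub>} = bnd (resol F) k V"
    if "V \<in> proj R" "k \<ge> 1" for k V
  proof -
    obtain n where k: "k = int (Suc n)" using cases[of k] \<open>k \<ge> 1\<close> by auto
    have k1: "k - 1 = int n" using k by simp
    have z: "\<zero>\<^bsub>fobj (syz F (Suc n)) V\<^esub> = \<zero>\<^bsub>val (resol F) (k - 1) V\<^esub>" unfolding k1 obS syz_Suc by simp
    show ?thesis using ker[OF that(1), of "Suc n"] unfolding z unfolding k d1 .
  qed
  ultimately show ?thesis by (simp add: proj_resolution_def)
qed

end

section \<open>Bilinear maps and tensor products of projective modules\<close>

text \<open>Linearity without the extensionality that \<open>mod_hom\<close> demands. Partial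
  applications of bilinear maps and composites then qualify without being restricted to the
  carrier.\<close>

definition lin :: "'u ring \<Rightarrow> 'u md \<Rightarrow> 'u md \<Rightarrow> ('u \<Rightarrow> 'u) \<Rightarrow> bool" where
  "lin S A T f \<longleftrightarrow> (\<forall>a\<in>carrier A. f a \<in> carrier T) \<and>
     (\<forall>a\<in>carrier A. \<forall>b\<in>carrier A. f (a \<oplus>\<^bsub>A\<^esub> b) = f a \<oplus>\<^bsub>T\<^esub> f b) \<and>
     (\<forall>s\<in>carrier S. \<forall>a\<in>carrier A. f (s \<odot>\<^bsub>A\<^esub> a) = s \<odot>\<^bsub>T\<^esub> f a)"

definition bil :: "'u ring \<Rightarrow> 'u md \<Rightarrow> 'u md \<Rightarrow> 'u md \<Rightarrow> ('u \<Rightarrow> 'u \<Rightarrow> 'u) \<Rightarrow> bool" where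
  "bil S A B T f \<longleftrightarrow> (\<forall>a\<in>carrier A. lin S B T (f a)) \<and> (\<forall>b\<in>carrier B. lin S A T (\<lambda>a. f a b))"

lemma linI:
  assumes "\<And>a. a \<in> carrier A \<Longrightarrow> f a \<in> carrier T"
    "\<And>a b. \<lbrakk>a \<in> carrier A; b \<in> carrier A\<rbrakk> \<Longrightarrow> f (a \<oplus>\<^bsub>A\<^esub> b) = f a \<oplus>\<^bsub>T\<^esub> f b"
    "\<And>s a. \<lbrakk>s \<in> carrier S; a \<in> carrier A\<rbrakk> \<Longrightarrow> f (s \<odot>\<^bsub>A\<^esub> a) = s \<odot>\<^bsub>T\<^esub> f a"
  shows "lin S A T f"
  using assms by (simp add: lin_def)

lemma linD:
  assumes "lin S A T f"
  shows "a \<in> carrier A \<Longrightarrow> f a \<in> carrier T"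
    "\<lbrakk>a \<in> carrier A; b \<in> carrier A\<rbrakk> \<Longrightarrow> f (a \<oplus>\<^bsub>A\<^esub> b) = f a \<oplus>\<^bsub>T\<^esub> f b"
    "\<lbrakk>s \<in> carrier S; a \<in> carrier A\<rbrakk> \<Longrightarrow> f (s \<odot>\<^bsub>A\<^esub> a) = s \<odot>\<^bsub>T\<^esub> f a"
  using assms by (auto simp: lin_def)

lemma lin_mod_hom: "f \<in> mod_hom S A T \<Longrightarrow> lin S A T f"
  by (rule linI) (auto simp: mod_hom_closed mod_hom_add mod_hom_smult)

lemma lin_restrict: "lin S A T f \<Longrightarrow> module S A \<Longrightarrow> restrict f (carrier A) \<in> mod_hom S A T"
  by (rule restrict_mod_homI) (auto simp: linD)

lemma lin_zero: "lin S A T f \<Longrightarrow> module S A \<Longrightarrow> module S T \<Longrightarrow> f \<zero>\<^bsub>A\<^esub> = \<zero>\<^bsub>T\<^esub>"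
  by (rule additive_zero) (auto simp: linD module.axioms(2))

lemma lin_comp: "lin S A B f \<Longrightarrow> lin S B T g \<Longrightarrow> lin S A T (\<lambda>a. g (f a))"
  by (rule linI) (auto simp: linD)

lemma bilI:
  assumes "\<And>a b. \<lbrakk>a \<in> carrier A; b \<in> carrier B\<rbrakk> \<Longrightarrow> f a b \<in> carrier T"
    "\<And>a a' b. \<lbrakk>a \<in> carrier A; a' \<in> carrier A; b \<in> carrier B\<rbrakk> \<Longrightarrow> f (a \<oplus>\<^bsub>A\<^esub> a') b = f a b \<oplus>\<^bsub>T\<^esub> f a' b"
    "\<And>s a b. \<lbrakk>s \<in> carrier S; a \<in> carrier A; b \<in> carrier B\<rbrakk> \<Longrightarrow> f (s \<odot>\<^bsub>A\<^esub> a) b = s \<odot>\<^bsub>T\<^esub> f a b"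
    "\<And>a b b'. \<lbrakk>a \<in> carrier A; b \<in> carrier B; b' \<in> carrier B\<rbrakk> \<Longrightarrow> f a (b \<oplus>\<^bsub>B\<^esub> b') = f a b \<oplus>\<^bsub>T\<^esub> f a b'"
    "\<And>s a b. \<lbrakk>s \<in> carrier S; a \<in> carrier A; b \<in> carrier B\<rbrakk> \<Longrightarrow> f a (s \<odot>\<^bsub>B\<^esub> b) = s \<odot>\<^bsub>T\<^esub> f a b"
  shows "bil S A B T f"
  using assms by (simp add: bil_def lin_def)

lemma bil_lin_l: "bil S A B T f \<Longrightarrow> b \<in> carrier B \<Longrightarrow> lin S A T (\<lambda>a. f a b)"
  by (simp add: bil_def)

lemma bil_lin_r: "bil S A B T f \<Longrightarrow> a \<in> carrier A \<Longrightarrow> lin S B T (f a)"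
  by (simp add: bil_def)

lemma bil_closed: "bil S A B T f \<Longrightarrow> a \<in> carrier A \<Longrightarrow> b \<in> carrier B \<Longrightarrow> f a b \<in> carrier T"
  by (simp add: bil_def lin_def)

lemma bil_comp: "bil S A B T f \<Longrightarrow> lin S T U g \<Longrightarrow> bil S A B U (\<lambda>a b. g (f a b))"
  by (simp add: bil_def lin_def)

lemma bil_precomp: "bil S A B T f \<Longrightarrow> lin S A' A g \<Longrightarrow> lin S B' B h \<Longrightarrow> bil S A' B' T (\<lambda>a b. f (g a) (h b))"
  by (simp add: bil_def lin_def)

section \<open>Tensor products over a commutative ring\<close>

lemma tmod_data: "module R V \<Longrightarrow> module R W \<Longrightarrow> tensor_data R V (\<lambda>v r. r \<odot>\<^bsub>V\<^esub> v) R W"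
proof -
  assume V: "module R V" and W: "module R W"
  interpret V: module R V by fact
  show ?thesis using V W by (auto simp: tensor_data_def V.smult_assoc1[symmetric] V.R.m_comm)
qed

lemma tmod_module: "module R V \<Longrightarrow> module R W \<Longrightarrow> module (R :: ('u :: infinite) ring) (tmod R V W)"
  unfolding tmod_def by (rule tensor_data.T_module[OF tmod_data])

lemma tel_bil:
  assumes V: "module R V" and W: "module (R :: ('u :: infinite) ring) W"
  shows "bil R V W (tmod R V W) (tel R V W)"
proof -
  interpret T: tensor_data R V "\<lambda>v r. r \<odot>\<^bsub>V\<^esub> v" R W by (rule tmod_data[OF V W])
  show ?thesis unfolding tmod_def tel_def
    by (rule bilI) (auto simp: T.t_add_l T.t_add_r T.smult_t T.t_bal[symmetric])
qed

lemmas tel_closed = bil_closed[OF tel_bil]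

lemma tel_zero:
  assumes V: "module R V" and W: "module (R :: ('u :: infinite) ring) W"
  shows "w \<in> carrier W \<Longrightarrow> tel R V W \<zero>\<^bsub>V\<^esub> w = \<zero>\<^bsub>tmod R V W\<^esub>"
    and "v \<in> carrier V \<Longrightarrow> tel R V W v \<zero>\<^bsub>W\<^esub> = \<zero>\<^bsub>tmod R V W\<^esub>"
  using lin_zero[OF bil_lin_l[OF tel_bil[OF V W]] V tmod_module[OF V W]]
    lin_zero[OF bil_lin_r[OF tel_bil[OF V W]] W tmod_module[OF V W]] by auto

lemma tmod_induct [consumes 3, case_names pure add]:
  assumes "module R V" "module (R :: ('u :: infinite) ring) W" "z \<in> carrier (tmod R V W)"
    and "\<And>v w. \<lbrakk>v \<in> carrier V; w \<in> carrier W\<rbrakk> \<Longrightarrow> P (tel R V W v w)"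
    and "\<And>x y. \<lbrakk>x \<in> carrier (tmod R V W); y \<in> carrier (tmod R V W); P x; P y\<rbrakk> \<Longrightarrow> P (x \<oplus>\<^bsub>tmod R V W\<^esub> y)"
  shows "P z"
  using tensor_data.tensor_induct[OF tmod_data[OF assms(1,2)], of z P] assms(3-) by (simp add: tmod_def tel_def)

lemma tlift_facts:
  assumes V: "module R V" and W: "module (R :: ('u :: infinite) ring) W" and T: "module R T" and f: "bil R V W T f"
  shows tlift_hom: "tlift R V W T f \<in> mod_hom R (tmod R V W) T"
    and tlift_tel: "\<And>v w. \<lbrakk>v \<in> carrier V; w \<in> carrier W\<rbrakk> \<Longrightarrow> tlift R V W T f (tel R V W v w) = f v w"
proof -
  interpret D: tensor_data R V "\<lambda>v r. r \<odot>\<^bsub>V\<^esub> v" R W by (rule tmod_data[OF V W])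
  note l = linD[OF bil_lin_l[OF f]] and r = linD[OF bil_lin_r[OF f]]
  have b: "D.balanced T f"
    by (rule D.balancedI) (use l r module.axioms(2)[OF T] in auto)
  show "tlift R V W T f \<in> mod_hom R (tmod R V W) T" unfolding tlift_def tmod_def
    by (rule D.lift_mod_hom[OF b T]) (use l in auto)
  show "\<And>v w. \<lbrakk>v \<in> carrier V; w \<in> carrier W\<rbrakk> \<Longrightarrow> tlift R V W T f (tel R V W v w) = f v w"
    unfolding tlift_def tel_def by (rule D.lift_t[OF b])
qed

lemma tmap_facts:
  assumes "module R V" "module R V'" "module R W" "module (R :: ('u :: infinite) ring) W'"
    and f: "f \<in> mod_hom R V W" and g: "g \<in> mod_hom R V' W'"
  shows tmap_hom: "tmap R V V' W W' f g \<in> mod_hom R (tmod R V V') (tmod R W W')"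
    and tmap_tel: "\<And>v v'. \<lbrakk>v \<in> carrier V; v' \<in> carrier V'\<rbrakk> \<Longrightarrow> tmap R V V' W W' f g (tel R V V' v v') = tel R W W' (f v) (g v')"
  unfolding tmap_def
  using tlift_facts[OF assms(1,2) tmod_module[OF assms(3,4)] bil_precomp[OF tel_bil[OF assms(3,4)] lin_mod_hom[OF f] lin_mod_hom[OF g]]]
  by auto

text \<open>The reassociation map is a lift in the first two variables, with the third as a
  parameter, followed by a lift in the third. Linearity in the parameter is not formal and is
  checked on pure tensors of the first two.\<close>

lemma tassoc_facts:
  assumes U: "module R U" and V: "module R V" and W: "module (R :: ('u :: infinite) ring) W"
  shows tassoc_hom: "tassoc R U V W \<in> mod_hom R (tmod R (tmod R U V) W) (tmod R U (tmod R V W))"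
    and tassoc_tel: "\<And>u v w. \<lbrakk>u \<in> carrier U; v \<in> carrier V; w \<in> carrier W\<rbrakk> \<Longrightarrow>
      tassoc R U V W (tel R (tmod R U V) W (tel R U V u v) w) = tel R U (tmod R V W) u (tel R V W v w)"
proof -
  let ?T = "tmod R U (tmod R V W)"
  note UV = tmod_module[OF U V] and VW = tmod_module[OF V W]
  note T = tmod_module[OF U VW]
  interpret T: module R ?T by (rule T)
  interpret UV: module R "tmod R U V" by (rule UV)
  note b1 = tel_bil[OF U VW] and b2 = tel_bil[OF V W]
  have b: "bil R U V ?T (\<lambda>u v. tel R U (tmod R V W) u (tel R V W v w))" if "w \<in> carrier W" for w
    by (rule bil_precomp[OF b1 _ bil_lin_l[OF b2 that]]) (rule linI, auto)
  let ?g = "\<lambda>t w. tlift R U V ?T (\<lambda>u v. tel R U (tmod R V W) u (tel R V W v w)) t"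
  note lh = tlift_hom[OF U V T b] and lt = tlift_tel[OF U V T b]
  note rl = linD[OF bil_lin_r[OF b1]] and rr = linD[OF bil_lin_r[OF b2]]
  interpret W: module R W by (rule W)
  have bb: "bil R (tmod R U V) W ?T ?g"
  proof (rule bilI)
    fix t w assume t: "t \<in> carrier (tmod R U V)" and w: "w \<in> carrier W"
    show "?g t w \<in> carrier ?T" using mod_hom_closed[OF lh[OF w] t] .
    show "?g (t \<oplus>\<^bsub>tmod R U V\<^esub> t') w = ?g t w \<oplus>\<^bsub>?T\<^esub> ?g t' w" if "t' \<in> carrier (tmod R U V)" for t'
      by (rule mod_hom_add[OF lh[OF w] t that])
    show "?g (s \<odot>\<^bsub>tmod R U V\<^esub> t) w = s \<odot>\<^bsub>?T\<^esub> ?g t w" if "s \<in> carrier R" for s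
      by (rule mod_hom_smult[OF lh[OF w] that t])
    { fix w' assume w': "w' \<in> carrier W"
      show "?g t (w \<oplus>\<^bsub>W\<^esub> w') = ?g t w \<oplus>\<^bsub>?T\<^esub> ?g t w'" using U V t
      proof (induction rule: tmod_induct)
        case (pure u v)
        then show ?case using w w' by (simp add: lt rl rr)
      next
        case (add x y)
        then show ?case using w w' mod_hom_closed[OF lh] by (simp add: mod_hom_add[OF lh] T.a_ac)
      qed }
    { fix s assume s: "s \<in> carrier R"
      show "?g t (s \<odot>\<^bsub>W\<^esub> w) = s \<odot>\<^bsub>?T\<^esub> ?g t w" using U V t
      proof (induction rule: tmod_induct)
        case (pure u v)
        then show ?case using w s by (simp add: lt rl rr)
      next
        case (add x y)
        then show ?case using w s mod_hom_closed[OF lh] by (simp add: mod_hom_add[OF lh] T.smult_r_distr)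
      qed }
  qed
  show "tassoc R U V W \<in> mod_hom R (tmod R (tmod R U V) W) ?T"
    unfolding tassoc_def by (rule tlift_hom[OF UV W T bb])
  show "tassoc R U V W (tel R (tmod R U V) W (tel R U V u v) w) = tel R U (tmod R V W) u (tel R V W v w)"
    if "u \<in> carrier U" "v \<in> carrier V" "w \<in> carrier W" for u v w
    unfolding tassoc_def using tlift_tel[OF UV W T bb tel_closed[OF U V that(1,2)] that(3)] lt[OF that(3,1,2)] by simp
qed

lemma tunit_facts:
  assumes V: "module (R :: ('u :: infinite) ring) V"
  shows tunit_l_hom: "tunit_l R V \<in> mod_hom R (tmod R (self_md R) V) V"
    and tunit_l_tel: "\<And>r v. \<lbrakk>r \<in> carrier R; v \<in> carrier V\<rbrakk> \<Longrightarrow> tunit_l R V (tel R (self_md R) V r v) = r \<odot>\<^bsub>V\<^esub> v"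
    and tunit_r_hom: "tunit_r R V \<in> mod_hom R (tmod R V (self_md R)) V"
    and tunit_r_tel: "\<And>r v. \<lbrakk>r \<in> carrier R; v \<in> carrier V\<rbrakk> \<Longrightarrow> tunit_r R V (tel R V (self_md R) v r) = r \<odot>\<^bsub>V\<^esub> v"
proof -
  interpret V: module R V by (rule V)
  note S = self_md_module[OF V.R.cring_axioms]
  have l: "bil R (self_md R) V V (\<lambda>r v. r \<odot>\<^bsub>V\<^esub> v)"
    by (rule bilI) (auto simp: V.smult_l_distr V.smult_r_distr V.smult_assoc1[symmetric] V.R.m_comm)
  have r: "bil R V (self_md R) V (\<lambda>v r. r \<odot>\<^bsub>V\<^esub> v)"
    by (rule bilI) (auto simp: V.smult_l_distr V.smult_r_distr V.smult_assoc1[symmetric] V.R.m_comm)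
  show "tunit_l R V \<in> mod_hom R (tmod R (self_md R) V) V"
    and "\<And>r v. \<lbrakk>r \<in> carrier R; v \<in> carrier V\<rbrakk> \<Longrightarrow> tunit_l R V (tel R (self_md R) V r v) = r \<odot>\<^bsub>V\<^esub> v"
    using tlift_facts[OF S V V l] by (auto simp: tunit_l_def)
  show "tunit_r R V \<in> mod_hom R (tmod R V (self_md R)) V"
    and "\<And>r v. \<lbrakk>r \<in> carrier R; v \<in> carrier V\<rbrakk> \<Longrightarrow> tunit_r R V (tel R V (self_md R) v r) = r \<odot>\<^bsub>V\<^esub> v"
    using tlift_facts[OF V S V r] by (auto simp: tunit_r_def)
qed

definition free_bil :: "'u ring \<Rightarrow> 's set \<Rightarrow> 't set \<Rightarrow> 'u md \<Rightarrow> ('s \<Rightarrow> 't \<Rightarrow> 'u) \<Rightarrow> 'u \<Rightarrow> 'u \<Rightarrow> 'u" where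
  "free_bil R S S' T a x y = free_ext R S T (\<lambda>s. free_ext R S' T (a s) y) x"

text \<open>The iterated extension is linear in the first variable by construction. Linearity in the
  second is shown by induction on the first; its scalar step interchanges two scalars and uses
  commutativity of the ring.\<close>

lemma free_bil_facts:
  assumes S: "free_module (R :: ('u :: infinite) ring) S" and S': "free_module R S'" and T: "module R T"
    and a: "\<And>s s'. \<lbrakk>s \<in> S; s' \<in> S'\<rbrakk> \<Longrightarrow> a s s' \<in> carrier T"
  shows free_bil_bil: "bil R (free_md R S) (free_md R S') T (free_bil R S S' T a)"
    and free_bil_gen: "\<And>s s'. \<lbrakk>s \<in> S; s' \<in> S'\<rbrakk> \<Longrightarrow> free_bil R S S' T a (free_gen R S s) (free_gen R S' s') = a s s'"
proof -
  interpret S: free_module R S by (rule S)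
  interpret S': free_module R S' by (rule S')
  interpret T: module R T by (rule T)
  interpret N: module R "free_md R S'" by (rule S'.free_md_module)
  have i: "free_ext R S' T (a s) \<in> mod_hom R (free_md R S') T" if "s \<in> S" for s
    by (rule S'.free_ext_hom[OF T a[OF that]])
  have ic: "free_ext R S' T (a s) y \<in> carrier T" if "s \<in> S" "y \<in> carrier (free_md R S')" for s y
    by (rule mod_hom_closed[OF i[OF that(1)] that(2)])
  have o: "(\<lambda>x. free_bil R S S' T a x y) \<in> mod_hom R (free_md R S) T" if "y \<in> carrier (free_md R S')" for y
    unfolding free_bil_def by (rule S.free_ext_hom[OF T ic[OF _ that]])
  have ob: "free_bil R S S' T a (free_gen R S s) y = free_ext R S' T (a s) y" if "s \<in> S" "y \<in> carrier (free_md R S')" for s y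
    unfolding free_bil_def by (rule S.free_ext_gen[OF T ic[OF _ that(2)] that(1)])
  have oz: "free_bil R S S' T a \<zero>\<^bsub>free_md R S\<^esub> y = \<zero>\<^bsub>T\<^esub>" if "y \<in> carrier (free_md R S')" for y
    by (rule mod_hom_zero[OF o[OF that] S.free_md_module T])
  show "bil R (free_md R S) (free_md R S') T (free_bil R S S' T a)"
  proof (rule bilI)
    fix x y assume x: "x \<in> carrier (free_md R S)" and y: "y \<in> carrier (free_md R S')"
    show "free_bil R S S' T a x y \<in> carrier T" by (rule mod_hom_closed[OF o[OF y] x])
    show "free_bil R S S' T a (x \<oplus>\<^bsub>free_md R S\<^esub> x') y = free_bil R S S' T a x y \<oplus>\<^bsub>T\<^esub> free_bil R S S' T a x' y" if "x' \<in> carrier (free_md R S)" for x'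
      by (rule mod_hom_add[OF o[OF y] x that])
    show "free_bil R S S' T a (s \<odot>\<^bsub>free_md R S\<^esub> x) y = s \<odot>\<^bsub>T\<^esub> free_bil R S S' T a x y" if "s \<in> carrier R" for s
      by (rule mod_hom_smult[OF o[OF y] that x])
    { fix y' assume y': "y' \<in> carrier (free_md R S')"
      show "free_bil R S S' T a x (y \<oplus>\<^bsub>free_md R S'\<^esub> y') = free_bil R S S' T a x y \<oplus>\<^bsub>T\<^esub> free_bil R S S' T a x y'" using x
      proof (induction rule: S.free_md_induct)
        case zero then show ?case using y y' by (simp add: oz)
      next
        case (bas s) then show ?case using y y' by (simp add: ob mod_hom_add[OF i])
      next
        case (add u v) then show ?case
          using y y' mod_hom_closed[OF o] by (simp add: mod_hom_add[OF o] T.a_ac)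
      next
        case (smult r u) then show ?case
          using y y' mod_hom_closed[OF o] by (simp add: mod_hom_smult[OF o] T.smult_r_distr)
      qed }
    { fix s assume s: "s \<in> carrier R"
      show "free_bil R S S' T a x (s \<odot>\<^bsub>free_md R S'\<^esub> y) = s \<odot>\<^bsub>T\<^esub> free_bil R S S' T a x y" using x
      proof (induction rule: S.free_md_induct)
        case zero then show ?case using y s by (simp add: oz)
      next
        case (bas k) then show ?case using y s by (simp add: ob mod_hom_smult[OF i])
      next
        case (add u v) then show ?case
          using y s mod_hom_closed[OF o] by (simp add: mod_hom_add[OF o] T.smult_r_distr)
      next
        case (smult r u) then show ?case
          using y s mod_hom_closed[OF o] by (simp add: mod_hom_smult[OF o] T.smult_assoc1[symmetric] S.m_comm)
      qed }
  qed
  show "free_bil R S S' T a (free_gen R S s) (free_gen R S' s') = a s s'" if "s \<in> S" "s' \<in> S'" for s s'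
    using ob[OF that(1)] S'.free_ext_gen[OF T a[OF that(1)] that(2)] by simp
qed

text \<open>A submodule that contains generators is everything. It is used to extend a property,
  whose solutions form a submodule, from generators to all elements.\<close>

lemma submod_generators:
  assumes V: "module R V" and N: "submod R V N" and G: "finite G" "G \<subseteq> N"
    and g: "\<And>v. v \<in> carrier V \<Longrightarrow> \<exists>c\<in>G \<rightarrow> carrier R. v = (\<Oplus>\<^bsub>V\<^esub>g\<in>G. c g \<odot>\<^bsub>V\<^esub> g)"
    and v: "v \<in> carrier V"
  shows "v \<in> N"
proof -
  obtain c where c: "c \<in> G \<rightarrow> carrier R" "v = (\<Oplus>\<^bsub>V\<^esub>g\<in>G. c g \<odot>\<^bsub>V\<^esub> g)" using g[OF v] by blast
  show ?thesis unfolding c(2)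
    by (rule finsum_submod[OF V N _ G(1)]) (use G in \<open>auto intro!: submodD(4)[OF N funcset_mem[OF c(1)]]\<close>)
qed

text \<open>The product of two generating sets generates. For projectivity, \<open>V\<close> and
  \<open>W\<close> are retracts of \<open>R^n\<close> and \<open>R^k\<close>, and a lift is
  determined by arbitrary choices at the pairs of basis vectors.\<close>

lemma tmod_proj:
  assumes R: "cring (R :: ('u :: infinite) ring)" and V: "V \<in> proj R" and W: "W \<in> proj R"
  shows "tmod R V W \<in> proj R"
proof -
  note Vm = proj_module[OF V] and Wm = proj_module[OF W]
  note Tm = tmod_module[OF Vm Wm]
  interpret V: module R V by (rule Vm)
  interpret W: module R W by (rule Wm)
  interpret T: module R "tmod R V W" by (rule Tm)
  note l = linD[OF bil_lin_l[OF tel_bil[OF Vm Wm]]] and r = linD[OF bil_lin_r[OF tel_bil[OF Vm Wm]]]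
  have "fin_gen R (tmod R V W)"
  proof -
    obtain G where G: "finite G" "G \<subseteq> carrier V"
      "\<And>v. v \<in> carrier V \<Longrightarrow> \<exists>c\<in>G \<rightarrow> carrier R. v = (\<Oplus>\<^bsub>V\<^esub>g\<in>G. c g \<odot>\<^bsub>V\<^esub> g)"
      using V by (auto simp: proj_def fin_gen_def)
    obtain G' where G': "finite G'" "G' \<subseteq> carrier W"
      "\<And>v. v \<in> carrier W \<Longrightarrow> \<exists>c\<in>G' \<rightarrow> carrier R. v = (\<Oplus>\<^bsub>W\<^esub>g\<in>G'. c g \<odot>\<^bsub>W\<^esub> g)"
      using W by (auto simp: proj_def fin_gen_def)
    let ?G = "(\<lambda>(g, g'). tel R V W g g') ` (G \<times> G')"
    have GG: "finite ?G" "?G \<subseteq> carrier (tmod R V W)" using tel_closed[OF Vm Wm] subsetD[OF G(2)] subsetD[OF G'(2)] G(1) G'(1) by auto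
    note sp = span_submod[OF Tm GG]
    define N where "N = span R (tmod R V W) ?G"
    note N = sp(1)[folded N_def] and GN = sp(2)[folded N_def]
    \<comment> \<open>One factor is kept a generator while the other varies; the elements
      \<open>w\<close> with \<open>g \<otimes> w\<close> in \<open>N\<close> form a submodule. The
      first factor is freed in the same way afterwards.\<close>
    have 1: "tel R V W g w \<in> N" if g: "g \<in> G" and w: "w \<in> carrier W" for g w
    proof -
      have gV: "g \<in> carrier V" using g G by auto
      have "submod R W {w \<in> carrier W. tel R V W g w \<in> N}"
        using submodD[OF N] tel_zero(2)[OF Vm Wm gV] r[OF gV] by (auto simp: submod_def)
      moreover have "G' \<subseteq> {w \<in> carrier W. tel R V W g w \<in> N}" using GN G' g by auto
      ultimately show ?thesis using submod_generators[OF Wm _ G'(1) _ G'(3) w] by blast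
    qed
    have 2: "tel R V W v w \<in> N" if v: "v \<in> carrier V" and w: "w \<in> carrier W" for v w
    proof -
      have "submod R V {v \<in> carrier V. tel R V W v w \<in> N}"
        using submodD[OF N] tel_zero(1)[OF Vm Wm w] l[OF w] by (auto simp: submod_def)
      moreover have "G \<subseteq> {v \<in> carrier V. tel R V W v w \<in> N}" using 1 G w by auto
      ultimately show ?thesis using submod_generators[OF Vm _ G(1) _ G(3) v] by blast
    qed
    show ?thesis
    proof (rule fin_genI[OF GG])
      fix z assume "z \<in> carrier (tmod R V W)"
      with Vm Wm show "z \<in> span R (tmod R V W) ?G" unfolding N_def[symmetric]
        by (induction rule: tmod_induct) (use 2 submodD(3)[OF N] in auto)
    qed
  qed
  moreover have "projective_md R (tmod R V W)"
    unfolding projective_md_def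
  proof (intro allI ballI impI)
    fix A B :: "'u md" and g f
    assume g: "g \<in> mod_hom R A B" and f: "f \<in> mod_hom R (tmod R V W) B" and A: "module R A" and B: "module R B"
      and s: "g ` carrier A = carrier B"
    obtain n p \<sigma> where p: "p \<in> mod_hom R (std R n) V" "\<sigma> \<in> mod_hom R V (std R n)"
      "\<And>v. v \<in> carrier V \<Longrightarrow> p (\<sigma> v) = v" by (rule proj_retract[OF R V]) (rule that)
    obtain k p' \<sigma>' where p': "p' \<in> mod_hom R (std R k) W" "\<sigma>' \<in> mod_hom R W (std R k)"
      "\<And>v. v \<in> carrier W \<Longrightarrow> p' (\<sigma>' v) = v" by (rule proj_retract[OF R W]) (rule that)
    let ?e = "\<lambda>n s. free_gen R {..<n :: nat} s"
    interpret n: free_module R "{..<n}" by (rule std_free[OF R])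
    interpret k: free_module R "{..<k}" by (rule std_free[OF R])
    have ec: "p (?e n s) \<in> carrier V" "p' (?e k t) \<in> carrier W" for s t
      using mod_hom_closed[OF p(1)] mod_hom_closed[OF p'(1)] by (auto simp: std_def)
    have "\<exists>a. a \<in> carrier A \<and> g a = f (tel R V W (p (?e n s)) (p' (?e k t)))" for s t
      using mod_hom_closed[OF f tel_closed[OF Vm Wm ec(1)[of s] ec(2)[of t]]] \<open>g ` carrier A = carrier B\<close> by (metis imageE)
    then obtain a where a: "\<And>s t. a s t \<in> carrier A \<and> g (a s t) = f (tel R V W (p (?e n s)) (p' (?e k t)))" by metis
    \<comment> \<open>The lift is first built as a bilinear map on \<open>R^n \<times> R^k\<close>,
      where values on basis pairs are free, and then pulled back along the sections. This spares an
      analysis of the tensor product of \<open>R^n\<close> and \<open>R^k\<close> itself.\<close>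
    define b where "b = free_bil R {..<n} {..<k} A a"
    have bb: "bil R (std R n) (std R k) A b" and be: "\<And>s t. \<lbrakk>s < n; t < k\<rbrakk> \<Longrightarrow> b (?e n s) (?e k t) = a s t"
      using free_bil_facts[OF std_free[OF R] std_free[OF R] A, where a = a] a by (auto simp: b_def std_def)
    have b2: "bil R V W A (\<lambda>v w. b (\<sigma> v) (\<sigma>' w))"
      by (rule bil_precomp[OF bb lin_mod_hom[OF p(2)] lin_mod_hom[OF p'(2)]])
    define h where "h = tlift R V W A (\<lambda>v w. b (\<sigma> v) (\<sigma>' w))"
    have h: "h \<in> mod_hom R (tmod R V W) A" and ht: "\<And>v w. \<lbrakk>v \<in> carrier V; w \<in> carrier W\<rbrakk> \<Longrightarrow> h (tel R V W v w) = b (\<sigma> v) (\<sigma>' w)"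
      using tlift_facts[OF Vm Wm A b2] by (auto simp: h_def)
    have b3: "bil R (std R n) (std R k) B (\<lambda>x y. g (b x y))" by (rule bil_comp[OF bb lin_mod_hom[OF g]])
    have b4: "bil R (std R n) (std R k) B (\<lambda>x y. f (tel R V W (p x) (p' y)))"
      by (rule bil_comp[OF bil_precomp[OF tel_bil[OF Vm Wm] lin_mod_hom[OF p(1)] lin_mod_hom[OF p'(1)]] lin_mod_hom[OF f]])
    have sm: "module R (std R n)" "module R (std R k)" using std_proj[OF R] proj_module by auto
    have "g (b x y) = f (tel R V W (p x) (p' y))" if x: "x \<in> carrier (std R n)" and y: "y \<in> carrier (std R k)" for x y
    proof -
      have 1: "g (b (?e n s) y) = f (tel R V W (p (?e n s)) (p' y))" if s: "s < n" for s
      proof -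
        have es: "?e n s \<in> carrier (std R n)" by (simp add: std_def)
        have "restrict (\<lambda>y. g (b (?e n s) y)) (carrier (std R k)) = restrict (\<lambda>y. f (tel R V W (p (?e n s)) (p' y))) (carrier (std R k))"
          by (rule k.free_md_hom_eqI[OF B, folded std_def, OF lin_restrict[OF bil_lin_r[OF b3 es] sm(2)] lin_restrict[OF bil_lin_r[OF b4 es] sm(2)]])
             (use be s a in \<open>auto simp: std_def\<close>)
        from fun_cong[OF this, of y] show ?thesis using y by simp
      qed
      have "restrict (\<lambda>x. g (b x y)) (carrier (std R n)) = restrict (\<lambda>x. f (tel R V W (p x) (p' y))) (carrier (std R n))"
        by (rule n.free_md_hom_eqI[OF B, folded std_def, OF lin_restrict[OF bil_lin_l[OF b3 y] sm(1)] lin_restrict[OF bil_lin_l[OF b4 y] sm(1)]])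
           (use 1 in \<open>auto simp: std_def\<close>)
      from fun_cong[OF this, of x] show ?thesis using x by simp
    qed
    note gb = this
    have "g (h z) = f z" if "z \<in> carrier (tmod R V W)" for z
      using Vm Wm that
    proof (induction rule: tmod_induct)
      case (pure v w)
      then show ?case using gb[OF mod_hom_closed[OF p(2)] mod_hom_closed[OF p'(2)], of v w] p(3) p'(3) ht by simp
    next
      case (add x y)
      then show ?case using mod_hom_closed[OF h] by (simp add: mod_hom_add[OF h] mod_hom_add[OF f] mod_hom_add[OF g])
    qed
    then show "\<exists>h\<in>mod_hom R (tmod R V W) A. \<forall>x\<in>carrier (tmod R V W). g (h x) = f x" using h by blast
  qed
  ultimately show ?thesis using Tm by (simp add: proj_def)
qed

section \<open>The multiplicative structure\<close>

context sqz
begin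

definition descend :: "'u md \<Rightarrow> 'u md \<Rightarrow> 'u md \<Rightarrow> ('u \<Rightarrow> 'u \<Rightarrow> 'u) \<Rightarrow> 'u \<Rightarrow> 'u \<Rightarrow> 'u" where
  "descend A B T f c d = ot T (f (SOME x. x \<in> carrier A \<and> ot A x = c) (SOME y. y \<in> carrier B \<and> ot B y = d))"

text \<open>With one argument fixed, a bilinear map is linear and so carries \<open>I\<close> of the
  source into \<open>I\<close> of the target. Hence it is compatible with the passage from
  \<open>N\<close> to \<open>N / I N\<close> in each argument.\<close>

lemma descend_facts:
  assumes A: "module R' A" and B: "module R' B" and T: "module R' T" and f: "bil R' A B T f"
  shows descend_ot: "\<And>x y. \<lbrakk>x \<in> carrier A; y \<in> carrier B\<rbrakk> \<Longrightarrow> descend A B T f (ot A x) (ot B y) = ot T (f x y)"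
    and descend_bil: "bil R (TT A) (TT B) (TT T) (descend A B T f)"
proof -
  interpret A: module R' A by (rule A)
  interpret B: module R' B by (rule B)
  interpret T: module R' T by (rule T)
  note l = linD[OF bil_lin_l[OF f]] and r = linD[OF bil_lin_r[OF f]]
  have cong_l: "ot T (f x y) = ot T (f x' y)"
    if x: "x \<in> carrier A" "x' \<in> carrier A" "ot A x = ot A x'" and y: "y \<in> carrier B" for x x' y
  proof -
    have "x \<ominus>\<^bsub>A\<^esub> x' \<in> I A" using ot_eq_iff[OF A x(1,2)] x(3) by simp
    then have "restrict (\<lambda>x. f x y) (carrier A) (x \<ominus>\<^bsub>A\<^esub> x') \<in> I T"
      by (rule I_hom[OF A T lin_restrict[OF bil_lin_l[OF f y] A]])
    moreover have "restrict (\<lambda>x. f x y) (carrier A) (x \<ominus>\<^bsub>A\<^esub> x') = f x y \<ominus>\<^bsub>T\<^esub> f x' y"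
      using mod_hom_diff[OF lin_restrict[OF bil_lin_l[OF f y] A] A T x(1,2)] x by simp
    ultimately show ?thesis using ot_eq_iff[OF T l(1)[OF y x(1)] l(1)[OF y x(2)]] by simp
  qed
  have cong_r: "ot T (f x y) = ot T (f x y')"
    if x: "x \<in> carrier A" and y: "y \<in> carrier B" "y' \<in> carrier B" "ot B y = ot B y'" for x y y'
  proof -
    have "y \<ominus>\<^bsub>B\<^esub> y' \<in> I B" using ot_eq_iff[OF B y(1,2)] y(3) by simp
    then have "restrict (f x) (carrier B) (y \<ominus>\<^bsub>B\<^esub> y') \<in> I T"
      by (rule I_hom[OF B T lin_restrict[OF bil_lin_r[OF f x] B]])
    moreover have "restrict (f x) (carrier B) (y \<ominus>\<^bsub>B\<^esub> y') = f x y \<ominus>\<^bsub>T\<^esub> f x y'"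
      using mod_hom_diff[OF lin_restrict[OF bil_lin_r[OF f x] B] B T y(1,2)] y by simp
    ultimately show ?thesis using ot_eq_iff[OF T r(1)[OF x y(1)] r(1)[OF x y(2)]] by simp
  qed
  show to: "descend A B T f (ot A x) (ot B y) = ot T (f x y)" if x: "x \<in> carrier A" and y: "y \<in> carrier B" for x y
  proof -
    let ?x = "SOME z. z \<in> carrier A \<and> ot A z = ot A x" and ?y = "SOME z. z \<in> carrier B \<and> ot B z = ot B y"
    have x': "?x \<in> carrier A \<and> ot A ?x = ot A x" by (rule someI[of _ x]) (use x in simp)
    have y': "?y \<in> carrier B \<and> ot B ?y = ot B y" by (rule someI[of _ y]) (use y in simp)
    show ?thesis unfolding descend_def using cong_l[of ?x x ?y] cong_r[of x ?y y] x y x' y' by simp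
  qed
  show "bil R (TT A) (TT B) (TT T) (descend A B T f)"
  proof (rule bilI)
    fix c d assume "c \<in> carrier (TT A)" "d \<in> carrier (TT B)"
    then obtain x y where x: "x \<in> carrier A" "c = ot A x" and y: "y \<in> carrier B" "d = ot B y"
      using ot_onto[OF A] ot_onto[OF B] by blast
    show "descend A B T f c d \<in> carrier (TT T)" using x y T l by (simp add: to)
    { fix c' assume "c' \<in> carrier (TT A)"
      then obtain x' where x': "x' \<in> carrier A" "c' = ot A x'" using ot_onto[OF A] by blast
      show "descend A B T f (c \<oplus>\<^bsub>TT A\<^esub> c') d = descend A B T f c d \<oplus>\<^bsub>TT T\<^esub> descend A B T f c' d"
        using x x' y l by (simp add: to ot_add[OF A, symmetric] ot_add[OF T, symmetric]) }
    { fix d' assume "d' \<in> carrier (TT B)"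
      then obtain y' where y': "y' \<in> carrier B" "d' = ot B y'" using ot_onto[OF B] by blast
      show "descend A B T f c (d \<oplus>\<^bsub>TT B\<^esub> d') = descend A B T f c d \<oplus>\<^bsub>TT T\<^esub> descend A B T f c d'"
        using x y y' r by (simp add: to ot_add[OF B, symmetric] ot_add[OF T, symmetric]) }
    { fix s assume "s \<in> carrier R"
      then obtain s' where s: "s' \<in> carrier R'" "s = q s'" using q_onto by blast
      show "descend A B T f (s \<odot>\<^bsub>TT A\<^esub> c) d = s \<odot>\<^bsub>TT T\<^esub> descend A B T f c d"
        using x y s l by (simp add: to ot_smult[OF A, symmetric] ot_smult[OF T, symmetric])
      show "descend A B T f c (s \<odot>\<^bsub>TT B\<^esub> d) = s \<odot>\<^bsub>TT T\<^esub> descend A B T f c d"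
        using x y s r by (simp add: to ot_smult[OF B, symmetric] ot_smult[OF T, symmetric]) }
  qed
qed

section \<open>The product on \<open>Q\<close>\<close>

lemma Q_lin_eqI:
  assumes T: "module R' T" and f: "lin R' (fobj Q V) T f" and g: "lin R' (fobj Q V) T g"
    and e: "\<And>v. v \<in> carrier V \<Longrightarrow> f (br V v) = g (br V v)" and x: "x \<in> carrier (fobj Q V)"
  shows "f x = g x"
  using x
  by (induction rule: Q_induct)
     (use e lin_zero[OF f Q_mod T] lin_zero[OF g Q_mod T] in \<open>auto simp: linD[OF f] linD[OF g]\<close>)

lemma Q_bil_eqI:
  assumes T: "module R' T" and f: "bil R' (fobj Q V) (fobj Q W) T f" and g: "bil R' (fobj Q V) (fobj Q W) T g"
    and e: "\<And>v w. \<lbrakk>v \<in> carrier V; w \<in> carrier W\<rbrakk> \<Longrightarrow> f (br V v) (br W w) = g (br V v) (br W w)"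
    and x: "x \<in> carrier (fobj Q V)" and y: "y \<in> carrier (fobj Q W)"
  shows "f x y = g x y"
proof (rule Q_lin_eqI[OF T bil_lin_l[OF f y] bil_lin_l[OF g y] _ x])
  fix v assume v: "v \<in> carrier V"
  show "f (br V v) y = g (br V v) y"
    by (rule Q_lin_eqI[OF T bil_lin_r[OF f br_closed] bil_lin_r[OF g br_closed] e[OF v] y])
qed

definition Qmul :: "'u md \<Rightarrow> 'u md \<Rightarrow> 'u \<Rightarrow> 'u \<Rightarrow> 'u" where
  "Qmul V W = free_bil R' (carrier V - {\<zero>\<^bsub>V\<^esub>}) (carrier W - {\<zero>\<^bsub>W\<^esub>}) (fobj Q (tmod R V W)) (\<lambda>v w. br (tmod R V W) (tel R V W v w))"

lemma Qmul_bil: "bil R' (fobj Q V) (fobj Q W) (fobj Q (tmod R V W)) (Qmul V W)"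
  using free_bil_bil[OF Q_free Q_free Q_mod] by (simp add: Qmul_def Q_obj[of V] Q_obj[of W])

lemma Qmul_br:
  assumes "V \<in> proj R" "W \<in> proj R" "v \<in> carrier V" "w \<in> carrier W"
  shows "Qmul V W (br V v) (br W w) = br (tmod R V W) (tel R V W v w)"
proof -
  note z = tel_zero[OF proj_module[OF assms(1)] proj_module[OF assms(2)]]
  note l = lin_zero[OF bil_lin_l[OF Qmul_bil br_closed] Q_mod Q_mod] lin_zero[OF bil_lin_r[OF Qmul_bil br_closed] Q_mod Q_mod]
  show ?thesis
  proof (cases "v = \<zero>\<^bsub>V\<^esub> \<or> w = \<zero>\<^bsub>W\<^esub>")
    \<comment> \<open>The basis does not contain zero, so this case is not covered by the values on
      generators. Both sides vanish, as the bracket of zero is zero and a tensor with a zero factor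
      is zero.\<close>
    case True
    then show ?thesis using z assms l by auto
  next
    case False
    have "free_bil R' (carrier V - {\<zero>\<^bsub>V\<^esub>}) (carrier W - {\<zero>\<^bsub>W\<^esub>}) (fobj Q (tmod R V W)) (\<lambda>v w. br (tmod R V W) (tel R V W v w))
        (free_gen R' (carrier V - {\<zero>\<^bsub>V\<^esub>}) v) (free_gen R' (carrier W - {\<zero>\<^bsub>W\<^esub>}) w) = br (tmod R V W) (tel R V W v w)"
      by (rule free_bil_gen[OF Q_free Q_free Q_mod br_closed]) (use assms False in auto)
    then show ?thesis by (simp add: Qmul_def br_def)
  qed
qed

lemma Qmul_closed: "\<lbrakk>x \<in> carrier (fobj Q V); y \<in> carrier (fobj Q W)\<rbrakk> \<Longrightarrow> Qmul V W x y \<in> carrier (fobj Q (tmod R V W))"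
  by (rule bil_closed[OF Qmul_bil])

lemma Qmul_zero:
  "y \<in> carrier (fobj Q W) \<Longrightarrow> Qmul V W \<zero>\<^bsub>fobj Q V\<^esub> y = \<zero>\<^bsub>fobj Q (tmod R V W)\<^esub>"
  "x \<in> carrier (fobj Q V) \<Longrightarrow> Qmul V W x \<zero>\<^bsub>fobj Q W\<^esub> = \<zero>\<^bsub>fobj Q (tmod R V W)\<^esub>"
  using lin_zero[OF bil_lin_l[OF Qmul_bil] Q_mod Q_mod] lin_zero[OF bil_lin_r[OF Qmul_bil] Q_mod Q_mod] by auto

lemmas tmodp = tmod_proj[OF R_cring]

text \<open>Both sides are bilinear over \<open>R'\<close>, the right one because \<open>R'\<close>
  acts through \<open>q\<close>, and on brackets both give \<open>v \<otimes> w\<close>. It makes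
  the kernel of \<open>\<epsilon>Q\<close> an ideal.\<close>

lemma \<epsilon>Q_mul:
  assumes V: "V \<in> proj R" and W: "W \<in> proj R" and x: "x \<in> carrier (fobj Q V)" and y: "y \<in> carrier (fobj Q W)"
  shows "\<epsilon>Q (tmod R V W) (Qmul V W x y) = tel R V W (\<epsilon>Q V x) (\<epsilon>Q W y)"
proof (rule Q_bil_eqI[OF restrict_scalars_module[OF proj_module[OF tmodp[OF V W]] q_hom R'_cring] _ _ _ x y])
  note Vm = proj_module[OF V] and Wm = proj_module[OF W]
  show "bil R' (fobj Q V) (fobj Q W) (restrict_scalars q (tmod R V W)) (\<lambda>x y. \<epsilon>Q (tmod R V W) (Qmul V W x y))"
    by (rule bil_comp[OF Qmul_bil lin_mod_hom[OF \<epsilon>Q_hom[OF tmodp[OF V W]]]])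
  note l = linD[OF bil_lin_l[OF tel_bil[OF Vm Wm]]] and r = linD[OF bil_lin_r[OF tel_bil[OF Vm Wm]]]
  have "bil R' (restrict_scalars q V) (restrict_scalars q W) (restrict_scalars q (tmod R V W)) (tel R V W)"
    by (rule bilI) (use l r in auto)
  then show "bil R' (fobj Q V) (fobj Q W) (restrict_scalars q (tmod R V W)) (\<lambda>x y. tel R V W (\<epsilon>Q V x) (\<epsilon>Q W y))"
    by (rule bil_precomp[OF _ lin_mod_hom[OF \<epsilon>Q_hom[OF V]] lin_mod_hom[OF \<epsilon>Q_hom[OF W]]])
  fix v w assume vw: "v \<in> carrier V" "w \<in> carrier W"
  then show "\<epsilon>Q (tmod R V W) (Qmul V W (br V v) (br W w)) = tel R V W (\<epsilon>Q V (br V v)) (\<epsilon>Q W (br W w))"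
    by (simp add: Qmul_br[OF V W] \<epsilon>Q_br[OF V] \<epsilon>Q_br[OF W] \<epsilon>Q_br[OF tmodp[OF V W]] tel_closed[OF Vm Wm])
qed

lemma Qmul_nat:
  assumes VW: "V \<in> proj R" "V' \<in> proj R" "W \<in> proj R" "W' \<in> proj R"
    and f: "f \<in> mod_hom R V W" and g: "g \<in> mod_hom R V' W'"
    and x: "x \<in> carrier (fobj Q V)" and y: "y \<in> carrier (fobj Q V')"
  shows "farr Q (tmod R V V') (tmod R W W') (tmap R V V' W W' f g) (Qmul V V' x y) =
    Qmul W W' (farr Q V W f x) (farr Q V' W' g y)"
proof (rule Q_bil_eqI[OF Q_mod _ _ _ x y])
  note m = VW[THEN proj_module]
  note tm = tmap_facts[OF m f g]
  note P = tmodp[OF VW(1,2)] and P' = tmodp[OF VW(3,4)]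
  show "bil R' (fobj Q V) (fobj Q V') (fobj Q (tmod R W W')) (\<lambda>x y. farr Q (tmod R V V') (tmod R W W') (tmap R V V' W W' f g) (Qmul V V' x y))"
    by (rule bil_comp[OF Qmul_bil lin_mod_hom[OF functor_arr[OF Q_functor P P' tm(1)]]])
  show "bil R' (fobj Q V) (fobj Q V') (fobj Q (tmod R W W')) (\<lambda>x y. Qmul W W' (farr Q V W f x) (farr Q V' W' g y))"
    by (rule bil_precomp[OF Qmul_bil lin_mod_hom[OF functor_arr[OF Q_functor VW(1,3) f]] lin_mod_hom[OF functor_arr[OF Q_functor VW(2,4) g]]])
  fix v w assume vw: "v \<in> carrier V" "w \<in> carrier V'"
  then show "farr Q (tmod R V V') (tmod R W W') (tmap R V V' W W' f g) (Qmul V V' (br V v) (br V' w)) =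
      Qmul W W' (farr Q V W f (br V v)) (farr Q V' W' g (br V' w))"
    using mod_hom_closed[OF f] mod_hom_closed[OF g]
    by (simp add: Qmul_br[OF VW(1,2)] Qmul_br[OF VW(3,4)] Q_arr[OF VW(1,3) f] Q_arr[OF VW(2,4) g]
        Q_arr[OF P P' tm(1)] tel_closed[OF m(1,2)] tm(2))
qed

text \<open>On three brackets both sides are the bracket of the reassociated triple tensor.
  Trilinearity is used in two stages, with \<open>z\<close> a bracket at first.\<close>

lemma Qmul_assoc:
  assumes UVW: "U \<in> proj R" "V \<in> proj R" "W \<in> proj R"
    and x: "x \<in> carrier (fobj Q U)" and y: "y \<in> carrier (fobj Q V)" and z: "z \<in> carrier (fobj Q W)"
  shows "farr Q (tmod R (tmod R U V) W) (tmod R U (tmod R V W)) (tassoc R U V W) (Qmul (tmod R U V) W (Qmul U V x y) z) =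
    Qmul U (tmod R V W) x (Qmul V W y z)"
proof -
  note m = UVW[THEN proj_module]
  note UV = tmodp[OF UVW(1,2)] and VW = tmodp[OF UVW(2,3)]
  note P = tmodp[OF UV UVW(3)] and P' = tmodp[OF UVW(1) VW]
  note ta = tassoc_facts[OF m]
  let ?a = "farr Q (tmod R (tmod R U V) W) (tmod R U (tmod R V W)) (tassoc R U V W)"
  note la = lin_mod_hom[OF functor_arr[OF Q_functor P P' ta(1)]]
  have id: "lin R' (fobj Q U) (fobj Q U) (\<lambda>x. x)" for U by (rule linI) auto
  have bas: "?a (Qmul (tmod R U V) W (Qmul U V x y) (br W w)) = Qmul U (tmod R V W) x (Qmul V W y (br W w))"
    if w: "w \<in> carrier W" for w
  proof (rule Q_bil_eqI[OF Q_mod _ _ _ x y])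
    show "bil R' (fobj Q U) (fobj Q V) (fobj Q (tmod R U (tmod R V W))) (\<lambda>x y. ?a (Qmul (tmod R U V) W (Qmul U V x y) (br W w)))"
      by (rule bil_comp[OF bil_comp[OF Qmul_bil bil_lin_l[OF Qmul_bil br_closed]] la])
    show "bil R' (fobj Q U) (fobj Q V) (fobj Q (tmod R U (tmod R V W))) (\<lambda>x y. Qmul U (tmod R V W) x (Qmul V W y (br W w)))"
      by (rule bil_precomp[OF Qmul_bil id bil_lin_l[OF Qmul_bil br_closed]])
    fix u v assume uv: "u \<in> carrier U" "v \<in> carrier V"
    then show "?a (Qmul (tmod R U V) W (Qmul U V (br U u) (br V v)) (br W w)) = Qmul U (tmod R V W) (br U u) (Qmul V W (br V v) (br W w))"
      using w tel_closed[OF m(1,2)] tel_closed[OF m(2,3)] tel_closed[OF tmod_module[OF m(1,2)] m(3)]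
      by (simp add: Qmul_br[OF UVW(1,2)] Qmul_br[OF UV UVW(3)] Qmul_br[OF UVW(2,3)] Qmul_br[OF UVW(1) VW]
          Q_arr[OF P P' ta(1)] ta(2))
  qed
  show ?thesis
    by (rule Q_lin_eqI[OF Q_mod lin_comp[OF bil_lin_r[OF Qmul_bil Qmul_closed[OF x y]] la]
      lin_comp[OF bil_lin_r[OF Qmul_bil y] bil_lin_r[OF Qmul_bil x]] bas z])
qed

lemma Qmul_unit:
  assumes V: "V \<in> proj R" and x: "x \<in> carrier (fobj Q V)"
  shows "farr Q (tmod R (self_md R) V) V (tunit_l R V) (Qmul (self_md R) V (br (self_md R) \<one>\<^bsub>R\<^esub>) x) = x"
    and "farr Q (tmod R V (self_md R)) V (tunit_r R V) (Qmul V (self_md R) x (br (self_md R) \<one>\<^bsub>R\<^esub>)) = x"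
proof -
  note Vm = proj_module[OF V]
  interpret V: module R V by (rule Vm)
  note S = proj_self[OF R_cring] and Sm = self_md_module[OF R_cring]
  note tu = tunit_facts[OF Vm]
  note P = tmodp[OF S V] and P' = tmodp[OF V S]
  have id: "lin R' (fobj Q V) (fobj Q V) (\<lambda>x. x)" by (rule linI) auto
  show "farr Q (tmod R (self_md R) V) V (tunit_l R V) (Qmul (self_md R) V (br (self_md R) \<one>\<^bsub>R\<^esub>) x) = x"
  proof (rule Q_lin_eqI[OF Q_mod lin_comp[OF bil_lin_r[OF Qmul_bil br_closed] lin_mod_hom[OF functor_arr[OF Q_functor P V tu(1)]]] id _ x])
    fix v assume v: "v \<in> carrier V"
    then show "farr Q (tmod R (self_md R) V) V (tunit_l R V) (Qmul (self_md R) V (br (self_md R) \<one>\<^bsub>R\<^esub>) (br V v)) = br V v"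
      using tel_closed[OF Sm Vm, of "\<one>\<^bsub>R\<^esub>" v] by (simp add: Qmul_br[OF S V] Q_arr[OF P V tu(1)] tu(2))
  qed
  show "farr Q (tmod R V (self_md R)) V (tunit_r R V) (Qmul V (self_md R) x (br (self_md R) \<one>\<^bsub>R\<^esub>)) = x"
  proof (rule Q_lin_eqI[OF Q_mod lin_comp[OF bil_lin_l[OF Qmul_bil br_closed] lin_mod_hom[OF functor_arr[OF Q_functor P' V tu(3)]]] id _ x])
    fix v assume v: "v \<in> carrier V"
    then show "farr Q (tmod R V (self_md R)) V (tunit_r R V) (Qmul V (self_md R) (br V v) (br (self_md R) \<one>\<^bsub>R\<^esub>)) = br V v"
      using tel_closed[OF Vm Sm, of v "\<one>\<^bsub>R\<^esub>"] by (simp add: Qmul_br[OF V S] Q_arr[OF P' V tu(3)] tu(4))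
  qed
qed

text \<open>
  \<open>Qmul\<close> does not vanish on pairs of elements of degree 1, although their product must lie in the
  zero module of degree 2.
\<close>

definition mu :: "int \<Rightarrow> int \<Rightarrow> 'u md \<Rightarrow> 'u md \<Rightarrow> 'u \<Rightarrow> 'u \<Rightarrow> 'u" where
  "mu p k V W x y = (if p = 1 \<and> k = 1 then \<zero>\<^bsub>fobj Q (tmod R V W)\<^esub> else Qmul V W x y)"

definition \<mu> :: "int \<Rightarrow> int \<Rightarrow> 'u md \<Rightarrow> 'u md \<Rightarrow> 'u \<Rightarrow> 'u" where
  "\<mu> p k V W = tlift R (TT (Q.L p V)) (TT (Q.L k W)) (TT (Q.L (p + k) (tmod R V W)))
     (descend (Q.L p V) (Q.L k W) (Q.L (p + k) (tmod R V W)) (mu p k V W))"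

text \<open>The unit sends \<open>r\<close> to the multiple \<open>r [1]\<close> and not to the
  bracket \<open>[r]\<close>, which is not additive in \<open>r\<close>.\<close>

definition unit :: "'u \<Rightarrow> 'u" where
  "unit = (\<lambda>r\<in>carrier R. r \<odot>\<^bsub>TT (fobj Q (self_md R))\<^esub> ot (fobj Q (self_md R)) (br (self_md R) \<one>\<^bsub>R\<^esub>))"

lemma lay_other: "\<lbrakk>n \<noteq> 0; n \<noteq> 1; x \<in> Q.lay n V\<rbrakk> \<Longrightarrow> x = \<zero>\<^bsub>fobj Q V\<^esub>"
  by (simp add: Q.lay_def)

text \<open>Products of degrees 0 and 1 lie in the kernel because it is an ideal. A factor in a
  degree other than 0 and 1 is zero, and then so is the product.\<close>

lemma mu_lay:
  assumes V: "V \<in> proj R" and W: "W \<in> proj R" and x: "x \<in> Q.lay p V" and y: "y \<in> Q.lay k W"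
  shows "mu p k V W x y \<in> Q.lay (p + k) (tmod R V W)"
proof -
  note P = tmodp[OF V W] and Vm = proj_module[OF V] and Wm = proj_module[OF W]
  have c: "x \<in> carrier (fobj Q V)" "y \<in> carrier (fobj Q W)" using Q.lay_sub V W x y by auto
  consider "p \<noteq> 0 \<and> p \<noteq> 1" | "k \<noteq> 0 \<and> k \<noteq> 1" | "p = 0" "k = 0" | "p = 1" "k = 1" | "p = 0" "k = 1" | "p = 1" "k = 0" by blast
  then show ?thesis
  proof cases
    case 1 then show ?thesis using lay_other[of p x V] x c P by (simp add: mu_def Qmul_zero)
  next
    case 2 then show ?thesis using lay_other[of k y W] y c P by (simp add: mu_def Qmul_zero)
  next
    case 3 then show ?thesis using c by (simp add: mu_def Qmul_closed)
  next
    case 4 then show ?thesis using P by (simp add: mu_def)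
  next
    case 5
    then have "\<epsilon>Q W y = \<zero>\<^bsub>W\<^esub>" using y by (simp add: Q.lay_def)
    then show ?thesis using 5 c Qmul_closed[OF c] \<epsilon>Q_mul[OF V W c] tel_zero(2)[OF Vm Wm] Q.\<epsilon>_closed[OF V c(1)]
      by (simp add: mu_def Q.lay_def)
  next
    case 6
    then have "\<epsilon>Q V x = \<zero>\<^bsub>V\<^esub>" using x by (simp add: Q.lay_def)
    then show ?thesis using 6 c Qmul_closed[OF c] \<epsilon>Q_mul[OF V W c] tel_zero(1)[OF Vm Wm] Q.\<epsilon>_closed[OF W c(2)]
      by (simp add: mu_def Q.lay_def)
  qed
qed

lemma mu_bil:
  assumes V: "V \<in> proj R" and W: "W \<in> proj R"
  shows "bil R' (Q.L p V) (Q.L k W) (Q.L (p + k) (tmod R V W)) (mu p k V W)"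
proof -
  interpret T: module R' "fobj Q (tmod R V W)" by (rule Q_mod)
  note l = linD[OF bil_lin_l[OF Qmul_bil[of V W]]] and r = linD[OF bil_lin_r[OF Qmul_bil[of V W]]]
  show ?thesis
    by (rule bilI) (use mu_lay[OF V W] Q.lay_sub[OF V] Q.lay_sub[OF W] l r in \<open>auto simp: mu_def\<close>)
qed

lemma \<mu>_facts:
  assumes V: "V \<in> proj R" and W: "W \<in> proj R"
  shows \<mu>_hom: "\<mu> p k V W \<in> mod_hom R (tmod R (TT (Q.L p V)) (TT (Q.L k W))) (TT (Q.L (p + k) (tmod R V W)))"
    and \<mu>_ot: "\<And>x y. \<lbrakk>x \<in> Q.lay p V; y \<in> Q.lay k W\<rbrakk> \<Longrightarrow>
      \<mu> p k V W (tel R (TT (Q.L p V)) (TT (Q.L k W)) (ot (Q.L p V) x) (ot (Q.L k W) y)) = ot (Q.L (p + k) (tmod R V W)) (mu p k V W x y)"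
    and \<mu>_bil: "bil R (TT (Q.L p V)) (TT (Q.L k W)) (TT (Q.L (p + k) (tmod R V W)))
      (\<lambda>x y. \<mu> p k V W (tel R (TT (Q.L p V)) (TT (Q.L k W)) x y))"
proof -
  note P = tmodp[OF V W]
  note m = Q.L_mod[OF V, of p] Q.L_mod[OF W, of k] Q.L_mod[OF P, of "p + k"]
  note tm = m[THEN TT_module]
  note tb = descend_facts[OF m mu_bil[OF V W]]
  note tl = tlift_facts[OF tm tb(2), folded \<mu>_def]
  show h: "\<mu> p k V W \<in> mod_hom R (tmod R (TT (Q.L p V)) (TT (Q.L k W))) (TT (Q.L (p + k) (tmod R V W)))" by (rule tl(1))
  show "\<mu> p k V W (tel R (TT (Q.L p V)) (TT (Q.L k W)) (ot (Q.L p V) x) (ot (Q.L k W) y)) = ot (Q.L (p + k) (tmod R V W)) (mu p k V W x y)"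
    if "x \<in> Q.lay p V" "y \<in> Q.lay k W" for x y
    using tl(2)[of "ot (Q.L p V) x" "ot (Q.L k W) y"] tb(1)[of x y] that m by simp
  show "bil R (TT (Q.L p V)) (TT (Q.L k W)) (TT (Q.L (p + k) (tmod R V W)))
      (\<lambda>x y. \<mu> p k V W (tel R (TT (Q.L p V)) (TT (Q.L k W)) x y))"
    by (rule bil_comp[OF tel_bil[OF tm(1,2)] lin_mod_hom[OF h]])
qed

section \<open>The axioms of the multiplicative structure\<close>

abbreviation "mm p k V W x y \<equiv> \<mu> p k V W (tel R (val Q.C p V) (val Q.C k W) x y)"

lemma mm_ot: "\<lbrakk>V \<in> proj R; W \<in> proj R; x \<in> Q.lay p V; y \<in> Q.lay k W\<rbrakk> \<Longrightarrow>
    mm p k V W (ot (Q.L p V) x) (ot (Q.L k W) y) = ot (Q.L (p + k) (tmod R V W)) (mu p k V W x y)"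
  using \<mu>_ot by simp

lemma unit_ot: "r \<in> carrier R' \<Longrightarrow> unit (q r) = ot (fobj Q (self_md R)) (r \<odot>\<^bsub>fobj Q (self_md R)\<^esub> br (self_md R) \<one>\<^bsub>R\<^esub>)"
  using ot_smult[OF Q_mod] by (simp add: unit_def)

lemma unit_closed: "r \<in> carrier R' \<Longrightarrow> r \<odot>\<^bsub>fobj Q V\<^esub> br V v \<in> carrier (fobj Q V)"
proof -
  interpret m: module R' "fobj Q V" by (rule Q_mod)
  show "r \<in> carrier R' \<Longrightarrow> r \<odot>\<^bsub>fobj Q V\<^esub> br V v \<in> carrier (fobj Q V)" by simp
qed

lemma unit_hom: "unit \<in> mod_hom R (self_md R) (val Q.C 0 (self_md R))"
proof -
  interpret T: module R "TT (fobj Q (self_md R))" by (rule TT_module[OF Q_mod])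
  have c: "ot (fobj Q (self_md R)) (br (self_md R) \<one>\<^bsub>R\<^esub>) \<in> carrier (TT (fobj Q (self_md R)))"
    using Q_mod by simp
  have "restrict (\<lambda>r. r \<odot>\<^bsub>TT (fobj Q (self_md R))\<^esub> ot (fobj Q (self_md R)) (br (self_md R) \<one>\<^bsub>R\<^esub>)) (carrier (self_md R))
      \<in> mod_hom R (self_md R) (TT (fobj Q (self_md R)))"
    by (rule restrict_mod_homI[OF _ _ _ self_md_module[OF R_cring]]) (use c in \<open>auto simp: T.smult_l_distr T.smult_assoc1\<close>)
  then show ?thesis by (simp add: unit_def)
qed

lemma C_ex: "\<lbrakk>V \<in> proj R; c \<in> carrier (val Q.C p V)\<rbrakk> \<Longrightarrow> \<exists>x\<in>Q.lay p V. c = ot (Q.L p V) x"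
  using Q.C_onto by simp

lemma mm_zero:
  assumes V: "V \<in> proj R" and W: "W \<in> proj R"
  shows "y \<in> carrier (TT (Q.L k W)) \<Longrightarrow> mm p k V W \<zero>\<^bsub>TT (Q.L p V)\<^esub> y = \<zero>\<^bsub>TT (Q.L (p + k) (tmod R V W))\<^esub>"
    and "x \<in> carrier (TT (Q.L p V)) \<Longrightarrow> mm p k V W x \<zero>\<^bsub>TT (Q.L k W)\<^esub> = \<zero>\<^bsub>TT (Q.L (p + k) (tmod R V W))\<^esub>"
proof -
  note tm = TT_module[OF Q.L_mod]
  show "y \<in> carrier (TT (Q.L k W)) \<Longrightarrow> mm p k V W \<zero>\<^bsub>TT (Q.L p V)\<^esub> y = \<zero>\<^bsub>TT (Q.L (p + k) (tmod R V W))\<^esub>"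
    using lin_zero[OF bil_lin_l[OF \<mu>_bil[OF V W, of p k]] tm[OF V] tm[OF tmodp[OF V W]], of y] by simp
  show "x \<in> carrier (TT (Q.L p V)) \<Longrightarrow> mm p k V W x \<zero>\<^bsub>TT (Q.L k W)\<^esub> = \<zero>\<^bsub>TT (Q.L (p + k) (tmod R V W))\<^esub>"
    using lin_zero[OF bil_lin_r[OF \<mu>_bil[OF V W, of p k]] tm[OF W] tm[OF tmodp[OF V W]], of x] by simp
qed

text \<open>The differential is induced by the inclusion in degree 1 and zero elsewhere. In
  bidegrees (0,1) and (1,0) both sides are thus the same product seen in degree 0; in bidegree
  (0,0), and whenever a factor vanishes, all terms are zero.\<close>

lemma mul_leibniz:
  assumes V: "V \<in> proj R" and W: "W \<in> proj R" and x: "x \<in> carrier (val Q.C p V)" and y: "y \<in> carrier (val Q.C k W)"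
  defines "T \<equiv> val Q.C (p + k - 1) (tmod R V W)" and "s \<equiv> mm p (k - 1) V W x (dif Q.C k W y)"
  shows "dif Q.C (p + k) (tmod R V W) (mm p k V W x y) =
    mm (p - 1) k V W (dif Q.C p V x) y \<oplus>\<^bsub>T\<^esub> (if even p then s else \<ominus>\<^bsub>T\<^esub> s)"
proof -
  note P = tmodp[OF V W]
  interpret T: module R T unfolding T_def using TT_module[OF Q.L_mod[OF P]] by simp
  obtain x' where x': "x' \<in> Q.lay p V" "x = ot (Q.L p V) x'" using C_ex[OF V x] by blast
  obtain y' where y': "y' \<in> Q.lay k W" "y = ot (Q.L k W) y'" using C_ex[OF W y] by blast
  have xc: "x \<in> carrier (TT (Q.L p V))" "y \<in> carrier (TT (Q.L k W))" using x y by auto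
  have dx: "dif Q.C p V x = (if p = 1 then ot (fobj Q V) x' else \<zero>\<^bsub>TT (Q.L (p - 1) V)\<^esub>)"
    and dy: "dif Q.C k W y = (if k = 1 then ot (fobj Q W) y' else \<zero>\<^bsub>TT (Q.L (k - 1) W)\<^esub>)"
    using Q.C_dif[OF V x'(1)] Q.C_dif[OF W y'(1)] x' y' by auto
  have dl: "dif Q.C (p + k) (tmod R V W) (mm p k V W x y) =
     (if p + k = 1 then ot (fobj Q (tmod R V W)) (mu p k V W x' y') else \<zero>\<^bsub>T\<^esub>)"
    using Q.C_dif[OF P mu_lay[OF V W x'(1) y'(1)]] mm_ot[OF V W x'(1) y'(1)] x' y' by (simp add: T_def)
  have e: "p - 1 + k = p + k - 1" "p + (k - 1) = p + k - 1" by auto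
  have z1: "mm (p - 1) k V W \<zero>\<^bsub>TT (Q.L (p - 1) V)\<^esub> y = \<zero>\<^bsub>T\<^esub>"
    using mm_zero(1)[OF V W xc(2), of "p - 1"] unfolding e by (simp add: T_def)
  have z2: "mm p (k - 1) V W x \<zero>\<^bsub>TT (Q.L (k - 1) W)\<^esub> = \<zero>\<^bsub>T\<^esub>"
    using mm_zero(2)[OF V W xc(1), of "k - 1"] unfolding e by (simp add: T_def)
  have nz: "\<ominus>\<^bsub>T\<^esub> \<zero>\<^bsub>T\<^esub> = \<zero>\<^bsub>T\<^esub>" using T.minus_equality[of "\<zero>\<^bsub>T\<^esub>" "\<zero>\<^bsub>T\<^esub>"] by simp
  have xF: "x' \<in> Q.lay 0 V" "y' \<in> Q.lay 0 W" using Q.lay_sub V W x' y' by auto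
  consider "p \<noteq> 0 \<and> p \<noteq> 1" | "k \<noteq> 0 \<and> k \<noteq> 1" | "p = 0" "k = 0" | "p = 1" "k = 1" | "p = 0" "k = 1" | "p = 1" "k = 0" by blast
  then show ?thesis
  proof cases
    case 1
    then have x0: "x = \<zero>\<^bsub>TT (Q.L p V)\<^esub>" using lay_other[of p x' V] x' V by simp
    moreover have "dif Q.C k W y \<in> carrier (TT (Q.L (k - 1) W))" using mod_hom_closed[OF Q.C_dif_hom[OF W] xc(2)] .
    ultimately have "s = \<zero>\<^bsub>T\<^esub>" using mm_zero(1)[OF V W, of _ "k - 1" p] unfolding s_def e by (simp add: T_def)
    moreover have "dif Q.C (p + k) (tmod R V W) (mm p k V W x y) = \<zero>\<^bsub>T\<^esub>"
      using x0 mm_zero(1)[OF V W xc(2), of p] mod_hom_zero[OF Q.C_dif_hom[OF P, of "p + k"] TT_module[OF Q.L_mod[OF P]] TT_module[OF Q.L_mod[OF P]]]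
      by (simp add: T_def)
    ultimately show ?thesis using 1 dx z1 by (simp add: nz)
  next
    case 2
    then have y0: "y = \<zero>\<^bsub>TT (Q.L k W)\<^esub>" using lay_other[of k y' W] y' W by simp
    have "dif Q.C p V x \<in> carrier (TT (Q.L (p - 1) V))" using mod_hom_closed[OF Q.C_dif_hom[OF V] xc(1)] .
    then have "mm (p - 1) k V W (dif Q.C p V x) y = \<zero>\<^bsub>T\<^esub>" using mm_zero(2)[OF V W, of _ "p - 1" k] y0 unfolding e by (simp add: T_def)
    moreover have "dif Q.C (p + k) (tmod R V W) (mm p k V W x y) = \<zero>\<^bsub>T\<^esub>"
      using y0 mm_zero(2)[OF V W xc(1), of k] mod_hom_zero[OF Q.C_dif_hom[OF P, of "p + k"] TT_module[OF Q.L_mod[OF P]] TT_module[OF Q.L_mod[OF P]]]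
      by (simp add: T_def)
    moreover have "s = \<zero>\<^bsub>T\<^esub>" using 2 dy z2 by (simp add: s_def)
    ultimately show ?thesis by (simp add: nz)
  next
    case 3
    then show ?thesis using dl dx dy z1 z2 by (simp add: s_def)
  next
    case 4
    \<comment> \<open>The two terms on the right are the same class of degree 1, computed once with
      \<open>x\<close> and once with \<open>y\<close> moved to degree 0. As \<open>p = 1\<close> is
      odd they enter with opposite signs.\<close>
    have "mm 0 1 V W (ot (fobj Q V) x') y = ot (Q.L 1 (tmod R V W)) (Qmul V W x' y')"
      using mm_ot[OF V W xF(1), of y' 1] y' 4 by (simp add: mu_def)
    moreover have "mm 1 0 V W x (ot (fobj Q W) y') = ot (Q.L 1 (tmod R V W)) (Qmul V W x' y')"
      using mm_ot[OF V W _ xF(2), of x' 1] x' 4 by (simp add: mu_def)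
    moreover have "ot (Q.L 1 (tmod R V W)) (Qmul V W x' y') \<in> carrier T"
      using mu_lay[OF V W xF(1), of y' 1] y' 4 Q.L_mod[OF P, of 1] by (simp add: T_def mu_def)
    ultimately show ?thesis using dl dx dy 4 by (simp add: s_def T.r_neg)
  next
    case 5
    have "mm 0 0 V W x (ot (fobj Q W) y') = ot (fobj Q (tmod R V W)) (Qmul V W x' y')"
      using mm_ot[OF V W xF] x' 5 by (simp add: mu_def)
    moreover have "ot (fobj Q (tmod R V W)) (Qmul V W x' y') \<in> carrier T"
      using 5 Q_mod Qmul_closed xF by (simp add: T_def)
    ultimately show ?thesis using dl dx dy z1 5 by (simp add: s_def mu_def)
  next
    case 6
    have "mm 0 0 V W (ot (fobj Q V) x') y = ot (fobj Q (tmod R V W)) (Qmul V W x' y')"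
      using mm_ot[OF V W xF] y' 6 by (simp add: mu_def)
    moreover have "ot (fobj Q (tmod R V W)) (Qmul V W x' y') \<in> carrier T"
      using 6 Q_mod Qmul_closed xF by (simp add: T_def)
    ultimately show ?thesis using dl dx dy z2 6 by (simp add: s_def mu_def nz)
  qed
qed

lemma mul_assoc:
  assumes UVW: "U \<in> proj R" "V \<in> proj R" "W \<in> proj R" and x: "x \<in> carrier (val Q.C p U)"
    and y: "y \<in> carrier (val Q.C k V)" and z: "z \<in> carrier (val Q.C l W)"
  shows "farr (ob Q.C (p + k + l)) (tmod R (tmod R U V) W) (tmod R U (tmod R V W)) (tassoc R U V W)
      (mm (p + k) l (tmod R U V) W (mm p k U V x y) z) = mm p (k + l) U (tmod R V W) x (mm k l V W y z)"
proof -
  note m = UVW[THEN proj_module]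
  note UV = tmodp[OF UVW(1,2)] and VW = tmodp[OF UVW(2,3)]
  note P = tmodp[OF UV UVW(3)] and P' = tmodp[OF UVW(1) VW]
  note ta = tassoc_hom[OF m]
  obtain x' where x': "x' \<in> Q.lay p U" "x = ot (Q.L p U) x'" using C_ex[OF UVW(1) x] by blast
  obtain y' where y': "y' \<in> Q.lay k V" "y = ot (Q.L k V) y'" using C_ex[OF UVW(2) y] by blast
  obtain z' where z': "z' \<in> Q.lay l W" "z = ot (Q.L l W) z'" using C_ex[OF UVW(3) z] by blast
  have c: "x' \<in> carrier (fobj Q U)" "y' \<in> carrier (fobj Q V)" "z' \<in> carrier (fobj Q W)"
    using Q.lay_sub UVW x' y' z' by auto
  note xy = mu_lay[OF UVW(1,2) x'(1) y'(1)] and yz = mu_lay[OF UVW(2,3) y'(1) z'(1)]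
  note xyz = mu_lay[OF UV UVW(3) xy z'(1)]
  have az: "farr Q (tmod R (tmod R U V) W) (tmod R U (tmod R V W)) (tassoc R U V W) \<zero>\<^bsub>fobj Q (tmod R (tmod R U V) W)\<^esub> = \<zero>\<^bsub>fobj Q (tmod R U (tmod R V W))\<^esub>"
    by (rule arr_zero[OF Q_functor P P' ta])
  have key: "farr Q (tmod R (tmod R U V) W) (tmod R U (tmod R V W)) (tassoc R U V W) (mu (p + k) l (tmod R U V) W (mu p k U V x' y') z')
      = mu p (k + l) U (tmod R V W) x' (mu k l V W y' z')"
  \<comment> \<open>With all degrees 0 or 1: if at most one of them is 1, no product has been set to
    zero and associativity of \<open>Qmul\<close> applies; if at least two are 1, both sides are
    zero. In the remaining case some factor is zero.\<close>
  proof (cases "(p = 0 \<or> p = 1) \<and> (k = 0 \<or> k = 1) \<and> (l = 0 \<or> l = 1)")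
    case True
    then show ?thesis using Qmul_assoc[OF UVW c] az c Qmul_closed
      by (auto simp: mu_def Qmul_zero)
  next
    case False
    then have "x' = \<zero>\<^bsub>fobj Q U\<^esub> \<or> y' = \<zero>\<^bsub>fobj Q V\<^esub> \<or> z' = \<zero>\<^bsub>fobj Q W\<^esub>"
      using lay_other x' y' z' by blast
    then show ?thesis using az c Qmul_closed[OF c(1,2)] Qmul_closed[OF c(2,3)] module.axioms(2)[OF Q_mod] abelian_group.axioms(1) abelian_monoid.zero_closed
      by (elim disjE) (simp_all add: mu_def Qmul_zero abelian_monoid.zero_closed[OF abelian_group.axioms(1)[OF module.axioms(2)[OF Q_mod]]])
  qed
  have e: "p + (k + l) = p + k + l" by simp
  show ?thesis
    unfolding x' y' z' mm_ot[OF UVW(1,2) x'(1) y'(1)] mm_ot[OF UVW(2,3) y'(1) z'(1)]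
      mm_ot[OF UV UVW(3) xy z'(1)] mm_ot[OF UVW(1) VW x'(1) yz] Q.C_arr[OF P P' ta xyz] key e ..
qed

lemma mul_nat:
  assumes VW: "V \<in> proj R" "V' \<in> proj R" "W \<in> proj R" "W' \<in> proj R"
    and f: "f \<in> mod_hom R V W" and g: "g \<in> mod_hom R V' W'"
    and x: "x \<in> carrier (val Q.C p V)" and y: "y \<in> carrier (val Q.C k V')"
  shows "farr (ob Q.C (p + k)) (tmod R V V') (tmod R W W') (tmap R V V' W W' f g) (mm p k V V' x y) =
    mm p k W W' (farr (ob Q.C p) V W f x) (farr (ob Q.C k) V' W' g y)"
proof -
  note m = VW[THEN proj_module]
  note tm = tmap_hom[OF m f g]
  note P = tmodp[OF VW(1,2)] and P' = tmodp[OF VW(3,4)]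
  obtain x' where x': "x' \<in> Q.lay p V" "x = ot (Q.L p V) x'" using C_ex[OF VW(1) x] by blast
  obtain y' where y': "y' \<in> Q.lay k V'" "y = ot (Q.L k V') y'" using C_ex[OF VW(2) y] by blast
  have c: "x' \<in> carrier (fobj Q V)" "y' \<in> carrier (fobj Q V')" using Q.lay_sub VW x' y' by auto
  have key: "farr Q (tmod R V V') (tmod R W W') (tmap R V V' W W' f g) (mu p k V V' x' y') = mu p k W W' (farr Q V W f x') (farr Q V' W' g y')"
    using Qmul_nat[OF VW f g c] arr_zero[OF Q_functor P P' tm] by (simp add: mu_def)
  show ?thesis
    unfolding x' y' mm_ot[OF VW(1,2) x'(1) y'(1)] Q.C_arr[OF P P' tm mu_lay[OF VW(1,2) x'(1) y'(1)]]
      Q.C_arr[OF VW(1,3) f x'(1)] Q.C_arr[OF VW(2,4) g y'(1)]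
      mm_ot[OF VW(3,4) Q.lay_arr[OF VW(1,3) f x'(1)] Q.lay_arr[OF VW(2,4) g y'(1)]] key ..
qed

text \<open>With \<open>s\<close> a lift of \<open>r\<close>, the unit is the class of
  \<open>s [1]\<close>. The scalar \<open>s\<close> comes out of the product, which leaves the
  product with \<open>[1]\<close>.\<close>

lemma mul_unit:
  assumes V: "V \<in> proj R" and r: "r \<in> carrier R" and x: "x \<in> carrier (val Q.C p V)"
  shows "farr (ob Q.C p) (tmod R (self_md R) V) V (tunit_l R V) (mm 0 p (self_md R) V (unit r) x) = r \<odot>\<^bsub>val Q.C p V\<^esub> x"
    and "farr (ob Q.C p) (tmod R V (self_md R)) V (tunit_r R V) (mm p 0 V (self_md R) x (unit r)) = r \<odot>\<^bsub>val Q.C p V\<^esub> x"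
proof -
  note S = proj_self[OF R_cring] and Vm = proj_module[OF V]
  note P = tmodp[OF S V] and P' = tmodp[OF V S] and tu = tunit_facts[OF Vm]
  obtain x' where x': "x' \<in> Q.lay p V" "x = ot (Q.L p V) x'" using C_ex[OF V x] by blast
  have c: "x' \<in> carrier (fobj Q V)" using Q.lay_sub[OF V x'(1)] .
  obtain s where s: "s \<in> carrier R'" "r = q s" using q_onto[OF r] by blast
  let ?b = "br (self_md R) \<one>\<^bsub>R\<^esub>"
  let ?u = "s \<odot>\<^bsub>fobj Q (self_md R)\<^esub> ?b"
  have u: "unit r = ot (Q.L 0 (self_md R)) ?u" "?u \<in> Q.lay 0 (self_md R)"
    using unit_ot[OF s(1)] unit_closed[OF s(1)] s by simp_all
  have r0: "r \<odot>\<^bsub>val Q.C p V\<^esub> x = ot (Q.L p V) (s \<odot>\<^bsub>fobj Q V\<^esub> x')"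
    using ot_smult[OF Q.L_mod[OF V, of p] s(1), of x'] x' s by simp
  have l1: "mu 0 p (self_md R) V ?u x' = s \<odot>\<^bsub>fobj Q (tmod R (self_md R) V)\<^esub> Qmul (self_md R) V ?b x'"
    using linD(3)[OF bil_lin_l[OF Qmul_bil c] s(1) br_closed] by (simp add: mu_def)
  have l2: "mu p 0 V (self_md R) x' ?u = s \<odot>\<^bsub>fobj Q (tmod R V (self_md R))\<^esub> Qmul V (self_md R) x' ?b"
    using linD(3)[OF bil_lin_r[OF Qmul_bil c] s(1) br_closed] by (simp add: mu_def)
  have a1: "farr Q (tmod R (self_md R) V) V (tunit_l R V) (mu 0 p (self_md R) V ?u x') = s \<odot>\<^bsub>fobj Q V\<^esub> x'"
    unfolding l1 mod_hom_smult[OF functor_arr[OF Q_functor P V tu(1)] s(1) Qmul_closed[OF br_closed c]] Qmul_unit[OF V c] ..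
  have a2: "farr Q (tmod R V (self_md R)) V (tunit_r R V) (mu p 0 V (self_md R) x' ?u) = s \<odot>\<^bsub>fobj Q V\<^esub> x'"
    unfolding l2 mod_hom_smult[OF functor_arr[OF Q_functor P' V tu(3)] s(1) Qmul_closed[OF c br_closed]] Qmul_unit[OF V c] ..
  have e: "0 + p = p" "p + 0 = p" by auto
  have ml: "mm 0 p (self_md R) V (unit r) x = ot (Q.L p (tmod R (self_md R) V)) (mu 0 p (self_md R) V ?u x')"
    using mm_ot[OF S V u(2) x'(1)] u x' by simp
  have mr: "mm p 0 V (self_md R) x (unit r) = ot (Q.L p (tmod R V (self_md R))) (mu p 0 V (self_md R) x' ?u)"
    using mm_ot[OF V S x'(1) u(2)] u x' by simp
  show "farr (ob Q.C p) (tmod R (self_md R) V) V (tunit_l R V) (mm 0 p (self_md R) V (unit r) x) = r \<odot>\<^bsub>val Q.C p V\<^esub> x"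
    unfolding ml r0 using Q.C_arr[OF P V tu(1) mu_lay[OF S V u(2) x'(1), unfolded e]] a1 by simp
  show "farr (ob Q.C p) (tmod R V (self_md R)) V (tunit_r R V) (mm p 0 V (self_md R) x (unit r)) = r \<odot>\<^bsub>val Q.C p V\<^esub> x"
    unfolding mr r0 using Q.C_arr[OF P' V tu(3) mu_lay[OF V S x'(1) u(2), unfolded e]] a2 by simp
qed

lemma Q_mult_structure: "mult_structure R Q.C unit \<mu>"
  unfolding mult_structure_def Let_def
proof (intro conjI allI ballI)
  show "unit \<in> mod_hom R (self_md R) (val Q.C 0 (self_md R))" by (rule unit_hom)
  note S = proj_self[OF R_cring]
  show "dif Q.C 0 (self_md R) (unit r) = \<zero>\<^bsub>val Q.C (- 1) (self_md R)\<^esub>" if r: "r \<in> carrier R" for r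
  proof -
    obtain s where s: "s \<in> carrier R'" "r = q s" using q_onto[OF r] by blast
    show ?thesis using Q.C_dif[OF S, of _ 0] unit_ot[OF s(1)] unit_closed[OF s(1)] s by simp
  qed
  show "\<mu> p k V W \<in> mod_hom R (tmod R (val Q.C p V) (val Q.C k W)) (val Q.C (p + k) (tmod R V W))"
    if "V \<in> proj R" "W \<in> proj R" for p k V W
    using \<mu>_hom[OF that] by simp
qed (rule mul_nat mul_leibniz mul_assoc mul_unit; assumption)+

text \<open>In bidegree (0,0) this is the compatibility of \<open>\<epsilon>Q\<close> with the
  products. In all other bidegrees the product on the target is zero, and the left side must be
  shown to vanish.\<close>

lemma Q_mult_map: "mult_map R Q.C unit \<mu> (stalk 0 incl_fctr) (incl_unit R) (incl_mul R) Q.aug"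
  unfolding mult_map_def
proof (intro conjI ballI allI)
  note S = proj_self[OF R_cring]
  fix r assume r: "r \<in> carrier R"
  obtain s where s: "s \<in> carrier R'" "r = q s" using q_onto[OF r] by blast
  show "Q.aug 0 (self_md R) (unit r) = incl_unit R r"
    using Q.aug_ot[OF S unit_closed[OF s(1)]] Q.\<epsilon>_smult[OF S s(1) br_closed] \<epsilon>Q_br[OF S, of "\<one>\<^bsub>R\<^esub>"] unit_ot[OF s(1)] s
    by (simp add: incl_unit_def)
next
  fix p k V W x y
  assume V: "V \<in> proj R" and W: "W \<in> proj R" and x: "x \<in> carrier (val Q.C p V)" and y: "y \<in> carrier (val Q.C k W)"
  let ?A = "stalk 0 incl_fctr"
  note P = tmodp[OF V W]
  have Am: "module R (val ?A n V)" if "V \<in> proj R" for n V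
    by (rule functor_module[OF complex_functor[OF stalk_complex[OF incl_fctr_functor R_cring]] that])
  have xc: "x \<in> carrier (TT (Q.L p V))" "y \<in> carrier (TT (Q.L k W))" using x y by auto
  have ax: "Q.aug p V x \<in> carrier (val ?A p V)" "Q.aug k W y \<in> carrier (val ?A k W)"
    using mod_hom_closed[OF Q.aug_hom[OF V] xc(1)] mod_hom_closed[OF Q.aug_hom[OF W] xc(2)] by auto
  note tc = tel_closed[OF Am[OF V] Am[OF W] ax]
  obtain x' where x': "x' \<in> Q.lay p V" "x = ot (Q.L p V) x'" using C_ex[OF V x] by blast
  obtain y' where y': "y' \<in> Q.lay k W" "y = ot (Q.L k W) y'" using C_ex[OF W y] by blast
  have c: "x' \<in> carrier (fobj Q V)" "y' \<in> carrier (fobj Q W)" using Q.lay_sub V W x' y' by auto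
  show "Q.aug (p + k) (tmod R V W) (mm p k V W x y) = incl_mul R p k V W (tel R (val ?A p V) (val ?A k W) (Q.aug p V x) (Q.aug k W y))"
  proof (cases "p = 0 \<and> k = 0")
    case True
    have "mm 0 0 V W x y = ot (fobj Q (tmod R V W)) (Qmul V W x' y')"
      using mm_ot[OF V W x'(1) y'(1)] x' y' True by (simp add: mu_def)
    then have "Q.aug 0 (tmod R V W) (mm 0 0 V W x y) = tel R V W (\<epsilon>Q V x') (\<epsilon>Q W y')"
      using Q.aug_ot[OF P Qmul_closed[OF c]] \<epsilon>Q_mul[OF V W c] by simp
    moreover have "Q.aug 0 V x = \<epsilon>Q V x'" "Q.aug 0 W y = \<epsilon>Q W y'"
      using Q.aug_ot[OF V c(1)] Q.aug_ot[OF W c(2)] x' y' True by simp_all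
    ultimately show ?thesis using True tc by (simp add: incl_mul_def stalk_ob)
  next
    case False
    have "mm p k V W x y \<in> carrier (TT (Q.L (p + k) (tmod R V W)))"
      using bil_closed[OF \<mu>_bil[OF V W] xc] by simp
    \<comment> \<open>The total degree can be 0, where the augmentation is not zero, without both
      degrees being 0. Then one of them is negative, so that factor vanishes.\<close>
    moreover have "mm p k V W x y = \<zero>\<^bsub>TT (Q.L (p + k) (tmod R V W))\<^esub>" if "p + k = 0"
    proof -
      have "(p \<noteq> 0 \<and> p \<noteq> 1) \<or> (k \<noteq> 0 \<and> k \<noteq> 1)" using False that by auto
      then have "x' = \<zero>\<^bsub>fobj Q V\<^esub> \<or> y' = \<zero>\<^bsub>fobj Q W\<^esub>" using lay_other x' y' by blast
      then show ?thesis using x' y' V W mm_zero(1)[OF V W xc(2), of p] mm_zero(2)[OF V W xc(1), of k] by auto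
    qed
    moreover have "Q.aug 0 (tmod R V W) \<zero>\<^bsub>TT (fobj Q (tmod R V W))\<^esub> = \<zero>\<^bsub>tmod R V W\<^esub>"
      using mod_hom_zero[OF Q.aug_hom[OF P, of 0] TT_module[OF Q.L_mod[OF P]] Am[OF P]] by (simp add: stalk_ob)
    ultimately have "Q.aug (p + k) (tmod R V W) (mm p k V W x y) = \<zero>\<^bsub>val ?A (p + k) (tmod R V W)\<^esub>"
      using Q.aug_nonzero[OF P, of "p + k"]
      by (cases "p + k = 0") (auto simp: stalk_ob)
    moreover have "incl_mul R p k V W (tel R (val ?A p V) (val ?A k W) (Q.aug p V x) (Q.aug k W y)) = \<zero>\<^bsub>val ?A (p + k) (tmod R V W)\<^esub>"
      unfolding incl_mul_def if_not_P[OF False] by (rule zero_map_apply[OF tc])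
    ultimately show ?thesis by simp
  qed
qed

lemma Q_mult: "mult_elem_ext R M ra Q.ext unit \<mu>"
proof -
  have "emid Q.ext = Q.C" "epr Q.ext = Q.aug" by (simp_all add: Q.ext_def)
  then show ?thesis using Q_elem Q_mult_structure Q_mult_map by (simp add: mult_elem_ext_def)
qed

text \<open>All resolutions give the class of the extension of \<open>Q\<close>, and there is at
  least one resolution, so the description in \<open>sqz_class\<close> denotes that class.\<close>

lemma sqz_class_eq: "sqz_class R M ra R' i q = el_class R M ra Q.ext"
proof -
  interpret r2: two_crings R R' by (simp add: two_crings_def R_cring R'_cring)
  have eq: "el_class R M ra (sqz_elext R M ra R' i q P \<epsilon>) = el_class R M ra Q.ext"
    if "proj_resolution R R' push_incl P \<epsilon>" for P \<epsilon>
  proof -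
    interpret resolution R R' M ra i q P \<epsilon> by unfold_locales (rule that)
    show ?thesis using class_eq by blast
  qed
  have ex: "proj_resolution R R' push_incl (r2.resol push_incl) (cov_map R R' push_incl)"
    by (rule r2.ex_resolution[OF push_fctr_functor[OF incl_fctr_functor q_hom R'_cring]])
  have El: "el_class R M ra Q.ext \<in> El R M ra"
    unfolding El_def el_class_def by (rule quotientI[OF Q_elem])
  show ?thesis unfolding sqz_class_def
  proof (rule the_equality)
    show "el_class R M ra Q.ext \<in> El R M ra \<and> (\<exists>P \<epsilon>. proj_resolution R R' push_incl P \<epsilon> \<and>
        el_class R M ra Q.ext = el_class R M ra (sqz_elext R M ra R' i q P \<epsilon>))"
      using El ex eq by metis
  next
    fix c assume "c \<in> El R M ra \<and> (\<exists>P \<epsilon>. proj_resolution R R' push_incl P \<epsilon> \<and>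
        c = el_class R M ra (sqz_elext R M ra R' i q P \<epsilon>))"
    then show "c = el_class R M ra Q.ext" using eq by blast
  qed
qed

end

theorem proposition5p4:
  fixes R R' :: "('u :: infinite) ring" and M :: "('u, 'u) module"
    and ra :: "'u \<Rightarrow> 'u \<Rightarrow> 'u" and i q :: "'u \<Rightarrow> 'u"
  assumes "cring R"
    and "bimodule R M ra"
    and "square_zero_ext R M ra R' i q"
    and "cring R'"
  shows "\<exists>E u \<mu>. mult_elem_ext R M ra E u \<mu> \<and> el_class R M ra E = sqz_class R M ra R' i q"
proof -
  interpret sqz R R' M ra i q
    using assms by (simp add: sqz_def)
  show ?thesis using Q_mult sqz_class_eq by metis
qed

end
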